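(* Let $p$ be a prime and let $\mathcal{F}$ be a saturated fusion system on a finite $p$-group $P$. If $\mathcal{E}$ is a weakly normal subsystem of $\mathcal{F}$, then $O^{p'}(\mathcal{E})$ is a normal subsystem of $\mathcal{F}$.
   Context: Maps are written on the right and composed from left to right. A fusion system $\mathcal{F}$ on a finite $p$-group $P$ is a category whose objects are the subgroups of $P$ and whose morphism sets $\mathrm{Hom}_{\mathcal{F}}(Q,R)$ consist of injective group homomorphisms $Q\to R$, composed as maps, containing every conjugation map $c_g:x\mapsto g^{-1}xg$ with $g\in P$, $Q^g\le R$, and such that for each morphism $\phi:Q\to R$ in $\mathcal F$ the isomorphism $Q\to Q\phi$ and its inverse lie in $\mathcal{F}$. A subgroup $Q$ is fully $\mathcal F$-automized if $\mathrm{Aut}_P(Q)$ (the automorphisms of $Q$ induced by conjugation by elements of $N_P(Q)$) is a Sylow $p$-subgroup of $\mathrm{Aut}_{\mathcal{F}}(Q)$; $R$ is receptive if every isomorphism $\phi:S\to R$ in $\mathcal F$ extends to a morphism $N_\phi\to P$ in $\mathcal F$, where $N_\phi$ is the preimage in $N_P(S)$ of $\mathrm{Aut}_P(S)\cap \mathrm{Aut}_P(R)^{\phi^{-1}}$. $\mathcal{F}$ is saturated if every $\mathcal{F}$-conjugacy class of subgroups contains a fully automized, receptive member. A subsystem of $\mathcal F$ on $T\le P$ is a fusion system on $T$ all of whose morphisms lie in $\mathcal F$. A subgroup $T\le P$ is strongly $\mathcal{F}$-closed if $Q\phi\le T$ for every $Q\le T$ and every morphism $\phi:Q\to P$ in $\mathcal{F}$.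 A subsystem $\mathcal{E}$ of $\mathcal{F}$ on a strongly $\mathcal{F}$-closed subgroup $T$ is $\mathcal{F}$-invariant if, whenever $Q\le R\le T$, $\phi:Q\to R$ is a morphism in $\mathcal{E}$ and $\psi:R\to T$ is a morphism in $\mathcal{F}$, the map $\psi^{-1}\phi\psi:Q\psi\to R\psi$ is in $\mathcal{E}$. $\mathcal{E}$ is weakly normal in $\mathcal{F}$ if it is saturated and $\mathcal{F}$-invariant. $\mathcal{E}$ is normal in $\mathcal{F}$ if it is weakly normal and, in addition, every $\phi\in\mathrm{Aut}_{\mathcal{E}}(T)$ extends to some $\bar\phi\in\mathrm{Aut}_{\mathcal{F}}(TC_P(T))$ with $[\bar\phi,C_P(T)]\le Z(T)$, where $[\bar\phi,C_P(T)]$ is generated by the elements $x^{-1}(x\bar\phi)$, $x\in C_P(T)$. For a saturated fusion system $\mathcal{E}$ on $T$, $O^{p'}(\mathcal{E})$ is the unique smallest weakly normal subsystem of $\mathcal{E}$ on the same $p$-group $T$ (its existence is known). *)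

theory Defs
  imports
    "HOL-Algebra.Group_Action"
    "HOL-Algebra.Generated_Groups"
    "HOL-Computational_Algebra.Primes"
begin

(* A fusion system is given by its morphism sets: F Q R is Hom_F(Q,R).  A morphism with
   domain Q is a function that is extensional on Q (undefined outside Q), and F Q R is empty
   unless Q and R are subgroups, so that a fusion system is determined uniquely as a HOL
   function and the pointwise order on F is inclusion of subsystems.  Maps in the source are
   written on the right: "phi followed by psi" is compose Q psi phi, and conjugation by g is
   x |-> g^-1 x g. *)

type_synonym 'a hom_sets = "'a set \<Rightarrow> 'a set \<Rightarrow> ('a \<Rightarrow> 'a) set"

definition conj_map :: "('a, 'b) monoid_scheme \<Rightarrow> 'a set \<Rightarrow> 'a \<Rightarrow> 'a \<Rightarrow> 'a" where
  "conj_map G Q g = (\<lambda>x\<in>Q. inv\<^bsub>G\<^esub> g \<otimes>\<^bsub>G\<^esub> x \<otimes>\<^bsub>G\<^esub> g)"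

definition centralizer :: "('a, 'b) monoid_scheme \<Rightarrow> 'a set \<Rightarrow> 'a set" where
  "centralizer G S = {g \<in> carrier G. \<forall>s\<in>S. g \<otimes>\<^bsub>G\<^esub> s = s \<otimes>\<^bsub>G\<^esub> g}"

definition center :: "('a, 'b) monoid_scheme \<Rightarrow> 'a set" where
  "center G = centralizer G (carrier G)"

locale p_group = group G for p :: nat and G (structure) +
  assumes finite_carrier: "finite (carrier G)"
    and order_p_power: "\<exists>n. order G = p ^ n"

locale fusion_system = p_group p G for p :: nat and G (structure) +
  fixes F :: "'a hom_sets"
  assumes morphism: "\<phi> \<in> F Q R \<Longrightarrow> subgroup Q G \<and> subgroup R G \<and>
      \<phi> \<in> mon (G\<lparr>carrier := Q\<rparr>) (G\<lparr>carrier := R\<rparr>) \<and> \<phi> \<in> extensional Q"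
    and conj_map_morphism: "\<lbrakk>subgroup Q G; subgroup R G; g \<in> carrier G; conj_map G Q g ` Q \<subseteq> R\<rbrakk>
      \<Longrightarrow> conj_map G Q g \<in> F Q R"
    and compose_morphism: "\<lbrakk>\<phi> \<in> F Q R; \<psi> \<in> F R S\<rbrakk> \<Longrightarrow> compose Q \<psi> \<phi> \<in> F Q S"
    and corestrict_morphism: "\<phi> \<in> F Q R \<Longrightarrow> \<phi> \<in> F Q (\<phi> ` Q)"
    and inverse_morphism: "\<phi> \<in> F Q R \<Longrightarrow> restrict (inv_into Q \<phi>) (\<phi> ` Q) \<in> F (\<phi> ` Q) Q"

(* By the axioms of a fusion system, the isomorphisms are the surjective morphisms. *)
definition isos :: "'a hom_sets \<Rightarrow> 'a set \<Rightarrow> 'a set \<Rightarrow> ('a \<Rightarrow> 'a) set" where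
  "isos F Q R = {\<phi> \<in> F Q R. \<phi> ` Q = R}"

(* The subgroups are finite, so F Q Q consists of automorphisms.  BijGroup multiplies from
   right to left; the opposite group has the same Sylow subgroups. *)
definition Aut :: "'a hom_sets \<Rightarrow> 'a set \<Rightarrow> ('a \<Rightarrow> 'a) monoid" where
  "Aut F Q = BijGroup Q\<lparr>carrier := F Q Q\<rparr>"

definition conj_auts :: "('a, 'b) monoid_scheme \<Rightarrow> 'a set \<Rightarrow> ('a \<Rightarrow> 'a) set" where
  "conj_auts G Q = conj_map G Q ` normalizer G Q"

definition sylow_subgroup :: "nat \<Rightarrow> 'a set \<Rightarrow> ('a, 'b) monoid_scheme \<Rightarrow> bool" where
  "sylow_subgroup p H A \<longleftrightarrow> subgroup H A \<and> card H = p ^ multiplicity p (order A)"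

definition fully_automized ::
    "nat \<Rightarrow> ('a, 'b) monoid_scheme \<Rightarrow> 'a hom_sets \<Rightarrow> 'a set \<Rightarrow> bool" where
  "fully_automized p G F Q \<longleftrightarrow> sylow_subgroup p (conj_auts G Q) (Aut F Q)"

(* N_phi for an isomorphism phi from S to R; written on the right, the elements of
   Aut_P(R)^(phi^-1) are the maps phi alpha phi^-1, i.e. first phi, then alpha, then phi^-1. *)
definition extension_domain ::
    "('a, 'b) monoid_scheme \<Rightarrow> 'a set \<Rightarrow> 'a set \<Rightarrow> ('a \<Rightarrow> 'a) \<Rightarrow> 'a set" where
  "extension_domain G S R \<phi> = {g \<in> normalizer G S. conj_map G S g \<in>
     conj_auts G S \<inter> {compose S (inv_into S \<phi>) (compose S \<alpha> \<phi>) | \<alpha>. \<alpha> \<in> conj_auts G R}}"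

definition receptive :: "('a, 'b) monoid_scheme \<Rightarrow> 'a hom_sets \<Rightarrow> 'a set \<Rightarrow> bool" where
  "receptive G F R \<longleftrightarrow> (\<forall>S. \<forall>\<phi>\<in>isos F S R.
     \<exists>\<psi>\<in>F (extension_domain G S R \<phi>) (carrier G). restrict \<psi> S = \<phi>)"

definition saturated :: "nat \<Rightarrow> ('a, 'b) monoid_scheme \<Rightarrow> 'a hom_sets \<Rightarrow> bool" where
  "saturated p G F \<longleftrightarrow> fusion_system p G F \<and>
     (\<forall>Q. subgroup Q G \<longrightarrow>
        (\<exists>R. isos F Q R \<noteq> {} \<and> fully_automized p G F R \<and> receptive G F R))"

definition subsystem ::
    "nat \<Rightarrow> ('a, 'b) monoid_scheme \<Rightarrow> 'a hom_sets \<Rightarrow> 'a set \<Rightarrow> 'a hom_sets \<Rightarrow> bool" where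
  "subsystem p G F T E \<longleftrightarrow> subgroup T G \<and> fusion_system p (G\<lparr>carrier := T\<rparr>) E \<and> E \<le> F"

definition strongly_closed ::
    "('a, 'b) monoid_scheme \<Rightarrow> 'a hom_sets \<Rightarrow> 'a set \<Rightarrow> bool" where
  "strongly_closed G F T \<longleftrightarrow> subgroup T G \<and>
     (\<forall>Q. Q \<subseteq> T \<longrightarrow> (\<forall>\<phi>\<in>F Q (carrier G). \<phi> ` Q \<subseteq> T))"

definition invariant_subsystem ::
    "nat \<Rightarrow> ('a, 'b) monoid_scheme \<Rightarrow> 'a hom_sets \<Rightarrow> 'a set \<Rightarrow> 'a hom_sets \<Rightarrow> bool" where
  "invariant_subsystem p G F T E \<longleftrightarrow> subsystem p G F T E \<and> strongly_closed G F T \<and>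
     (\<forall>Q R. Q \<subseteq> R \<longrightarrow> R \<subseteq> T \<longrightarrow> (\<forall>\<phi>\<in>E Q R. \<forall>\<psi>\<in>F R T.
        (\<lambda>x\<in>\<psi> ` Q. \<psi> (\<phi> (inv_into R \<psi> x))) \<in> E (\<psi> ` Q) (\<psi> ` R)))"

definition weakly_normal ::
    "nat \<Rightarrow> ('a, 'b) monoid_scheme \<Rightarrow> 'a hom_sets \<Rightarrow> 'a set \<Rightarrow> 'a hom_sets \<Rightarrow> bool" where
  "weakly_normal p G F T E \<longleftrightarrow>
     invariant_subsystem p G F T E \<and> saturated p (G\<lparr>carrier := T\<rparr>) E"

definition normal_subsystem ::
    "nat \<Rightarrow> ('a, 'b) monoid_scheme \<Rightarrow> 'a hom_sets \<Rightarrow> 'a set \<Rightarrow> 'a hom_sets \<Rightarrow> bool" where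
  "normal_subsystem p G F T E \<longleftrightarrow> weakly_normal p G F T E \<and>
     (\<forall>\<phi>\<in>E T T.
        \<exists>\<psi>\<in>F (T <#>\<^bsub>G\<^esub> centralizer G T) (T <#>\<^bsub>G\<^esub> centralizer G T).
          restrict \<psi> T = \<phi> \<and>
          generate G {inv\<^bsub>G\<^esub> x \<otimes>\<^bsub>G\<^esub> \<psi> x | x. x \<in> centralizer G T}
            \<subseteq> center (G\<lparr>carrier := T\<rparr>))"

(* O^{p'}(E) for a saturated fusion system E on the group G *)
definition O_p_prime :: "nat \<Rightarrow> ('a, 'b) monoid_scheme \<Rightarrow> 'a hom_sets \<Rightarrow> 'a hom_sets" where
  "O_p_prime p G E = (LEAST D. weakly_normal p G E (carrier G) D)"

end

theory Submission
  imports Defs "HOL-Algebra.Sylow" "HOL-Algebra.Multiplicative_Group" "HOL-Number_Theory.Cong"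
begin

text \<open>Let \<open>OE\<close> be the system on \<open>T\<close> generated by the maps \<open>\<psi>\<^sup>-\<^sup>1 c\<^sub>t \<psi>\<close>, where \<open>U \<le> T\<close> is \<open>F\<close>-centric and
  conjugate under \<open>Aut\<^sub>F(T)\<close> to a fully automized receptive subgroup of \<open>F\<close>, \<open>t \<in> N\<^sub>T(U)\<close> and \<open>\<psi> \<in> Aut\<^sub>E(U)\<close>, together with
  all \<open>\<alpha> \<in> Aut\<^sub>E(T)\<close> whose restriction to some \<open>F\<close>-centric subgroup is already in \<open>OE\<close>. Every weakly normal
  subsystem of \<open>E\<close> on \<open>T\<close> contains \<open>OE\<close>. Conversely, two Frattini arguments (\<open>F\<close>-morphisms inside \<open>T\<close> factor
  through \<open>Aut\<^sub>F(T)\<close> and \<open>E\<close>, and \<open>E\<close>-morphisms factor through \<open>Aut\<^sub>E(T)\<close> and \<open>OE\<close>) show that \<open>OE\<close> is invariant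
  in \<open>F\<close>. It is saturated: on centric subgroups because extensions in \<open>E\<close> of maps in \<open>OE\<close> stay in \<open>OE\<close>, on the
  other subgroups \<open>R\<close> by downward induction on \<open>|R|\<close>, extending maps to \<open>R C\<^sub>T(R)\<close>. Hence \<open>OE\<close> is \<open>O\<^sup>p\<^sup>'(E)\<close>.

  For normality, consider the maps \<open>f\<close> on centric \<open>Q\<close> that extend in \<open>F\<close> to a map \<open>h\<close> on \<open>Q C\<^sub>P(T)\<close> with
  \<open>y\<^sup>-\<^sup>1 h(y) \<in> T\<close> for all \<open>y\<close>. The generators have this property by receptivity, and it survives composition and
  inversion. Let \<open>\<alpha> \<in> Aut\<^sub>E(T)\<close> restrict to a map with the property on a centric
  \<open>Q\<close>, and let \<open>\<gamma>\<close> be the automorphism of \<open>Q C\<^sub>P(T)\<close>, trivial on \<open>Q\<close>, by which its lift differs from an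
  extension \<open>b\<close> of \<open>\<alpha>\<close> to \<open>T C\<^sub>P(T)\<close>. For \<open>m\<close> divisible by a high power of \<open>p\<close> and congruent to \<open>1\<close> modulo the
  \<open>p'\<close>-parts of the orders, \<open>\<gamma>\<^sup>m\<close> has order prime to \<open>p\<close> and extends to \<open>T C\<^sub>P(T)\<close> as the identity on \<open>T\<close>;
  composed with \<open>b\<^sup>m\<close> it shows that \<open>\<alpha>\<^sup>m\<close> has the property on \<open>T\<close>, and \<open>\<alpha>\<close> differs from \<open>\<alpha>\<^sup>m\<close> by a \<open>p\<close>-element of
  \<open>Aut\<^sub>E(T)\<close>, which is inner. So every map in
  \<open>Aut\<^sub>O\<^sub>E(T)\<close> has the property.\<close>

section \<open>Sylow theory\<close>

text \<open>The rule \<open>ext\<close> rests on one principle. Two E-morphisms that agree on a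
  subgroup Q containing its own centralizer differ by an automorphism trivial on Q; such an
  automorphism has p-power order; and p-elements of E-automizers are forced into every E-invariant
  system on T, because such a system contains all groups Aut_T(R). Centric subgroups are therefore
  the place where membership can be tested. The representatives are good for F, because receptivity
  in F lets their automorphisms extend over centralizers in the whole group, which normality needs;
  closing them up under Aut_F(T) keeps the generators invariant. The obstacle for normality is that
  an extension of \<alpha> in Aut_E(T) to T C_P(T) may act nontrivially modulo T. Comparing it with
  a lift over Q leaves an error term, and extending this error along the chain of normalizers
  creates uncontrolled p-parts at every step. Passing to a power that is its own p'-part removes
  them; this is the origin of the exponent m.\<close>

lemma (in group_action) p_group_fixed_points_mod:
  assumes p: "prime (p::nat)" and ord: "order G = p ^ k" and fin: "finite E"
  shows "card E mod p = card {x\<in>E. \<forall>g\<in>carrier G. \<phi> g x = x} mod p"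
proof -
  let ?Fx = "{x\<in>E. \<forall>g\<in>carrier G. \<phi> g x = x}"
  let ?O = "orbits G E \<phi>"
  have sing: "orbit G \<phi> x = {x}" if "x \<in> ?Fx" for x
    using that orbit_refl[of x] unfolding orbit_def by auto
  have fixed_sub: "(\<lambda>x. {x}) ` ?Fx \<subseteq> ?O"
    using sing unfolding orbits_def by fastforce
  have finO: "finite ?O"
    using fin partition.partition_coverture[OF orbit_partition] finite_UnionD by metis
  have dvd: "p dvd card Y" if Y: "Y \<in> ?O - (\<lambda>x. {x}) ` ?Fx" for Y
  proof -
    from Y obtain x where x: "x \<in> E" "Y = orbit G \<phi> x" unfolding orbits_def by auto
    have "card Y dvd p ^ k"
      using orbit_stabilizer_theorem[OF x(1)] ord x(2) by (metis dvd_triv_left)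
    then obtain i where i: "card Y = p ^ i" using p divides_primepow_nat by blast
    have "card Y \<noteq> 1"
    proof
      assume "card Y = 1"
      then obtain y where y: "Y = {y}" using card_1_singletonE by blast
      have "x \<in> Y" using orbit_refl[OF x(1)] x(2) by simp
      hence Yx: "Y = {x}" using y by blast
      hence "\<forall>g\<in>carrier G. \<phi> g x = x" using x(2) unfolding orbit_def by auto
      thus False using Y Yx x(1) by blast
    qed
    thus ?thesis using i by (cases i) auto
  qed
  have "card E = (\<Sum>Y\<in>?O. card Y)"
    using partition.disjoint_sum[OF orbit_partition fin, of "\<lambda>_. 1::nat"] by simp
  also have "\<dots> = (\<Sum>Y\<in>?O - (\<lambda>x. {x}) ` ?Fx. card Y) + (\<Sum>Y\<in>(\<lambda>x. {x}) ` ?Fx. card Y)"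
    by (rule sum.subset_diff[OF fixed_sub finO])
  also have "(\<Sum>Y\<in>(\<lambda>x. {x}) ` ?Fx. card Y) = card ?Fx"
    by (subst sum.reindex) (auto simp: inj_on_def)
  finally have "card E = (\<Sum>Y\<in>?O - (\<lambda>x. {x}) ` ?Fx. card Y) + card ?Fx" .
  moreover have "p dvd (\<Sum>Y\<in>?O - (\<lambda>x. {x}) ` ?Fx. card Y)" using dvd by (rule dvd_sum)
  ultimately show ?thesis by (auto elim!: dvdE)
qed

lemma (in group_action) p_group_fixed_point:
  assumes "prime (p::nat)" and "order G = p ^ k" and "finite E" and "\<not> p dvd card E"
  shows "\<exists>x\<in>E. \<forall>g\<in>carrier G. \<phi> g x = x"
proof (rule ccontr)
  assume no_fix: "\<not> ?thesis"
  have "{x\<in>E. \<forall>g\<in>carrier G. \<phi> g x = x} = {}" by (rule equals0I) (use no_fix in blast)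
  hence "card {x\<in>E. \<forall>g\<in>carrier G. \<phi> g x = x} = 0" by (simp only: card.empty)
  hence "card E mod p = 0" using p_group_fixed_points_mod[OF assms(1-3)] by (simp only: mod_0)
  thus False using assms(4) by (simp only: dvd_eq_mod_eq_0 not_True_eq_False)
qed

text \<open>\<open>BijGroup\<close> composes from right to left, so right cosets carry an action
  only through the inverse: b acts as right multiplication by inv b.\<close>

lemma (in group) rcosets_action:
  assumes S: "subgroup S G"
  shows "group_action G (rcosets S) (\<lambda>b. \<lambda>X\<in>rcosets S. X #> inv b)"
proof -
  have sub: "X \<subseteq> carrier G" if "X \<in> rcosets S" for X
    using that rcosets_part_G[OF S] by blast
  have mem: "X #> b \<in> rcosets S" if X: "X \<in> rcosets S" and b: "b \<in> carrier G" for X b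
  proof -
    from X obtain g where g: "g \<in> carrier G" "X = S #> g" unfolding RCOSETS_def by auto
    have "X #> b = S #> (g \<otimes> b)"
      using g b S by (simp add: coset_mult_assoc subgroup.subset)
    thus ?thesis using g b unfolding RCOSETS_def by auto
  qed
  have bij: "(\<lambda>X\<in>rcosets S. X #> inv b) \<in> Bij (rcosets S)" if b: "b \<in> carrier G" for b
    unfolding Bij_def
  proof (intro IntI CollectI)
    show "bij_betw (\<lambda>X\<in>rcosets S. X #> inv b) (rcosets S) (rcosets S)"
      by (rule bij_betwI[where g = "\<lambda>X. X #> b"])
        (use b in \<open>auto simp: mem sub coset_mult_assoc\<close>)
  qed simp
  show ?thesis
    unfolding group_action_def group_hom_def group_hom_axioms_def hom_def
  proof (intro conjI group_axioms group_BijGroup CollectI ballI)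
    show "(\<lambda>b. \<lambda>X\<in>rcosets S. X #> inv b) \<in> carrier G \<rightarrow> carrier (BijGroup (rcosets S))"
      using bij by (auto simp: BijGroup_def)
    fix x y assume xy: "x \<in> carrier G" "y \<in> carrier G"
    show "(\<lambda>X\<in>rcosets S. X #> inv (x \<otimes> y)) =
        (\<lambda>X\<in>rcosets S. X #> inv x) \<otimes>\<^bsub>BijGroup (rcosets S)\<^esub> (\<lambda>X\<in>rcosets S. X #> inv y)"
      using xy bij[OF xy(1)] bij[OF xy(2)]
      by (auto simp: BijGroup_def compose_def fun_eq_iff mem sub inv_mult_group coset_mult_assoc)
  qed
qed

text \<open>S acts on its own right cosets, and their number is a positive power of p, so the number
  of fixed cosets is divisible by p. As S itself is fixed, a second coset S g is fixed, which says
  that g S g^-1 lies in S.\<close>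

lemma (in group) p_group_normalizer_grows:
  assumes p: "prime p" and fin: "finite (carrier G)" and ord: "order G = p ^ n"
    and S: "subgroup S G" "S \<noteq> carrier G"
  shows "\<exists>g\<in>carrier G - S. \<forall>s\<in>S. g \<otimes> s \<otimes> inv g \<in> S"
proof -
  have SG: "S \<subseteq> carrier G" using S(1) subgroup.subset by blast
  let ?\<phi> = "\<lambda>b. \<lambda>X\<in>rcosets S. X #> inv b"
  interpret act: group_action "G\<lparr>carrier := S\<rparr>" "rcosets S" ?\<phi>
    by (rule group_action.induced_action[OF rcosets_action[OF S(1)] S(1)])
  have idx: "card (rcosets S) * card S = p ^ n" using lagrange[OF S(1)] ord by simp
  then obtain i j where i: "card (rcosets S) = p ^ i" and j: "card S = p ^ j"
    using divides_primepow_nat[OF p] dvd_triv_left dvd_triv_right by metis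
  have "card (rcosets S) \<noteq> 1"
  proof
    assume "card (rcosets S) = 1"
    hence "card S = card (carrier G)" using idx ord by (simp add: order_def)
    thus False using S(2) SG fin card_subset_eq by blast
  qed
  hence "p dvd card (rcosets S)" using i by (cases i) auto
  let ?Fx = "{X\<in>rcosets S. \<forall>b\<in>S. ?\<phi> b X = X}"
  have finR: "finite (rcosets S)" using fin rcosets_part_G[OF S(1)] finite_UnionD by metis
  have eq: "card (rcosets S) mod p = card ?Fx mod p"
  proof -
    have ordS: "order (G\<lparr>carrier := S\<rparr>) = p ^ j" and carS: "carrier (G\<lparr>carrier := S\<rparr>) = S"
      using j by (simp_all add: order_def)
    show ?thesis using act.p_group_fixed_points_mod[OF p ordS finR] unfolding carS .
  qed
  have dvd: "p dvd card ?Fx"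
    using \<open>p dvd card (rcosets S)\<close> unfolding dvd_eq_mod_eq_0 eq .
  have SR: "S \<in> rcosets S"
    using rcosetsI[OF SG one_closed] SG by simp
  have "S #> inv s = S" if "s \<in> S" for s
    using that S(1) SG by (intro coset_join2) (auto simp: subgroup.m_inv_closed)
  hence "S \<in> ?Fx" using SR by auto
  have "card ?Fx \<noteq> 1"
  proof
    assume "card ?Fx = 1"
    with dvd have "p dvd 1" by (simp only:)
    thus False using p by (auto dest: prime_gt_1_nat)
  qed
  hence "?Fx \<noteq> {S}" by (rule contrapos_nn) (erule ssubst, simp)
  then obtain X where X: "X \<in> rcosets S" "\<forall>b\<in>S. ?\<phi> b X = X" "X \<noteq> S" using \<open>S \<in> ?Fx\<close> by blast
  then obtain g where g: "g \<in> carrier G" "X = S #> g" unfolding RCOSETS_def by auto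
  have "g \<notin> S" using g X(3) S(1) coset_join2 by blast
  moreover have "g \<otimes> b \<otimes> inv g \<in> S" if b: "b \<in> S" for b
  proof -
    have bG: "b \<in> carrier G" using b SG by blast
    have ib: "inv b \<in> S" using b S(1) by (simp add: subgroup.m_inv_closed)
    have "S #> g #> inv (inv b) = S #> g" using X ib g by auto
    hence "S #> (g \<otimes> b) = S #> g" using bG g SG by (simp add: coset_mult_assoc)
    hence "g \<otimes> b \<in> S #> g" using bG g S(1) by (metis m_closed rcos_self)
    then obtain s where "s \<in> S" "g \<otimes> b = s \<otimes> g" unfolding r_coset_def by auto
    thus ?thesis using g bG S(1) by (metis inv_solve_right m_closed subgroup.mem_carrier)
  qed
  ultimately show ?thesis using g(1) by blast
qed

text \<open>The number of cosets of S is prime to p, so the p-group B fixes some coset S g; then g B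
  g^-1 lies in S.\<close>

theorem (in group) sylow_conjugate:
  assumes p: "prime p" and fin: "finite (carrier G)" and S: "sylow_subgroup p S G"
    and B: "subgroup B G" "card B = p ^ k"
  shows "\<exists>g\<in>carrier G. \<forall>b\<in>B. g \<otimes> b \<otimes> inv g \<in> S"
proof -
  have sS: "subgroup S G" and cS: "card S = p ^ multiplicity p (order G)"
    using S unfolding sylow_subgroup_def by auto
  interpret act: group_action "G\<lparr>carrier := B\<rparr>" "rcosets S" "\<lambda>b. \<lambda>X\<in>rcosets S. X #> inv b"
    by (rule group_action.induced_action[OF rcosets_action[OF sS] B(1)])
  have ord0: "order G \<noteq> 0" using fin order_gt_0_iff_finite by auto
  have idx: "card (rcosets S) * p ^ multiplicity p (order G) = order G"
    using lagrange[OF sS] cS by simp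
  have "\<not> p dvd card (rcosets S)"
  proof
    assume "p dvd card (rcosets S)"
    then have "p ^ Suc (multiplicity p (order G)) dvd order G"
      using idx by (metis mult_dvd_mono dvd_refl power_Suc)
    thus False using ord0 p
      by (metis power_dvd_iff_le_multiplicity not_prime_unit Suc_n_not_le_n)
  qed
  moreover have "finite (rcosets S)"
    using fin rcosets_part_G[OF sS] finite_UnionD by metis
  moreover have "order (G\<lparr>carrier := B\<rparr>) = p ^ k" using B by (simp add: order_def)
  ultimately obtain X where X: "X \<in> rcosets S"
      "\<forall>b\<in>B. (\<lambda>X\<in>rcosets S. X #> inv b) X = X"
    using act.p_group_fixed_point[OF p, of k] by auto
  then obtain g where g: "g \<in> carrier G" "X = S #> g" unfolding RCOSETS_def by auto
  have "g \<otimes> b \<otimes> inv g \<in> S" if b: "b \<in> B" for b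
  proof -
    have bG: "b \<in> carrier G" using b B(1) subgroup.subset by blast
    have ib: "inv b \<in> B" using b B(1) by (simp add: subgroup.m_inv_closed)
    have "S #> g #> inv (inv b) = S #> g" using X(2) ib g X(1) by auto
    hence "S #> (g \<otimes> b) = S #> g"
      using bG g sS by (simp add: coset_mult_assoc subgroup.subset)
    hence "g \<otimes> b \<in> S #> g" using bG g sS
      by (metis m_closed rcos_self)
    then obtain s where "s \<in> S" "g \<otimes> b = s \<otimes> g" unfolding r_coset_def by auto
    thus ?thesis using g bG sS by (metis inv_solve_right m_closed subgroup.mem_carrier)
  qed
  thus ?thesis using g by blast
qed

lemma (in group) sylow_subgroup_exists:
  assumes p: "prime p" and fin: "finite (carrier G)"
  shows "\<exists>S. sylow_subgroup p S G"
proof -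
  have "p ^ multiplicity p (order G) dvd order G" by (rule multiplicity_dvd)
  then obtain m where "order G = p ^ multiplicity p (order G) * m" by auto
  from sylow_thm[OF p is_group this fin] show ?thesis unfolding sylow_subgroup_def by auto
qed

lemma (in group) conj_image_subgroup:
  assumes "g \<in> carrier G" "subgroup B G"
  shows "subgroup ((\<lambda>b. g \<otimes> b \<otimes> inv g) ` B) G" "card ((\<lambda>b. g \<otimes> b \<otimes> inv g) ` B) = card B"
proof -
  have BG: "B \<subseteq> carrier G" using assms(2) subgroup.subset by blast
  show "subgroup ((\<lambda>b. g \<otimes> b \<otimes> inv g) ` B) G"
  proof (rule subgroupI)
    show "(\<lambda>b. g \<otimes> b \<otimes> inv g) ` B \<subseteq> carrier G" using BG assms(1) by auto
    show "(\<lambda>b. g \<otimes> b \<otimes> inv g) ` B \<noteq> {}" using subgroup.one_closed[OF assms(2)] by auto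
    fix a assume "a \<in> (\<lambda>b. g \<otimes> b \<otimes> inv g) ` B"
    then obtain b where b: "b \<in> B" "a = g \<otimes> b \<otimes> inv g" by auto
    have "inv a = g \<otimes> inv b \<otimes> inv g" using b BG assms(1)
      by (simp add: inv_mult_group m_assoc subset_iff)
    thus "inv a \<in> (\<lambda>b. g \<otimes> b \<otimes> inv g) ` B" using b subgroup.m_inv_closed[OF assms(2)] by auto
    fix a' assume "a' \<in> (\<lambda>b. g \<otimes> b \<otimes> inv g) ` B"
    then obtain b' where b': "b' \<in> B" "a' = g \<otimes> b' \<otimes> inv g" by auto
    have "b \<in> carrier G" "b' \<in> carrier G" using b b' BG by auto
    then have "a \<otimes> a' = g \<otimes> (b \<otimes> b') \<otimes> inv g" using b b' assms(1)
      by (metis inv_closed inv_solve_left m_assoc m_closed)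
    thus "a \<otimes> a' \<in> (\<lambda>b. g \<otimes> b \<otimes> inv g) ` B"
      using b b' subgroup.m_closed[OF assms(2)] by auto
  qed
  have "inj_on (\<lambda>b. g \<otimes> b \<otimes> inv g) B" using BG assms(1) 
    by (auto simp: inj_on_def subset_iff)
  thus "card ((\<lambda>b. g \<otimes> b \<otimes> inv g) ` B) = card B" by (rule card_image)
qed

text \<open>Conjugate B into an arbitrary Sylow subgroup and move that Sylow subgroup back by the
  inverse element.\<close>

lemma (in group) sylow_subgroup_containing:
  assumes p: "prime p" and fin: "finite (carrier G)" and B: "subgroup B G" "card B = p ^ k"
  shows "\<exists>S. sylow_subgroup p S G \<and> B \<subseteq> S"
proof -
  obtain S where S: "sylow_subgroup p S G" using sylow_subgroup_exists[OF p fin] by blast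
  obtain g where g: "g \<in> carrier G" "\<forall>b\<in>B. g \<otimes> b \<otimes> inv g \<in> S"
    using sylow_conjugate[OF p fin S B] by blast
  let ?S' = "(\<lambda>b. inv g \<otimes> b \<otimes> inv (inv g)) ` S"
  have sS: "subgroup S G" using S unfolding sylow_subgroup_def by auto
  have "sylow_subgroup p ?S' G"
    using S conj_image_subgroup[OF inv_closed[OF g(1)] sS] unfolding sylow_subgroup_def by simp
  moreover have "b \<in> ?S'" if b: "b \<in> B" for b
  proof -
    have "b \<in> carrier G" using b B(1) subgroup.subset by blast
    hence "b = inv g \<otimes> (g \<otimes> b \<otimes> inv g) \<otimes> inv (inv g)" using g(1) by (simp add: m_assoc inv_solve_left)
    thus ?thesis using g(2) b by blast
  qed
  ultimately show ?thesis by blast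
qed

text \<open>If another prime q divided the order, a nontrivial element of a Sylow q-subgroup would
  have order dividing both a power of q and a power of p.\<close>

lemma (in group) p_group_order_if_elements_p_power:
  assumes p: "prime p" and fin: "finite (carrier G)"
    and el: "\<And>x. x \<in> carrier G \<Longrightarrow> \<exists>k. x [^] (p ^ k :: nat) = \<one>"
  shows "\<exists>n. order G = p ^ n"
proof -
  have ord0: "order G > 0" using fin order_gt_0_iff_finite by auto
  have "q = p" if q: "prime q" "q dvd order G" for q
  proof (rule ccontr)
    assume "q \<noteq> p"
    obtain S where S: "sylow_subgroup q S G" using sylow_subgroup_exists[OF q(1) fin] by blast
    hence sS: "subgroup S G" and cS: "card S = q ^ multiplicity q (order G)"
      unfolding sylow_subgroup_def by auto
    have "multiplicity q (order G) > 0" using q ord0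
      by (simp add: prime_multiplicity_gt_zero_iff)
    hence "card S > 1" using cS q(1) by (metis one_less_power prime_gt_1_nat)
    then obtain x where x: "x \<in> S" "x \<noteq> \<one>"
      by (metis One_nat_def card.empty card_1_singleton_iff card_mono finite.simps
          linorder_not_less singletonI subsetI less_imp_neq card_insert_disjoint equals0D finite_subset
          fin sS subgroup.subset bot_nat_0.not_eq_extremum insertCI less_numeral_extra(4))
    have xG: "x \<in> carrier G" using x sS subgroup.subset by blast
    interpret S: group "G\<lparr>carrier := S\<rparr>" using sS by (rule subgroup_imp_group)
    have "x [^]\<^bsub>G\<lparr>carrier := S\<rparr>\<^esub> order (G\<lparr>carrier := S\<rparr>) = \<one>"
      using S.pow_order_eq_1[of x] x by simp
    hence "x [^] (q ^ multiplicity q (order G)) = \<one>"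
      using cS by (simp add: order_def nat_pow_consistent[symmetric])
    moreover obtain k where "x [^] (p ^ k) = \<one>" using el[OF xG] by blast
    ultimately have "ord x dvd q ^ multiplicity q (order G)" "ord x dvd p ^ k"
      using xG by (simp_all add: pow_eq_id)
    moreover have "coprime (q ^ multiplicity q (order G)) (p ^ k)"
      using \<open>q \<noteq> p\<close> q(1) p by (simp add: primes_coprime)
    ultimately have "ord x = 1" by (metis coprime_common_divisor_nat nat_dvd_1_iff_1)
    hence "x = \<one>" using ord_eq_1[OF xG] by metis
    thus False using x by blast
  qed
  moreover obtain r where r: "order G = p ^ multiplicity p (order G) * r" "\<not> p dvd r"
    using multiplicity_decompose'[of "order G" p] ord0 p
    by (metis not_prime_unit less_numeral_extra(3))
  ultimately have "r = 1" by (metis dvd_mult prime_factor_nat)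
  thus ?thesis using r(1) by auto
qed

section \<open>Groups of permutations\<close>

lemma BijGroup_mult: "f \<in> Bij Q \<Longrightarrow> g \<in> Bij Q \<Longrightarrow> f \<otimes>\<^bsub>BijGroup Q\<^esub> g = compose Q f g"
  and BijGroup_one: "\<one>\<^bsub>BijGroup Q\<^esub> = (\<lambda>x\<in>Q. x)"
  and BijGroup_carrier: "carrier (BijGroup Q) = Bij Q"
  by (auto simp: BijGroup_def)

lemma BijD: "f \<in> Bij Q \<Longrightarrow> bij_betw f Q Q" "f \<in> Bij Q \<Longrightarrow> x \<in> Q \<Longrightarrow> f x \<in> Q"
  by (auto simp: Bij_def bij_betw_def)

lemma Bij_eqI: "f \<in> Bij Q \<Longrightarrow> g \<in> Bij Q \<Longrightarrow> (\<And>x. x \<in> Q \<Longrightarrow> f x = g x) \<Longrightarrow> f = g"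
  by (rule extensionalityI[of _ Q]) (auto simp: Bij_def)

lemma finite_Bij: "finite Q \<Longrightarrow> finite (Bij Q)"
  by (rule finite_subset[OF _ finite_PiE[of Q "\<lambda>_. Q"]]) (auto simp: Bij_def bij_betw_def PiE_def)

text \<open>Closure under inverses comes from finiteness: left multiplication by a is injective on
  the finite set, hence hits the identity.\<close>

lemma BijGroup_subgroupI:
  assumes "finite Q" and sub: "\<AA> \<subseteq> Bij Q" and one: "(\<lambda>x\<in>Q. x) \<in> \<AA>"
    and closed: "\<And>a b. a \<in> \<AA> \<Longrightarrow> b \<in> \<AA> \<Longrightarrow> compose Q a b \<in> \<AA>"
  shows "subgroup \<AA> (BijGroup Q)"
proof -
  interpret B: group "BijGroup Q" by (rule group_BijGroup)
  have fin: "finite \<AA>" using finite_Bij[OF assms(1)] sub finite_subset by blast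
  have cl: "a \<otimes>\<^bsub>BijGroup Q\<^esub> b \<in> \<AA>" if "a \<in> \<AA>" "b \<in> \<AA>" for a b
    using that closed sub by (simp add: BijGroup_mult subset_iff)
  show ?thesis
  proof (rule B.subgroupI)
    show "\<AA> \<subseteq> carrier (BijGroup Q)" using sub by (simp add: BijGroup_carrier)
    show "\<AA> \<noteq> {}" using one by blast
    fix a assume a: "a \<in> \<AA>"
    have "inj_on (\<lambda>b. a \<otimes>\<^bsub>BijGroup Q\<^esub> b) \<AA>"
    proof (rule inj_onI)
      fix b c assume "b \<in> \<AA>" "c \<in> \<AA>" and eq: "a \<otimes>\<^bsub>BijGroup Q\<^esub> b = a \<otimes>\<^bsub>BijGroup Q\<^esub> c"
      hence "a \<in> carrier (BijGroup Q)" "b \<in> carrier (BijGroup Q)" "c \<in> carrier (BijGroup Q)"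
        unfolding BijGroup_carrier using a sub by blast+
      thus "b = c" using eq by simp
    qed
    moreover have "(\<lambda>b. a \<otimes>\<^bsub>BijGroup Q\<^esub> b) ` \<AA> \<subseteq> \<AA>" using cl[OF a] by auto
    ultimately have "(\<lambda>b. a \<otimes>\<^bsub>BijGroup Q\<^esub> b) ` \<AA> = \<AA>" using fin by (simp add: endo_inj_surj)
    then obtain b where b: "b \<in> \<AA>" "a \<otimes>\<^bsub>BijGroup Q\<^esub> b = \<one>\<^bsub>BijGroup Q\<^esub>"
      unfolding BijGroup_one using one by (metis (no_types, lifting) imageE)
    have ab: "a \<in> carrier (BijGroup Q)" "b \<in> carrier (BijGroup Q)"
      unfolding BijGroup_carrier using a b(1) sub by blast+
    have "inv\<^bsub>BijGroup Q\<^esub> a = b"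
      by (rule B.inv_equality[OF B.inv_comm[OF b(2) ab] ab])
    thus "inv\<^bsub>BijGroup Q\<^esub> a \<in> \<AA>" using b by simp
  qed (use cl in auto)
qed

text \<open>Counterpart of \<open>sylow_subgroup\<close> for two sets of permutations inside one
  \<open>BijGroup\<close>, so that no carrier has to be updated. That the sets are subgroups is
  supplied separately.\<close>

definition sylow_in :: "nat \<Rightarrow> 'a set \<Rightarrow> 'a set \<Rightarrow> bool" where
  "sylow_in p S A \<longleftrightarrow> S \<subseteq> A \<and> card S = p ^ multiplicity p (card A)"

text \<open>By Lagrange \<open>card S\<close> divides \<open>card K\<close>, which divides
  \<open>card A\<close>, so the multiplicity of p in \<open>card K\<close> is squeezed.\<close>

lemma sylow_in_between:
  assumes p: "prime p" and "finite Q" and A: "subgroup A (BijGroup Q)" and K: "subgroup K (BijGroup Q)"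
    and S: "subgroup S (BijGroup Q)"
    and syl: "sylow_in p S A" and SK: "S \<subseteq> K" and KA: "K \<subseteq> A"
  shows "sylow_in p S K"
proof -
  have fin: "finite (Bij Q)" using finite_Bij assms(2) by blast
  have AB: "A \<subseteq> Bij Q" "K \<subseteq> Bij Q" using A K by (metis BijGroup_carrier subgroup.subset)+
  interpret B: group "BijGroup Q" by (rule group_BijGroup)
  interpret GA: group "BijGroup Q\<lparr>carrier := A\<rparr>" by (rule B.subgroup_imp_group[OF A])
  interpret GK: group "BijGroup Q\<lparr>carrier := K\<rparr>" by (rule B.subgroup_imp_group[OF K])
  have "card K dvd card A"
    using dvdI[OF GA.lagrange[OF B.subgroup_incl[OF K A KA], symmetric, unfolded mult.commute[of _ "card K"]]]
    by (simp add: order_def)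
  moreover have "card S dvd card K"
    using dvdI[OF GK.lagrange[OF B.subgroup_incl[OF S K SK], symmetric, unfolded mult.commute[of _ "card S"]]]
    by (simp add: order_def)
  moreover have "card A \<noteq> 0" "card K \<noteq> 0"
    using fin AB A K by (metis card_0_eq empty_iff finite_subset subgroup.one_closed)+
  moreover have "card S = p ^ multiplicity p (card A)" using syl unfolding sylow_in_def by blast
  ultimately have "multiplicity p (card K) \<le> multiplicity p (card A)"
      "multiplicity p (card A) \<le> multiplicity p (card K)"
    using p by (simp add: dvd_imp_multiplicity_le, intro multiplicity_geI) auto
  thus ?thesis using syl SK unfolding sylow_in_def by auto
qed

text \<open>The relation g b g^-1 = s is recorded as g b = s g, pointwise on Q: this is the form in
  which it later combines with morphisms defined on Q.\<close>

lemma sylow_in_conjugate: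
  assumes p: "prime p" and fin: "finite Q" and A: "subgroup A (BijGroup Q)"
    and S: "subgroup S (BijGroup Q)" "sylow_in p S A"
    and B: "subgroup B (BijGroup Q)" "B \<subseteq> A" "card B = p ^ k"
  shows "\<exists>g\<in>A. \<forall>b\<in>B. \<exists>s\<in>S. \<forall>x\<in>Q. g (b x) = s (g x)"
proof -
  have SA: "S \<subseteq> A" using S(2) unfolding sylow_in_def by blast
  interpret B: group "BijGroup Q" by (rule group_BijGroup)
  have AB: "A \<subseteq> Bij Q" using A by (metis BijGroup_carrier subgroup.subset)
  interpret GA: group "BijGroup Q\<lparr>carrier := A\<rparr>" by (rule B.subgroup_imp_group[OF A])
  have finA: "finite (carrier (BijGroup Q\<lparr>carrier := A\<rparr>))"
    using finite_subset[OF AB finite_Bij[OF fin]] by simp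
  have sS: "sylow_subgroup p S (BijGroup Q\<lparr>carrier := A\<rparr>)"
    using S(2) B.subgroup_incl[OF S(1) A SA] unfolding sylow_in_def sylow_subgroup_def
    by (simp add: order_def)
  obtain g where g: "g \<in> A" and *: "\<And>b. b \<in> B \<Longrightarrow> g \<otimes>\<^bsub>BijGroup Q\<^esub> b \<otimes>\<^bsub>BijGroup Q\<^esub> inv\<^bsub>BijGroup Q\<^esub> g \<in> S"
    using GA.sylow_conjugate[OF p finA sS B.subgroup_incl[OF B(1) A B(2)] B(3)] A
    by (auto simp: B.m_inv_consistent)
  have "\<exists>s\<in>S. \<forall>x\<in>Q. g (b x) = s (g x)" if b: "b \<in> B" for b
  proof -
    let ?s = "g \<otimes>\<^bsub>BijGroup Q\<^esub> b \<otimes>\<^bsub>BijGroup Q\<^esub> inv\<^bsub>BijGroup Q\<^esub> g"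
    have mem: "g \<in> Bij Q" "b \<in> Bij Q" "?s \<in> Bij Q"
      using g b AB B(2) SA *[OF b] by auto
    have "g \<in> carrier (BijGroup Q)" "b \<in> carrier (BijGroup Q)"
      using mem by (simp_all add: BijGroup_carrier)
    hence "?s \<otimes>\<^bsub>BijGroup Q\<^esub> g = g \<otimes>\<^bsub>BijGroup Q\<^esub> b"
      by (simp add: B.m_assoc)
    hence "compose Q ?s g = compose Q g b" using mem by (simp add: BijGroup_mult del: B.m_assoc)
    hence "\<forall>x\<in>Q. g (b x) = ?s (g x)" by (metis compose_eq)
    thus ?thesis using *[OF b] by blast
  qed
  thus ?thesis using g by blast
qed

lemma sylow_in_containing:
  assumes p: "prime p" and fin: "finite Q" and A: "subgroup A (BijGroup Q)"
    and B: "subgroup B (BijGroup Q)" "B \<subseteq> A" "card B = p ^ k"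
  shows "\<exists>S. subgroup S (BijGroup Q) \<and> sylow_in p S A \<and> B \<subseteq> S"
proof -
  interpret B: group "BijGroup Q" by (rule group_BijGroup)
  have AB: "A \<subseteq> Bij Q" using A by (metis BijGroup_carrier subgroup.subset)
  interpret GA: group "BijGroup Q\<lparr>carrier := A\<rparr>" by (rule B.subgroup_imp_group[OF A])
  have finA: "finite (carrier (BijGroup Q\<lparr>carrier := A\<rparr>))"
    using finite_subset[OF AB finite_Bij[OF fin]] by simp
  obtain S where S: "sylow_subgroup p S (BijGroup Q\<lparr>carrier := A\<rparr>)" "B \<subseteq> S"
    using GA.sylow_subgroup_containing[OF p finA B.subgroup_incl[OF B(1) A B(2)] B(3)] by blast
  hence "subgroup S (BijGroup Q)" "sylow_in p S A"
    using B.incl_subgroup[OF A, of S] subgroup.subset[of S "BijGroup Q\<lparr>carrier := A\<rparr>"]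
    unfolding sylow_subgroup_def sylow_in_def by (auto simp: order_def)
  thus ?thesis using S(2) by blast
qed

lemma BijGroup_pow_apply:
  assumes "f \<in> Bij Q" "x \<in> Q"
  shows "(f [^]\<^bsub>BijGroup Q\<^esub> n) x = (f ^^ n) x"
proof -
  interpret B: group "BijGroup Q" by (rule group_BijGroup)
  have fB: "f \<in> carrier (BijGroup Q)" using assms(1) by (simp add: BijGroup_carrier)
  show ?thesis
  proof (induction n)
    case 0 show ?case using assms(2) by (simp add: BijGroup_one)
  next
    case (Suc n)
    have "f [^]\<^bsub>BijGroup Q\<^esub> Suc n = compose Q f (f [^]\<^bsub>BijGroup Q\<^esub> n)"
      using assms(1) B.nat_pow_Suc2[OF fB] B.nat_pow_closed[OF fB]
      by (simp add: BijGroup_mult BijGroup_carrier)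
    thus ?case using Suc assms(2) by (simp add: compose_eq)
  qed
qed

lemma p_power_card_if_funpow:
  assumes p: "prime p" and fin: "finite Q" and B: "subgroup B (BijGroup Q)"
    and el: "\<And>b. b \<in> B \<Longrightarrow> \<exists>k. \<forall>x\<in>Q. (b ^^ (p ^ k)) x = x"
  shows "\<exists>n. card B = p ^ n"
proof -
  interpret B: group "BijGroup Q" by (rule group_BijGroup)
  interpret GB: group "BijGroup Q\<lparr>carrier := B\<rparr>" by (rule B.subgroup_imp_group[OF B])
  have BB: "B \<subseteq> Bij Q" using B by (metis BijGroup_carrier subgroup.subset)
  have "\<exists>n. order (BijGroup Q\<lparr>carrier := B\<rparr>) = p ^ n"
  proof (rule GB.p_group_order_if_elements_p_power[OF p])
    show "finite (carrier (BijGroup Q\<lparr>carrier := B\<rparr>))" using finite_subset[OF BB finite_Bij[OF fin]] by simp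
    fix b assume b: "b \<in> carrier (BijGroup Q\<lparr>carrier := B\<rparr>)"
    then obtain k where k: "\<forall>x\<in>Q. (b ^^ (p ^ k)) x = x" using el by auto
    have bB: "b \<in> Bij Q" using b BB by auto
    have "b [^]\<^bsub>BijGroup Q\<^esub> (p ^ k) = \<one>\<^bsub>BijGroup Q\<^esub>"
    proof (rule Bij_eqI[of _ Q])
      show "b [^]\<^bsub>BijGroup Q\<^esub> (p ^ k) \<in> Bij Q" using bB B.nat_pow_closed[of b "p ^ k"] by (simp add: BijGroup_carrier)
      show "\<one>\<^bsub>BijGroup Q\<^esub> \<in> Bij Q" using B.one_closed by (simp only: BijGroup_carrier)
      fix x assume "x \<in> Q"
      thus "(b [^]\<^bsub>BijGroup Q\<^esub> (p ^ k)) x = \<one>\<^bsub>BijGroup Q\<^esub> x"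
        using k bB by (simp add: BijGroup_pow_apply BijGroup_one)
    qed
    hence "b [^]\<^bsub>BijGroup Q\<lparr>carrier := B\<rparr>\<^esub> (p ^ k) = \<one>\<^bsub>BijGroup Q\<lparr>carrier := B\<rparr>\<^esub>"
      unfolding B.nat_pow_consistent[symmetric] by simp
    thus "\<exists>k. b [^]\<^bsub>BijGroup Q\<lparr>carrier := B\<rparr>\<^esub> (p ^ k) = \<one>\<^bsub>BijGroup Q\<lparr>carrier := B\<rparr>\<^esub>"
      by blast
  qed
  thus ?thesis by (simp add: order_def)
qed

text \<open>The map b |-> f b f^-1 is multiplicative and injective. It carries groups of
  automorphisms along isomorphisms, whichever fusion system these belong to.\<close>

lemma Bij_conj_subgroup:
  assumes f: "bij_betw f Q R" and fin: "finite Q" and B: "subgroup B (BijGroup Q)"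
  defines "\<Phi> \<equiv> \<lambda>b. \<lambda>y\<in>R. f (b (inv_into Q f y))"
  shows "subgroup (\<Phi> ` B) (BijGroup R)" "card (\<Phi> ` B) = card B"
proof -
  have BB: "B \<subseteq> Bij Q" using B by (metis BijGroup_carrier subgroup.subset)
  have inj: "inj_on f Q" and fQ: "f ` Q = R" using f unfolding bij_betw_def by (rule conjunct1, rule conjunct2)
  have finR: "finite R" unfolding fQ[symmetric] using fin by (rule finite_imageI)
  have app: "\<Phi> b (f x) = f (b x)" if "x \<in> Q" for b x
  proof -
    have "f x \<in> R" unfolding fQ[symmetric] using that by (rule imageI)
    thus ?thesis unfolding \<Phi>_def by (simp only: restrict_apply' inv_into_f_f[OF inj that])
  qed
  have bij: "\<Phi> b \<in> Bij R" if b: "b \<in> B" for b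
  proof -
    have "bij_betw b Q Q" using b BB by (auto intro: BijD(1))
    from bij_betw_trans[OF bij_betw_trans[OF bij_betw_inv_into[OF f] this] f]
    have "bij_betw (f \<circ> (b \<circ> inv_into Q f)) R R" .
    moreover have "bij_betw (\<Phi> b) R R = bij_betw (f \<circ> (b \<circ> inv_into Q f)) R R"
      by (rule bij_betw_cong) (simp add: \<Phi>_def)
    ultimately have "bij_betw (\<Phi> b) R R" by (simp only:)
    thus ?thesis unfolding Bij_def by (auto simp: \<Phi>_def)
  qed
  show "subgroup (\<Phi> ` B) (BijGroup R)"
  proof (rule BijGroup_subgroupI[OF finR])
    show "\<Phi> ` B \<subseteq> Bij R" using bij by auto
    have "(\<lambda>x\<in>Q. x) \<in> B" using subgroup.one_closed[OF B] by (simp add: BijGroup_one)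
    moreover have "\<Phi> (\<lambda>x\<in>Q. x) = (\<lambda>y\<in>R. y)"
    proof
      fix y show "\<Phi> (\<lambda>x\<in>Q. x) y = (\<lambda>y\<in>R. y) y"
      proof (cases "y \<in> R")
        case True
        hence "inv_into Q f y \<in> Q" "f (inv_into Q f y) = y" using fQ by (simp_all add: inv_into_into f_inv_into_f)
        thus ?thesis using True by (simp add: \<Phi>_def)
      qed (simp add: \<Phi>_def)
    qed
    ultimately show "(\<lambda>y\<in>R. y) \<in> \<Phi> ` B" by (metis image_eqI)
    fix a c assume "a \<in> \<Phi> ` B" "c \<in> \<Phi> ` B"
    then obtain b d where bd: "b \<in> B" "a = \<Phi> b" "d \<in> B" "c = \<Phi> d" by auto
    have m: "compose Q b d \<in> B"
      using subgroup.m_closed[OF B bd(1,3)] bd BB by (simp add: BijGroup_mult subset_iff)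
    have "compose R a c = \<Phi> (compose Q b d)"
    proof (rule Bij_eqI[of _ R])
      show "compose R a c \<in> Bij R" unfolding bd(2,4) by (rule compose_Bij[OF bij[OF bd(1)] bij[OF bd(3)]])
      show "\<Phi> (compose Q b d) \<in> Bij R" by (rule bij[OF m])
      fix y assume "y \<in> R"
      then obtain x where x: "x \<in> Q" "y = f x" using fQ by auto
      have "d x \<in> Q" using bd BB BijD(2)[of d Q x] x by blast
      thus "compose R a c y = \<Phi> (compose Q b d) y"
        using x(1) \<open>y \<in> R\<close> unfolding bd(2,4) x(2) by (simp add: compose_eq app)
    qed
    thus "compose R a c \<in> \<Phi> ` B" using m by (simp only: imageI)
  qed
  have "inj_on \<Phi> B"
  proof (rule inj_onI)
    fix b d assume bd: "b \<in> B" "d \<in> B" "\<Phi> b = \<Phi> d"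
    have "b x = d x" if x: "x \<in> Q" for x
    proof -
      have "f (b x) = f (d x)" using app[OF x, of b] app[OF x, of d] bd(3) by simp
      moreover have "b x \<in> Q" "d x \<in> Q" using bd BB BijD(2)[of b Q x] BijD(2)[of d Q x] x by blast+
      ultimately show ?thesis using inj_onD[OF inj] by metis
    qed
    thus "b = d" using bd(1,2) BB by (intro Bij_eqI[of b Q d]) auto
  qed
  thus "card (\<Phi> ` B) = card B" by (rule card_image)
qed

section \<open>Conjugation, normalizers and centralizers\<close>

text \<open>A total version of \<open>conj_map\<close>, so that composites and powers of
  conjugations carry no domains along.\<close>

definition conj_by :: "('a, 'b) monoid_scheme \<Rightarrow> 'a \<Rightarrow> 'a \<Rightarrow> 'a" where
  "conj_by G g x = inv\<^bsub>G\<^esub> g \<otimes>\<^bsub>G\<^esub> x \<otimes>\<^bsub>G\<^esub> g"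

definition normalizer_in :: "('a, 'b) monoid_scheme \<Rightarrow> 'a set \<Rightarrow> 'a set \<Rightarrow> 'a set" where
  "normalizer_in G T Q = {g \<in> T. conj_by G g ` Q = Q}"

definition centralizer_in :: "('a, 'b) monoid_scheme \<Rightarrow> 'a set \<Rightarrow> 'a set \<Rightarrow> 'a set" where
  "centralizer_in G T Q = {g \<in> T. \<forall>x\<in>Q. g \<otimes>\<^bsub>G\<^esub> x = x \<otimes>\<^bsub>G\<^esub> g}"

context group
begin

lemma conj_by_closed [simp]: "g \<in> carrier G \<Longrightarrow> x \<in> carrier G \<Longrightarrow> conj_by G g x \<in> carrier G"
  by (simp add: conj_by_def)

lemma mult_inv_cancel [simp]: "g \<in> carrier G \<Longrightarrow> x \<in> carrier G \<Longrightarrow> g \<otimes> (inv g \<otimes> x) = x"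
  and inv_mult_cancel [simp]: "g \<in> carrier G \<Longrightarrow> x \<in> carrier G \<Longrightarrow> inv g \<otimes> (g \<otimes> x) = x"
  by (simp_all add: m_assoc[symmetric])

lemma conj_by_mult: "g \<in> carrier G \<Longrightarrow> x \<in> carrier G \<Longrightarrow> y \<in> carrier G \<Longrightarrow>
    conj_by G g (x \<otimes> y) = conj_by G g x \<otimes> conj_by G g y"
  unfolding conj_by_def by (simp add: m_assoc)

lemma conj_by_conj_by: "g \<in> carrier G \<Longrightarrow> h \<in> carrier G \<Longrightarrow> x \<in> carrier G \<Longrightarrow>
    conj_by G h (conj_by G g x) = conj_by G (g \<otimes> h) x"
  unfolding conj_by_def by (simp add: m_assoc inv_mult_group)

lemma conj_by_one [simp]: "x \<in> carrier G \<Longrightarrow> conj_by G \<one> x = x"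
  by (simp add: conj_by_def)

lemma conj_by_inv1 [simp]: "g \<in> carrier G \<Longrightarrow> x \<in> carrier G \<Longrightarrow> conj_by G (inv g) (conj_by G g x) = x"
  and conj_by_inv2 [simp]: "g \<in> carrier G \<Longrightarrow> x \<in> carrier G \<Longrightarrow> conj_by G g (conj_by G (inv g) x) = x"
  by (simp_all add: conj_by_conj_by)

lemma conj_by_inj: "g \<in> carrier G \<Longrightarrow> x \<in> carrier G \<Longrightarrow> y \<in> carrier G \<Longrightarrow> conj_by G g x = conj_by G g y \<longleftrightarrow> x = y"
  by (metis conj_by_inv1)

lemma conj_by_commute: "g \<in> carrier G \<Longrightarrow> x \<in> carrier G \<Longrightarrow> conj_by G g x = x \<longleftrightarrow> g \<otimes> x = x \<otimes> g"
  unfolding conj_by_def by (metis inv_closed inv_solve_left m_assoc m_closed)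

lemma conj_by_mem: "subgroup Q G \<Longrightarrow> g \<in> Q \<Longrightarrow> x \<in> Q \<Longrightarrow> conj_by G g x \<in> Q"
  unfolding conj_by_def by (simp add: subgroup.m_closed subgroup.m_inv_closed)

lemma conj_by_pow: "g \<in> carrier G \<Longrightarrow> x \<in> carrier G \<Longrightarrow> (conj_by G g ^^ n) x = conj_by G (g [^] n) x"
proof (induction n)
  case (Suc n) thus ?case by (simp add: conj_by_conj_by)
qed simp

lemma normalizer_inD: "g \<in> normalizer_in G T Q \<Longrightarrow> g \<in> T" "g \<in> normalizer_in G T Q \<Longrightarrow> x \<in> Q \<Longrightarrow> conj_by G g x \<in> Q"
  unfolding normalizer_in_def by auto

lemma centralizer_inD: "g \<in> centralizer_in G T Q \<Longrightarrow> g \<in> T" "g \<in> centralizer_in G T Q \<Longrightarrow> x \<in> Q \<Longrightarrow> g \<otimes> x = x \<otimes> g"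
  unfolding centralizer_in_def by auto

lemma centralizer_in_mono: "T \<subseteq> T' \<Longrightarrow> centralizer_in G T Q \<subseteq> centralizer_in G T' Q" "Q \<subseteq> Q' \<Longrightarrow> centralizer_in G T Q' \<subseteq> centralizer_in G T Q"
  unfolding centralizer_in_def by auto

lemma normalizer_in_mono: "T \<subseteq> T' \<Longrightarrow> normalizer_in G T Q \<subseteq> normalizer_in G T' Q"
  unfolding normalizer_in_def by auto

lemma centralizer_in_conj_by: "subgroup T G \<Longrightarrow> Q \<subseteq> carrier G \<Longrightarrow> g \<in> T \<Longrightarrow> g \<in> centralizer_in G T Q \<longleftrightarrow> (\<forall>x\<in>Q. conj_by G g x = x)"
  unfolding centralizer_in_def by (auto simp: conj_by_commute subgroup.mem_carrier subset_iff)

lemma subgroup_normalizer_in: 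
  assumes T: "subgroup T G" and Q: "subgroup Q G"
  shows "subgroup (normalizer_in G T Q) G"
proof (rule subgroupI)
  have TG: "\<And>x. x \<in> T \<Longrightarrow> x \<in> carrier G" and QG: "\<And>x. x \<in> Q \<Longrightarrow> x \<in> carrier G"
    using T Q subgroup.mem_carrier by metis+
  show "normalizer_in G T Q \<subseteq> carrier G" using TG normalizer_inD(1) by blast
  have "\<one> \<in> normalizer_in G T Q" unfolding normalizer_in_def using subgroup.one_closed[OF T] QG by simp
  thus "normalizer_in G T Q \<noteq> {}" by blast
  fix a assume a: "a \<in> normalizer_in G T Q"
  hence aT: "a \<in> T" "conj_by G a ` Q = Q" unfolding normalizer_in_def by auto
  have "conj_by G (inv a) ` Q = conj_by G (inv a) ` conj_by G a ` Q" using aT by simp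
  also have "\<dots> = Q" unfolding image_image using aT(1) TG QG by simp
  finally show "inv a \<in> normalizer_in G T Q" unfolding normalizer_in_def using aT T by (simp add: subgroup.m_inv_closed)
  fix b assume b: "b \<in> normalizer_in G T Q"
  hence bT: "b \<in> T" "conj_by G b ` Q = Q" unfolding normalizer_in_def by auto
  have "conj_by G (a \<otimes> b) ` Q = conj_by G b ` conj_by G a ` Q"
    unfolding image_image using aT(1) bT(1) TG QG by (simp add: conj_by_conj_by)
  thus "a \<otimes> b \<in> normalizer_in G T Q" unfolding normalizer_in_def using aT bT T by (simp add: subgroup.m_closed)
qed

lemma subgroup_centralizer_in:
  assumes T: "subgroup T G" and Q: "Q \<subseteq> carrier G"
  shows "subgroup (centralizer_in G T Q) G"
proof (rule subgroupI)
  have TG: "\<And>x. x \<in> T \<Longrightarrow> x \<in> carrier G" using T subgroup.mem_carrier by metis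
  show "centralizer_in G T Q \<subseteq> carrier G" using TG centralizer_inD(1) by blast
  show "centralizer_in G T Q \<noteq> {}" using subgroup.one_closed[OF T] Q unfolding centralizer_in_def by (auto simp: subset_iff)
  fix a assume a: "a \<in> centralizer_in G T Q"
  have aT: "a \<in> T" using a centralizer_inD by blast
  show "inv a \<in> centralizer_in G T Q"
  proof -
    have "conj_by G (inv a) x = x" if x: "x \<in> Q" for x
    proof -
      have "conj_by G a x = x" using a aT x centralizer_in_conj_by[OF T Q aT] by blast
      thus ?thesis using conj_by_inv1[of a x] aT TG Q x by auto
    qed
    thus ?thesis using centralizer_in_conj_by[OF T Q] aT T by (simp add: subgroup.m_inv_closed)
  qed
  fix b assume b: "b \<in> centralizer_in G T Q"
  have bT: "b \<in> T" using b centralizer_inD by blast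
  have "conj_by G (a \<otimes> b) x = x" if x: "x \<in> Q" for x
  proof -
    have "conj_by G a x = x" "conj_by G b x = x" using a b x centralizer_in_conj_by[OF T Q aT] centralizer_in_conj_by[OF T Q bT] by blast+
    thus ?thesis using conj_by_conj_by[of a b x] aT bT TG Q x by auto
  qed
  thus "a \<otimes> b \<in> centralizer_in G T Q" using centralizer_in_conj_by[OF T Q] aT bT T by (simp add: subgroup.m_closed)
qed

lemma centralizer_in_sub_normalizer_in: "subgroup T G \<Longrightarrow> Q \<subseteq> carrier G \<Longrightarrow> centralizer_in G T Q \<subseteq> normalizer_in G T Q"
  unfolding normalizer_in_def using centralizer_in_conj_by[of T Q] centralizer_inD(1)[of _ T Q] by (force simp: image_iff)

lemma conj_by_image_subgroup: "subgroup Q G \<Longrightarrow> g \<in> Q \<Longrightarrow> conj_by G g ` Q = Q"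
proof
  assume Q: "subgroup Q G" and g: "g \<in> Q"
  show "conj_by G g ` Q \<subseteq> Q" using conj_by_mem[OF Q g] by blast
  show "Q \<subseteq> conj_by G g ` Q"
  proof
    fix x assume x: "x \<in> Q"
    have "conj_by G (inv g) x \<in> Q" using conj_by_mem[OF Q] Q g x by (simp add: subgroup.m_inv_closed)
    moreover have "x = conj_by G g (conj_by G (inv g) x)" using Q g x by (simp add: subgroup.mem_carrier)
    ultimately show "x \<in> conj_by G g ` Q" by blast
  qed
qed

lemma subgroup_sub_normalizer_in: "subgroup T G \<Longrightarrow> subgroup Q G \<Longrightarrow> Q \<subseteq> T \<Longrightarrow> Q \<subseteq> normalizer_in G T Q"
  unfolding normalizer_in_def using conj_by_image_subgroup by blast

lemma finite_normalizer_inI: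
  assumes "finite Q" "Q \<subseteq> carrier G" "g \<in> carrier G" "\<And>x. x \<in> Q \<Longrightarrow> conj_by G g x \<in> Q"
  shows "conj_by G g ` Q = Q"
proof (rule endo_inj_surj[OF assms(1)])
  show "conj_by G g ` Q \<subseteq> Q" using assms(4) by blast
  show "inj_on (conj_by G g) Q" using assms(2,3) conj_by_inj by (meson inj_onI subsetD)
qed

lemma subgroup_set_mult:
  assumes A: "subgroup A G" and B: "subgroup B G" and n: "\<And>a b. a \<in> A \<Longrightarrow> b \<in> B \<Longrightarrow> conj_by G a b \<in> B"
  shows "subgroup (A <#> B) G"
proof (rule subgroupI)
  have AG: "\<And>x. x \<in> A \<Longrightarrow> x \<in> carrier G" and BG: "\<And>x. x \<in> B \<Longrightarrow> x \<in> carrier G"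
    using A B subgroup.mem_carrier by metis+
  show "A <#> B \<subseteq> carrier G" unfolding set_mult_def using AG BG by blast
  show "A <#> B \<noteq> {}" unfolding set_mult_def using subgroup.one_closed[OF A] subgroup.one_closed[OF B] by blast
  fix u assume "u \<in> A <#> B"
  then obtain a b where ab: "a \<in> A" "b \<in> B" "u = a \<otimes> b" unfolding set_mult_def by blast
  have "inv u = inv a \<otimes> conj_by G (inv a) (inv b)"
    unfolding conj_by_def using ab AG BG by (simp add: inv_mult_group m_assoc[symmetric])
  moreover have "inv a \<in> A" "conj_by G (inv a) (inv b) \<in> B"
    using ab A B n by (auto simp: subgroup.m_inv_closed)
  ultimately show "inv u \<in> A <#> B" unfolding set_mult_def by blast
  fix v assume "v \<in> A <#> B"
  then obtain c d where cd: "c \<in> A" "d \<in> B" "v = c \<otimes> d" unfolding set_mult_def by blast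
  have "u \<otimes> v = (a \<otimes> c) \<otimes> (conj_by G c b \<otimes> d)"
    unfolding conj_by_def using ab cd AG BG by (simp add: m_assoc[symmetric]) (simp add: m_assoc)
  moreover have "a \<otimes> c \<in> A" "conj_by G c b \<otimes> d \<in> B"
    using ab cd A B n by (auto simp: subgroup.m_closed)
  ultimately show "u \<otimes> v \<in> A <#> B" unfolding set_mult_def by blast
qed

lemma set_mult_mem: "a \<in> A \<Longrightarrow> b \<in> B \<Longrightarrow> a \<otimes> b \<in> A <#> B"
  unfolding set_mult_def by blast

lemma set_mult_sup:
  assumes A: "subgroup A G" and B: "subgroup B G"
  shows "A \<subseteq> A <#> B" "B \<subseteq> A <#> B"
proof (safe)
  fix a assume a: "a \<in> A"
  have "a \<otimes> \<one> \<in> A <#> B" by (rule set_mult_mem[OF a subgroup.one_closed[OF B]])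
  thus "a \<in> A <#> B" using subgroup.mem_carrier[OF A a] by simp
next
  fix b assume b: "b \<in> B"
  have "\<one> \<otimes> b \<in> A <#> B" by (rule set_mult_mem[OF subgroup.one_closed[OF A] b])
  thus "b \<in> A <#> B" using subgroup.mem_carrier[OF B b] by simp
qed

lemma set_mult_least:
  assumes "subgroup C G" "A \<subseteq> C" "B \<subseteq> C" shows "A <#> B \<subseteq> C"
  unfolding set_mult_def using assms(2,3) by (auto intro!: subgroup.m_closed[OF assms(1)])

end

section \<open>Finite p-groups: exponents, orders of subgroups and growth of normalizers\<close>

locale finite_p_group = p_group p G for p :: nat and G (structure) +
  assumes p_prime: "prime p"
begin

lemma finite_sub: "Q \<subseteq> carrier G \<Longrightarrow> finite Q"
  using finite_carrier finite_subset by blast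

lemma finite_subgroup: "subgroup Q G \<Longrightarrow> finite Q"
  using finite_sub subgroup.subset by blast

lemma pow_p: obtains n where "\<And>x. x \<in> carrier G \<Longrightarrow> x [^] (p ^ n :: nat) = \<one>"
proof -
  from order_p_power obtain n where "order G = p ^ n" by blast
  thus ?thesis using that[of n] pow_order_eq_1 by simp
qed

lemma subgroup_order_p_power:
  assumes "subgroup Q G" shows "\<exists>n. card Q = p ^ n"
proof -
  obtain n where "order G = p ^ n" using order_p_power by blast
  hence "card Q dvd p ^ n" using lagrange[OF assms] by (metis dvd_triv_right)
  thus ?thesis using p_prime divides_primepow_nat by blast
qed

lemma normalizer_in_grows:
  assumes T: "subgroup T G" and Q: "subgroup Q G" and QT: "Q \<subset> T"
  shows "Q \<subset> normalizer_in G T Q"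
proof -
  interpret T: group "G\<lparr>carrier := T\<rparr>" by (rule subgroup_imp_group[OF T])
  have TG: "\<And>x. x \<in> T \<Longrightarrow> x \<in> carrier G" and QG: "\<And>x. x \<in> Q \<Longrightarrow> x \<in> carrier G"
    using T Q subgroup.mem_carrier by metis+
  obtain n where n: "card T = p ^ n" using subgroup_order_p_power[OF T] by blast
  have "subgroup Q (G\<lparr>carrier := T\<rparr>)" using subgroup_incl[OF Q T] QT by blast
  from T.p_group_normalizer_grows[OF p_prime _ _ this, of n] n QT finite_subgroup[OF T]
  obtain g where g: "g \<in> T - Q" "\<And>s. s \<in> Q \<Longrightarrow> g \<otimes> s \<otimes> inv g \<in> Q"
    using T by (auto simp: order_def)
  have gG: "g \<in> carrier G" using g TG by blast
  \<comment> \<open>The element g maps Q into itself by x |-> g x g^-1, whereas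
    \<open>conj_by\<close> conjugates by g^-1 x g; so the witness is inv g.\<close>
  have "conj_by G (inv g) ` Q = Q"
    by (rule finite_normalizer_inI) (use g gG QG finite_subgroup[OF Q] in \<open>auto simp: conj_by_def\<close>)
  hence "inv g \<in> normalizer_in G T Q" using g T unfolding normalizer_in_def by (simp add: subgroup.m_inv_closed)
  moreover have "inv g \<notin> Q" using g gG Q by (metis DiffD2 inv_inv subgroup.m_inv_closed)
  ultimately show ?thesis using subgroup_sub_normalizer_in[OF T Q] QT by blast
qed

end

section \<open>Fusion systems as predicates\<close>

definition Auts :: "('a set \<Rightarrow> ('a \<Rightarrow> 'a) \<Rightarrow> bool) \<Rightarrow> 'a set \<Rightarrow> ('a \<Rightarrow> 'a) set" where
  "Auts H Q = {f \<in> extensional Q. H Q f \<and> f ` Q = Q}"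

definition AutT :: "('a, 'b) monoid_scheme \<Rightarrow> 'a set \<Rightarrow> 'a set \<Rightarrow> ('a \<Rightarrow> 'a) set" where
  "AutT G T Q = (\<lambda>g. restrict (conj_by G g) Q) ` normalizer_in G T Q"

text \<open>The subgroups \<open>V\<close> range over the subgroups between \<open>S\<close> and the extension domain of \<open>f\<close>.\<close>

definition is_receptive :: "('a, 'b) monoid_scheme \<Rightarrow> 'a set \<Rightarrow> ('a set \<Rightarrow> ('a \<Rightarrow> 'a) \<Rightarrow> bool) \<Rightarrow> 'a set \<Rightarrow> bool" where
  "is_receptive G T H R \<longleftrightarrow> (\<forall>S f V. H S f \<and> f ` S = R \<and> subgroup V G \<and> S \<subseteq> V \<and> V \<subseteq> normalizer_in G T S \<and>
     (\<forall>g\<in>V. \<exists>u\<in>normalizer_in G T R. \<forall>x\<in>S. f (conj_by G g x) = conj_by G u (f x)) \<longrightarrow>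
     (\<exists>h. H V h \<and> (\<forall>x\<in>S. h x = f x)))"

text \<open>Fully automized and receptive: the kind of member that saturation demands in every
  conjugacy class.\<close>

definition good :: "nat \<Rightarrow> ('a, 'b) monoid_scheme \<Rightarrow> 'a set \<Rightarrow> ('a set \<Rightarrow> ('a \<Rightarrow> 'a) \<Rightarrow> bool) \<Rightarrow> 'a set \<Rightarrow> bool" where
  "good p G T H R \<longleftrightarrow> subgroup R G \<and> R \<subseteq> T \<and> sylow_in p (AutT G T R) (Auts H R) \<and> is_receptive G T H R"

text \<open>\<open>H Q f\<close> says that the restriction of \<open>f\<close> to \<open>Q\<close> is a morphism from \<open>Q\<close> to \<open>T\<close>; the values of \<open>f\<close>
  outside \<open>Q\<close> are irrelevant. All subgroups live in one ambient group \<open>G\<close>.\<close>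

locale fusion_pred = finite_p_group p G for p :: nat and G (structure) +
  fixes T :: "'a set" and H :: "'a set \<Rightarrow> ('a \<Rightarrow> 'a) \<Rightarrow> bool"
  assumes T: "subgroup T G"
    and H_dom: "H Q f \<Longrightarrow> subgroup Q G \<and> Q \<subseteq> T \<and> f ` Q \<subseteq> T \<and> inj_on f Q"
    and H_mult: "H Q f \<Longrightarrow> x \<in> Q \<Longrightarrow> y \<in> Q \<Longrightarrow> f (x \<otimes> y) = f x \<otimes> f y"
    and H_cong: "H Q f \<Longrightarrow> (\<And>x. x \<in> Q \<Longrightarrow> f x = g x) \<Longrightarrow> H Q g"
    and H_conj_by: "subgroup Q G \<Longrightarrow> Q \<subseteq> T \<Longrightarrow> t \<in> T \<Longrightarrow> H Q (conj_by G t)"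
    and H_comp: "H Q f \<Longrightarrow> H R g \<Longrightarrow> f ` Q \<subseteq> R \<Longrightarrow> H Q (\<lambda>x. g (f x))"
    and H_inv: "H Q f \<Longrightarrow> H (f ` Q) (inv_into Q f)"
begin

lemma is_receptiveD:
  assumes "is_receptive G T H R" "H S f" "f ` S = R" "subgroup V G" "S \<subseteq> V" "V \<subseteq> normalizer_in G T S"
    "\<And>g. g \<in> V \<Longrightarrow> \<exists>u\<in>normalizer_in G T R. \<forall>x\<in>S. f (conj_by G g x) = conj_by G u (f x)"
  obtains h where "H V h" "\<And>x. x \<in> S \<Longrightarrow> h x = f x"
  using assms unfolding is_receptive_def by blast

lemma TG: "x \<in> T \<Longrightarrow> x \<in> carrier G"
  using T by (rule subgroup.mem_carrier)

lemma T_sub: "T \<subseteq> carrier G"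
  using TG by blast

lemma H_sub: "H Q f \<Longrightarrow> subgroup Q G"
  and H_subT: "H Q f \<Longrightarrow> Q \<subseteq> T"
  and H_imgT: "H Q f \<Longrightarrow> f ` Q \<subseteq> T"
  and H_inj: "H Q f \<Longrightarrow> inj_on f Q"
  using H_dom by blast+

lemma H_mem: "H Q f \<Longrightarrow> x \<in> Q \<Longrightarrow> x \<in> carrier G" "H Q f \<Longrightarrow> x \<in> Q \<Longrightarrow> f x \<in> carrier G"
  "H Q f \<Longrightarrow> x \<in> Q \<Longrightarrow> f x \<in> T"
  using H_dom[of Q f] TG by blast+

lemma H_img: "H Q f \<Longrightarrow> subgroup (f ` Q) G"
  by (rule H_sub[OF H_inv])

lemma H_id: "subgroup Q G \<Longrightarrow> Q \<subseteq> T \<Longrightarrow> H Q (\<lambda>x. x)"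
  by (rule H_cong[OF H_conj_by[of Q \<one>]]) (use T TG in \<open>auto simp: subgroup.one_closed\<close>)

lemma H_restr: assumes "H Q f" "subgroup Q' G" "Q' \<subseteq> Q" shows "H Q' f"
proof -
  have "Q' \<subseteq> T" using assms H_subT by blast
  from H_comp[OF H_id[OF assms(2) this] assms(1)] assms(3) show ?thesis by simp
qed

lemma H_card: "H Q f \<Longrightarrow> card (f ` Q) = card Q"
  by (rule card_image[OF H_inj])

lemma H_fin: "H Q f \<Longrightarrow> finite Q"
  by (rule finite_subgroup[OF H_sub])

lemma H_one: assumes "H Q f" shows "f \<one> = \<one>"
proof -
  have o: "\<one> \<in> Q" using H_sub[OF assms] by (rule subgroup.one_closed)
  have "f \<one> \<otimes> f \<one> = f \<one>" using H_mult[OF assms o o] by simp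
  thus ?thesis using H_mem(2)[OF assms o] by simp
qed

lemma H_minv: assumes "H Q f" "x \<in> Q" shows "f (inv x) = inv (f x)"
proof -
  have i: "inv x \<in> Q" using H_sub[OF assms(1)] assms(2) by (rule subgroup.m_inv_closed)
  have "f (inv x) \<otimes> f x = \<one>"
    using H_mult[OF assms(1) i assms(2)] H_one[OF assms(1)] H_mem(1)[OF assms] by simp
  thus ?thesis using H_mem(2)[OF assms] H_mem(2)[OF assms(1) i] by (metis inv_equality)
qed

lemma H_cjv: assumes "H Q f" "g \<in> Q" "x \<in> Q" shows "f (conj_by G g x) = conj_by G (f g) (f x)"
proof -
  have i: "inv g \<in> Q" using H_sub[OF assms(1)] assms(2) by (rule subgroup.m_inv_closed)
  have "inv g \<otimes> x \<in> Q" using H_sub[OF assms(1)] i assms(3) by (rule subgroup.m_closed)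
  thus ?thesis unfolding conj_by_def using assms i by (simp add: H_mult H_minv)
qed

lemma H_inv_l: "H Q f \<Longrightarrow> x \<in> Q \<Longrightarrow> inv_into Q f (f x) = x"
  by (rule inv_into_f_f[OF H_inj])

lemma H_inv_img: "H Q f \<Longrightarrow> inv_into Q f ` f ` Q = Q"
  by (simp add: H_inj)

lemma H_img_sub: "H Q f \<Longrightarrow> subgroup Q' G \<Longrightarrow> Q' \<subseteq> Q \<Longrightarrow> subgroup (f ` Q') G"
  by (rule H_img[OF H_restr])

lemma H_eq_iff: "H Q f \<Longrightarrow> x \<in> Q \<Longrightarrow> y \<in> Q \<Longrightarrow> f x = f y \<longleftrightarrow> x = y"
  using H_inj inj_on_eq_iff by metis

lemma H_normalizer_in: assumes "H Q f" "g \<in> Q" "g \<in> normalizer_in G T S" "S \<subseteq> Q" shows "f g \<in> normalizer_in G T (f ` S)"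
proof -
  have "conj_by G (f g) ` f ` S = (\<lambda>x. f (conj_by G g x)) ` S"
    unfolding image_image by (rule image_cong) (use assms H_cjv in auto)
  also have "\<dots> = f ` conj_by G g ` S" by (simp add: image_image)
  also have "\<dots> = f ` S" using assms(3) by (simp add: normalizer_in_def)
  finally show ?thesis using H_mem(3)[OF assms(1,2)] by (simp add: normalizer_in_def)
qed

lemma H_centralizer_in: assumes "H Q f" "g \<in> Q" "g \<in> centralizer_in G T S" "S \<subseteq> Q" shows "f g \<in> centralizer_in G T (f ` S)"
  unfolding centralizer_in_def
proof (safe)
  show "f g \<in> T" using H_mem(3)[OF assms(1,2)] .
  fix x assume x: "x \<in> S"
  have "f (g \<otimes> x) = f (x \<otimes> g)" using centralizer_inD(2)[OF assms(3) x] by simp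
  thus "f g \<otimes> f x = f x \<otimes> f g" using H_mult[OF assms(1)] assms(2,4) x by (metis subsetD)
qed

lemma H_funpow: assumes "H Q f" "f ` Q = Q" shows "H Q (f ^^ n) \<and> (f ^^ n) ` Q = Q"
proof (induction n)
  case 0 show ?case using H_id[OF H_sub[OF assms(1)] H_subT[OF assms(1)]] by (simp add: id_def)
next
  case (Suc n)
  have "H Q (\<lambda>x. f ((f ^^ n) x))" using H_comp[OF _ assms(1)] Suc by simp
  moreover have "(\<lambda>x. f ((f ^^ n) x)) ` Q = Q" using Suc assms(2) by (metis image_image)
  ultimately show ?case by (simp add: comp_def)
qed

lemma normalizer_in_sub: "subgroup Q G \<Longrightarrow> subgroup (normalizer_in G T Q) G"
  by (rule subgroup_normalizer_in[OF T])

lemma centralizer_in_sub: "subgroup Q G \<Longrightarrow> subgroup (centralizer_in G T Q) G"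
  by (rule subgroup_centralizer_in[OF T subgroup.subset])

lemma sub_normalizer_in: "subgroup Q G \<Longrightarrow> Q \<subseteq> T \<Longrightarrow> Q \<subseteq> normalizer_in G T Q"
  by (rule subgroup_sub_normalizer_in[OF T])

lemma nrmT: "normalizer_in G T Q \<subseteq> T" and cenT: "centralizer_in G T Q \<subseteq> T"
  unfolding normalizer_in_def centralizer_in_def by auto

lemma Auts_Bij: "Auts H Q \<subseteq> Bij Q"
  unfolding Auts_def Bij_def bij_betw_def using H_inj by blast

lemma AutsI: "H Q f \<Longrightarrow> f ` Q = Q \<Longrightarrow> restrict f Q \<in> Auts H Q"
  unfolding Auts_def using H_cong[of Q f "restrict f Q"] by auto

lemma AutsD: "f \<in> Auts H Q \<Longrightarrow> H Q f" "f \<in> Auts H Q \<Longrightarrow> f ` Q = Q"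
  unfolding Auts_def by auto

lemma Auts_subgroup:
  assumes "subgroup Q G" "Q \<subseteq> T" shows "subgroup (Auts H Q) (BijGroup Q)"
proof (rule BijGroup_subgroupI[OF finite_subgroup[OF assms(1)] Auts_Bij])
  show "(\<lambda>x\<in>Q. x) \<in> Auts H Q" by (rule AutsI[OF H_id[OF assms]]) simp
  fix a b assume ab: "a \<in> Auts H Q" "b \<in> Auts H Q"
  have "H Q (\<lambda>x. a (b x))" using H_comp[OF AutsD(1)[OF ab(2)] AutsD(1)[OF ab(1)]] AutsD(2)[OF ab(2)] by simp
  moreover have "(\<lambda>x. a (b x)) ` Q = Q" using AutsD(2)[OF ab(1)] AutsD(2)[OF ab(2)] by (metis image_image)
  ultimately show "compose Q a b \<in> Auts H Q" unfolding compose_def by (rule AutsI)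
qed

lemma AutT_sub_Auts:
  assumes "subgroup Q G" "Q \<subseteq> T" shows "AutT G T Q \<subseteq> Auts H Q"
  unfolding AutT_def
proof
  fix f assume "f \<in> (\<lambda>g. restrict (conj_by G g) Q) ` normalizer_in G T Q"
  then obtain g where g: "g \<in> T" "conj_by G g ` Q = Q" "f = restrict (conj_by G g) Q" unfolding normalizer_in_def by auto
  show "f \<in> Auts H Q" unfolding g(3) by (rule AutsI[OF H_conj_by[OF assms g(1)] g(2)])
qed

text \<open>Iterating conjugation by g gives conjugation by powers of g, so each element of the
  image has p-power order.\<close>

lemma AutT_image_subgroup:
  assumes Q: "subgroup Q G" "Q \<subseteq> T" and V: "subgroup V G" "V \<subseteq> normalizer_in G T Q"
  shows "subgroup ((\<lambda>g. restrict (conj_by G g) Q) ` V) (BijGroup Q)"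
    and "\<exists>k. card ((\<lambda>g. restrict (conj_by G g) Q) ` V) = p ^ k"
proof -
  let ?B = "(\<lambda>g. restrict (conj_by G g) Q) ` V"
  have QG: "\<And>x. x \<in> Q \<Longrightarrow> x \<in> carrier G" and VG: "\<And>x. x \<in> V \<Longrightarrow> x \<in> carrier G"
    using Q(1) V(1) subgroup.mem_carrier by metis+
  have sub: "?B \<subseteq> Bij Q"
    using AutT_sub_Auts[OF Q] Auts_Bij[of Q] V(2) unfolding AutT_def by blast
  show B: "subgroup ?B (BijGroup Q)"
  proof (rule BijGroup_subgroupI[OF finite_subgroup[OF Q(1)] sub])
    have "restrict (conj_by G \<one>) Q = (\<lambda>x\<in>Q. x)" by (rule restrict_ext) (use QG in simp)
    thus "(\<lambda>x\<in>Q. x) \<in> ?B" using subgroup.one_closed[OF V(1)] by (metis imageI)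
    fix a b assume "a \<in> ?B" "b \<in> ?B"
    then obtain g h where gh: "g \<in> V" "a = restrict (conj_by G g) Q" "h \<in> V" "b = restrict (conj_by G h) Q" by auto
    have hg: "h \<otimes> g \<in> V" using gh V(1) by (simp add: subgroup.m_closed)
    have "compose Q a b = restrict (conj_by G (h \<otimes> g)) Q"
    proof
      fix x show "compose Q a b x = restrict (conj_by G (h \<otimes> g)) Q x"
      proof (cases "x \<in> Q")
        case True
        have "conj_by G h x \<in> Q" using normalizer_inD(2)[of h T Q x] gh(3) V(2) True by blast
        thus ?thesis using True QG VG gh by (simp add: compose_eq conj_by_conj_by)
      qed (simp add: compose_def)
    qed
    thus "compose Q a b \<in> ?B" using hg by blast
  qed
  obtain n where n: "\<And>x. x \<in> carrier G \<Longrightarrow> x [^] (p ^ n) = \<one>" using pow_p by blast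
  show "\<exists>k. card ?B = p ^ k"
  proof (rule p_power_card_if_funpow[OF p_prime finite_subgroup[OF Q(1)] B])
    fix b assume "b \<in> ?B"
    then obtain g where g: "g \<in> V" "b = restrict (conj_by G g) Q" by auto
    have cl: "conj_by G g x \<in> Q" if "x \<in> Q" for x using normalizer_inD(2)[of g T Q x] g(1) V(2) that by blast
    have "(b ^^ m) x = (conj_by G g ^^ m) x \<and> (conj_by G g ^^ m) x \<in> Q" if "x \<in> Q" for x m
      using that by (induction m) (use g(2) cl in auto)
    moreover have "(conj_by G g ^^ (p ^ n)) x = x" if "x \<in> Q" for x
      using conj_by_pow[of g x "p ^ n"] n[OF VG[OF g(1)]] that VG[OF g(1)] QG by simp
    ultimately show "\<exists>k. \<forall>x\<in>Q. (b ^^ (p ^ k)) x = x" by metis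
  qed
qed

lemma AutT_subgroup:
  assumes "subgroup Q G" "Q \<subseteq> T"
  shows "subgroup (AutT G T Q) (BijGroup Q)" "\<exists>k. card (AutT G T Q) = p ^ k"
  using AutT_image_subgroup[OF assms normalizer_in_sub[OF assms(1)] subset_refl] unfolding AutT_def by auto

section \<open>Moving p-groups of automorphisms into good subgroups\<close>

lemma conj_into_sylow:
  assumes R: "subgroup R G" "R \<subseteq> T" and A: "subgroup A (BijGroup R)" "sylow_in p (AutT G T R) A"
    and f: "bij_betw f Q R" "finite Q" and B: "subgroup B (BijGroup Q)" "card B = p ^ k"
    and BA: "\<And>b. b \<in> B \<Longrightarrow> (\<lambda>y\<in>R. f (b (inv_into Q f y))) \<in> A"
  obtains k where "k \<in> A" "\<And>b. b \<in> B \<Longrightarrow> \<exists>u\<in>normalizer_in G T R. \<forall>x\<in>Q. k (f (b x)) = conj_by G u (k (f x))"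
proof -
  let ?\<Phi> = "\<lambda>b. \<lambda>y\<in>R. f (b (inv_into Q f y))"
  have ss: "subgroup (?\<Phi> ` B) (BijGroup R)" "card (?\<Phi> ` B) = p ^ k"
    using Bij_conj_subgroup[OF f B(1)] B(2) by auto
  have sub: "?\<Phi> ` B \<subseteq> A" using BA by blast
  obtain g where g: "g \<in> A" "\<And>b. b \<in> ?\<Phi> ` B \<Longrightarrow> \<exists>s\<in>AutT G T R. \<forall>x\<in>R. g (b x) = s (g x)"
    using sylow_in_conjugate[OF p_prime finite_subgroup[OF R(1)] A(1) AutT_subgroup(1)[OF R] A(2) ss(1) sub ss(2)]
    by blast
  have gR: "g x \<in> R" if "x \<in> R" for x
    using g(1) A(1) BijD(2)[of g R x] that subgroup.subset[OF A(1)] unfolding BijGroup_carrier by blast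
  have "\<exists>u\<in>normalizer_in G T R. \<forall>x\<in>Q. g (f (b x)) = conj_by G u (g (f x))" if b: "b \<in> B" for b
  proof -
    obtain s where s: "s \<in> AutT G T R" "\<forall>x\<in>R. g (?\<Phi> b x) = s (g x)" using g(2)[OF imageI[OF b]] by blast
    then obtain u where u: "u \<in> normalizer_in G T R" "s = restrict (conj_by G u) R" unfolding AutT_def by blast
    have "g (f (b x)) = conj_by G u (g (f x))" if x: "x \<in> Q" for x
    proof -
      have fx: "f x \<in> R" "inv_into Q f (f x) = x"
        using f(1) x unfolding bij_betw_def by auto
      show ?thesis using s(2)[rule_format, OF fx(1)] fx u(2) gR[OF fx(1)] by simp
    qed
    thus ?thesis using u(1) by blast
  qed
  thus ?thesis using that g(1) by blast
qed

lemma H_conj_aut: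
  assumes f: "H Q f" "f ` Q = R" and b: "b \<in> Auts H Q"
  shows "(\<lambda>y\<in>R. f (b (inv_into Q f y))) \<in> Auts H R"
proof (rule AutsI)
  have i: "H R (inv_into Q f)" "inv_into Q f ` R = Q" using H_inv[OF f(1)] H_inv_img[OF f(1)] f(2) by auto
  have "H R (\<lambda>y. b (inv_into Q f y))" using H_comp[OF i(1) AutsD(1)[OF b]] i(2) by simp
  moreover have e: "(\<lambda>y. b (inv_into Q f y)) ` R = Q" using i(2) AutsD(2)[OF b] by (metis image_image)
  ultimately show "H R (\<lambda>y. f (b (inv_into Q f y)))" using H_comp[OF _ f(1), of R "\<lambda>y. b (inv_into Q f y)"] by simp
  show "(\<lambda>y. f (b (inv_into Q f y))) ` R = R" using e f(2) by (metis image_image)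
qed

lemma sylow_conj_hom:
  assumes R: "subgroup R G" "R \<subseteq> T" and syl: "sylow_in p (AutT G T R) (Auts H R)"
    and f: "H Q f" "f ` Q = R" and B: "subgroup B (BijGroup Q)" "card B = p ^ k" "B \<subseteq> Auts H Q"
  obtains \<chi> where "H Q \<chi>" "\<chi> ` Q = R" "\<And>b. b \<in> B \<Longrightarrow> \<exists>u\<in>normalizer_in G T R. \<forall>x\<in>Q. \<chi> (b x) = conj_by G u (\<chi> x)"
proof -
  have bij: "bij_betw f Q R" using f H_inj unfolding bij_betw_def by blast
  obtain k where k: "k \<in> Auts H R" "\<And>b. b \<in> B \<Longrightarrow> \<exists>u\<in>normalizer_in G T R. \<forall>x\<in>Q. k (f (b x)) = conj_by G u (k (f x))"
    using conj_into_sylow[OF R Auts_subgroup[OF R] syl bij H_fin[OF f(1)] B(1,2)] H_conj_aut[OF f] B(3) by blast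
  have "H Q (\<lambda>x. k (f x))" using H_comp[OF f(1) AutsD(1)[OF k(1)]] f(2) by simp
  moreover have "(\<lambda>x. k (f x)) ` Q = R" using f(2) AutsD(2)[OF k(1)] by (metis image_image)
  ultimately show ?thesis using that k(2) by blast
qed

text \<open>After f is corrected by an automorphism of R, all of B acts on R through N_T(R). As B
  contains the action of V, the corrected map has V in its extension domain. The conclusion keeps
  track of B itself, which may be larger than the action of V.\<close>

lemma good_conj_ext:
  assumes R: "good p G T H R" and f: "H Q f" "f ` Q = R"
    and B: "subgroup B (BijGroup Q)" "card B = p ^ k" "B \<subseteq> Auts H Q"
    and V: "subgroup V G" "Q \<subseteq> V" "V \<subseteq> normalizer_in G T Q" "\<And>g. g \<in> V \<Longrightarrow> \<exists>b\<in>B. \<forall>x\<in>Q. conj_by G g x = b x"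
  obtains h where "H V h" "h ` Q = R" "\<And>b. b \<in> B \<Longrightarrow> \<exists>u\<in>normalizer_in G T R. \<forall>x\<in>Q. h (b x) = conj_by G u (h x)"
proof -
  have R': "subgroup R G" "R \<subseteq> T" "sylow_in p (AutT G T R) (Auts H R)" "is_receptive G T H R"
    using R unfolding good_def by auto
  obtain \<chi> where chi: "H Q \<chi>" "\<chi> ` Q = R" "\<And>b. b \<in> B \<Longrightarrow> \<exists>u\<in>normalizer_in G T R. \<forall>x\<in>Q. \<chi> (b x) = conj_by G u (\<chi> x)"
    using sylow_conj_hom[OF R'(1-3) f B] by blast
  have "\<exists>u\<in>normalizer_in G T R. \<forall>x\<in>Q. \<chi> (conj_by G g x) = conj_by G u (\<chi> x)" if g: "g \<in> V" for g
  proof -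
    obtain b where b: "b \<in> B" "\<forall>x\<in>Q. conj_by G g x = b x" using V(4)[OF g] by blast
    thus ?thesis using chi(3)[OF b(1)] by simp
  qed
  then obtain h where h: "H V h" "\<And>x. x \<in> Q \<Longrightarrow> h x = \<chi> x"
    using is_receptiveD[OF R'(4) chi(1,2) V(1-3)] by blast
  have "h ` Q = R" using chi(2) h(2) by (metis image_cong)
  moreover have "\<exists>u\<in>normalizer_in G T R. \<forall>x\<in>Q. h (b x) = conj_by G u (h x)" if b: "b \<in> B" for b
  proof -
    have "b x \<in> Q" if "x \<in> Q" for x using AutsD(2)[of b Q] b B(3) that by blast
    thus ?thesis using chi(3)[OF b] h(2) by simp
  qed
  ultimately show ?thesis using that h(1) by blast
qed

text \<open>The case B = Aut_T(Q) and V = N_T(Q). The map h need not extend f; only the image R of Q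
  is kept.\<close>

lemma good_normalizer_in_ext:
  assumes R: "good p G T H R" and f: "H Q f" "f ` Q = R"
  obtains h where "H (normalizer_in G T Q) h" "h ` Q = R"
proof -
  have Q: "subgroup Q G" "Q \<subseteq> T" using f H_sub H_subT by blast+
  obtain k where k: "card (AutT G T Q) = p ^ k" using AutT_subgroup(2)[OF Q] by blast
  show ?thesis
    by (rule good_conj_ext[OF R f AutT_subgroup(1)[OF Q] k AutT_sub_Auts[OF Q] normalizer_in_sub[OF Q(1)] sub_normalizer_in[OF Q] subset_refl])
      (use that in \<open>auto simp: AutT_def\<close>)
qed

lemma H_normalizer_in_img: "H (normalizer_in G T Q) h \<Longrightarrow> subgroup Q G \<Longrightarrow> Q \<subseteq> T \<Longrightarrow> h ` normalizer_in G T Q \<subseteq> normalizer_in G T (h ` Q)"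
  using H_normalizer_in[of "normalizer_in G T Q" h _ Q] sub_normalizer_in by blast

text \<open>The extension embeds N_T(Q) in N_T(R) and C_T(Q) in C_T(R): good subgroups are fully
  normalized and fully centralized.\<close>

lemma good_normalizer_in_card:
  assumes R: "good p G T H R" and f: "H Q f" "f ` Q = R"
  shows "card (normalizer_in G T Q) \<le> card (normalizer_in G T R)" "card (centralizer_in G T Q) \<le> card (centralizer_in G T R)"
proof -
  have Q: "subgroup Q G" "Q \<subseteq> T" using f H_sub H_subT by blast+
  have R': "subgroup R G" using R unfolding good_def by blast
  obtain h where h: "H (normalizer_in G T Q) h" "h ` Q = R" using good_normalizer_in_ext[OF R f] by blast
  have "card (normalizer_in G T Q) = card (h ` normalizer_in G T Q)" using H_card[OF h(1)] by simp
  also have "\<dots> \<le> card (normalizer_in G T R)"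
    using card_mono[OF finite_subgroup[OF normalizer_in_sub[OF R']]] H_normalizer_in_img[OF h(1) Q] h(2) by simp
  finally show "card (normalizer_in G T Q) \<le> card (normalizer_in G T R)" .
  have cn: "centralizer_in G T Q \<subseteq> normalizer_in G T Q" by (rule centralizer_in_sub_normalizer_in[OF T subgroup.subset[OF Q(1)]])
  have "card (centralizer_in G T Q) = card (h ` centralizer_in G T Q)"
    using H_card[OF H_restr[OF h(1) centralizer_in_sub[OF Q(1)] cn]] by simp
  also have "\<dots> \<le> card (centralizer_in G T R)"
  proof (rule card_mono[OF finite_subgroup[OF centralizer_in_sub[OF R']]])
    show "h ` centralizer_in G T Q \<subseteq> centralizer_in G T R"
      using H_centralizer_in[OF h(1) _ _ sub_normalizer_in[OF Q]] cn h(2) by blast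
  qed
  finally show "card (centralizer_in G T Q) \<le> card (centralizer_in G T R)" .
qed

lemma Auts_card_le:
  assumes "H Q f" "f ` Q = R" shows "card (Auts H Q) \<le> card (Auts H R)"
proof -
  have Q: "subgroup Q G" "Q \<subseteq> T" and R: "subgroup R G" using assms H_sub H_subT H_img by blast+
  have bij: "bij_betw f Q R" using assms H_inj unfolding bij_betw_def by blast
  have "card ((\<lambda>b. \<lambda>y\<in>R. f (b (inv_into Q f y))) ` Auts H Q) = card (Auts H Q)"
    by (rule Bij_conj_subgroup(2)[OF bij H_fin[OF assms(1)] Auts_subgroup[OF Q]])
  moreover have "(\<lambda>b. \<lambda>y\<in>R. f (b (inv_into Q f y))) ` Auts H Q \<subseteq> Auts H R"
    using H_conj_aut[OF assms] by blast
  moreover have "finite (Auts H R)" using finite_subset[OF Auts_Bij finite_Bij[OF finite_subgroup[OF R]]] .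
  ultimately show ?thesis using card_mono by metis
qed

lemma Auts_card: assumes "H Q f" "f ` Q = R" shows "card (Auts H Q) = card (Auts H R)"
  using Auts_card_le[OF assms] Auts_card_le[of R "inv_into Q f" Q] H_inv[OF assms(1)] H_inv_img[OF assms(1)] assms(2)
  by simp

lemma AutT_card_le:
  assumes Q: "subgroup Q G" "Q \<subseteq> T" and h: "H (normalizer_in G T Q) h" "h ` Q = R"
  shows "card (AutT G T Q) \<le> card (AutT G T R)"
proof -
  have fQ: "H Q h" by (rule H_restr[OF h(1) Q(1) sub_normalizer_in[OF Q]])
  have R: "subgroup R G" "R \<subseteq> T" using H_img[OF fQ] H_imgT[OF fQ] h(2) by auto
  have bij: "bij_betw h Q R" using fQ h(2) H_inj unfolding bij_betw_def by blast
  let ?\<Phi> = "\<lambda>b. \<lambda>y\<in>R. h (b (inv_into Q h y))"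
  have "card (?\<Phi> ` AutT G T Q) = card (AutT G T Q)"
    by (rule Bij_conj_subgroup(2)[OF bij finite_subgroup[OF Q(1)] AutT_subgroup(1)[OF Q]])
  moreover have "?\<Phi> ` AutT G T Q \<subseteq> AutT G T R"
  proof (safe)
    fix b assume "b \<in> AutT G T Q"
    then obtain g where g: "g \<in> normalizer_in G T Q" "b = restrict (conj_by G g) Q" unfolding AutT_def by blast
    have "?\<Phi> b = restrict (conj_by G (h g)) R"
    proof
      fix y show "?\<Phi> b y = restrict (conj_by G (h g)) R y"
      proof (cases "y \<in> R")
        case True
        then obtain x where x: "x \<in> Q" "y = h x" using h(2) by blast
        have "x \<in> normalizer_in G T Q" using x sub_normalizer_in[OF Q] by blast
        thus ?thesis using True x g H_inv_l[OF fQ x(1)] H_cjv[OF h(1) g(1)] by simp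
      qed simp
    qed
    moreover have "h g \<in> normalizer_in G T R" using H_normalizer_in_img[OF h(1) Q] g(1) h(2) by blast
    ultimately show "?\<Phi> b \<in> AutT G T R" unfolding AutT_def by blast
  qed
  moreover have "finite (AutT G T R)" unfolding AutT_def using finite_subgroup[OF normalizer_in_sub[OF R(1)]] by blast
  ultimately show ?thesis using card_mono by metis
qed

text \<open>Goodness is pulled back along e, which identifies the two full normalizers. To extend a
  map f onto R, extend e f onto R0; the extension takes its values in N_T(R0), where e can be
  undone.\<close>

lemma good_transfer:
  assumes R: "subgroup R G" "R \<subseteq> T" and R0: "good p G T H R0"
    and e: "H (normalizer_in G T R) e" "e ` R = R0" "e ` normalizer_in G T R = normalizer_in G T R0"
  shows "good p G T H R"
proof -
  have R0': "subgroup R0 G" "R0 \<subseteq> T" "sylow_in p (AutT G T R0) (Auts H R0)" "is_receptive G T H R0"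
    using R0 unfolding good_def by auto
  have eR: "H R e" by (rule H_restr[OF e(1) R(1) sub_normalizer_in[OF R]])
  let ?e = "inv_into (normalizer_in G T R) e"
  have ei: "H (normalizer_in G T R0) ?e" using H_inv[OF e(1)] e(3) by simp
  have ei0: "?e ` R0 = R"
  proof -
    have "?e ` e ` R = (\<lambda>x. x) ` R" unfolding image_image
      by (rule image_cong) (use H_inv_l[OF e(1)] sub_normalizer_in[OF R] in auto)
    thus ?thesis using e(2) by simp
  qed
  have "card (AutT G T R) = card (AutT G T R0)"
    using AutT_card_le[OF R e(1,2)] AutT_card_le[OF R0'(1,2) ei ei0] by simp
  hence "sylow_in p (AutT G T R) (Auts H R)"
    using R0'(3) AutT_sub_Auts[OF R] Auts_card[OF eR e(2)] unfolding sylow_in_def by simp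
  moreover have "is_receptive G T H R"
    unfolding is_receptive_def
  proof (intro allI impI, elim conjE)
    fix S f V
    assume f: "H S f" "f ` S = R" and V: "subgroup V G" "S \<subseteq> V" "V \<subseteq> normalizer_in G T S"
      and c: "\<forall>g\<in>V. \<exists>u\<in>normalizer_in G T R. \<forall>x\<in>S. f (conj_by G g x) = conj_by G u (f x)"
    have ef: "H S (\<lambda>x. e (f x))" "(\<lambda>x. e (f x)) ` S = R0"
      using H_comp[OF f(1) eR] f(2) e(2) by (auto simp: image_image[symmetric])
    have "\<exists>u\<in>normalizer_in G T R0. \<forall>x\<in>S. e (f (conj_by G g x)) = conj_by G u (e (f x))" if g: "g \<in> V" for g
    proof -
      obtain u where u: "u \<in> normalizer_in G T R" "\<forall>x\<in>S. f (conj_by G g x) = conj_by G u (f x)" using c g by blast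
      have "e (conj_by G u (f x)) = conj_by G (e u) (e (f x))" if "x \<in> S" for x
        using H_cjv[OF e(1) u(1), of "f x"] f(2) that sub_normalizer_in[OF R] by blast
      thus ?thesis using u e(3) by (metis imageI)
    qed
    then obtain h where h: "H V h" "\<And>x. x \<in> S \<Longrightarrow> h x = e (f x)"
      using is_receptiveD[OF R0'(4) ef V] by blast
    have hS: "h ` S = R0" using h(2) ef(2) by (metis image_cong)
    have "h ` V \<subseteq> normalizer_in G T R0" using H_normalizer_in[OF h(1) _ _ V(2)] V(3) hS by blast
    hence "H V (\<lambda>x. ?e (h x))" by (rule H_comp[OF h(1) ei])
    moreover have "?e (h x) = f x" if x: "x \<in> S" for x
    proof -
      have "f x \<in> normalizer_in G T R" using f(2) x sub_normalizer_in[OF R] by blast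
      thus ?thesis using h(2)[OF x] H_inv_l[OF e(1)] by simp
    qed
    ultimately show "\<exists>h. H V h \<and> (\<forall>x\<in>S. h x = f x)" by blast
  qed
  ultimately show ?thesis using R unfolding good_def by blast
qed

definition is_saturated :: bool where
  "is_saturated \<longleftrightarrow> (\<forall>Q. subgroup Q G \<longrightarrow> Q \<subseteq> T \<longrightarrow> (\<exists>f. H Q f \<and> good p G T H (f ` Q)))"

lemma is_saturatedE:
  assumes is_saturated "subgroup Q G" "Q \<subseteq> T" obtains f where "H Q f" "good p G T H (f ` Q)"
  using assms unfolding is_saturated_def by blast

end

section \<open>The Frattini argument\<close>

text \<open>The transport \<psi> f \<psi>^-1 from the invariance condition, as a map on
  \<psi>(R).\<close>

definition conj_fun :: "'a set \<Rightarrow> ('a \<Rightarrow> 'a) \<Rightarrow> ('a \<Rightarrow> 'a) \<Rightarrow> 'a \<Rightarrow> 'a" where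
  "conj_fun R \<psi> f = (\<lambda>y. \<psi> (f (inv_into R \<psi> y)))"

text \<open>Invariance of D under one single map \<psi>, isolated so that it can be checked
  separately on the two factors of a factorization.\<close>

definition stable :: "('a set \<Rightarrow> ('a \<Rightarrow> 'a) \<Rightarrow> bool) \<Rightarrow> 'a set \<Rightarrow> ('a \<Rightarrow> 'a) \<Rightarrow> bool" where
  "stable D R \<psi> \<longleftrightarrow> (\<forall>Q f. D Q f \<longrightarrow> Q \<subseteq> R \<longrightarrow> f ` Q \<subseteq> R \<longrightarrow> D (\<psi> ` Q) (conj_fun R \<psi> f))"

lemma conj_fun_apply: "inj_on \<psi> R \<Longrightarrow> x \<in> R \<Longrightarrow> conj_fun R \<psi> f (\<psi> x) = \<psi> (f x)"
  unfolding conj_fun_def by simp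

context fusion_pred
begin

lemma stableD: "stable H R \<psi> \<Longrightarrow> H Q f \<Longrightarrow> Q \<subseteq> R \<Longrightarrow> f ` Q \<subseteq> R \<Longrightarrow> H (\<psi> ` Q) (conj_fun R \<psi> f)"
  unfolding stable_def by blast

lemma stable_cong:
  assumes "stable H R \<psi>" "\<And>x. x \<in> R \<Longrightarrow> \<psi> x = \<chi> x" "inj_on \<psi> R"
  shows "stable H R \<chi>"
  unfolding stable_def
proof (intro allI impI)
  fix Q f assume f: "H Q f" "Q \<subseteq> R" "f ` Q \<subseteq> R"
  have inj: "inj_on \<chi> R" using assms(2,3) by (metis inj_on_cong)
  have "H (\<psi> ` Q) (conj_fun R \<psi> f)" by (rule stableD[OF assms(1) f])
  moreover have "\<psi> ` Q = \<chi> ` Q" using assms(2) f(2) by (metis image_cong subsetD)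
  moreover have "conj_fun R \<psi> f y = conj_fun R \<chi> f y" if y: "y \<in> \<chi> ` Q" for y
  proof -
    obtain x where x: "x \<in> Q" "y = \<chi> x" using y by blast
    hence xR: "x \<in> R" "f x \<in> R" using f by auto
    show ?thesis using conj_fun_apply[OF inj xR(1), of f] conj_fun_apply[OF assms(3) xR(1), of f]
      assms(2)[OF xR(1)] assms(2)[OF xR(2)] x(2) by simp
  qed
  ultimately show "H (\<chi> ` Q) (conj_fun R \<chi> f)" using H_cong by metis
qed

lemma stable_comp:
  assumes "stable H R \<alpha>" "stable H R' \<beta>" "\<alpha> ` R \<subseteq> R'" "inj_on \<alpha> R" "inj_on \<beta> R'"
  shows "stable H R (\<lambda>x. \<beta> (\<alpha> x))"
  unfolding stable_def
proof (intro allI impI)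
  fix Q f assume f: "H Q f" "Q \<subseteq> R" "f ` Q \<subseteq> R"
  have 1: "H (\<alpha> ` Q) (conj_fun R \<alpha> f)" by (rule stableD[OF assms(1) f])
  have e: "conj_fun R \<alpha> f ` \<alpha> ` Q = \<alpha> ` f ` Q"
    unfolding image_image by (rule image_cong) (use f(2) conj_fun_apply[OF assms(4)] in auto)
  have 2: "H (\<beta> ` \<alpha> ` Q) (conj_fun R' \<beta> (conj_fun R \<alpha> f))"
    by (rule stableD[OF assms(2) 1]) (use f assms(3) e in auto)
  have inj: "inj_on (\<lambda>x. \<beta> (\<alpha> x)) R"
    using comp_inj_on[OF assms(4) inj_on_subset[OF assms(5,3)]] by (simp add: comp_def)
  have "conj_fun R' \<beta> (conj_fun R \<alpha> f) y = conj_fun R (\<lambda>x. \<beta> (\<alpha> x)) f y" if y: "y \<in> \<beta> ` \<alpha> ` Q" for y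
  proof -
    obtain x where x: "x \<in> Q" "y = \<beta> (\<alpha> x)" using y by blast
    hence xR: "x \<in> R" "\<alpha> x \<in> R'" using f(2) assms(3) by auto
    show ?thesis
      using conj_fun_apply[OF inj xR(1), of f] conj_fun_apply[OF assms(5) xR(2), of "conj_fun R \<alpha> f"]
        conj_fun_apply[OF assms(4) xR(1), of f] x(2) by simp
  qed
  thus "H ((\<lambda>x. \<beta> (\<alpha> x)) ` Q) (conj_fun R (\<lambda>x. \<beta> (\<alpha> x)) f)"
    using H_cong[OF 2] by (simp add: image_image)
qed

lemma stable_H: assumes "H R e" shows "stable H R e"
  unfolding stable_def
proof (intro allI impI)
  fix Q f assume f: "H Q f" "Q \<subseteq> R" "f ` Q \<subseteq> R"
  have i: "H (e ` R) (inv_into R e)" by (rule H_inv[OF assms])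
  have i': "H (e ` Q) (inv_into R e)"
    by (rule H_restr[OF i H_img_sub[OF assms H_sub[OF f(1)] f(2)]]) (use f(2) in blast)
  have im: "inv_into R e ` e ` Q = Q"
    using inv_into_image_cancel[OF H_inj[OF assms] f(2)] .
  have "H (e ` Q) (\<lambda>y. f (inv_into R e y))" by (rule H_comp[OF i' f(1)]) (simp add: im)
  moreover have "(\<lambda>y. f (inv_into R e y)) ` e ` Q = f ` Q" using im by (metis image_image)
  ultimately show "H (e ` Q) (conj_fun R e f)"
    unfolding conj_fun_def using H_comp[OF _ assms, of "e ` Q" "\<lambda>y. f (inv_into R e y)"] f(3) by simp
qed

end

text \<open>This setting occurs for F over E and again for E over the generated system, where P and
  T coincide; one Frattini argument thus serves both.\<close>

locale closed_fusion_sub = F: fusion_pred p G P FF + E: fusion_pred p G T EE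
  for p :: nat and G (structure) and P FF T EE +
  assumes TP: "T \<subseteq> P"
    and E_F: "EE Q f \<Longrightarrow> FF Q f"
    and closed: "FF Q f \<Longrightarrow> Q \<subseteq> T \<Longrightarrow> f ` Q \<subseteq> T"
begin

lemma autT: assumes "FF T \<alpha>" shows "\<alpha> ` T = T" "FF T (inv_into T \<alpha>)" "inv_into T \<alpha> ` T = T"
    "\<And>x. x \<in> T \<Longrightarrow> inv_into T (inv_into T \<alpha>) x = \<alpha> x"
proof -
  show a: "\<alpha> ` T = T" using endo_inj_surj[OF F.H_fin[OF assms] closed[OF assms] F.H_inj[OF assms]] by blast
  show i: "FF T (inv_into T \<alpha>)" using F.H_inv[OF assms] a by simp
  show b: "inv_into T \<alpha> ` T = T" using F.H_inv_img[OF assms] a by simp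
  fix x assume x: "x \<in> T"
  have "\<alpha> x \<in> T" "inv_into T \<alpha> (\<alpha> x) = x" using x a F.H_inv_l[OF assms] by auto
  thus "inv_into T (inv_into T \<alpha>) x = \<alpha> x" using F.H_inv_l[OF i, of "\<alpha> x"] by simp
qed

definition factorizes :: "'a set \<Rightarrow> ('a \<Rightarrow> 'a) \<Rightarrow> bool" where
  "factorizes Q f \<longleftrightarrow> (\<exists>\<alpha> e. FF T \<alpha> \<and> EE (\<alpha> ` Q) e \<and> (\<forall>x\<in>Q. f x = e (\<alpha> x)))"

lemma factorizesE:
  assumes "factorizes Q f"
  obtains \<alpha> e where "FF T \<alpha>" "EE (\<alpha> ` Q) e" "\<And>x. x \<in> Q \<Longrightarrow> f x = e (\<alpha> x)"
  using assms unfolding factorizes_def by blast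

lemma factorizes_cong: "factorizes Q f \<Longrightarrow> (\<And>x. x \<in> Q \<Longrightarrow> f x = g x) \<Longrightarrow> factorizes Q g"
  unfolding factorizes_def by (metis (no_types, lifting))

lemma factorizes_restr: assumes "factorizes V f" "subgroup Q G" "Q \<subseteq> V" "V \<subseteq> T" shows "factorizes Q f"
proof -
  obtain \<alpha> e where a: "FF T \<alpha>" "EE (\<alpha> ` V) e" "\<And>x. x \<in> V \<Longrightarrow> f x = e (\<alpha> x)" using factorizesE[OF assms(1)] by blast
  have "EE (\<alpha> ` Q) e"
    by (rule E.H_restr[OF a(2) F.H_img_sub[OF a(1) assms(2)]]) (use assms in auto)
  thus ?thesis unfolding factorizes_def using a assms(3) by blast
qed

lemma factorizes_E: assumes "EE Q e" shows "factorizes Q e"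
  unfolding factorizes_def using F.H_id[OF E.T TP] assms by (intro exI[of _ "\<lambda>x. x"] exI[of _ e]) simp

lemma stableT: "stable EE T \<alpha> \<Longrightarrow> EE Q f \<Longrightarrow> EE (\<alpha> ` Q) (conj_fun T \<alpha> f)"
  using E.stableD[of T \<alpha> Q f] E.H_subT[of Q f] E.H_imgT[of Q f] by blast

context
  assumes inv: "\<And>\<alpha>. FF T \<alpha> \<Longrightarrow> stable EE T \<alpha>"
begin

text \<open>With f = e \<alpha> and g = d \<beta> the composite is d (\<beta> e \<beta>^-1) \<beta>
  \<alpha>, and the bracket stays in the small system by stability under \<beta>.\<close>

lemma factorizes_comp:
  assumes Q: "Q \<subseteq> T" and f: "factorizes Q f" and g: "factorizes (f ` Q) g"
  shows "factorizes Q (\<lambda>x. g (f x))"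
proof -
  obtain \<alpha> e where a: "FF T \<alpha>" "EE (\<alpha> ` Q) e" "\<And>x. x \<in> Q \<Longrightarrow> f x = e (\<alpha> x)" using factorizesE[OF f] by blast
  obtain \<beta> d where b: "FF T \<beta>" "EE (\<beta> ` f ` Q) d" "\<And>x. x \<in> f ` Q \<Longrightarrow> g x = d (\<beta> x)" using factorizesE[OF g] by blast
  have ba: "FF T (\<lambda>x. \<beta> (\<alpha> x))" by (rule F.H_comp[OF a(1) b(1)]) (simp add: autT[OF a(1)])
  have 1: "EE (\<beta> ` \<alpha> ` Q) (conj_fun T \<beta> e)" by (rule stableT[OF inv[OF b(1)] a(2)])
  have c: "conj_fun T \<beta> e (\<beta> (\<alpha> x)) = \<beta> (f x)" if "x \<in> Q" for x
    using conj_fun_apply[OF F.H_inj[OF b(1)], of "\<alpha> x" e] a(3)[OF that] autT(1)[OF a(1)] Q that by auto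
  have "conj_fun T \<beta> e ` \<beta> ` \<alpha> ` Q = \<beta> ` f ` Q"
    unfolding image_image by (rule image_cong) (use c in auto)
  hence "EE (\<beta> ` \<alpha> ` Q) (\<lambda>y. d (conj_fun T \<beta> e y))" by (intro E.H_comp[OF 1 b(2)]) simp
  hence "EE ((\<lambda>x. \<beta> (\<alpha> x)) ` Q) (\<lambda>y. d (conj_fun T \<beta> e y))" by (simp add: image_image)
  thus ?thesis unfolding factorizes_def using ba c b(3)
    by (intro exI[of _ "\<lambda>x. \<beta> (\<alpha> x)"] exI[of _ "\<lambda>y. d (conj_fun T \<beta> e y)"]) auto
qed

text \<open>The inverse of e \<alpha> is (\<alpha>^-1 e^-1 \<alpha>) \<alpha>^-1.\<close>

lemma factorizes_inv:
  assumes Q: "Q \<subseteq> T" and f: "FF Q f" "factorizes Q f"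
  shows "factorizes (f ` Q) (inv_into Q f)"
proof -
  obtain \<alpha> e where a: "FF T \<alpha>" "EE (\<alpha> ` Q) e" "\<And>x. x \<in> Q \<Longrightarrow> f x = e (\<alpha> x)" using factorizesE[OF f(2)] by blast
  let ?\<beta> = "inv_into T \<alpha>"
  have im: "e ` \<alpha> ` Q = f ` Q" unfolding image_image by (rule image_cong) (use a(3) in auto)
  have "EE (e ` \<alpha> ` Q) (inv_into (\<alpha> ` Q) e)" by (rule E.H_inv[OF a(2)])
  from stableT[OF inv[OF autT(2)[OF a(1)]] this]
  have 1: "EE (?\<beta> ` f ` Q) (conj_fun T ?\<beta> (inv_into (\<alpha> ` Q) e))" unfolding im .
  have "inv_into Q f y = conj_fun T ?\<beta> (inv_into (\<alpha> ` Q) e) (?\<beta> y)" if y: "y \<in> f ` Q" for y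
  proof -
    obtain x where x: "x \<in> Q" "y = f x" using y by blast
    have yT: "y \<in> T" using y closed[OF f(1) Q] by blast
    have "conj_fun T ?\<beta> (inv_into (\<alpha> ` Q) e) (?\<beta> y) = ?\<beta> (inv_into (\<alpha> ` Q) e y)"
      by (rule conj_fun_apply[OF F.H_inj[OF autT(2)[OF a(1)]] yT])
    also have "\<dots> = ?\<beta> (\<alpha> x)" using x a(3)[OF x(1)] E.H_inv_l[OF a(2), of "\<alpha> x"] by simp
    also have "\<dots> = x" using x(1) Q F.H_inv_l[OF a(1)] by blast
    finally show ?thesis using F.H_inv_l[OF f(1) x(1)] x(2) by simp
  qed
  thus ?thesis unfolding factorizes_def using autT(2)[OF a(1)] 1 by blast
qed

text \<open>Downward induction on the order of Q. For each proper Q the hypothesis supplies a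
  conjugate R that is reached from its conjugates inside T by maps defined on larger subgroups, and
  whose automorphisms extend properly after correction by some k of the small system. All maps on
  larger subgroups factorize by induction, and f is reassembled from their restrictions.\<close>

theorem frattini:
  assumes hyp: "\<And>Q. subgroup Q G \<Longrightarrow> Q \<subset> T \<Longrightarrow> \<exists>R. (\<exists>f. FF Q f \<and> f ` Q = R) \<and>
      (\<forall>Q' f. FF Q' f \<longrightarrow> Q' \<subseteq> T \<longrightarrow> f ` Q' = R \<longrightarrow> (\<exists>V h. Q' \<subset> V \<and> V \<subseteq> T \<and> FF V h \<and> h ` Q' = R)) \<and>
      (\<forall>\<psi>. FF R \<psi> \<longrightarrow> \<psi> ` R = R \<longrightarrow> (\<exists>k V h. EE R k \<and> k ` R = R \<and> R \<subset> V \<and> V \<subseteq> T \<and> FF V h \<and> (\<forall>x\<in>R. k (\<psi> x) = h x)))"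
    and f: "FF Q f" "Q \<subseteq> T"
  shows "factorizes Q f"
  using f
proof (induction "card T - card Q" arbitrary: Q f rule: less_induct)
  case less
  have finT: "finite T" by (rule F.finite_subgroup[OF E.T])
  have Qs: "subgroup Q G" using F.H_sub[OF less.prems(1)] .
  have up: "factorizes Q' h" if "FF V h" "Q' \<subset> V" "V \<subseteq> T" "card Q' = card Q" "subgroup Q' G" for V h Q'
  proof -
    have "card Q' < card V" "card V \<le> card T"
      using psubset_card_mono[OF finite_subset[OF that(3) finT] that(2)] card_mono[OF finT that(3)] by auto
    hence "factorizes V h" using less.hyps[of V h] that by simp
    thus ?thesis using factorizes_restr[of V h Q'] that by blast
  qed
  show ?case
  proof (cases "Q = T")
    case True
    have "EE (f ` Q) (\<lambda>x. x)" using E.H_id[OF E.T] autT(1)[of f] less.prems True by simp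
    thus ?thesis unfolding factorizes_def using less.prems True by blast
  next
    case False
    hence QT: "Q \<subset> T" using less.prems(2) by blast
    obtain R f0 where R: "FF Q f0" "f0 ` Q = R"
      and ext: "\<And>Q' f. FF Q' f \<Longrightarrow> Q' \<subseteq> T \<Longrightarrow> f ` Q' = R \<Longrightarrow> \<exists>V h. Q' \<subset> V \<and> V \<subseteq> T \<and> FF V h \<and> h ` Q' = R"
      and aut: "\<And>\<psi>. FF R \<psi> \<Longrightarrow> \<psi> ` R = R \<Longrightarrow> \<exists>k V h. EE R k \<and> k ` R = R \<and> R \<subset> V \<and> V \<subseteq> T \<and> FF V h \<and> (\<forall>x\<in>R. k (\<psi> x) = h x)"
      using hyp[OF Qs QT] by (elim exE conjE) (rule that, assumption, assumption, metis, metis)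
    let ?Q' = "f ` Q"
    have Q'T: "?Q' \<subseteq> T" by (rule closed[OF less.prems])
    have Rs: "subgroup R G" using F.H_img[OF R(1)] R(2) by simp
    have cR: "card R = card Q" using F.H_card[OF R(1)] R(2) by simp
    have fi: "FF ?Q' (inv_into Q f)" "inv_into Q f ` ?Q' = Q" using F.H_inv F.H_inv_img less.prems(1) by blast+
    have e1: "FF ?Q' (\<lambda>y. f0 (inv_into Q f y))" by (rule F.H_comp[OF fi(1) R(1)]) (simp add: fi(2))
    have e2: "(\<lambda>y. f0 (inv_into Q f y)) ` ?Q' = R" using fi(2) R(2) by (metis image_image)
    from ext[OF e1 Q'T e2] obtain V' h' where h': "?Q' \<subset> V'" "V' \<subseteq> T" "FF V' h'" "h' ` ?Q' = R"
      by (elim exE conjE) (rule that)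
    from ext[OF R(1) less.prems(2) R(2)] obtain V h where h: "Q \<subset> V" "V \<subseteq> T" "FF V h" "h ` Q = R"
      by (elim exE conjE) (rule that)
    have hQ: "FF Q h" using F.H_restr[OF h(3) Qs] h(1) by blast
    have h'Q: "FF ?Q' h'" using F.H_restr[OF h'(3) F.H_img[OF less.prems(1)]] h'(1) by blast
    have f1: "factorizes Q h" by (rule up[OF h(3,1,2) refl Qs])
    have f2: "factorizes ?Q' h'" by (rule up[OF h'(3,1,2) F.H_card[OF less.prems(1)] F.H_img[OF less.prems(1)]])
    have hi: "FF R (inv_into Q h)" "inv_into Q h ` R = Q" using F.H_inv[OF hQ] F.H_inv_img[OF hQ] h(4) by auto
    \<comment> \<open>The extendable maps h and h' take Q and f(Q) onto R, so f turns into the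
      automorphism \<psi> = h' f h^-1 of R. Once k \<psi> = h2 on R with h2 extendable, f = h'^-1
      k^-1 h2 h.\<close>
    let ?\<psi> = "\<lambda>y. h' (f (inv_into Q h y))"
    have s1: "FF R (\<lambda>y. f (inv_into Q h y))" using F.H_comp[OF hi(1) less.prems(1)] hi(2) by simp
    have s2: "(\<lambda>y. f (inv_into Q h y)) ` R = ?Q'" using hi(2) by (metis image_image)
    have psi: "FF R ?\<psi>" using F.H_comp[OF s1 h'Q] s2 by simp
    have psiR: "?\<psi> ` R = R" using s2 h'(4) by (metis image_image)
    from aut[OF psi psiR] obtain k V2 h2 where k: "EE R k" "k ` R = R" "R \<subset> V2" "V2 \<subseteq> T" "FF V2 h2" "\<And>x. x \<in> R \<Longrightarrow> k (?\<psi> x) = h2 x"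
      by (elim exE conjE) (rule that, assumption+, blast)
    have f3: "factorizes R h2" by (rule up[OF k(5,3,4) cR Rs])
    have h2R: "h2 ` R = R"
    proof -
      have "h2 ` R = k ` ?\<psi> ` R" unfolding image_image by (rule image_cong) (use k(6) in auto)
      thus ?thesis using psiR k(2) by simp
    qed
    have f4: "factorizes R (inv_into R k)" using factorizes_E[OF E.H_inv[OF k(1)]] k(2) by simp
    have kR: "inv_into R k ` R = R" using E.H_inv_img[OF k(1)] k(2) by simp
    have f5: "factorizes R (inv_into ?Q' h')" using factorizes_inv[OF Q'T h'Q f2] h'(4) by simp
    have "factorizes Q (\<lambda>x. h2 (h x))" by (rule factorizes_comp[OF less.prems(2) f1]) (simp add: h(4) f3)
    moreover have i1: "(\<lambda>x. h2 (h x)) ` Q = R" using h(4) h2R by (metis image_image)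
    ultimately have "factorizes Q (\<lambda>x. inv_into R k (h2 (h x)))"
      using factorizes_comp[OF less.prems(2), of "\<lambda>x. h2 (h x)" "inv_into R k"] f4 by simp
    moreover have "(\<lambda>x. inv_into R k (h2 (h x))) ` Q = R" using i1 kR by (metis image_image)
    ultimately have "factorizes Q (\<lambda>x. inv_into ?Q' h' (inv_into R k (h2 (h x))))"
      using factorizes_comp[OF less.prems(2), of "\<lambda>x. inv_into R k (h2 (h x))" "inv_into ?Q' h'"] f5 by simp
    moreover have "inv_into ?Q' h' (inv_into R k (h2 (h x))) = f x" if x: "x \<in> Q" for x
    proof -
      have hx: "h x \<in> R" using x h(4) by blast
      have fx: "f x \<in> ?Q'" using x by blast
      have "h2 (h x) = k (h' (f x))" using k(6)[OF hx] F.H_inv_l[OF hQ x] by simp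
      moreover have "h' (f x) \<in> R" using fx h'(4) by blast
      ultimately show ?thesis using E.H_inv_l[OF k(1)] F.H_inv_l[OF h'Q fx] by simp
    qed
    ultimately show ?thesis by (rule factorizes_cong)
  qed
qed

text \<open>Since e \<alpha> = \<alpha> (\<alpha>^-1 e \<alpha>), the automorphism of T can be
  applied last instead of first.\<close>

lemma factorizes_swap:
  assumes "factorizes Q f" "Q \<subseteq> T"
  obtains \<alpha> d where "FF T \<alpha>" "EE Q d" "\<And>x. x \<in> Q \<Longrightarrow> f x = \<alpha> (d x)"
proof -
  obtain \<alpha> e where a: "FF T \<alpha>" "EE (\<alpha> ` Q) e" "\<And>x. x \<in> Q \<Longrightarrow> f x = e (\<alpha> x)" using factorizesE[OF assms(1)] by blast
  let ?\<beta> = "inv_into T \<alpha>"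
  have im: "?\<beta> ` \<alpha> ` Q = Q" by (rule inv_into_image_cancel[OF F.H_inj[OF a(1)] assms(2)])
  have d: "EE Q (conj_fun T ?\<beta> e)" using stableT[OF inv[OF autT(2)[OF a(1)]] a(2)] im by simp
  have "f x = \<alpha> (conj_fun T ?\<beta> e x)" if x: "x \<in> Q" for x
  proof -
    have xT: "x \<in> T" "\<alpha> x \<in> T" using x assms(2) autT(1)[OF a(1)] by auto
    have "conj_fun T ?\<beta> e x = ?\<beta> (e (\<alpha> x))"
      unfolding conj_fun_def using autT(4)[OF a(1) xT(1)] by simp
    moreover have "e (\<alpha> x) \<in> \<alpha> ` T" using E.H_mem(3)[OF a(2)] x autT(1)[OF a(1)] by blast
    ultimately show ?thesis using a(3)[OF x] f_inv_into_f[of "e (\<alpha> x)" \<alpha> T] by simp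
  qed
  thus ?thesis using that a(1) d by blast
qed

end

end

section \<open>Weakly normal subsystems\<close>

locale weakly_normal_pair = closed_fusion_sub p G "carrier G" FF T EE
  for p :: nat and G (structure) and FF T EE +
  assumes F_sat: "F.is_saturated" and E_sat: "E.is_saturated"
    and E_stable: "FF R \<psi> \<Longrightarrow> R \<subseteq> T \<Longrightarrow> stable EE R \<psi>"
begin

lemma T_normal: assumes "g \<in> carrier G" "t \<in> T" shows "conj_by G g t \<in> T"
proof -
  have "FF T (conj_by G g)" by (rule F.H_conj_by[OF E.T E.T_sub assms(1)])
  from closed[OF this] assms(2) show ?thesis by blast
qed

text \<open>The F-good subgroups of T, closed up under Aut_F(T). Every subgroup of T turns out to
  have an E-conjugate in this class, although good subgroups of F are only promised up to
  F-conjugacy.\<close>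

definition T_good :: "'a set \<Rightarrow> bool" where
  "T_good R \<longleftrightarrow> R \<subseteq> T \<and> (\<exists>\<alpha>. FF T \<alpha> \<and> good p G (carrier G) FF (\<alpha> ` R))"

text \<open>All F-conjugates are tested, but their centralizers are taken in T, not in the ambient
  group.\<close>

definition centric :: "'a set \<Rightarrow> bool" where
  "centric Q \<longleftrightarrow> subgroup Q G \<and> Q \<subseteq> T \<and> (\<forall>f. FF Q f \<longrightarrow> centralizer_in G T (f ` Q) \<subseteq> f ` Q)"

lemma FF_id: "subgroup Q G \<Longrightarrow> FF Q (\<lambda>x. x)"
  by (rule F.H_id[OF _ subgroup.subset])

lemma FF_inv: assumes "FF Q f" "f ` Q = R" shows "FF R (inv_into Q f)" "inv_into Q f ` R = Q"
  using F.H_inv[OF assms(1)] F.H_inv_img[OF assms(1)] assms(2) by auto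

lemma EE_inv: assumes "EE Q f" "f ` Q = R" shows "EE R (inv_into Q f)" "inv_into Q f ` R = Q"
  using E.H_inv[OF assms(1)] E.H_inv_img[OF assms(1)] assms(2) by auto

lemma FF_comp: assumes "FF Q f" "f ` Q = R" "FF R g" shows "FF Q (\<lambda>x. g (f x))" "(\<lambda>x. g (f x)) ` Q = g ` R"
  using F.H_comp[OF assms(1,3)] assms(2) by (auto simp: image_image[symmetric])

lemma EE_comp: assumes "EE Q f" "f ` Q = R" "EE R g" shows "EE Q (\<lambda>x. g (f x))" "(\<lambda>x. g (f x)) ` Q = g ` R"
  using E.H_comp[OF assms(1,3)] assms(2) by (auto simp: image_image[symmetric])

lemma normalizer_in_T_carrier: "normalizer_in G T Q \<subseteq> normalizer_in G (carrier G) Q"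
  by (rule F.normalizer_in_mono[OF E.T_sub])

lemma F_good_ext:
  assumes V: "good p G (carrier G) FF V" and f: "FF Q f" "f ` Q = V" "Q \<subseteq> T"
  obtains h where "FF (normalizer_in G T Q) h" "h ` Q = V"
proof -
  obtain h where h: "FF (normalizer_in G (carrier G) Q) h" "h ` Q = V" using F.good_normalizer_in_ext[OF V f(1,2)] by blast
  have "FF (normalizer_in G T Q) h" by (rule F.H_restr[OF h(1) E.normalizer_in_sub[OF F.H_sub[OF f(1)]] normalizer_in_T_carrier])
  thus ?thesis using that h(2) by blast
qed

lemma T_good_sub: assumes "T_good R" shows "R \<subseteq> T" "subgroup R G"
proof -
  show RT: "R \<subseteq> T" using assms unfolding T_good_def by blast
  obtain \<alpha> where a: "FF T \<alpha>" "good p G (carrier G) FF (\<alpha> ` R)" using assms unfolding T_good_def by blast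
  have "subgroup (inv_into T \<alpha> ` \<alpha> ` R) G"
    by (rule F.H_img_sub[OF autT(2)[OF a(1)]]) (use a(2) RT autT(1)[OF a(1)] in \<open>auto simp: good_def\<close>)
  thus "subgroup R G" using inv_into_image_cancel[OF F.H_inj[OF a(1)] RT] by simp
qed

lemma T_good_ext:
  assumes R: "T_good R" and f: "FF Q f" "f ` Q = R" "Q \<subseteq> T"
  obtains h where "FF (normalizer_in G T Q) h" "h ` Q = R" "h ` normalizer_in G T Q \<subseteq> normalizer_in G T R"
proof -
  obtain \<alpha> where a: "FF T \<alpha>" "good p G (carrier G) FF (\<alpha> ` R)" using R unfolding T_good_def by blast
  note Rs = T_good_sub[OF R]
  have Qs: "subgroup Q G" by (rule F.H_sub[OF f(1)])
  have aR: "FF R \<alpha>" by (rule F.H_restr[OF a(1) Rs(2,1)])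
  obtain h where h: "FF (normalizer_in G T Q) h" "h ` Q = \<alpha> ` R"
    using F_good_ext[OF a(2) FF_comp[OF f(1,2) aR] f(3)] by blast
  have hT: "h ` normalizer_in G T Q \<subseteq> T" by (rule closed[OF h(1) E.nrmT])
  let ?h = "\<lambda>x. inv_into T \<alpha> (h x)"
  have 1: "FF (normalizer_in G T Q) ?h" by (rule F.H_comp[OF h(1) autT(2)[OF a(1)] hT])
  have 2: "?h ` Q = R"
  proof -
    have "?h ` Q = inv_into T \<alpha> ` h ` Q" by (simp add: image_image)
    thus ?thesis using h(2) inv_into_image_cancel[OF F.H_inj[OF a(1)] Rs(1)] by simp
  qed
  have 3: "?h ` normalizer_in G T Q \<subseteq> normalizer_in G T R"
  proof
    fix y assume "y \<in> ?h ` normalizer_in G T Q"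
    then obtain g where g: "g \<in> normalizer_in G T Q" "y = ?h g" by blast
    have "y \<in> normalizer_in G (carrier G) (?h ` Q)"
      unfolding g(2) by (rule F.H_normalizer_in[OF 1 g(1) _ E.sub_normalizer_in[OF Qs f(3)]]) (use g(1) normalizer_in_T_carrier in blast)
    moreover have "y \<in> T" using closed[OF 1 E.nrmT] g by blast
    ultimately show "y \<in> normalizer_in G T R" unfolding 2 normalizer_in_def by blast
  qed
  show ?thesis by (rule that[OF 1 2 3])
qed

text \<open>Let R0 be an E-good conjugate of R. An F-morphism embeds N_T(R0) in N_T(R), so the
  E-morphism from N_T(R) to N_T(R0) is bijective by counting, and goodness in E passes back to
  R.\<close>

lemma T_good_good: assumes R: "T_good R" shows "good p G T EE R"
proof -
  note Rs = T_good_sub[OF R]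
  obtain f0 where f0: "EE R f0" "good p G T EE (f0 ` R)" using E.is_saturatedE[OF E_sat Rs(2,1)] by blast
  let ?R0 = "f0 ` R"
  have R0: "subgroup ?R0 G" "?R0 \<subseteq> T" using f0(2) unfolding good_def by auto
  obtain e where e: "EE (normalizer_in G T R) e" "e ` R = ?R0" using E.good_normalizer_in_ext[OF f0(2,1) refl] by blast
  obtain c where c: "FF (normalizer_in G T ?R0) c" "c ` ?R0 = R" "c ` normalizer_in G T ?R0 \<subseteq> normalizer_in G T R"
    by (rule T_good_ext[OF R FF_inv[OF E_F[OF f0(1)] refl] R0(2)])
  have sub: "e ` normalizer_in G T R \<subseteq> normalizer_in G T ?R0" using E.H_normalizer_in_img[OF e(1) Rs(2,1)] e(2) by simp
  have "card (normalizer_in G T ?R0) \<le> card (normalizer_in G T R)"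
    using F.H_card[OF c(1)] card_mono[OF F.finite_subgroup[OF E.normalizer_in_sub[OF Rs(2)]] c(3)] by simp
  hence "e ` normalizer_in G T R = normalizer_in G T ?R0"
    by (intro card_seteq[OF F.finite_subgroup[OF E.normalizer_in_sub[OF R0(1)]] sub]) (simp add: E.H_card[OF e(1)])
  thus ?thesis using E.good_transfer[OF Rs(2,1) f0(2) e] by blast
qed

lemma F_good_T_good: assumes "good p G (carrier G) FF V" "V \<subseteq> T" shows "T_good V"
proof -
  have "good p G (carrier G) FF ((\<lambda>x. x) ` V)" using assms(1) unfolding image_ident .
  from exI[of "\<lambda>\<alpha>. FF T \<alpha> \<and> good p G (carrier G) FF (\<alpha> ` V)", OF conjI[OF FF_id[OF E.T] this]] assms(2)
  show ?thesis unfolding T_good_def by (rule conjI[rotated])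
qed

text \<open>An F-good conjugate R of Q serves. As E is invariant, an F-automorphism \<psi> of R
  carries Aut_T(R) to a p-subgroup of Aut_E(R). Sylow's theorem in Aut_E(R) gives k returning it
  into Aut_T(R), so k \<psi> extends in F to N_T(R), which is larger than R.\<close>

lemma F_frattini: assumes "FF Q f" "Q \<subseteq> T" shows "factorizes Q f"
proof (rule frattini[OF _ _ assms])
  show "\<And>\<alpha>. FF T \<alpha> \<Longrightarrow> stable EE T \<alpha>" using E_stable by blast
  fix Q assume Q: "subgroup Q G" "Q \<subset> T"
  obtain f where f: "FF Q f" "good p G (carrier G) FF (f ` Q)"
    using F.is_saturatedE[OF F_sat Q(1) subgroup.subset[OF Q(1)]] by blast
  let ?R = "f ` Q"
  have RT: "?R \<subseteq> T" using closed[OF f(1)] Q(2) by blast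
  have R: "T_good ?R" by (rule F_good_T_good[OF f(2) RT])
  have Rs: "subgroup ?R G" by (rule T_good_sub(2)[OF R])
  have ne: "?R \<noteq> T" using F.H_card[OF f(1)] psubset_card_mono[OF F.finite_subgroup[OF E.T] Q(2)] by auto
  show "\<exists>R. (\<exists>f. FF Q f \<and> f ` Q = R) \<and>
      (\<forall>Q' f. FF Q' f \<longrightarrow> Q' \<subseteq> T \<longrightarrow> f ` Q' = R \<longrightarrow> (\<exists>V h. Q' \<subset> V \<and> V \<subseteq> T \<and> FF V h \<and> h ` Q' = R)) \<and>
      (\<forall>\<psi>. FF R \<psi> \<longrightarrow> \<psi> ` R = R \<longrightarrow> (\<exists>k V h. EE R k \<and> k ` R = R \<and> R \<subset> V \<and> V \<subseteq> T \<and> FF V h \<and> (\<forall>x\<in>R. k (\<psi> x) = h x)))"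
  proof (rule exI[of _ ?R], intro conjI allI impI)
    show "\<exists>fa. FF Q fa \<and> fa ` Q = ?R" using f(1) by blast
    fix Q' f' assume f': "FF Q' f'" "Q' \<subseteq> T" "f' ` Q' = ?R"
    obtain h where h: "FF (normalizer_in G T Q') h" "h ` Q' = ?R" by (rule T_good_ext[OF R f'(1,3,2)])
    have "Q' \<noteq> T" using ne autT(1)[of f'] f' by blast
    hence "Q' \<subset> normalizer_in G T Q'" using F.normalizer_in_grows[OF E.T F.H_sub[OF f'(1)]] f'(2) by blast
    hence "Q' \<subset> normalizer_in G T Q' \<and> normalizer_in G T Q' \<subseteq> T \<and> FF (normalizer_in G T Q') h \<and> h ` Q' = ?R"
      using h(1,2) E.nrmT[of Q'] by simp
    thus "\<exists>V h. Q' \<subset> V \<and> V \<subseteq> T \<and> FF V h \<and> h ` Q' = ?R"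
      by - (rule exI, rule exI, assumption)
  next
    fix \<psi> assume psi: "FF ?R \<psi>" "\<psi> ` ?R = ?R"
    have gE: "sylow_in p (AutT G T ?R) (Auts EE ?R)" using T_good_good[OF R] unfolding good_def by blast
    have rF: "is_receptive G (carrier G) FF ?R" using f(2) unfolding good_def by blast
    have bij: "bij_betw \<psi> ?R ?R" using psi F.H_inj unfolding bij_betw_def by blast
    obtain kk where kk: "card (AutT G T ?R) = p ^ kk" using E.AutT_subgroup(2)[OF Rs RT] by blast
    have BA: "(\<lambda>y\<in>?R. \<psi> (b (inv_into ?R \<psi> y))) \<in> Auts EE ?R" if b: "b \<in> AutT G T ?R" for b
    proof -
      have bE: "b \<in> Auts EE ?R" using E.AutT_sub_Auts[OF Rs RT] b by blast
      have "EE (\<psi> ` ?R) (conj_fun ?R \<psi> b)"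
        by (rule E.stableD[OF E_stable[OF psi(1) RT] E.AutsD(1)[OF bE]]) (use E.AutsD(2)[OF bE] in auto)
      moreover have "conj_fun ?R \<psi> b ` ?R = ?R"
      proof -
        have "conj_fun ?R \<psi> b ` \<psi> ` ?R = \<psi> ` b ` ?R"
          unfolding image_image[of _ \<psi>] image_image[of \<psi> b]
          by (rule image_cong) (use conj_fun_apply[OF F.H_inj[OF psi(1)]] in auto)
        thus ?thesis using psi(2) E.AutsD(2)[OF bE] by simp
      qed
      ultimately show ?thesis using E.AutsI[of ?R "conj_fun ?R \<psi> b"] psi(2) unfolding conj_fun_def by simp
    qed
    obtain k where k: "k \<in> Auts EE ?R"
      "\<And>b. b \<in> AutT G T ?R \<Longrightarrow> \<exists>u\<in>normalizer_in G T ?R. \<forall>x\<in>?R. k (\<psi> (b x)) = conj_by G u (k (\<psi> x))"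
      using E.conj_into_sylow[OF Rs RT E.Auts_subgroup[OF Rs RT] gE bij F.finite_subgroup[OF Rs] E.AutT_subgroup(1)[OF Rs RT] kk BA]
      by blast
    note kp = FF_comp[OF psi E_F[OF E.AutsD(1)[OF k(1)]]]
    have "\<exists>u\<in>normalizer_in G (carrier G) ?R. \<forall>x\<in>?R. k (\<psi> (conj_by G g x)) = conj_by G u (k (\<psi> x))" if g: "g \<in> normalizer_in G T ?R" for g
    proof -
      have "restrict (conj_by G g) ?R \<in> AutT G T ?R" using g unfolding AutT_def by blast
      then obtain u where u: "u \<in> normalizer_in G T ?R" "\<forall>x\<in>?R. k (\<psi> (restrict (conj_by G g) ?R x)) = conj_by G u (k (\<psi> x))" using k(2) by blast
      have "\<forall>x\<in>?R. k (\<psi> (conj_by G g x)) = conj_by G u (k (\<psi> x))" using u(2) by simp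
      thus ?thesis using u(1) normalizer_in_T_carrier by blast
    qed
    then obtain h where h: "FF (normalizer_in G T ?R) h" "\<And>x. x \<in> ?R \<Longrightarrow> h x = k (\<psi> x)"
      using F.is_receptiveD[OF rF kp(1) _ E.normalizer_in_sub[OF Rs] E.sub_normalizer_in[OF Rs RT] normalizer_in_T_carrier]
        kp(2) E.AutsD(2)[OF k(1)] by (metis (no_types, lifting))
    have "?R \<subset> normalizer_in G T ?R" using F.normalizer_in_grows[OF E.T Rs] RT ne by blast
    thus "\<exists>k V h. EE ?R k \<and> k ` ?R = ?R \<and> ?R \<subset> V \<and> V \<subseteq> T \<and> FF V h \<and> (\<forall>x\<in>?R. k (\<psi> x) = h x)"
      using k(1) E.AutsD[OF k(1)] h E.nrmT by (intro exI[of _ k] exI[of _ "normalizer_in G T ?R"] exI[of _ h]) auto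
  qed
qed

lemma F_swap:
  assumes "FF Q f" "Q \<subseteq> T"
  obtains \<alpha> d where "FF T \<alpha>" "EE Q d" "\<And>x. x \<in> Q \<Longrightarrow> f x = \<alpha> (d x)"
  using factorizes_swap[OF _ F_frattini[OF assms] assms(2)] E_stable by blast

text \<open>Factor a map onto an F-good subgroup as \<alpha> d with d in E; the image of d is
  \<open>T_good\<close> with \<alpha> as the witness.\<close>

lemma T_good_exists:
  assumes "subgroup Q G" "Q \<subseteq> T" obtains f where "EE Q f" "T_good (f ` Q)"
proof -
  obtain f where f: "FF Q f" "good p G (carrier G) FF (f ` Q)"
    using F.is_saturatedE[OF F_sat assms(1) subgroup.subset[OF assms(1)]] by blast
  obtain \<alpha> d where d: "FF T \<alpha>" "EE Q d" "\<And>x. x \<in> Q \<Longrightarrow> f x = \<alpha> (d x)" using F_swap[OF f(1) assms(2)] by blast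
  have "\<alpha> ` d ` Q = f ` Q" unfolding image_image by (rule image_cong) (use d(3) in auto)
  hence "T_good (d ` Q)" unfolding T_good_def using d(1) f(2) E.H_imgT[OF d(2)] by auto
  thus ?thesis using that d(2) by blast
qed

lemma T_good_autT: assumes "T_good R" "FF T \<beta>" shows "T_good (\<beta> ` R)"
proof -
  obtain \<alpha> where a: "FF T \<alpha>" "good p G (carrier G) FF (\<alpha> ` R)" using assms unfolding T_good_def by blast
  have RT: "R \<subseteq> T" by (rule T_good_sub(1)[OF assms(1)])
  have "FF T (\<lambda>x. \<alpha> (inv_into T \<beta> x))" by (rule FF_comp(1)[OF autT(2,3)[OF assms(2)] a(1)])
  moreover have "(\<lambda>x. \<alpha> (inv_into T \<beta> x)) ` \<beta> ` R = \<alpha> ` R"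
    unfolding image_image by (rule image_cong) (use RT F.H_inv_l[OF assms(2)] in auto)
  moreover have "\<beta> ` R \<subseteq> T" using autT(1)[OF assms(2)] RT by blast
  ultimately show ?thesis unfolding T_good_def using a(2) by metis
qed

lemma centric_sub: "centric Q \<Longrightarrow> subgroup Q G" "centric Q \<Longrightarrow> Q \<subseteq> T"
  unfolding centric_def by auto

lemma centricD: "centric Q \<Longrightarrow> FF Q f \<Longrightarrow> centralizer_in G T (f ` Q) \<subseteq> f ` Q"
  unfolding centric_def by blast

lemma centric_centralizer_in: "centric Q \<Longrightarrow> centralizer_in G T Q \<subseteq> Q"
  using centricD[OF _ FF_id[OF centric_sub(1)], of Q] by simp

lemma centric_img: assumes "centric Q" "FF Q f" shows "centric (f ` Q)"
  unfolding centric_def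
proof (intro conjI allI impI)
  show "subgroup (f ` Q) G" by (rule F.H_img[OF assms(2)])
  show "f ` Q \<subseteq> T" by (rule closed[OF assms(2) centric_sub(2)[OF assms(1)]])
  fix g assume "FF (f ` Q) g"
  from centricD[OF assms(1) FF_comp(1)[OF assms(2) refl this]]
  show "centralizer_in G T (g ` f ` Q) \<subseteq> g ` f ` Q" by (simp add: image_image)
qed

lemma centric_sup: assumes "centric Q" "Q \<subseteq> U" "subgroup U G" "U \<subseteq> T" shows "centric U"
  unfolding centric_def
proof (intro conjI allI impI assms(3,4))
  fix f assume f: "FF U f"
  have "centralizer_in G T (f ` U) \<subseteq> centralizer_in G T (f ` Q)" by (rule F.centralizer_in_mono(2)) (use assms(2) in blast)
  also have "\<dots> \<subseteq> f ` Q" by (rule centricD[OF assms(1) F.H_restr[OF f centric_sub(1)[OF assms(1)] assms(2)]])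
  finally show "centralizer_in G T (f ` U) \<subseteq> f ` U" using assms(2) by blast
qed

lemma centric_T: "centric T"
  unfolding centric_def using E.T autT(1) E.cenT by auto

lemma T_good_centralizer_in_card:
  assumes R: "T_good R" and f: "FF Q f" "f ` Q = R" "Q \<subseteq> T"
  shows "card (centralizer_in G T Q) \<le> card (centralizer_in G T R)"
proof -
  have Qs: "subgroup Q G" by (rule F.H_sub[OF f(1)])
  obtain h where h: "FF (normalizer_in G T Q) h" "h ` Q = R" by (rule T_good_ext[OF R f])
  have cn: "centralizer_in G T Q \<subseteq> normalizer_in G T Q" by (rule F.centralizer_in_sub_normalizer_in[OF E.T subgroup.subset[OF Qs]])
  have "h ` centralizer_in G T Q \<subseteq> centralizer_in G T R"
  proof
    fix y assume "y \<in> h ` centralizer_in G T Q"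
    then obtain g where g: "g \<in> centralizer_in G T Q" "y = h g" by blast
    have "y \<in> centralizer_in G (carrier G) (h ` Q)"
      unfolding g(2) by (rule F.H_centralizer_in[OF h(1) _ _ E.sub_normalizer_in[OF Qs f(3)]]) (use g(1) cn F.centralizer_in_mono(1)[OF E.T_sub] in auto)
    moreover have "y \<in> T" using closed[OF h(1) E.nrmT] g cn by blast
    ultimately show "y \<in> centralizer_in G T R" unfolding h(2) centralizer_in_def by blast
  qed
  hence "card (h ` centralizer_in G T Q) \<le> card (centralizer_in G T R)"
    by (rule card_mono[OF F.finite_subgroup[OF E.centralizer_in_sub[OF T_good_sub(2)[OF R]]]])
  thus ?thesis using F.H_card[OF F.H_restr[OF h(1) E.centralizer_in_sub[OF Qs] cn]] by simp
qed

text \<open>A \<open>T_good\<close> subgroup has the largest centralizer in its F-class, so the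
  inclusion of f(C_T(R)) in C_T(f(R)) is an equality by counting.\<close>

lemma T_good_centralizer_in_img:
  assumes R: "T_good R" and f: "FF V f" "R \<subseteq> V" "centralizer_in G T R \<subseteq> V" "V \<subseteq> T"
  shows "f ` centralizer_in G T R = centralizer_in G T (f ` R)"
proof -
  note Rs = T_good_sub[OF R]
  have fR: "FF R f" by (rule F.H_restr[OF f(1) Rs(2) f(2)])
  have Ps: "subgroup (f ` R) G" "f ` R \<subseteq> T" using F.H_img[OF fR] closed[OF fR Rs(1)] by auto
  have fC: "FF (centralizer_in G T R) f" by (rule F.H_restr[OF f(1) E.centralizer_in_sub[OF Rs(2)] f(3)])
  have sub: "f ` centralizer_in G T R \<subseteq> centralizer_in G T (f ` R)"
  proof
    fix y assume "y \<in> f ` centralizer_in G T R"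
    then obtain g where g: "g \<in> centralizer_in G T R" "y = f g" by blast
    have "y \<in> centralizer_in G (carrier G) (f ` R)"
      unfolding g(2) by (rule F.H_centralizer_in[OF f(1) _ _ f(2)]) (use g(1) f(3) F.centralizer_in_mono(1)[OF E.T_sub] in auto)
    moreover have "y \<in> T" using closed[OF fC E.cenT] g by blast
    ultimately show "y \<in> centralizer_in G T (f ` R)" unfolding centralizer_in_def by blast
  qed
  moreover have "card (centralizer_in G T (f ` R)) \<le> card (f ` centralizer_in G T R)"
    using T_good_centralizer_in_card[OF R FF_inv[OF fR refl] Ps(2)] F.H_card[OF fC] by simp
  ultimately show ?thesis by (rule card_seteq[OF F.finite_subgroup[OF E.centralizer_in_sub[OF Ps(1)]]])
qed

text \<open>The bridge from noncentric to centric subgroups: R C_T(R) is centric for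
  \<open>T_good\<close> R and acts on R by inner automorphisms only.\<close>

definition prod_CT :: "'a set \<Rightarrow> 'a set" where
  "prod_CT R = R <#> centralizer_in G T R"

lemma prod_CT_sub:
  assumes "subgroup R G" "R \<subseteq> T"
  shows "subgroup (prod_CT R) G" "R \<subseteq> prod_CT R" "centralizer_in G T R \<subseteq> prod_CT R" "prod_CT R \<subseteq> T" "prod_CT R \<subseteq> normalizer_in G T R"
proof -
  have cs: "subgroup (centralizer_in G T R) G" by (rule E.centralizer_in_sub[OF assms(1)])
  show "subgroup (prod_CT R) G" unfolding prod_CT_def
  proof (rule F.subgroup_set_mult[OF assms(1) cs])
    fix a b assume ab: "a \<in> R" "b \<in> centralizer_in G T R"
    have "conj_by G a b = b"
      using ab F.centralizer_inD(2)[OF ab(2,1)] E.TG E.cenT assms(2) by (subst F.conj_by_commute) auto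
    thus "conj_by G a b \<in> centralizer_in G T R" using ab by simp
  qed
  show "R \<subseteq> prod_CT R" "centralizer_in G T R \<subseteq> prod_CT R" unfolding prod_CT_def by (rule F.set_mult_sup[OF assms(1) cs])+
  show "prod_CT R \<subseteq> T" unfolding prod_CT_def by (rule F.set_mult_least[OF E.T assms(2) E.cenT])
  show "prod_CT R \<subseteq> normalizer_in G T R" unfolding prod_CT_def
    by (rule F.set_mult_least[OF E.normalizer_in_sub[OF assms(1)] E.sub_normalizer_in[OF assms] F.centralizer_in_sub_normalizer_in[OF E.T subgroup.subset[OF assms(1)]]])
qed

lemma prod_CT_least: "subgroup V G \<Longrightarrow> R \<subseteq> V \<Longrightarrow> centralizer_in G T R \<subseteq> V \<Longrightarrow> prod_CT R \<subseteq> V"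
  unfolding prod_CT_def by (rule F.set_mult_least)

text \<open>Any element of T centralizing f(R C_T(R)) lies in C_T(f(R)), which equals
  f(C_T(R)).\<close>

lemma prod_CT_centric: assumes R: "T_good R" shows "centric (prod_CT R)"
  unfolding centric_def
proof (intro conjI allI impI)
  note W = prod_CT_sub[OF T_good_sub(2,1)[OF R]]
  show "subgroup (prod_CT R) G" "prod_CT R \<subseteq> T" by (rule W)+
  fix f assume f: "FF (prod_CT R) f"
  have "centralizer_in G T (f ` prod_CT R) \<subseteq> centralizer_in G T (f ` R)" by (rule F.centralizer_in_mono(2)) (use W(2) in blast)
  also have "\<dots> = f ` centralizer_in G T R" using T_good_centralizer_in_img[OF R f W(2-4)] by simp
  finally show "centralizer_in G T (f ` prod_CT R) \<subseteq> f ` prod_CT R" using W(3) by blast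
qed

lemma T_good_noncentric: assumes R: "T_good R" and "\<not> centric R" shows "\<not> centralizer_in G T R \<subseteq> R"
proof
  assume c: "centralizer_in G T R \<subseteq> R"
  note Rs = T_good_sub[OF R]
  have "centric R" unfolding centric_def
  proof (intro conjI allI impI Rs)
    fix f assume f: "FF R f"
    show "centralizer_in G T (f ` R) \<subseteq> f ` R" using T_good_centralizer_in_img[OF R f subset_refl c Rs(1)] c by blast
  qed
  thus False using assms(2) by blast
qed

end

section \<open>Automorphisms trivial on a self-centralizing subgroup, and p-elements of E\<close>

context fusion_pred
begin

lemma stable_restr:
  assumes "stable H V \<psi>" "R \<subseteq> V" "inj_on \<psi> V" shows "stable H R \<psi>"
  unfolding stable_def
proof (intro allI impI)
  fix Q f assume f: "H Q f" "Q \<subseteq> R" "f ` Q \<subseteq> R"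
  have 1: "H (\<psi> ` Q) (conj_fun V \<psi> f)" by (rule stableD[OF assms(1) f(1)]) (use f assms(2) in auto)
  have "conj_fun V \<psi> f y = conj_fun R \<psi> f y" if y: "y \<in> \<psi> ` Q" for y
  proof -
    obtain x where x: "x \<in> R" "x \<in> V" "y = \<psi> x" using y f(2) assms(2) by blast
    show ?thesis unfolding x(3)
      using conj_fun_apply[OF assms(3) x(2), of f] conj_fun_apply[OF inj_on_subset[OF assms(3,2)] x(1), of f] by simp
  qed
  thus "H (\<psi> ` Q) (conj_fun R \<psi> f)" by (rule H_cong[OF 1])
qed

text \<open>If x and its conjugate by n both lie in Q, they are fixed by \<gamma>; applying \<gamma>
  to the conjugation shows that n and \<gamma>(n) act alike on Q.\<close>

lemma fix_sub_centralizes: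
  assumes g: "H N \<gamma>" and fx: "\<And>x. x \<in> Q \<Longrightarrow> \<gamma> x = x" and Q: "subgroup Q G" "Q \<subseteq> N" "N \<subseteq> normalizer_in G T Q"
    and n: "n \<in> N"
  shows "inv n \<otimes> \<gamma> n \<in> centralizer_in G T Q"
proof -
  have NT: "N \<subseteq> T" by (rule H_subT[OF g])
  have nT: "n \<in> T" "\<gamma> n \<in> T" using n NT H_mem(3)[OF g n] by auto
  hence nG: "n \<in> carrier G" "\<gamma> n \<in> carrier G" using TG by auto
  have zT: "inv n \<otimes> \<gamma> n \<in> T" using nT T by (simp add: subgroup.m_closed subgroup.m_inv_closed)
  have QG: "Q \<subseteq> carrier G" using Q(1) by (rule subgroup.subset)
  have "conj_by G (inv n \<otimes> \<gamma> n) y = y" if y: "y \<in> Q" for y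
  proof -
    have "conj_by G n ` Q = Q" using Q(3) n unfolding normalizer_in_def by blast
    then obtain x where x: "x \<in> Q" "y = conj_by G n x" using y by blast
    have "conj_by G (inv n \<otimes> \<gamma> n) y = conj_by G (\<gamma> n) (conj_by G (inv n) y)"
      using nG y QG by (subst conj_by_conj_by) auto
    also have "\<dots> = conj_by G (\<gamma> n) (\<gamma> x)" using x nG QG fx[OF x(1)] by auto
    also have "\<dots> = \<gamma> (conj_by G n x)" using H_cjv[OF g n, of x] x(1) Q(2) by auto
    also have "\<dots> = y" using x(2) y fx by simp
    finally show ?thesis .
  qed
  thus ?thesis using centralizer_in_conj_by[OF T QG zT] by blast
qed

text \<open>The shift z = n^-1 \<gamma>(n) lies in Q and is fixed by \<gamma>, so \<gamma>^i(n) = n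
  z^i; the exponent p^k kills z.\<close>

lemma shift_funpow:
  assumes g: "H N \<gamma>" and Q: "subgroup Q G" "Q \<subseteq> N" and fx: "\<And>x. x \<in> Q \<Longrightarrow> \<gamma> x = x"
    and z: "\<And>n. n \<in> N \<Longrightarrow> inv n \<otimes> \<gamma> n \<in> Q"
    and k: "\<And>x. x \<in> carrier G \<Longrightarrow> x [^] (p ^ k :: nat) = \<one>" and n: "n \<in> N"
  shows "(\<gamma> ^^ (p ^ k)) n = n"
proof -
  let ?z = "inv n \<otimes> \<gamma> n"
  have nG: "n \<in> carrier G" "\<gamma> n \<in> carrier G" "?z \<in> carrier G" using H_mem(1,2)[OF g n] by auto
  have zi: "?z [^] (i::nat) \<in> Q" for i
    using z[OF n] Q(1) by (induction i) (auto simp: subgroup.one_closed subgroup.m_closed)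
  have "(\<gamma> ^^ i) n = n \<otimes> ?z [^] i" for i
  proof (induction i)
    case (Suc i)
    have "(\<gamma> ^^ Suc i) n = \<gamma> n \<otimes> \<gamma> (?z [^] i)"
      using Suc H_mult[OF g n] zi[of i] Q(2) by auto
    also have "\<dots> = n \<otimes> ?z \<otimes> ?z [^] i" using nG fx[OF zi] by simp
    also have "\<dots> = n \<otimes> ?z [^] Suc i" using nG by (simp only: m_assoc nat_pow_closed nat_pow_Suc2)
    finally show ?case .
  qed (use nG in simp)
  thus ?thesis using k[OF nG(3)] nG by simp
qed

lemma fix_sub_funpow:
  assumes g: "H N \<gamma>" and fx: "\<And>x. x \<in> Q \<Longrightarrow> \<gamma> x = x"
    and Q: "subgroup Q G" "Q \<subseteq> N" "N \<subseteq> normalizer_in G T Q" "centralizer_in G T Q \<subseteq> Q"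
  shows "\<exists>k. \<forall>x\<in>N. (\<gamma> ^^ (p ^ k)) x = x"
proof -
  obtain k where k: "\<And>x. x \<in> carrier G \<Longrightarrow> x [^] (p ^ k) = \<one>" using pow_p by blast
  have z: "inv n \<otimes> \<gamma> n \<in> Q" if "n \<in> N" for n
    using fix_sub_centralizes[OF g fx Q(1-3) that] Q(4) by blast
  have "(\<gamma> ^^ (p ^ k)) n = n" if "n \<in> N" for n by (rule shift_funpow[OF g Q(1,2) fx z k that])
  thus ?thesis by blast
qed

lemma funpow_cyclic:
  assumes g: "H N \<gamma>" "\<gamma> ` N = N" and k: "\<forall>x\<in>N. (\<gamma> ^^ (p ^ k)) x = x"
  obtains B where "subgroup B (BijGroup N)" "\<exists>n. card B = p ^ n" "B \<subseteq> Auts H N" "restrict \<gamma> N \<in> B"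
proof
  let ?B = "range (\<lambda>i::nat. restrict (\<gamma> ^^ i) N)"
  have st: "(\<gamma> ^^ i) x \<in> N" if "x \<in> N" for x i using H_funpow[OF g, of i] that by blast
  show sub: "?B \<subseteq> Auts H N"
  proof
    fix b assume "b \<in> ?B"
    then obtain i where i: "b = restrict (\<gamma> ^^ i) N" by blast
    show "b \<in> Auts H N" unfolding i using H_funpow[OF g, of i] by (intro AutsI) auto
  qed
  show B: "subgroup ?B (BijGroup N)"
  proof (rule BijGroup_subgroupI[OF H_fin[OF g(1)]])
    show "?B \<subseteq> Bij N" using sub Auts_Bij by blast
    have "restrict (\<gamma> ^^ 0) N = (\<lambda>x\<in>N. x)" by (rule restrict_ext) simp
    thus "(\<lambda>x\<in>N. x) \<in> ?B" by (metis rangeI)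
    fix a b assume "a \<in> ?B" "b \<in> ?B"
    then obtain i j where ij: "a = restrict (\<gamma> ^^ i) N" "b = restrict (\<gamma> ^^ j) N" by blast
    have "compose N a b = restrict (\<gamma> ^^ (i + j)) N"
      unfolding ij compose_def by (rule restrict_ext) (use st in \<open>auto simp: funpow_add\<close>)
    thus "compose N a b \<in> ?B" by blast
  qed
  have "restrict (\<gamma> ^^ 1) N \<in> ?B" by (rule rangeI)
  thus "restrict \<gamma> N \<in> ?B" by simp
  show "\<exists>n. card ?B = p ^ n"
  proof (rule p_power_card_if_funpow[OF p_prime H_fin[OF g(1)] B])
    fix b assume "b \<in> ?B"
    then obtain i where i: "b = restrict (\<gamma> ^^ i) N" by blast
    have "(b ^^ m) x = ((\<gamma> ^^ i) ^^ m) x \<and> (b ^^ m) x \<in> N" if "x \<in> N" for x m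
      using that by (induction m) (use i st in auto)
    moreover have "((\<gamma> ^^ i) ^^ (p ^ k)) x = x" if x: "x \<in> N" for x
    proof -
      have "((\<gamma> ^^ i) ^^ (p ^ k)) x = ((\<gamma> ^^ (p ^ k)) ^^ i) x" by (simp add: funpow_mult mult.commute)
      also have "\<dots> = x" using k x by (induction i) auto
      finally show ?thesis .
    qed
    ultimately show "\<exists>k. \<forall>x\<in>N. (b ^^ (p ^ k)) x = x" by metis
  qed
qed

end

context weakly_normal_pair
begin

text \<open>Because Aut_T(R) is Sylow in Aut_E(R) for good R, some c in E turns \<gamma> into
  conjugation by an element u of T. That conjugation lies in every fusion system on T, and stability
  of \<open>DP\<close> under E carries it back to \<gamma>.\<close>

lemma E_p_element:
  assumes DP: "fusion_pred p G T DP" and st: "\<And>R \<psi>. EE R \<psi> \<Longrightarrow> stable DP R \<psi>"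
    and g: "EE N \<gamma>" "\<gamma> ` N = N" "\<exists>k. \<forall>x\<in>N. (\<gamma> ^^ (p ^ k)) x = x"
  shows "DP N \<gamma>"
proof -
  interpret DP: fusion_pred p G T DP by (rule DP)
  obtain k where k: "\<forall>x\<in>N. (\<gamma> ^^ (p ^ k)) x = x" using g(3) by blast
  obtain B where B: "subgroup B (BijGroup N)" "\<exists>n. card B = p ^ n" "B \<subseteq> Auts EE N" "restrict \<gamma> N \<in> B"
    using E.funpow_cyclic[OF g(1,2) k] by blast
  obtain n where n: "card B = p ^ n" using B(2) by blast
  obtain f where f: "EE N f" "T_good (f ` N)" using T_good_exists[OF E.H_sub[OF g(1)] E.H_subT[OF g(1)]] by blast
  let ?R = "f ` N"
  have R: "subgroup ?R G" "?R \<subseteq> T" "sylow_in p (AutT G T ?R) (Auts EE ?R)"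
    using T_good_good[OF f(2)] unfolding good_def by auto
  obtain c where c: "EE N c" "c ` N = ?R" "\<And>b. b \<in> B \<Longrightarrow> \<exists>u\<in>normalizer_in G T ?R. \<forall>x\<in>N. c (b x) = conj_by G u (c x)"
    using E.sylow_conj_hom[OF R f(1) refl B(1) n B(3)] by blast
  obtain u where u: "u \<in> normalizer_in G T ?R" "\<forall>x\<in>N. c (restrict \<gamma> N x) = conj_by G u (c x)" using c(3)[OF B(4)] by blast
  note ci = EE_inv[OF c(1,2)]
  have cu: "DP ?R (conj_by G u)" by (rule DP.H_conj_by[OF R(1,2) F.normalizer_inD(1)[OF u(1)]])
  have "conj_by G u ` ?R = ?R" using u(1) unfolding normalizer_in_def by blast
  hence "DP (inv_into N c ` ?R) (conj_fun ?R (inv_into N c) (conj_by G u))"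
    by (intro DP.stableD[OF st[OF ci(1)] cu]) auto
  hence d: "DP N (conj_fun ?R (inv_into N c) (conj_by G u))" unfolding ci(2) .
  show ?thesis
  proof (rule DP.H_cong[OF d])
    fix x assume x: "x \<in> N"
    have cx: "c x \<in> ?R" using x c(2) by blast
    have gx: "\<gamma> x \<in> N" using g(2) x by blast
    have "conj_fun ?R (inv_into N c) (conj_by G u) (inv_into N c (c x)) = inv_into N c (conj_by G u (c x))"
      by (rule conj_fun_apply[OF E.H_inj[OF ci(1)] cx])
    also have "conj_by G u (c x) = c (\<gamma> x)" using u(2) x by simp
    finally show "conj_fun ?R (inv_into N c) (conj_by G u) x = \<gamma> x"
      using E.H_inv_l[OF c(1) x] E.H_inv_l[OF c(1) gx] by simp
  qed
qed

text \<open>Move f(Q) by \<eta> to a good subgroup of \<open>DP\<close> and extend \<eta> f from Q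
  to a map b on N inside \<open>DP\<close>. As b and \<eta> f agree on Q, they differ by an
  E-automorphism \<gamma> of N trivial on Q. It has p-power order because Q contains its
  centralizer, so it lies in \<open>DP\<close>, and f = \<eta>^-1 b \<gamma>^-1.\<close>

lemma E_star_step:
  assumes DP: "fusion_pred p G T DP" and st: "\<And>R \<psi>. EE R \<psi> \<Longrightarrow> stable DP R \<psi>"
    and sat: "fusion_pred.is_saturated p G T DP" and DE: "\<And>Q f. DP Q f \<Longrightarrow> EE Q f"
    and f: "EE N f" "centric Q" "Q \<subseteq> N" "N \<subseteq> normalizer_in G T Q" "DP Q f"
  shows "DP N f"
proof -
  interpret DP: fusion_pred p G T DP by (rule DP)
  note Qs = centric_sub[OF f(2)]
  have Ns: "subgroup N G" by (rule E.H_sub[OF f(1)])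
  let ?Q' = "f ` Q"
  have Q's: "subgroup ?Q' G" "?Q' \<subseteq> T" using DP.H_img[OF f(5)] DP.H_imgT[OF f(5)] by auto
  obtain \<eta>0 where e0: "DP ?Q' \<eta>0" "good p G T DP (\<eta>0 ` ?Q')" using DP.is_saturatedE[OF sat Q's] by blast
  let ?R = "\<eta>0 ` ?Q'"
  obtain \<eta> where e: "DP (normalizer_in G T ?Q') \<eta>" "\<eta> ` ?Q' = ?R" using DP.good_normalizer_in_ext[OF e0(2,1) refl] by blast
  have Rs: "subgroup ?R G" "?R \<subseteq> T" "is_receptive G T DP ?R" using e0(2) unfolding good_def by auto
  have eQ': "DP ?Q' \<eta>" by (rule DP.H_restr[OF e(1) Q's(1) E.sub_normalizer_in[OF Q's]])
  have ef: "DP Q (\<lambda>x. \<eta> (f x))" by (rule DP.H_comp[OF f(5) eQ']) simp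
  have efQ: "(\<lambda>x. \<eta> (f x)) ` Q = ?R" using e(2) by (simp add: image_image)
  have fn: "f n \<in> normalizer_in G T ?Q'" if "n \<in> N" for n
    using E.H_normalizer_in[OF f(1) that _ f(3)] f(4) that by blast
  have fN: "f ` N \<subseteq> normalizer_in G T ?Q'" using fn by blast
  have eN: "DP (f ` N) \<eta>" by (rule DP.H_restr[OF e(1) E.H_img[OF f(1)] fN])
  have efn: "\<eta> (f (conj_by G n x)) = conj_by G (\<eta> (f n)) (\<eta> (f x))" if "n \<in> N" "x \<in> N" for n x
    using E.H_cjv[OF f(1) that] DP.H_cjv[OF eN, of "f n" "f x"] that by simp
  obtain b where b: "DP N b" "\<And>x. x \<in> Q \<Longrightarrow> b x = \<eta> (f x)"
  proof (rule DP.is_receptiveD[OF Rs(3) ef efQ Ns f(3,4)])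
    fix n assume n: "n \<in> N"
    have "\<eta> (f n) \<in> normalizer_in G T ?R" using subsetD[OF DP.H_normalizer_in_img[OF e(1) Q's] imageI[OF fn[OF n]]] unfolding e(2) .
    thus "\<exists>u\<in>normalizer_in G T ?R. \<forall>x\<in>Q. \<eta> (f (conj_by G n x)) = conj_by G u (\<eta> (f x))"
      using efn[OF n] f(3) by blast
  qed blast
  have EEef: "EE N (\<lambda>x. \<eta> (f x))" by (rule EE_comp(1)[OF f(1) refl DE[OF eN]])
  have Rc: "centralizer_in G T ?R \<subseteq> ?R"
    using centricD[OF f(2) E_F[OF DE[OF ef]]] efQ by simp
  \<comment> \<open>The elements b(n) and \<eta>(f(n)) act alike on \<eta>(f(Q)), so their quotient
    centralizes this subgroup and hence lies in it. This is what makes \<gamma> a map of N to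
    itself.\<close>
  have bN: "b ` N \<subseteq> \<eta> ` f ` N"
  proof
    fix y assume "y \<in> b ` N"
    then obtain n where n: "n \<in> N" "y = b n" by blast
    have T2: "b n \<in> T" "\<eta> (f n) \<in> T" using DP.H_mem(3)[OF b(1) n(1)] E.H_mem(3)[OF EEef n(1)] by auto
    hence G2: "b n \<in> carrier G" "\<eta> (f n) \<in> carrier G" using E.TG by auto
    let ?c = "b n \<otimes> inv (\<eta> (f n))"
    have cT: "?c \<in> T" using T2 E.T by (simp add: subgroup.m_closed subgroup.m_inv_closed)
    have "conj_by G ?c y = y" if y: "y \<in> ?R" for y
    proof -
      obtain x where x: "x \<in> Q" "y = \<eta> (f x)" using y efQ by blast
      have xN: "x \<in> N" using x f(3) by blast
      have yG: "y \<in> carrier G" using y Rs(2) E.TG by blast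
      have "conj_by G n x \<in> Q" using F.normalizer_inD(2)[of n T Q x] n f(4) x by blast
      hence "conj_by G (b n) y = conj_by G (\<eta> (f n)) y"
        using DP.H_cjv[OF b(1) n(1) xN] efn[OF n(1) xN] b(2) x by simp
      thus ?thesis using F.conj_by_conj_by[of "b n" "inv (\<eta> (f n))" y] G2 yG by simp
    qed
    hence "?c \<in> centralizer_in G T ?R" using F.centralizer_in_conj_by[OF E.T _ cT, of ?R] Rs(2) E.T_sub by blast
    hence "?c \<in> ?R" using Rc by blast
    then obtain x where x: "x \<in> Q" "?c = \<eta> (f x)" using efQ by blast
    have xN: "x \<in> N" using x f(3) by blast
    have "y = ?c \<otimes> \<eta> (f n)" using n G2 by (simp add: F.m_assoc)
    also have "\<dots> = \<eta> (f (x \<otimes> n))" using x(2) E.H_mult[OF EEef xN n(1)] by simp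
    finally show "y \<in> \<eta> ` f ` N" using xN n(1) Ns by (simp add: subgroup.m_closed)
  qed
  let ?ei = "inv_into (f ` N) \<eta>"
  have ei: "DP (\<eta> ` f ` N) ?ei" by (rule DP.H_inv[OF eN])
  have eb: "DP N (\<lambda>x. ?ei (b x))" by (rule DP.H_comp[OF b(1) ei bN])
  have ebN: "(\<lambda>x. ?ei (b x)) ` N \<subseteq> f ` N" using bN DP.H_inv_img[OF eN] by (auto simp: image_subset_iff)
  note fi = EE_inv[OF f(1) refl]
  let ?\<gamma> = "\<lambda>x. inv_into N f (?ei (b x))"
  have g: "EE N ?\<gamma>" by (rule E.H_comp[OF DE[OF eb] fi(1) ebN])
  have gN: "?\<gamma> ` N = N"
    by (rule endo_inj_surj[OF E.H_fin[OF f(1)] _ E.H_inj[OF g]]) (use ebN fi(2) in blast)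
  have gQ: "?\<gamma> x = x" if "x \<in> Q" for x
    using b(2)[OF that] that f(3) DP.H_inv_l[OF eN, of "f x"] E.H_inv_l[OF f(1), of x] by auto
  have pw: "\<exists>k. \<forall>x\<in>N. (?\<gamma> ^^ (p ^ k)) x = x"
    by (rule E.fix_sub_funpow[OF g gQ Qs(1) f(3,4) centric_centralizer_in[OF f(2)]])
  have gD: "DP N ?\<gamma>" by (rule E_p_element[OF DP st g gN pw])
  have gi: "DP N (inv_into N ?\<gamma>)" "inv_into N ?\<gamma> ` N = N"
    using DP.H_inv[OF gD] DP.H_inv_img[OF gD] gN by auto
  have "DP N (\<lambda>x. ?ei (b (inv_into N ?\<gamma> x)))" by (rule DP.H_comp[OF gi(1) eb]) (simp add: gi(2))
  moreover have "?ei (b (inv_into N ?\<gamma> x)) = f x" if x: "x \<in> N" for x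
  proof -
    obtain n where n: "n \<in> N" "x = ?\<gamma> n" using x gN by blast
    have "inv_into N ?\<gamma> x = n" unfolding n(2) by (rule inv_into_f_f[OF E.H_inj[OF g] n(1)])
    moreover have "f (?\<gamma> n) = ?ei (b n)" using f_inv_into_f[of "?ei (b n)" f N] ebN n(1) by blast
    ultimately show ?thesis using n(2) by simp
  qed
  ultimately show ?thesis by (rule DP.H_cong)
qed

text \<open>Climb from Q through the normalizers inside N, which grow strictly and stay
  centric.\<close>

lemma E_star:
  assumes DP: "fusion_pred p G T DP" and st: "\<And>R \<psi>. EE R \<psi> \<Longrightarrow> stable DP R \<psi>"
    and sat: "fusion_pred.is_saturated p G T DP" and DE: "\<And>Q f. DP Q f \<Longrightarrow> EE Q f"
    and f: "EE N f" "centric Q" "Q \<subseteq> N" "DP Q f"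
  shows "DP N f"
  using f(2-4)
proof (induction "card N - card Q" arbitrary: Q rule: less_induct)
  case less
  have Ns: "subgroup N G" "N \<subseteq> T" using E.H_sub[OF f(1)] E.H_subT[OF f(1)] by auto
  note Qs = centric_sub[OF less.prems(1)]
  show ?case
  proof (cases "Q = N")
    case True thus ?thesis using less.prems by simp
  next
    case False
    hence g: "Q \<subset> normalizer_in G N Q" using F.normalizer_in_grows[OF Ns(1) Qs(1)] less.prems(2) by blast
    have n: "subgroup (normalizer_in G N Q) G" by (rule F.subgroup_normalizer_in[OF Ns(1) Qs(1)])
    have nN: "normalizer_in G N Q \<subseteq> N" using F.normalizer_inD(1) by blast
    have nT: "normalizer_in G N Q \<subseteq> normalizer_in G T Q" by (rule F.normalizer_in_mono[OF Ns(2)])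
    have Qn: "Q \<subseteq> normalizer_in G N Q" using g by blast
    have 1: "DP (normalizer_in G N Q) f"
      by (rule E_star_step[OF DP st sat DE E.H_restr[OF f(1) n nN] less.prems(1) Qn nT less.prems(3)])
    have c: "centric (normalizer_in G N Q)" by (rule centric_sup[OF less.prems(1) Qn n]) (use nN Ns in blast)
    have "card Q < card (normalizer_in G N Q)" "card (normalizer_in G N Q) \<le> card N"
      using psubset_card_mono[OF F.finite_subgroup[OF n] g] card_mono[OF F.finite_subgroup[OF Ns(1)] nN] by auto
    hence "card N - card (normalizer_in G N Q) < card N - card Q" by linarith
    from less.hyps[OF this c nN 1] show ?thesis .
  qed
qed

section \<open>The generated subsystem\<close>

text \<open>This turns out to be \<open>O\<^sup>p\<^sup>'(E)\<close>. The rule \<open>ext\<close> holds in every weakly normal subsystem of \<open>E\<close> on \<open>T\<close>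
  (\<open>E_star\<close>), and it is what makes the generated system saturated.\<close>

inductive OE :: "'a set \<Rightarrow> ('a \<Rightarrow> 'a) \<Rightarrow> bool" where
  gen: "\<lbrakk>centric U; T_good U; t \<in> normalizer_in G T U; EE U \<psi>; \<psi> ` U = U\<rbrakk> \<Longrightarrow> OE U (conj_fun U \<psi> (conj_by G t))"
| congr: "\<lbrakk>OE Q f; \<forall>x\<in>Q. f x = g x\<rbrakk> \<Longrightarrow> OE Q g"
| comp: "\<lbrakk>OE Q f; OE (f ` Q) g\<rbrakk> \<Longrightarrow> OE Q (\<lambda>x. g (f x))"
| restr: "\<lbrakk>OE Q f; subgroup Q' G; Q' \<subseteq> Q\<rbrakk> \<Longrightarrow> OE Q' f"
| inv: "OE Q f \<Longrightarrow> OE (f ` Q) (inv_into Q f)"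
| ext: "\<lbrakk>EE T \<alpha>; centric Q; OE Q \<alpha>\<rbrakk> \<Longrightarrow> OE T \<alpha>"

lemma gen_in:
  assumes DP: "fusion_pred p G T DP" and st: "EE U \<psi> \<Longrightarrow> stable DP U \<psi>"
    and U: "subgroup U G" "U \<subseteq> T" "t \<in> normalizer_in G T U" "EE U \<psi>" "\<psi> ` U = U"
  shows "DP U (conj_fun U \<psi> (conj_by G t))"
proof -
  interpret DP: fusion_pred p G T DP by (rule DP)
  have "DP U (conj_by G t)" by (rule DP.H_conj_by[OF U(1,2) F.normalizer_inD(1)[OF U(3)]])
  moreover have "conj_by G t ` U = U" using U(3) unfolding normalizer_in_def by blast
  ultimately have "DP (\<psi> ` U) (conj_fun U \<psi> (conj_by G t))"
    by (intro DP.stableD[OF st[OF U(4)]]) auto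
  thus ?thesis unfolding U(5) .
qed

lemma OE_EE: "OE Q f \<Longrightarrow> EE Q f"
proof (induction rule: OE.induct)
  case (gen U t \<psi>)
  show ?case
    by (rule gen_in[OF E.fusion_pred_axioms E.stable_H centric_sub[OF gen(1)] gen(3-5)])
next
  case (congr Q f g) thus ?case using E.H_cong[of Q f g] by blast
next
  case (comp Q f g) thus ?case using EE_comp(1)[OF _ refl] by blast
next
  case (restr Q f Q') thus ?case using E.H_restr by blast
next
  case (inv Q f) thus ?case using E.H_inv by blast
qed

lemma T_good_T: "T_good T"
proof -
  obtain f where f: "FF T f" "good p G (carrier G) FF (f ` T)"
    using F.is_saturatedE[OF F_sat E.T E.T_sub] by blast
  show ?thesis using F_good_T_good[of T] f(2) autT(1)[OF f(1)] by simp
qed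

text \<open>A restriction of the generator with U = T and \<psi> the identity.\<close>

lemma OE_conj_by: assumes "subgroup Q G" "Q \<subseteq> T" "t \<in> T" shows "OE Q (conj_by G t)"
proof -
  have t: "t \<in> normalizer_in G T T" using F.conj_by_image_subgroup[OF E.T assms(3)] assms(3) unfolding normalizer_in_def by blast
  have i: "EE T (\<lambda>x. x)" by (rule E.H_id[OF E.T subset_refl])
  have 1: "OE T (conj_fun T (\<lambda>x. x) (conj_by G t))" by (rule gen[OF centric_T T_good_T t i]) simp
  have e: "\<forall>x\<in>T. conj_fun T (\<lambda>x. x) (conj_by G t) x = conj_by G t x"
    using conj_fun_apply[of "\<lambda>x. x" T _ "conj_by G t"] by simp
  show ?thesis by (rule restr[OF congr[OF 1 e] assms(1,2)])
qed

sublocale OE: fusion_pred p G T OE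
proof (rule fusion_pred.intro, rule F.finite_p_group_axioms, rule fusion_pred_axioms.intro)
  show "subgroup T G" by (rule E.T)
  show "OE Q f \<Longrightarrow> subgroup Q G \<and> Q \<subseteq> T \<and> f ` Q \<subseteq> T \<and> inj_on f Q" for Q f
    using E.H_dom OE_EE by blast
  show "OE Q f \<Longrightarrow> x \<in> Q \<Longrightarrow> y \<in> Q \<Longrightarrow> f (x \<otimes> y) = f x \<otimes> f y" for Q f x y
    using E.H_mult OE_EE by blast
  show "OE Q f \<Longrightarrow> (\<And>x. x \<in> Q \<Longrightarrow> f x = g x) \<Longrightarrow> OE Q g" for Q f g
    using congr[of Q f g] by blast
  show "subgroup Q G \<Longrightarrow> Q \<subseteq> T \<Longrightarrow> t \<in> T \<Longrightarrow> OE Q (conj_by G t)" for Q t by (rule OE_conj_by)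
  show "OE Q f \<Longrightarrow> OE R g \<Longrightarrow> f ` Q \<subseteq> R \<Longrightarrow> OE Q (\<lambda>x. g (f x))" for Q f R g
    using comp[of Q f g] restr[of R g "f ` Q"] E.H_img[OF OE_EE, of Q f] by blast
  show "OE Q f \<Longrightarrow> OE (f ` Q) (inv_into Q f)" for Q f by (rule inv)
qed

lemma OE_FF: "OE Q f \<Longrightarrow> FF Q f"
  using OE_EE E_F by blast

lemma autT_memT: "FF T \<alpha> \<Longrightarrow> x \<in> T \<Longrightarrow> \<alpha> x \<in> T"
  using autT(1)[of \<alpha>] by blast

lemma autT_normalizer_in: assumes "FF T \<alpha>" "t \<in> normalizer_in G T U" "U \<subseteq> T" shows "\<alpha> t \<in> normalizer_in G T (\<alpha> ` U)"
proof -
  have t: "t \<in> T" "t \<in> normalizer_in G (carrier G) U" using assms(2) F.normalizer_inD(1) normalizer_in_T_carrier by blast+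
  have "\<alpha> t \<in> normalizer_in G (carrier G) (\<alpha> ` U)" by (rule F.H_normalizer_in[OF assms(1) t assms(3)])
  thus ?thesis using autT_memT[OF assms(1) t(1)] unfolding normalizer_in_def by blast
qed

text \<open>Each premise of each rule is invariant under Aut_F(T): centricity and
  \<open>T_good\<close> are defined through F, and E is stable.\<close>

lemma OE_autT_aux:
  assumes a: "FF T \<alpha>"
  shows "OE Q f \<Longrightarrow> OE (\<alpha> ` Q) (conj_fun T \<alpha> f)"
proof (induction rule: OE.induct)
  case (gen U t \<psi>)
  note Us = centric_sub[OF gen(1)]
  have inj: "inj_on \<alpha> T" by (rule F.H_inj[OF a])
  have aU: "FF U \<alpha>" by (rule F.H_restr[OF a Us])
  let ?U = "\<alpha> ` U" and ?\<psi> = "conj_fun T \<alpha> \<psi>"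
  have psi: "EE ?U ?\<psi>" by (rule stableT[OF E_stable[OF a subset_refl] gen(4)])
  have app: "?\<psi> (\<alpha> z) = \<alpha> (\<psi> z)" if "z \<in> U" for z using conj_fun_apply[OF inj, of z \<psi>] Us(2) that by blast
  have psiU: "?\<psi> ` ?U = ?U"
  proof -
    have "?\<psi> ` ?U = \<alpha> ` \<psi> ` U" unfolding image_image by (rule image_cong) (use app in auto)
    thus ?thesis using gen(5) by simp
  qed
  have g: "OE ?U (conj_fun ?U ?\<psi> (conj_by G (\<alpha> t)))"
    by (rule OE.gen[OF centric_img[OF gen(1) aU] T_good_autT[OF gen(2) a] autT_normalizer_in[OF a gen(3) Us(2)] psi psiU])
  show ?case
  proof (rule OE.congr[OF g], rule ballI)
    fix y assume "y \<in> ?U"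
    then obtain z where z: "z \<in> U" "y = \<alpha> (\<psi> z)"
      by (subst (asm) gen(5)[symmetric]) (auto simp: image_image)
    have tT: "t \<in> T" by (rule F.normalizer_inD(1)[OF gen(3)])
    have zT: "z \<in> T" "\<psi> z \<in> U" "\<psi> z \<in> T" using z Us(2) gen(5) by blast+
    have "conj_fun ?U ?\<psi> (conj_by G (\<alpha> t)) (?\<psi> (\<alpha> z)) = ?\<psi> (conj_by G (\<alpha> t) (\<alpha> z))"
      by (rule conj_fun_apply[OF E.H_inj[OF psi]]) (use z(1) in blast)
    also have "conj_by G (\<alpha> t) (\<alpha> z) = \<alpha> (conj_by G t z)" using F.H_cjv[OF a tT zT(1)] by simp
    also have "?\<psi> (\<alpha> (conj_by G t z)) = \<alpha> (\<psi> (conj_by G t z))" by (rule app) (rule F.normalizer_inD(2)[OF gen(3) z(1)])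
    also have "\<dots> = conj_fun T \<alpha> (conj_fun U \<psi> (conj_by G t)) (\<alpha> (\<psi> z))"
      using conj_fun_apply[OF inj zT(3), of "conj_fun U \<psi> (conj_by G t)"] conj_fun_apply[OF E.H_inj[OF gen(4)] z(1), of "conj_by G t"]
      by simp
    finally show "conj_fun ?U ?\<psi> (conj_by G (\<alpha> t)) y = conj_fun T \<alpha> (conj_fun U \<psi> (conj_by G t)) y"
      unfolding z(2) app[OF z(1)] .
  qed
next
  case (congr Q f g)
  show ?case
  proof (rule OE.congr[OF congr(3)], rule ballI)
    fix y assume "y \<in> \<alpha> ` Q"
    then obtain x where x: "x \<in> Q" "y = \<alpha> x" by blast
    have "x \<in> T" using x OE.H_subT[OF congr(1)] by blast
    thus "conj_fun T \<alpha> f y = conj_fun T \<alpha> g y"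
      using conj_fun_apply[OF F.H_inj[OF a]] x congr(2) by simp
  qed
next
  case (comp Q f g)
  have app: "conj_fun T \<alpha> h (\<alpha> x) = \<alpha> (h x)" if "x \<in> T" for x h
    using conj_fun_apply[OF F.H_inj[OF a] that] .
  have QT: "Q \<subseteq> T" "f ` Q \<subseteq> T" by (rule OE.H_subT[OF comp(1)], rule OE.H_imgT[OF comp(1)])
  have im: "conj_fun T \<alpha> f ` \<alpha> ` Q = \<alpha> ` f ` Q"
    unfolding image_image by (rule image_cong) (use app QT in auto)
  have 1: "OE (\<alpha> ` Q) (\<lambda>x. conj_fun T \<alpha> g (conj_fun T \<alpha> f x))"
    by (rule OE.comp[OF comp(3)]) (simp add: im comp(4))
  show ?case
  proof (rule OE.congr[OF 1], rule ballI)
    fix y assume "y \<in> \<alpha> ` Q"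
    then obtain x where x: "x \<in> Q" "y = \<alpha> x" by blast
    have "x \<in> T" "f x \<in> T" using x QT by blast+
    thus "conj_fun T \<alpha> g (conj_fun T \<alpha> f y) = conj_fun T \<alpha> (\<lambda>x. g (f x)) y" using app x by simp
  qed
next
  case (restr Q f Q')
  have "subgroup (\<alpha> ` Q') G"
    by (rule F.H_img_sub[OF a restr(2)]) (use restr(3) OE.H_subT[OF restr(1)] in blast)
  thus ?case by (rule OE.restr[OF restr(4)]) (use restr(3) in blast)
next
  case (inv Q f)
  have app: "conj_fun T \<alpha> h (\<alpha> x) = \<alpha> (h x)" if "x \<in> T" for x h
    using conj_fun_apply[OF F.H_inj[OF a] that] .
  have QT: "Q \<subseteq> T" "f ` Q \<subseteq> T" by (rule OE.H_subT[OF inv(1)], rule OE.H_imgT[OF inv(1)])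
  have im: "conj_fun T \<alpha> f ` \<alpha> ` Q = \<alpha> ` f ` Q"
    unfolding image_image by (rule image_cong) (use app QT in auto)
  have 1: "OE (\<alpha> ` f ` Q) (inv_into (\<alpha> ` Q) (conj_fun T \<alpha> f))" using OE.inv[OF inv(2)] unfolding im .
  show ?case
  proof (rule OE.congr[OF 1], rule ballI)
    fix y assume "y \<in> \<alpha> ` f ` Q"
    then obtain x where x: "x \<in> Q" "y = \<alpha> (f x)" by blast
    have xT: "x \<in> T" "f x \<in> T" using x QT by blast+
    have "inv_into (\<alpha> ` Q) (conj_fun T \<alpha> f) (conj_fun T \<alpha> f (\<alpha> x)) = \<alpha> x"
      by (rule OE.H_inv_l[OF inv(2)]) (use x in blast)
    thus "inv_into (\<alpha> ` Q) (conj_fun T \<alpha> f) y = conj_fun T \<alpha> (inv_into Q f) y"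
      using app xT x OE.H_inv_l[OF inv(1) x(1)] by simp
  qed
next
  case (ext \<beta> Q)
  have e: "EE (\<alpha> ` T) (conj_fun T \<alpha> \<beta>)" by (rule stableT[OF E_stable[OF a subset_refl] ext(1)])
  have c: "centric (\<alpha> ` Q)" by (rule centric_img[OF ext(2) F.H_restr[OF a centric_sub[OF ext(2)]]])
  show ?case using OE.ext[OF _ c ext(4)] e unfolding autT(1)[OF a] by blast
qed

lemma OE_autT: "FF T \<alpha> \<Longrightarrow> stable OE T \<alpha>"
  unfolding stable_def using OE_autT_aux by blast

text \<open>E now plays the part of the large system, in preparation for the second Frattini
  argument.\<close>

sublocale ED: closed_fusion_sub p G T EE T OE
  by unfold_locales (use OE_EE E.H_imgT in auto)

lemma prod_CT_conj_by: assumes "subgroup R G" "R \<subseteq> T" "g \<in> prod_CT R" shows "\<exists>a\<in>R. \<forall>x\<in>R. conj_by G g x = conj_by G a x"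
proof -
  obtain a c where ac: "a \<in> R" "c \<in> centralizer_in G T R" "g = a \<otimes> c" using assms(3) unfolding prod_CT_def set_mult_def by blast
  have G: "a \<in> carrier G" "c \<in> carrier G" using ac assms(2) E.TG F.centralizer_inD(1) by blast+
  have "conj_by G g x = conj_by G a x" if x: "x \<in> R" for x
  proof -
    have xG: "x \<in> carrier G" using x assms(2) E.TG by blast
    have "conj_by G a x \<in> R" by (rule F.conj_by_mem[OF assms(1) ac(1) x])
    hence "conj_by G c (conj_by G a x) = conj_by G a x"
      using ac(2) F.centralizer_in_conj_by[OF E.T _ F.centralizer_inD(1)[OF ac(2)], of R] assms(2) E.T_sub by blast
    thus ?thesis unfolding ac(3) using F.conj_by_conj_by[OF G xG] by simp
  qed
  thus ?thesis using ac(1) by blast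
qed

text \<open>S C_T(S) induces only inner automorphisms of S, and f turns these into inner
  automorphisms of R; so S C_T(S) lies in the extension domain of every such f.\<close>

lemma E_prod_CT_ext:
  assumes R: "T_good R" and f: "EE S f" "f ` S = R"
  obtains h where "EE (prod_CT S) h" "\<And>x. x \<in> S \<Longrightarrow> h x = f x"
proof -
  have Ss: "subgroup S G" "S \<subseteq> T" using E.H_sub[OF f(1)] E.H_subT[OF f(1)] by auto
  have rc: "is_receptive G T EE R" using T_good_good[OF R] unfolding good_def by blast
  note W = prod_CT_sub[OF Ss]
  show ?thesis
  proof (rule E.is_receptiveD[OF rc f W(1,2,5)])
    fix g assume g: "g \<in> prod_CT S"
    obtain a where a: "a \<in> S" "\<forall>x\<in>S. conj_by G g x = conj_by G a x" using prod_CT_conj_by[OF Ss g] by blast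
    have "f a \<in> normalizer_in G T R" using a(1) f(2) E.sub_normalizer_in[OF T_good_sub(2,1)[OF R]] by blast
    moreover have "\<forall>x\<in>S. f (conj_by G g x) = conj_by G (f a) (f x)" using a(2) E.H_cjv[OF f(1) a(1)] by simp
    ultimately show "\<exists>u\<in>normalizer_in G T R. \<forall>x\<in>S. f (conj_by G g x) = conj_by G u (f x)" by blast
  qed (use that in blast)
qed

text \<open>Aut_T(R) is Sylow in Aut_E(R), and Aut_OE(R) lies between the two.\<close>

lemma sylow_OE:
  assumes "T_good R" shows "sylow_in p (AutT G T R) (Auts OE R)"
proof -
  note Rs = T_good_sub(2,1)[OF assms]
  have s: "sylow_in p (AutT G T R) (Auts EE R)" using T_good_good[OF assms] unfolding good_def by blast
  have "Auts OE R \<subseteq> Auts EE R" unfolding Auts_def using OE_EE by blast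
  thus ?thesis
    by (rule sylow_in_between[OF F.p_prime F.finite_subgroup[OF Rs(1)] E.Auts_subgroup[OF Rs] OE.Auts_subgroup[OF Rs]
          E.AutT_subgroup(1)[OF Rs] s OE.AutT_sub_Auts[OF Rs]])
qed

text \<open>For noncentric R an automorphism extends to R C_T(R), which is larger than R, and k is
  the identity. For centric R the conjugate of Aut_T(R) under \<psi> consists of generators of
  \<open>OE\<close>, so Sylow's theorem inside Aut_OE(R) supplies k.\<close>

lemma E_frattini: assumes "EE Q f" shows "ED.factorizes Q f"
proof (rule ED.frattini[OF _ _ assms E.H_subT[OF assms]])
  show "\<And>\<alpha>. EE T \<alpha> \<Longrightarrow> stable OE T \<alpha>" using OE_autT E_F by blast
  fix Q assume Q: "subgroup Q G" "Q \<subset> T"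
  obtain f where f: "EE Q f" "T_good (f ` Q)" using T_good_exists[OF Q(1)] Q(2) by blast
  let ?R = "f ` Q"
  note Rs = T_good_sub[OF f(2)]
  have R: "good p G T EE ?R" by (rule T_good_good[OF f(2)])
  have ne: "?R \<noteq> T" using E.H_card[OF f(1)] psubset_card_mono[OF F.finite_subgroup[OF E.T] Q(2)] by auto
  have grow: "Q' \<subset> normalizer_in G T Q'" if "subgroup Q' G" "Q' \<subseteq> T" "Q' \<noteq> T" for Q'
    using F.normalizer_in_grows[OF E.T that(1)] that by blast
  show "\<exists>R. (\<exists>f. EE Q f \<and> f ` Q = R) \<and>
      (\<forall>Q' f. EE Q' f \<longrightarrow> Q' \<subseteq> T \<longrightarrow> f ` Q' = R \<longrightarrow> (\<exists>V h. Q' \<subset> V \<and> V \<subseteq> T \<and> EE V h \<and> h ` Q' = R)) \<and>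
      (\<forall>\<psi>. EE R \<psi> \<longrightarrow> \<psi> ` R = R \<longrightarrow> (\<exists>k V h. OE R k \<and> k ` R = R \<and> R \<subset> V \<and> V \<subseteq> T \<and> EE V h \<and> (\<forall>x\<in>R. k (\<psi> x) = h x)))"
  proof (rule exI[of _ ?R], intro conjI allI impI)
    show "\<exists>fa. EE Q fa \<and> fa ` Q = ?R" using f(1) by blast
    fix Q' f' assume f': "EE Q' f'" "Q' \<subseteq> T" "f' ` Q' = ?R"
    obtain h where h: "EE (normalizer_in G T Q') h" "h ` Q' = ?R" using E.good_normalizer_in_ext[OF R f'(1,3)] by blast
    have "Q' \<noteq> T" using ne autT(1)[OF E_F, of f'] f' by blast
    hence "Q' \<subset> normalizer_in G T Q' \<and> normalizer_in G T Q' \<subseteq> T \<and> EE (normalizer_in G T Q') h \<and> h ` Q' = ?R"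
      using h(1,2) E.nrmT[of Q'] grow[OF E.H_sub[OF f'(1)] f'(2)] by simp
    thus "\<exists>V h. Q' \<subset> V \<and> V \<subseteq> T \<and> EE V h \<and> h ` Q' = ?R" by - (rule exI, rule exI, assumption)
  next
    fix \<psi> assume psi: "EE ?R \<psi>" "\<psi> ` ?R = ?R"
    have fin: "\<exists>k V h. OE ?R k \<and> k ` ?R = ?R \<and> ?R \<subset> V \<and> V \<subseteq> T \<and> EE V h \<and> (\<forall>x\<in>?R. k (\<psi> x) = h x)"
      if "OE ?R k" "k ` ?R = ?R" "?R \<subset> V" "V \<subseteq> T" "EE V h" "\<And>x. x \<in> ?R \<Longrightarrow> h x = k (\<psi> x)" for k V h
      using that by (intro exI[of _ k] exI[of _ V] exI[of _ h]) auto
    show "\<exists>k V h. OE ?R k \<and> k ` ?R = ?R \<and> ?R \<subset> V \<and> V \<subseteq> T \<and> EE V h \<and> (\<forall>x\<in>?R. k (\<psi> x) = h x)"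
    proof (cases "centric ?R")
      case False
      obtain h where h: "EE (prod_CT ?R) h" "\<And>x. x \<in> ?R \<Longrightarrow> h x = \<psi> x" using E_prod_CT_ext[OF f(2) psi] by blast
      note W = prod_CT_sub[OF Rs(2,1)]
      have "?R \<subset> prod_CT ?R" using W T_good_noncentric[OF f(2) False] by blast
      from fin[OF OE.H_id[OF Rs(2,1)] _ this W(4) h] show ?thesis by simp
    next
      case True
      have bij: "bij_betw \<psi> ?R ?R" using psi E.H_inj unfolding bij_betw_def by blast
      obtain kk where kk: "card (AutT G T ?R) = p ^ kk" using E.AutT_subgroup(2)[OF Rs(2,1)] by blast
      have BA: "(\<lambda>y\<in>?R. \<psi> (b (inv_into ?R \<psi> y))) \<in> Auts OE ?R" if b: "b \<in> AutT G T ?R" for b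
      proof -
        obtain t where t: "t \<in> normalizer_in G T ?R" "b = restrict (conj_by G t) ?R" using b unfolding AutT_def by blast
        have g: "OE ?R (conj_fun ?R \<psi> (conj_by G t))" by (rule gen[OF True f(2) t(1) psi])
        have eq: "\<psi> (b (inv_into ?R \<psi> y)) = conj_fun ?R \<psi> (conj_by G t) y" if "y \<in> ?R" for y
          using inv_into_into[of y \<psi> ?R] that psi(2) unfolding t(2) conj_fun_def by simp
        have "conj_by G t ` ?R = ?R" using t(1) unfolding normalizer_in_def by blast
        hence "conj_fun ?R \<psi> (conj_by G t) ` ?R = ?R"
          unfolding conj_fun_def using psi(2) EE_inv(2)[OF psi] by (metis image_image)
        from OE.AutsI[OF g this] have "restrict (conj_fun ?R \<psi> (conj_by G t)) ?R \<in> Auts OE ?R" .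
        moreover have "restrict (conj_fun ?R \<psi> (conj_by G t)) ?R = (\<lambda>y\<in>?R. \<psi> (b (inv_into ?R \<psi> y)))"
          by (rule restrict_ext) (use eq in simp)
        ultimately show ?thesis by simp
      qed
      obtain k where k: "k \<in> Auts OE ?R"
        "\<And>b. b \<in> AutT G T ?R \<Longrightarrow> \<exists>u\<in>normalizer_in G T ?R. \<forall>x\<in>?R. k (\<psi> (b x)) = conj_by G u (k (\<psi> x))"
        using E.conj_into_sylow[OF Rs(2,1) OE.Auts_subgroup[OF Rs(2,1)] sylow_OE[OF f(2)] bij F.finite_subgroup[OF Rs(2)]
            E.AutT_subgroup(1)[OF Rs(2,1)] kk BA] by blast
      have kp: "EE ?R (\<lambda>x. k (\<psi> x))" "(\<lambda>x. k (\<psi> x)) ` ?R = ?R"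
        using EE_comp[OF psi OE_EE[OF OE.AutsD(1)[OF k(1)]]] OE.AutsD(2)[OF k(1)] by auto
      have rc: "is_receptive G T EE ?R" using R unfolding good_def by blast
      obtain h where h: "EE (normalizer_in G T ?R) h" "\<And>x. x \<in> ?R \<Longrightarrow> h x = k (\<psi> x)"
      proof (rule E.is_receptiveD[OF rc kp E.normalizer_in_sub[OF Rs(2)] E.sub_normalizer_in[OF Rs(2,1)] subset_refl])
        fix g assume g: "g \<in> normalizer_in G T ?R"
        have "restrict (conj_by G g) ?R \<in> AutT G T ?R" using g unfolding AutT_def by blast
        from k(2)[OF this] show "\<exists>u\<in>normalizer_in G T ?R. \<forall>x\<in>?R. k (\<psi> (conj_by G g x)) = conj_by G u (k (\<psi> x))" by simp
      qed blast
      show ?thesis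
        by (rule fin[OF OE.AutsD[OF k(1)] grow[OF Rs(2,1) ne] E.nrmT h])
    qed
  qed
qed

lemma E_autT_stable: "EE T \<alpha> \<Longrightarrow> stable OE T \<alpha>"
  using OE_autT E_F by blast

lemma E_swap:
  assumes "EE Q f"
  obtains \<alpha> d where "EE T \<alpha>" "OE Q d" "\<And>x. x \<in> Q \<Longrightarrow> f x = \<alpha> (d x)"
  using ED.factorizes_swap[OF _ E_frattini[OF assms] E.H_subT[OF assms]] E_autT_stable by blast

text \<open>Write \<psi> = e \<alpha>: here \<alpha> stabilizes \<open>OE\<close> as an automorphism
  of T, and e does so as a morphism of \<open>OE\<close>.\<close>

lemma OE_E_stable: assumes "EE R \<psi>" shows "stable OE R \<psi>"
proof -
  obtain \<alpha> e where a: "EE T \<alpha>" "OE (\<alpha> ` R) e" "\<And>x. x \<in> R \<Longrightarrow> \<psi> x = e (\<alpha> x)"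
    using ED.factorizesE[OF E_frattini[OF assms]] by blast
  have RT: "R \<subseteq> T" by (rule E.H_subT[OF assms])
  have inj: "inj_on \<alpha> R" by (rule inj_on_subset[OF E.H_inj[OF a(1)] RT])
  have s1: "stable OE R \<alpha>" by (rule OE.stable_restr[OF E_autT_stable[OF a(1)] RT E.H_inj[OF a(1)]])
  have s2: "stable OE R (\<lambda>x. e (\<alpha> x))"
    by (rule OE.stable_comp[OF s1 OE.stable_H[OF a(2)] subset_refl inj OE.H_inj[OF a(2)]])
  have "inj_on (\<lambda>x. e (\<alpha> x)) R" using comp_inj_on[OF inj OE.H_inj[OF a(2)]] by (simp add: comp_def)
  thus ?thesis using OE.stable_cong[OF s2, of \<psi>] a(3) by simp
qed

lemma OE_F_stable: assumes "FF R \<psi>" "R \<subseteq> T" shows "stable OE R \<psi>"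
proof -
  obtain \<alpha> e where a: "FF T \<alpha>" "EE (\<alpha> ` R) e" "\<And>x. x \<in> R \<Longrightarrow> \<psi> x = e (\<alpha> x)"
    using factorizesE[OF F_frattini[OF assms]] by blast
  have inj: "inj_on \<alpha> R" by (rule inj_on_subset[OF F.H_inj[OF a(1)] assms(2)])
  have s1: "stable OE R \<alpha>" by (rule OE.stable_restr[OF OE_autT[OF a(1)] assms(2) F.H_inj[OF a(1)]])
  have s2: "stable OE R (\<lambda>x. e (\<alpha> x))"
    by (rule OE.stable_comp[OF s1 OE_E_stable[OF a(2)] subset_refl inj E.H_inj[OF a(2)]])
  have "inj_on (\<lambda>x. e (\<alpha> x)) R" using comp_inj_on[OF inj E.H_inj[OF a(2)]] by (simp add: comp_def)
  thus ?thesis using OE.stable_cong[OF s2, of \<psi>] a(3) by simp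
qed

text \<open>The conclusion of \<open>E_star\<close> for \<open>OE\<close>, obtained before
  saturation is known: writing f = e \<alpha> with e in \<open>OE\<close>, the factor \<alpha> is in
  \<open>OE\<close> on Q, and the rule \<open>ext\<close> puts it in \<open>OE\<close> on T.\<close>

lemma OE_star: assumes f: "EE N f" "centric Q" "Q \<subseteq> N" "OE Q f" shows "OE N f"
proof -
  obtain \<alpha> e where a: "EE T \<alpha>" "OE (\<alpha> ` N) e" "\<And>x. x \<in> N \<Longrightarrow> f x = e (\<alpha> x)"
    using ED.factorizesE[OF E_frattini[OF f(1)]] by blast
  have N: "subgroup N G" "N \<subseteq> T" using E.H_sub[OF f(1)] E.H_subT[OF f(1)] by auto
  note Qs = centric_sub[OF f(2)]
  have im: "f ` Q = e ` \<alpha> ` Q" unfolding image_image by (rule image_cong) (use a(3) f(3) in auto)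
  have eQ: "OE (\<alpha> ` Q) e" by (rule OE.H_restr[OF a(2) E.H_img_sub[OF a(1) Qs]]) (use f(3) in blast)
  have "OE Q (\<lambda>x. inv_into (\<alpha> ` Q) e (f x))"
    by (rule OE.comp[OF f(4)]) (simp add: im OE.inv[OF eQ])
  hence "OE Q \<alpha>"
  proof (rule OE.H_cong)
    fix x assume x: "x \<in> Q"
    have "f x = e (\<alpha> x)" using a(3) x f(3) by blast
    thus "inv_into (\<alpha> ` Q) e (f x) = \<alpha> x" using OE.H_inv_l[OF eQ, of "\<alpha> x"] x by simp
  qed
  hence "OE T \<alpha>" by (rule ext[OF a(1) f(2)])
  hence "OE N \<alpha>" by (rule OE.H_restr[OF _ N])
  hence "OE N (\<lambda>x. e (\<alpha> x))" by (rule OE.comp) (rule a(2))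
  thus ?thesis by (rule OE.H_cong) (use a(3) in simp)
qed

text \<open>Generators are conjugates of maps induced by T and come from stability; the rule
  \<open>ext\<close> is an instance of \<open>E_star\<close>.\<close>

lemma OE_least:
  assumes DP: "fusion_pred p G T DP" and st: "\<And>R \<psi>. EE R \<psi> \<Longrightarrow> stable DP R \<psi>"
    and sat: "fusion_pred.is_saturated p G T DP" and DE: "\<And>Q f. DP Q f \<Longrightarrow> EE Q f"
  shows "OE Q f \<Longrightarrow> DP Q f"
proof (induction rule: OE.induct)
  case (gen U t \<psi>)
  show ?case by (rule gen_in[OF DP st centric_sub[OF gen(1)] gen(3-5)])
next
  case (congr Q f g) thus ?case using fusion_pred.H_cong[OF DP, of Q f g] by blast
next
  case (comp Q f g) thus ?case using fusion_pred.H_comp[OF DP, of Q f "f ` Q" g] by blast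
next
  case (restr Q f Q') thus ?case using fusion_pred.H_restr[OF DP, of Q f Q'] by blast
next
  case (inv Q f) thus ?case using fusion_pred.H_inv[OF DP, of Q f] by blast
next
  case (ext \<alpha> Q)
  show ?case by (rule E_star[OF DP st sat DE ext(1,2) centric_sub(2)[OF ext(2)] ext(4)])
qed

end

section \<open>Saturation of the generated subsystem\<close>

context group
begin

lemma conj_by_conj_by_hom: "a \<in> carrier G \<Longrightarrow> v \<in> carrier G \<Longrightarrow> x \<in> carrier G \<Longrightarrow>
    conj_by G a (conj_by G v x) = conj_by G (conj_by G a v) (conj_by G a x)"
  unfolding conj_by_def by (simp add: m_assoc inv_mult_group)

end

context fusion_pred
begin

text \<open>The group N_\<psi> of the receptivity condition in a form free of the inverse of \<psi>;
  it is later identified with \<open>extension_domain\<close>.\<close>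

definition ext_dom :: "'a set \<Rightarrow> 'a set \<Rightarrow> ('a \<Rightarrow> 'a) \<Rightarrow> 'a set" where
  "ext_dom R R' \<psi> = {g \<in> normalizer_in G T R. \<exists>u\<in>normalizer_in G T R'. \<forall>x\<in>R. \<psi> (conj_by G g x) = conj_by G u (\<psi> x)}"

lemma ext_dom_normalizer_in: "ext_dom R R' \<psi> \<subseteq> normalizer_in G T R"
  unfolding ext_dom_def by blast

lemma ext_domD: assumes "g \<in> ext_dom R R' \<psi>" obtains u where "u \<in> normalizer_in G T R'" "\<And>x. x \<in> R \<Longrightarrow> \<psi> (conj_by G g x) = conj_by G u (\<psi> x)"
  using assms unfolding ext_dom_def by blast

lemma ext_dom_subgroup:
  assumes f: "H R \<psi>" "\<psi> ` R = R'" shows "subgroup (ext_dom R R' \<psi>) G" "R \<subseteq> ext_dom R R' \<psi>"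
proof -
  have R: "subgroup R G" "R \<subseteq> T" using H_sub[OF f(1)] H_subT[OF f(1)] by auto
  have R': "subgroup R' G" "R' \<subseteq> T" using H_img[OF f(1)] H_imgT[OF f(1)] f(2) by auto
  have nG: "\<And>g. g \<in> normalizer_in G T R' \<Longrightarrow> g \<in> carrier G" "\<And>g. g \<in> normalizer_in G T R \<Longrightarrow> g \<in> carrier G" using nrmT TG by blast+
  show RN: "R \<subseteq> ext_dom R R' \<psi>"
  proof
    fix g assume g: "g \<in> R"
    have "\<psi> g \<in> normalizer_in G T R'" using g f(2) sub_normalizer_in[OF R'] by blast
    moreover have "\<forall>x\<in>R. \<psi> (conj_by G g x) = conj_by G (\<psi> g) (\<psi> x)" using H_cjv[OF f(1) g] by blast
    ultimately show "g \<in> ext_dom R R' \<psi>" unfolding ext_dom_def using g sub_normalizer_in[OF R] by blast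
  qed
  show "subgroup (ext_dom R R' \<psi>) G"
  proof (rule subgroupI)
    show "ext_dom R R' \<psi> \<subseteq> carrier G" using ext_dom_normalizer_in nG by blast
    show "ext_dom R R' \<psi> \<noteq> {}" using RN subgroup.one_closed[OF R(1)] by blast
    fix g assume g: "g \<in> ext_dom R R' \<psi>"
    obtain u where u: "u \<in> normalizer_in G T R'" "\<And>x. x \<in> R \<Longrightarrow> \<psi> (conj_by G g x) = conj_by G u (\<psi> x)" by (rule ext_domD[OF g]) (rule that)
    have gn: "g \<in> normalizer_in G T R" using g ext_dom_normalizer_in by blast
    have i: "inv g \<in> normalizer_in G T R" "inv u \<in> normalizer_in G T R'"
      using gn u(1) normalizer_in_sub R(1) R'(1) subgroup.m_inv_closed by metis+
    have "\<psi> (conj_by G (inv g) x) = conj_by G (inv u) (\<psi> x)" if x: "x \<in> R" for x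
    proof -
      have z: "conj_by G (inv g) x \<in> R" using normalizer_inD(2)[OF i(1) x] .
      have "\<psi> x = conj_by G u (\<psi> (conj_by G (inv g) x))"
        using u(2)[OF z] nG(2)[OF gn] H_mem(1)[OF f(1) x] by simp
      thus ?thesis using nG(1)[OF u(1)] H_mem(2)[OF f(1) z] by simp
    qed
    thus "inv g \<in> ext_dom R R' \<psi>" unfolding ext_dom_def using i by blast
    fix h assume h: "h \<in> ext_dom R R' \<psi>"
    obtain v where v: "v \<in> normalizer_in G T R'" "\<And>x. x \<in> R \<Longrightarrow> \<psi> (conj_by G h x) = conj_by G v (\<psi> x)" by (rule ext_domD[OF h]) (rule that)
    have hn: "h \<in> normalizer_in G T R" using h ext_dom_normalizer_in by blast
    have m: "g \<otimes> h \<in> normalizer_in G T R" "u \<otimes> v \<in> normalizer_in G T R'"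
      using subgroup.m_closed[OF normalizer_in_sub[OF R(1)] gn hn] subgroup.m_closed[OF normalizer_in_sub[OF R'(1)] u(1) v(1)] by auto
    have "\<psi> (conj_by G (g \<otimes> h) x) = conj_by G (u \<otimes> v) (\<psi> x)" if x: "x \<in> R" for x
    proof -
      have "\<psi> (conj_by G (g \<otimes> h) x) = \<psi> (conj_by G h (conj_by G g x))"
        using conj_by_conj_by[OF nG(2)[OF gn] nG(2)[OF hn] H_mem(1)[OF f(1) x]] by simp
      also have "\<dots> = conj_by G v (conj_by G u (\<psi> x))" using v(2)[OF normalizer_inD(2)[OF gn x]] u(2)[OF x] by simp
      also have "\<dots> = conj_by G (u \<otimes> v) (\<psi> x)" by (rule conj_by_conj_by[OF nG(1)[OF u(1)] nG(1)[OF v(1)] H_mem(2)[OF f(1) x]])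
      finally show ?thesis .
    qed
    thus "g \<otimes> h \<in> ext_dom R R' \<psi>" unfolding ext_dom_def using m by blast
  qed
qed

lemma is_receptive_ext_dom:
  assumes "is_receptive G T H R" "H S f" "f ` S = R" "subgroup V G" "S \<subseteq> V" "V \<subseteq> ext_dom S R f"
  obtains h where "H V h" "\<And>x. x \<in> S \<Longrightarrow> h x = f x"
proof (rule is_receptiveD[OF assms(1-5)])
  show "V \<subseteq> normalizer_in G T S" using assms(6) ext_dom_normalizer_in by blast
  fix g assume "g \<in> V"
  hence "g \<in> ext_dom S R f" using assms(6) by blast
  thus "\<exists>u\<in>normalizer_in G T R. \<forall>x\<in>S. f (conj_by G g x) = conj_by G u (f x)" unfolding ext_dom_def by blast
qed (use that in blast)

lemma is_receptiveI:
  assumes "\<And>S f V. H S f \<Longrightarrow> f ` S = R \<Longrightarrow> subgroup V G \<Longrightarrow> S \<subseteq> V \<Longrightarrow> V \<subseteq> ext_dom S R f \<Longrightarrow>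
    \<exists>h. H V h \<and> (\<forall>x\<in>S. h x = f x)"
  shows "is_receptive G T H R"
  unfolding is_receptive_def
proof (intro allI impI, elim conjE)
  fix S f V assume a: "H S f" "f ` S = R" "subgroup V G" "S \<subseteq> V" "V \<subseteq> normalizer_in G T S"
    "\<forall>g\<in>V. \<exists>u\<in>normalizer_in G T R. \<forall>x\<in>S. f (conj_by G g x) = conj_by G u (f x)"
  have "V \<subseteq> ext_dom S R f" using a(5,6) unfolding ext_dom_def by blast
  thus "\<exists>h. H V h \<and> (\<forall>x\<in>S. h x = f x)" using assms[OF a(1-4)] by blast
qed

lemma is_receptive_mult:
  assumes R: "is_receptive G T H R" and f: "H S f" "f ` S = R" and C: "subgroup C G" "C \<subseteq> ext_dom S R f"
  obtains h where "H (C <#> S) h" "\<And>x. x \<in> S \<Longrightarrow> h x = f x"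
proof -
  have Ss: "subgroup S G" by (rule H_sub[OF f(1)])
  have s: "subgroup (C <#> S) G"
    by (rule subgroup_set_mult[OF C(1) Ss]) (use C(2) ext_dom_normalizer_in normalizer_inD(2) in blast)
  have l: "C <#> S \<subseteq> ext_dom S R f" by (rule set_mult_least[OF ext_dom_subgroup(1)[OF f] C(2) ext_dom_subgroup(2)[OF f]])
  show ?thesis by (rule is_receptive_ext_dom[OF R f s set_mult_sup(2)[OF C(1) Ss] l]) (rule that)
qed

end

section \<open>Receptivity at centric subgroups, and extension beyond R C_T(R)\<close>

context weakly_normal_pair
begin

text \<open>Map N_T(S) by E so that S lands in \<open>T_good\<close>, then strip off the factor in
  Aut_E(T); \<open>T_good\<close> is closed under Aut_F(T), so the remaining
  \<open>OE\<close>-morphism still has a \<open>T_good\<close> image.\<close>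

lemma OE_normalizer_in_to_T_good:
  assumes "subgroup S G" "S \<subseteq> T"
  obtains \<eta> where "OE (normalizer_in G T S) \<eta>" "T_good (\<eta> ` S)"
proof -
  obtain f where f: "EE S f" "T_good (f ` S)" by (rule T_good_exists[OF assms])
  obtain h where h: "EE (normalizer_in G T S) h" "h ` S = f ` S" by (rule E.good_normalizer_in_ext[OF T_good_good[OF f(2)] f(1) refl])
  obtain \<alpha> d where d: "EE T \<alpha>" "OE (normalizer_in G T S) d" "\<And>x. x \<in> normalizer_in G T S \<Longrightarrow> h x = \<alpha> (d x)" by (rule E_swap[OF h(1)]) blast
  have dT: "d ` S \<subseteq> T" using OE.H_imgT[OF d(2)] E.sub_normalizer_in[OF assms] by blast
  have "h ` S = \<alpha> ` d ` S" unfolding image_image by (rule image_cong) (use d(3) E.sub_normalizer_in[OF assms] in auto)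
  hence "T_good (inv_into T \<alpha> ` \<alpha> ` d ` S)" using T_good_autT[OF f(2) autT(2)[OF E_F[OF d(1)]]] h(2) by simp
  hence "T_good (d ` S)" using inv_into_image_cancel[OF E.H_inj[OF d(1)] dT] by simp
  thus ?thesis using that d(2) by blast
qed

lemma T_good_exists_OE:
  assumes "subgroup S G" "S \<subseteq> T"
  obtains f where "OE S f" "T_good (f ` S)"
proof -
  obtain f where f: "OE (normalizer_in G T S) f" "T_good (f ` S)" by (rule OE_normalizer_in_to_T_good[OF assms])
  show ?thesis by (rule that[OF OE.H_restr[OF f(1) assms(1) E.sub_normalizer_in[OF assms]] f(2)])
qed

text \<open>E provides an extension, and it lies in \<open>OE\<close> because it does so on the
  centric subgroup S.\<close>

lemma is_receptive_centric:
  assumes R: "T_good R" "centric R" shows "is_receptive G T OE R"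
proof (rule OE.is_receptiveI)
  fix S f V assume f: "OE S f" "f ` S = R" and V: "subgroup V G" "S \<subseteq> V" "V \<subseteq> OE.ext_dom S R f"
  have rc: "is_receptive G T EE R" using T_good_good[OF R(1)] unfolding good_def by blast
  obtain h where h: "EE V h" "\<And>x. x \<in> S \<Longrightarrow> h x = f x"
    by (rule E.is_receptive_ext_dom[OF rc OE_EE[OF f(1)] f(2) V]) blast
  have c: "centric S" using centric_img[OF R(2)] FF_inv[OF OE_FF[OF f(1)] f(2)] by metis
  have "OE S h" by (rule OE.H_cong[OF f(1)]) (use h(2) in simp)
  hence "OE V h" by (rule OE_star[OF h(1) c V(2)])
  thus "\<exists>h. OE V h \<and> (\<forall>x\<in>S. h x = f x)" using h(2) by blast
qed

text \<open>An intermediate goal for noncentric subgroups: extension over the centralizer. With both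
  ends \<open>T_good\<close> the extension maps R C_T(R) onto R' C_T(R'), so the relation can be
  composed and inverted.\<close>

definition extends_to_prod_CT :: "'a set \<Rightarrow> 'a set \<Rightarrow> ('a \<Rightarrow> 'a) \<Rightarrow> bool" where
  "extends_to_prod_CT R R' \<psi> \<longleftrightarrow> T_good R \<and> T_good R' \<and> \<psi> ` R = R' \<and> (\<exists>h. OE (prod_CT R) h \<and> (\<forall>x\<in>R. h x = \<psi> x))"

lemma extends_to_prod_CTE:
  assumes "extends_to_prod_CT R R' \<psi>"
  obtains h where "OE (prod_CT R) h" "\<And>x. x \<in> R \<Longrightarrow> h x = \<psi> x" "h ` R = R'" "h ` prod_CT R = prod_CT R'" "T_good R" "T_good R'"
proof -
  have R: "T_good R" "T_good R'" "\<psi> ` R = R'" using assms unfolding extends_to_prod_CT_def by auto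
  obtain h where h: "OE (prod_CT R) h" "\<And>x. x \<in> R \<Longrightarrow> h x = \<psi> x" using assms unfolding extends_to_prod_CT_def by blast
  have hR: "h ` R = R'" using h(2) R(3) by (metis image_cong)
  note W = prod_CT_sub[OF T_good_sub(2,1)[OF R(1)]]
  have hC: "h ` centralizer_in G T R = centralizer_in G T R'" using T_good_centralizer_in_img[OF R(1) OE_FF[OF h(1)] W(2-4)] hR by simp
  have "h ` (R <#> centralizer_in G T R) = (h ` R) <#> (h ` centralizer_in G T R)"
  proof -
    have m: "h (a \<otimes> c) = h a \<otimes> h c" if "a \<in> R" "c \<in> centralizer_in G T R" for a c
      using OE.H_mult[OF h(1), of a c] that W(2,3) by blast
    show ?thesis
    proof (rule Set.set_eqI)
      fix y
      have "y \<in> h ` (R <#> centralizer_in G T R) \<longleftrightarrow> (\<exists>a\<in>R. \<exists>c\<in>centralizer_in G T R. y = h (a \<otimes> c))" unfolding set_mult_def by blast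
      also have "\<dots> \<longleftrightarrow> (\<exists>a\<in>R. \<exists>c\<in>centralizer_in G T R. y = h a \<otimes> h c)" using m by auto
      also have "\<dots> \<longleftrightarrow> y \<in> (h ` R) <#> (h ` centralizer_in G T R)" unfolding set_mult_def by blast
      finally show "y \<in> h ` (R <#> centralizer_in G T R) \<longleftrightarrow> y \<in> (h ` R) <#> (h ` centralizer_in G T R)" .
    qed
  qed
  hence "h ` prod_CT R = prod_CT R'" unfolding prod_CT_def hR hC .
  thus ?thesis using that h hR R by blast
qed

lemma extends_to_prod_CT_cong: "extends_to_prod_CT R R' \<psi> \<Longrightarrow> (\<And>x. x \<in> R \<Longrightarrow> \<psi> x = \<chi> x) \<Longrightarrow> extends_to_prod_CT R R' \<chi>"
  unfolding extends_to_prod_CT_def by (metis image_cong)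

lemma extends_to_prod_CT_comp:
  assumes "extends_to_prod_CT R R' \<psi>" "extends_to_prod_CT R' R'' \<chi>" shows "extends_to_prod_CT R R'' (\<lambda>x. \<chi> (\<psi> x))"
proof -
  obtain h where h: "OE (prod_CT R) h" "\<And>x. x \<in> R \<Longrightarrow> h x = \<psi> x" "h ` R = R'" "h ` prod_CT R = prod_CT R'" "T_good R" "T_good R'"
    by (rule extends_to_prod_CTE[OF assms(1)]) (rule that)
  obtain k where k: "OE (prod_CT R') k" "\<And>x. x \<in> R' \<Longrightarrow> k x = \<chi> x" "k ` R' = R''" "k ` prod_CT R' = prod_CT R''" "T_good R'" "T_good R''"
    by (rule extends_to_prod_CTE[OF assms(2)]) (rule that)
  have 1: "OE (prod_CT R) (\<lambda>x. k (h x))" by (rule OE.comp[OF h(1)]) (simp add: h(4) k(1))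
  have 2: "k (h x) = \<chi> (\<psi> x)" if "x \<in> R" for x using h(2,3) k(2) that by (metis imageI)
  have "(\<lambda>x. \<chi> (\<psi> x)) ` R = (\<lambda>x. k (h x)) ` R" by (rule image_cong) (use 2 in auto)
  also have "\<dots> = R''" using h(3) k(3) by (simp add: image_image[symmetric])
  finally show ?thesis unfolding extends_to_prod_CT_def using h(5) k(6) 1 2 by blast
qed

lemma extends_to_prod_CT_inv: assumes "extends_to_prod_CT R R' \<psi>" "inj_on \<psi> R" shows "extends_to_prod_CT R' R (inv_into R \<psi>)"
proof -
  obtain h where h: "OE (prod_CT R) h" "\<And>x. x \<in> R \<Longrightarrow> h x = \<psi> x" "h ` R = R'" "h ` prod_CT R = prod_CT R'" "T_good R" "T_good R'"
    by (rule extends_to_prod_CTE[OF assms(1)]) (rule that)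
  have R: "\<psi> ` R = R'" using assms(1) unfolding extends_to_prod_CT_def by blast
  have 1: "OE (prod_CT R') (inv_into (prod_CT R) h)" using OE.inv[OF h(1)] h(4) by simp
  have 2: "inv_into (prod_CT R) h y = inv_into R \<psi> y" if y: "y \<in> R'" for y
  proof -
    obtain x where x: "x \<in> R" "y = \<psi> x" using y R by blast
    have "x \<in> prod_CT R" using x(1) prod_CT_sub(2)[OF T_good_sub(2,1)[OF h(5)]] by blast
    thus ?thesis using OE.H_inv_l[OF h(1), of x] h(2)[OF x(1)] x inv_into_f_f[OF assms(2) x(1)] by simp
  qed
  have 3: "inv_into R \<psi> ` R' = R" using assms(2) R by (metis inv_into_image_cancel subset_refl)
  show ?thesis unfolding extends_to_prod_CT_def using h(5,6) 1 2 3 by blast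
qed

lemma normalizer_in_prod_CT: assumes R: "T_good R" shows "normalizer_in G T R \<subseteq> normalizer_in G T (prod_CT R)"
proof
  fix g assume g: "g \<in> normalizer_in G T R"
  have gT: "g \<in> T" "conj_by G g ` R = R" using g unfolding normalizer_in_def by auto
  note W = prod_CT_sub[OF T_good_sub(2,1)[OF R]]
  have "extends_to_prod_CT R R (conj_by G g)" unfolding extends_to_prod_CT_def using R gT(2) OE.H_conj_by[OF W(1,4) gT(1)] by blast
  from extends_to_prod_CTE[OF this] have c: "conj_by G g ` centralizer_in G T R = centralizer_in G T R"
    using T_good_centralizer_in_img[OF R OE_FF[OF OE.H_conj_by[OF W(1,4) gT(1)]] W(2-4)] gT(2) by simp
  have "conj_by G g x \<in> prod_CT R" if x: "x \<in> prod_CT R" for x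
  proof -
    obtain a b where ab: "a \<in> R" "b \<in> centralizer_in G T R" "x = a \<otimes> b" using x unfolding prod_CT_def set_mult_def by blast
    have "conj_by G g x = conj_by G g a \<otimes> conj_by G g b"
      unfolding ab(3) using ab E.TG gT(1) W(2,3,4) by (intro F.conj_by_mult) blast+
    moreover have "conj_by G g a \<in> R" "conj_by G g b \<in> centralizer_in G T R" using ab gT(2) c by blast+
    ultimately show ?thesis unfolding prod_CT_def using F.set_mult_mem by metis
  qed
  hence "conj_by G g ` prod_CT R = prod_CT R"
    by (intro F.finite_normalizer_inI F.finite_subgroup[OF W(1)] subgroup.subset[OF W(1)] E.TG[OF gT(1)])
  thus "g \<in> normalizer_in G T (prod_CT R)" unfolding normalizer_in_def using gT(1) by blast
qed

text \<open>The group in which Sylow corrections are made when the action on R may change only by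
  elements of N; with trivial N it is the pointwise stabilizer of R.\<close>

lemma restr_aut_subgroup:
  assumes S: "subgroup S G" "S \<subseteq> T" and R: "R \<subseteq> S" and N: "subgroup N G" "N \<subseteq> normalizer_in G T R"
  shows "subgroup {\<tau> \<in> Auts OE S. \<exists>u\<in>N. \<forall>x\<in>R. \<tau> x = conj_by G u x} (BijGroup S)"
proof (rule BijGroup_subgroupI[OF F.finite_subgroup[OF S(1)]])
  let ?M = "{\<tau> \<in> Auts OE S. \<exists>u\<in>N. \<forall>x\<in>R. \<tau> x = conj_by G u x}"
  have SG: "x \<in> carrier G" if "x \<in> S" for x using that S(2) E.TG by blast
  have NG: "u \<in> carrier G" if "u \<in> N" for u using that N(1) subgroup.mem_carrier by metis
  show "?M \<subseteq> Bij S" using OE.Auts_Bij by blast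
  have "(\<lambda>x\<in>S. x) \<in> Auts OE S" by (rule OE.AutsI[OF OE.H_id[OF S]]) simp
  moreover have "\<forall>x\<in>R. (\<lambda>x\<in>S. x) x = conj_by G \<one> x" using R SG by auto
  ultimately show "(\<lambda>x\<in>S. x) \<in> ?M" using subgroup.one_closed[OF N(1)] by blast
  fix a b assume "a \<in> ?M" "b \<in> ?M"
  then obtain u v where ab: "a \<in> Auts OE S" "u \<in> N" "\<forall>x\<in>R. a x = conj_by G u x"
    "b \<in> Auts OE S" "v \<in> N" "\<forall>x\<in>R. b x = conj_by G v x" by blast
  have "compose S a b \<in> Auts OE S"
    using subgroup.m_closed[OF OE.Auts_subgroup[OF S] ab(1,4)] BijGroup_mult[of a S b] ab(1,4) OE.Auts_Bij[of S]
    by (metis subsetD)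
  moreover have "compose S a b x = conj_by G (v \<otimes> u) x" if x: "x \<in> R" for x
  proof -
    have "conj_by G v x \<in> R" using F.normalizer_inD(2)[of v T R x] ab(5) N(2) x by blast
    thus ?thesis using x R ab(3,6) F.conj_by_conj_by[OF NG[OF ab(5)] NG[OF ab(2)] SG] by (auto simp: compose_eq)
  qed
  ultimately show "compose S a b \<in> ?M" using subgroup.m_closed[OF N(1) ab(5,2)] by blast
qed

text \<open>The extension h0 to W = R C_T(R) need not respect the action of the extension domain N
  of \<psi> on W. Let M be the group of \<open>OE\<close>-automorphisms of W' = R' C_T(R') that act
  on R' like an element of N_T(R'). The group A' induced by N_T(R') is Sylow in M, so some \<kappa>
  in M corrects h0 until the action of N goes into A'. The corrected map then extends to N in E, and
  the extension lies in \<open>OE\<close> because W is centric.\<close>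

lemma extends_to_prod_CT_extend:
  assumes X: "extends_to_prod_CT R R' \<psi>"
  shows "\<exists>h. OE (OE.ext_dom R R' \<psi>) h \<and> (\<forall>x\<in>R. h x = \<psi> x)"
proof -
  obtain h0 where h0: "OE (prod_CT R) h0" "\<And>x. x \<in> R \<Longrightarrow> h0 x = \<psi> x" "h0 ` R = R'" "h0 ` prod_CT R = prod_CT R'" "T_good R" "T_good R'"
    by (rule extends_to_prod_CTE[OF X]) (rule that)
  let ?W = "prod_CT R" and ?W' = "prod_CT R'" and ?N = "OE.ext_dom R R' \<psi>"
  note Rs = T_good_sub(2,1)[OF h0(5)] and R's = T_good_sub(2,1)[OF h0(6)]
  note W = prod_CT_sub[OF Rs] and W' = prod_CT_sub[OF R's]
  have psi: "OE R \<psi>" by (rule OE.H_cong[OF OE.H_restr[OF h0(1) Rs(1) W(2)] h0(2)])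
  have psiR: "\<psi> ` R = R'" using X unfolding extends_to_prod_CT_def by blast
  note Ns = OE.ext_dom_subgroup[OF psi psiR]
  have Nn: "?N \<subseteq> normalizer_in G T R" by (rule OE.ext_dom_normalizer_in)
  have NW: "?N \<subseteq> normalizer_in G T ?W" using Nn normalizer_in_prod_CT[OF h0(5)] by blast
  have n'W: "normalizer_in G T R' \<subseteq> normalizer_in G T ?W'" by (rule normalizer_in_prod_CT[OF h0(6)])
  have n's: "subgroup (normalizer_in G T R') G" by (rule E.normalizer_in_sub[OF R's(1)])
  have W'G: "x \<in> carrier G" if "x \<in> ?W'" for x using that W'(4) E.TG by blast
  have WN: "?W \<subseteq> ?N"
  proof
    fix g assume g: "g \<in> ?W"
    obtain a where a: "a \<in> R" "\<forall>x\<in>R. conj_by G g x = conj_by G a x" using prod_CT_conj_by[OF Rs g] by blast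
    have "\<psi> a \<in> normalizer_in G T R'" using a(1) psiR E.sub_normalizer_in[OF R's] by blast
    moreover have "\<forall>x\<in>R. \<psi> (conj_by G g x) = conj_by G (\<psi> a) (\<psi> x)" using a(2) OE.H_cjv[OF psi a(1)] by simp
    ultimately show "g \<in> ?N" unfolding OE.ext_dom_def using g W(5) by blast
  qed
  let ?A = "(\<lambda>g. restrict (conj_by G g) ?W) ` ?N" and ?A' = "(\<lambda>g. restrict (conj_by G g) ?W') ` normalizer_in G T R'"
  let ?M = "{\<tau> \<in> Auts OE ?W'. \<exists>u\<in>normalizer_in G T R'. \<forall>x\<in>R'. \<tau> x = conj_by G u x}"
  have Ms: "subgroup ?M (BijGroup ?W')"
    by (rule restr_aut_subgroup[OF W'(1,4,2) n's subset_refl])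
  have A's: "subgroup ?A' (BijGroup ?W')" "\<exists>k. card ?A' = p ^ k"
    using OE.AutT_image_subgroup[OF W'(1,4) n's n'W] by auto
  have As: "subgroup ?A (BijGroup ?W)" "\<exists>k. card ?A = p ^ k"
    using OE.AutT_image_subgroup[OF W(1,4) Ns(1) NW] by auto
  have A'M: "?A' \<subseteq> ?M"
  proof
    fix a assume "a \<in> ?A'"
    then obtain g where g: "g \<in> normalizer_in G T R'" "a = restrict (conj_by G g) ?W'" by blast
    have "a \<in> Auts OE ?W'" using OE.AutT_sub_Auts[OF W'(1,4)] n'W g unfolding AutT_def by blast
    thus "a \<in> ?M" using g W'(2) by auto
  qed
  obtain k' where k': "card ?A' = p ^ k'" using A's(2) by blast
  \<comment> \<open>To see that A' is Sylow in M, take a Sylow subgroup B above it;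
    \<open>BA\<close> will show B = A'.\<close>
  obtain B where B: "subgroup B (BijGroup ?W')" "sylow_in p B ?M" "?A' \<subseteq> B"
    using sylow_in_containing[OF F.p_prime F.finite_subgroup[OF W'(1)] Ms A's(1) A'M k'] by blast
  have BM: "B \<subseteq> ?M" using B(2) unfolding sylow_in_def by blast
  hence BE: "B \<subseteq> Auts EE ?W'" using OE_EE unfolding Auts_def by blast
  obtain kB where kB: "card B = p ^ kB" using B(2) unfolding sylow_in_def by blast
  obtain f1 where f1: "EE ?W' f1" "T_good (f1 ` ?W')" by (rule T_good_exists[OF W'(1,4)])
  have gd: "good p G T EE (f1 ` ?W')" by (rule T_good_good[OF f1(2)])
  let ?W2 = "f1 ` ?W'"
  obtain \<chi> where chi: "EE (normalizer_in G T R') \<chi>" "\<chi> ` ?W' = ?W2"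
    "\<And>b. b \<in> B \<Longrightarrow> \<exists>u\<in>normalizer_in G T ?W2. \<forall>x\<in>?W'. \<chi> (b x) = conj_by G u (\<chi> x)"
  proof (rule E.good_conj_ext[OF gd f1(1) refl B(1) kB BE n's W'(5) n'W])
    fix g assume g: "g \<in> normalizer_in G T R'"
    hence "restrict (conj_by G g) ?W' \<in> B" using B(3) by blast
    thus "\<exists>b\<in>B. \<forall>x\<in>?W'. conj_by G g x = b x" by (rule bexI[rotated]) simp
  qed blast
  let ?R2 = "\<chi> ` R'"
  have chiR: "EE R' \<chi>" by (rule E.H_restr[OF chi(1) R's(1) E.sub_normalizer_in[OF R's]])
  have chiW: "EE ?W' \<chi>" by (rule E.H_restr[OF chi(1) W'(1,5)])
  have R2s: "subgroup ?R2 G" "?R2 \<subseteq> T" using E.H_img[OF chiR] E.H_imgT[OF chiR] by auto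
  \<comment> \<open>R' is fully normalized in E, so \<chi> fills the normalizer of \<chi>(R'). An
    element u of T that realizes some b in B normalizes \<chi>(R'), hence is \<chi>(v) for some v in
    N_T(R'), and b is conjugation by v.\<close>
  have chiN: "\<chi> ` normalizer_in G T R' = normalizer_in G T ?R2"
  proof (rule card_seteq[OF F.finite_subgroup[OF E.normalizer_in_sub[OF R2s(1)]] E.H_normalizer_in_img[OF chi(1) R's]])
    show "card (normalizer_in G T ?R2) \<le> card (\<chi> ` normalizer_in G T R')"
      using E.good_normalizer_in_card(1)[OF T_good_good[OF h0(6)] EE_inv[OF chiR refl]] E.H_card[OF chi(1)] by simp
  qed
  have BA': "B \<subseteq> ?A'"
  proof
    fix b assume b: "b \<in> B"
    obtain u where u: "u \<in> normalizer_in G T ?W2" "\<forall>x\<in>?W'. \<chi> (b x) = conj_by G u (\<chi> x)" using chi(3)[OF b] by blast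
    obtain w where w: "w \<in> normalizer_in G T R'" "\<forall>x\<in>R'. b x = conj_by G w x" using b BM by blast
    have bR: "b ` R' = R'"
    proof -
      have "b ` R' = conj_by G w ` R'" by (rule image_cong) (use w(2) in auto)
      thus ?thesis using w(1) unfolding normalizer_in_def by simp
    qed
    have "conj_by G u ` ?R2 = \<chi> ` b ` R'" unfolding image_image by (rule image_cong) (use u(2) W'(2) in auto)
    hence "u \<in> normalizer_in G T ?R2" using bR F.normalizer_inD(1)[OF u(1)] unfolding normalizer_in_def by simp
    then obtain v where v: "v \<in> normalizer_in G T R'" "u = \<chi> v" using chiN by blast
    have bB: "b \<in> Bij ?W'" using b BM OE.Auts_Bij by blast
    have vB: "restrict (conj_by G v) ?W' \<in> Bij ?W'" using A'M v(1) OE.Auts_Bij by blast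
    have "b = restrict (conj_by G v) ?W'"
    proof (rule Bij_eqI[OF bB vB])
      fix x assume x: "x \<in> ?W'"
      have xn: "x \<in> normalizer_in G T R'" using x W'(5) by blast
      have vx: "conj_by G v x \<in> normalizer_in G T R'" by (rule F.conj_by_mem[OF n's v(1) xn])
      have bx: "b x \<in> normalizer_in G T R'" using BijD(2)[OF bB x] W'(5) by blast
      have "\<chi> (b x) = \<chi> (conj_by G v x)" using u(2) x v(2) E.H_cjv[OF chi(1) v(1) xn] by simp
      thus "b x = restrict (conj_by G v) ?W' x" using E.H_eq_iff[OF chi(1) bx vx] x by simp
    qed
    thus "b \<in> ?A'" using v(1) by blast
  qed
  hence BA: "B = ?A'" using B(3) by blast
  let ?\<Phi> = "\<lambda>b. \<lambda>y\<in>?W'. h0 (b (inv_into ?W h0 y))"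
  have bij: "bij_betw h0 ?W ?W'" using OE.H_inj[OF h0(1)] h0(4) unfolding bij_betw_def by blast
  note Phi = Bij_conj_subgroup[OF bij F.finite_subgroup[OF W(1)] As(1)]
  obtain kA where kA: "card (?\<Phi> ` ?A) = p ^ kA" using As(2) Phi(2) by metis
  have PhiM: "?\<Phi> ` ?A \<subseteq> ?M"
  proof
    fix t assume "t \<in> ?\<Phi> ` ?A"
    then obtain g where g: "g \<in> ?N" "t = ?\<Phi> (restrict (conj_by G g) ?W)" by blast
    have "restrict (conj_by G g) ?W \<in> Auts OE ?W" using OE.AutT_sub_Auts[OF W(1,4)] NW g(1) unfolding AutT_def by blast
    hence 1: "t \<in> Auts OE ?W'" unfolding g(2) by (rule OE.H_conj_aut[OF h0(1,4)])
    obtain u where u: "u \<in> normalizer_in G T R'" "\<And>x. x \<in> R \<Longrightarrow> \<psi> (conj_by G g x) = conj_by G u (\<psi> x)" by (rule OE.ext_domD[OF g(1)]) blast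
    have "t x = conj_by G u x" if x: "x \<in> R'" for x
    proof -
      obtain z where z: "z \<in> R" "x = h0 z" using x h0(3) by blast
      have zW: "z \<in> ?W" using z W(2) by blast
      have "conj_by G g z \<in> R" using F.normalizer_inD(2)[of g T R z] g(1) Nn z(1) by blast
      thus ?thesis unfolding g(2) using x W'(2) zW OE.H_inv_l[OF h0(1) zW] z h0(2) u(2)[OF z(1)] by auto
    qed
    thus "t \<in> ?M" using 1 u(1) by blast
  qed
  have A'syl: "sylow_in p ?A' ?M" using B(2) BA by simp
  obtain \<kappa> where kap: "\<kappa> \<in> ?M" "\<forall>b\<in>?\<Phi> ` ?A. \<exists>s\<in>?A'. \<forall>x\<in>?W'. \<kappa> (b x) = s (\<kappa> x)"
    using sylow_in_conjugate[OF F.p_prime F.finite_subgroup[OF W'(1)] Ms A's(1) A'syl Phi(1) PhiM kA] by blast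
  have kD: "OE ?W' \<kappa>" "\<kappa> ` ?W' = ?W'" using kap(1) OE.AutsD by blast+
  obtain u0 where u0: "u0 \<in> normalizer_in G T R'" "\<forall>x\<in>R'. \<kappa> x = conj_by G u0 x" using kap(1) by blast
  have i0: "inv u0 \<in> normalizer_in G T R'" using u0(1) n's by (simp add: subgroup.m_inv_closed)
  have u0G: "u0 \<in> carrier G" "inv u0 \<in> carrier G" "inv u0 \<in> T" using F.normalizer_inD(1)[OF u0(1)] F.normalizer_inD(1)[OF i0] E.TG by auto
  \<comment> \<open>On R' the correction \<kappa> is conjugation by u0. Undoing it restores \<psi>
    on R, and the action of N still goes into A' since u0 lies in N_T(R').\<close>
  let ?\<psi>1 = "\<lambda>z. conj_by G (inv u0) (\<kappa> (h0 z))"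
  have kh: "OE ?W (\<lambda>z. \<kappa> (h0 z))" "(\<lambda>z. \<kappa> (h0 z)) ` ?W = ?W'"
    using OE.comp[OF h0(1)] h0(4) kD by (auto simp: image_image[symmetric])
  have cW: "OE ?W' (conj_by G (inv u0))" by (rule OE.H_conj_by[OF W'(1,4) u0G(3)])
  have cW': "conj_by G (inv u0) ` ?W' = ?W'" using i0 n'W unfolding normalizer_in_def by blast
  have p1: "OE ?W ?\<psi>1" using OE.comp[OF kh(1), of "conj_by G (inv u0)"] cW kh(2) by simp
  have p1W: "?\<psi>1 ` ?W = ?W'"
  proof -
    have "?\<psi>1 ` ?W = conj_by G (inv u0) ` (\<lambda>z. \<kappa> (h0 z)) ` ?W" by (simp only: image_image)
    thus ?thesis using kh(2) cW' by simp
  qed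
  have p1R: "?\<psi>1 z = \<psi> z" if z: "z \<in> R" for z
  proof -
    have hz: "h0 z \<in> R'" using z h0(3) by blast
    thus ?thesis using u0(2) h0(2)[OF z] u0G W'G W'(2) by auto
  qed
  have p1c: "\<exists>v\<in>normalizer_in G T R'. \<forall>z\<in>?W. ?\<psi>1 (conj_by G g z) = conj_by G v (?\<psi>1 z)" if g: "g \<in> ?N" for g
  proof -
    obtain s where s: "s \<in> ?A'" "\<forall>x\<in>?W'. \<kappa> (?\<Phi> (restrict (conj_by G g) ?W) x) = s (\<kappa> x)" using kap(2) g by blast
    then obtain v where v: "v \<in> normalizer_in G T R'" "s = restrict (conj_by G v) ?W'" by blast
    have vG: "v \<in> carrier G" using F.normalizer_inD(1)[OF v(1)] E.TG by blast
    have "?\<psi>1 (conj_by G g z) = conj_by G (conj_by G (inv u0) v) (?\<psi>1 z)" if z: "z \<in> ?W" for z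
    proof -
      have hz: "h0 z \<in> ?W'" "\<kappa> (h0 z) \<in> ?W'" using z h0(4) kh(2) by blast+
      have "\<kappa> (h0 (conj_by G g z)) = conj_by G v (\<kappa> (h0 z))"
        using s(2)[rule_format, OF hz(1)] hz z OE.H_inv_l[OF h0(1) z] v(2) by simp
      thus ?thesis using F.conj_by_conj_by_hom[OF u0G(2) vG W'G[OF hz(2)]] by simp
    qed
    moreover have "conj_by G (inv u0) v \<in> normalizer_in G T R'" by (rule F.conj_by_mem[OF n's i0 v(1)])
    ultimately show ?thesis by blast
  qed
  let ?f = "\<lambda>z. \<chi> (?\<psi>1 z)"
  have f: "EE ?W ?f" "?f ` ?W = ?W2"
    using EE_comp[OF OE_EE[OF p1] p1W chiW] chi(2) by auto
  have rc: "is_receptive G T EE ?W2" using gd unfolding good_def by blast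
  obtain \<omega> where om: "EE ?N \<omega>" "\<And>x. x \<in> ?W \<Longrightarrow> \<omega> x = ?f x"
  proof (rule E.is_receptiveD[OF rc f Ns(1) WN NW])
    fix g assume g: "g \<in> ?N"
    obtain v where v: "v \<in> normalizer_in G T R'" "\<forall>z\<in>?W. ?\<psi>1 (conj_by G g z) = conj_by G v (?\<psi>1 z)" using p1c[OF g] by blast
    have "restrict (conj_by G v) ?W' \<in> B" unfolding BA using v(1) by blast
    from chi(3)[OF this] obtain u where u: "u \<in> normalizer_in G T ?W2" "\<forall>x\<in>?W'. \<chi> (restrict (conj_by G v) ?W' x) = conj_by G u (\<chi> x)" by blast
    have "?f (conj_by G g z) = conj_by G u (?f z)" if z: "z \<in> ?W" for z
    proof -
      have "?\<psi>1 z \<in> ?W'" using z p1W by blast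
      thus ?thesis using v(2) z u(2) by auto
    qed
    thus "\<exists>u\<in>normalizer_in G T ?W2. \<forall>x\<in>?W. ?f (conj_by G g x) = conj_by G u (?f x)" using u(1) by blast
  qed blast
  have omR: "\<omega> ` R = ?R2"
  proof -
    have "\<omega> ` R = \<chi> ` \<psi> ` R" unfolding image_image by (rule image_cong) (use om(2) W(2) p1R in auto)
    thus ?thesis using psiR by simp
  qed
  \<comment> \<open>N normalizes R, so its image normalizes \<chi>(R') and lies where \<chi> can be
    undone.\<close>
  have omN: "\<omega> ` ?N \<subseteq> \<chi> ` normalizer_in G T R'"
  proof (rule image_subsetI)
    fix g assume g: "g \<in> ?N"
    show "\<omega> g \<in> \<chi> ` normalizer_in G T R'"
      using E.H_normalizer_in[OF om(1) g subsetD[OF Nn g] Ns(2)] unfolding omR chiN .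
  qed
  have ci: "EE (\<chi> ` normalizer_in G T R') (inv_into (normalizer_in G T R') \<chi>)" by (rule E.H_inv[OF chi(1)])
  have q: "EE ?N (\<lambda>x. inv_into (normalizer_in G T R') \<chi> (\<omega> x))" by (rule E.H_comp[OF om(1) ci omN])
  have qW: "inv_into (normalizer_in G T R') \<chi> (\<omega> x) = ?\<psi>1 x" if x: "x \<in> ?W" for x
  proof -
    have "?\<psi>1 x \<in> normalizer_in G T R'" using x p1W W'(5) by blast
    thus ?thesis using om(2)[OF x] E.H_inv_l[OF chi(1)] by simp
  qed
  have "OE ?W (\<lambda>x. inv_into (normalizer_in G T R') \<chi> (\<omega> x))" by (rule OE.H_cong[OF p1]) (use qW in simp)
  hence "OE ?N (\<lambda>x. inv_into (normalizer_in G T R') \<chi> (\<omega> x))" by (rule OE_star[OF q prod_CT_centric[OF h0(5)] WN])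
  moreover have "inv_into (normalizer_in G T R') \<chi> (\<omega> x) = \<psi> x" if "x \<in> R" for x using qW p1R that W(2) by auto
  ultimately show ?thesis by blast
qed

end

context fusion_pred
begin

text \<open>Normalizers grow in the p-group V C_T(R). An element v c that normalizes V and lies
  outside V yields c in C_T(R) with the same two properties.\<close>

lemma centralizer_in_grows:
  assumes R: "subgroup R G" "R \<subseteq> T" and V: "subgroup V G" "R \<subseteq> V" "V \<subseteq> normalizer_in G T R" and n: "\<not> centralizer_in G T R \<subseteq> V"
  shows "\<exists>c\<in>normalizer_in G (centralizer_in G T R) V. c \<notin> V"
proof -
  let ?C = "centralizer_in G T R"
  have Cs: "subgroup ?C G" by (rule centralizer_in_sub[OF R(1)])
  have RG: "R \<subseteq> carrier G" using R(1) by (rule subgroup.subset)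
  have VT: "V \<subseteq> T" using V(3) nrmT by blast
  have nC: "conj_by G a b \<in> ?C" if a: "a \<in> V" and b: "b \<in> ?C" for a b
  proof -
    have aT: "a \<in> T" "b \<in> T" using a b VT cenT by blast+
    have aG: "a \<in> carrier G" "b \<in> carrier G" using aT TG by auto
    have cT: "conj_by G a b \<in> T" using conj_by_mem[OF T aT] .
    have "conj_by G (conj_by G a b) y = y" if y: "y \<in> R" for y
    proof -
      have "conj_by G a ` R = R" using a V(3) unfolding normalizer_in_def by blast
      then obtain x where x: "x \<in> R" "y = conj_by G a x" using y by blast
      have xG: "x \<in> carrier G" using x RG by blast
      have "conj_by G (conj_by G a b) y = conj_by G a (conj_by G b x)" using conj_by_conj_by_hom[OF aG xG] x(2) by simp
      also have "conj_by G b x = x" using centralizer_in_conj_by[OF T RG aT(2)] b x(1) by blast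
      finally show ?thesis using x(2) by simp
    qed
    thus ?thesis using centralizer_in_conj_by[OF T RG cT] by blast
  qed
  have VCs: "subgroup (V <#> ?C) G" by (rule subgroup_set_mult[OF V(1) Cs nC])
  have "V \<subset> V <#> ?C" using set_mult_sup[OF V(1) Cs] n by blast
  from normalizer_in_grows[OF VCs V(1) this] obtain g where g: "g \<in> normalizer_in G (V <#> ?C) V" "g \<notin> V" by blast
  obtain v c where vc: "v \<in> V" "c \<in> ?C" "g = v \<otimes> c" using normalizer_inD(1)[OF g(1)] unfolding set_mult_def by blast
  have G: "v \<in> carrier G" "c \<in> carrier G" using vc VT cenT TG by blast+
  have "conj_by G c ` V = V"
  proof -
    have "conj_by G c ` V = conj_by G c ` conj_by G v ` V" using conj_by_image_subgroup[OF V(1) vc(1)] by simp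
    also have "\<dots> = conj_by G g ` V" unfolding image_image vc(3)
      by (rule image_cong) (use conj_by_conj_by[OF G] VT TG in auto)
    also have "\<dots> = V" using g(1) unfolding normalizer_in_def by blast
    finally show ?thesis .
  qed
  moreover have "c \<notin> V" using g(2) vc V(1) by (metis subgroup.m_closed)
  ultimately show ?thesis using vc(2) unfolding normalizer_in_def by blast
qed

end

section \<open>From an extension over a proper overgroup to one over the centralizer\<close>

context weakly_normal_pair
begin

lemma fix_aut_subgroup:
  assumes S: "subgroup S G" "S \<subseteq> T" and R: "R \<subseteq> S"
  shows "subgroup {\<tau> \<in> Auts OE S. \<forall>x\<in>R. \<tau> x = x} (BijGroup S)"
proof -
  have o: "{\<one>} \<subseteq> normalizer_in G T R" "subgroup {\<one>} G"
    using R S(2) E.TG subgroup.one_closed[OF E.T] F.triv_subgroup unfolding normalizer_in_def by (auto simp: subset_iff image_iff)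
  have "{\<tau> \<in> Auts OE S. \<exists>u\<in>{\<one>}. \<forall>x\<in>R. \<tau> x = conj_by G u x} = {\<tau> \<in> Auts OE S. \<forall>x\<in>R. \<tau> x = x}"
    using R S(2) E.TG by (auto simp: subset_iff)
  with restr_aut_subgroup[OF S R o(2,1)] show ?thesis by simp
qed

lemma T_good_centralizer_in_transport:
  assumes "T_good R'" "FF V f" "R \<subseteq> V" "V \<subseteq> T" "f ` R = R'" "subgroup R G" "centralizer_in G T R' \<subseteq> f ` V"
  shows "centralizer_in G T R \<subseteq> V"
proof -
  let ?i = "inv_into V f"
  have i: "FF (f ` V) ?i" "?i ` f ` V = V" using FF_inv[OF assms(2) refl] by auto
  have "?i ` centralizer_in G T R' = centralizer_in G T (?i ` R')"
    by (rule T_good_centralizer_in_img[OF assms(1) i(1) _ assms(7) closed[OF assms(2,4)]]) (use assms(3,5) in blast)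
  moreover have "?i ` R' = R" unfolding assms(5)[symmetric] by (rule inv_into_image_cancel[OF F.H_inj[OF assms(2)] assms(3)])
  ultimately have "centralizer_in G T R = ?i ` centralizer_in G T R'" by simp
  also have "\<dots> \<subseteq> V" using assms(7) i(2) by blast
  finally show ?thesis .
qed

text \<open>Downward induction on the order of V. If C_T(R) is not inside V, enlarge V and \<psi>(V)
  by the parts C and C' of the centralizers that normalize them. The map \<psi> itself need not
  extend to C V, so both sides are sent to a third subgroup V2: \<chi> extends over C' \<psi>(V),
  and \<chi> \<kappa> \<psi> over C V, where \<kappa> is trivial on \<psi>(R). On R the two
  extensions differ exactly by \<psi>, so the induction hypothesis for both gives the claim for
  \<psi>. Receptivity of V2 is available because V2 has more than n elements.\<close>

lemma extends_to_prod_CT_if_extends: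
  assumes IH: "\<And>R1. T_good R1 \<Longrightarrow> n < card R1 \<Longrightarrow> is_receptive G T OE R1"
  shows "T_good R \<Longrightarrow> T_good (\<psi> ` R) \<Longrightarrow> card R = n \<Longrightarrow> OE V \<psi> \<Longrightarrow> R \<subset> V \<Longrightarrow> V \<subseteq> normalizer_in G T R \<Longrightarrow> extends_to_prod_CT R (\<psi> ` R) \<psi>"
proof (induction "card T - card V" arbitrary: R V \<psi> rule: less_induct)
  case less
  let ?R' = "\<psi> ` R" and ?V' = "\<psi> ` V"
  note Rs = T_good_sub(2,1)[OF less.prems(1)] and R's = T_good_sub(2,1)[OF less.prems(2)]
  have V: "subgroup V G" "V \<subseteq> T" using OE.H_sub[OF less.prems(4)] OE.H_subT[OF less.prems(4)] by auto
  have V': "subgroup ?V' G" "?V' \<subseteq> T" using OE.H_img[OF less.prems(4)] OE.H_imgT[OF less.prems(4)] by auto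
  have RV: "R \<subseteq> V" using less.prems(5) by blast
  have R'V': "?R' \<subseteq> ?V'" using RV by blast
  show ?case
  proof (cases "centralizer_in G T R \<subseteq> V")
    case True
    have "prod_CT R \<subseteq> V" by (rule prod_CT_least[OF V(1) RV True])
    hence "OE (prod_CT R) \<psi>" using OE.H_restr[OF less.prems(4) prod_CT_sub(1)[OF Rs]] by blast
    thus ?thesis unfolding extends_to_prod_CT_def using less.prems(1,2) by blast
  next
    case False
    let ?C = "normalizer_in G (centralizer_in G T R) V" and ?C' = "normalizer_in G (centralizer_in G T ?R') ?V'"
    have psiR: "OE R \<psi>" by (rule OE.H_restr[OF less.prems(4) Rs(1) RV])
    have cardR': "card ?R' = n" using OE.H_card[OF psiR] less.prems(3) by simp
    have cardV': "card ?V' = card V" by (rule OE.H_card[OF less.prems(4)])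
    have cardV: "n < card V" using psubset_card_mono[OF F.finite_subgroup[OF V(1)] less.prems(5)] less.prems(3) by simp
    have V'n: "?V' \<subseteq> normalizer_in G T ?R'"
    proof (rule image_subsetI)
      fix g assume g: "g \<in> V"
      show "\<psi> g \<in> normalizer_in G T ?R'" by (rule OE.H_normalizer_in[OF less.prems(4) g _ RV]) (use g less.prems(6) in blast)
    qed
    have False': "\<not> centralizer_in G T ?R' \<subseteq> ?V'"
      using T_good_centralizer_in_transport[OF less.prems(2) OE_FF[OF less.prems(4)] RV V(2) refl Rs(1)] False by blast
    have Cs: "subgroup ?C G" by (rule F.subgroup_normalizer_in[OF E.centralizer_in_sub[OF Rs(1)] V(1)])
    have C's: "subgroup ?C' G" by (rule F.subgroup_normalizer_in[OF E.centralizer_in_sub[OF R's(1)] V'(1)])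
    have Cn: "?C \<subseteq> normalizer_in G T V" "?C' \<subseteq> normalizer_in G T ?V'" by (rule F.normalizer_in_mono[OF E.cenT])+
    have Cc: "?C \<subseteq> centralizer_in G T R" "?C' \<subseteq> centralizer_in G T ?R'" using F.normalizer_inD(1) by blast+
    have CR: "conj_by G c x = x" if "c \<in> ?C" "x \<in> R" for c x
      using F.centralizer_in_conj_by[OF E.T _ F.centralizer_inD(1), of R c R] Cc(1) that Rs(2) E.T_sub by blast
    have CR': "conj_by G c x = x" if "c \<in> ?C'" "x \<in> ?R'" for c x
      using F.centralizer_in_conj_by[OF E.T _ F.centralizer_inD(1), of ?R' c ?R'] Cc(2) that R's(2) E.T_sub by blast
    let ?U = "?C <#> V" and ?U' = "?C' <#> ?V'"
    obtain c where c: "c \<in> ?C" "c \<notin> V" using E.centralizer_in_grows[OF Rs V(1) RV less.prems(6) False] by blast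
    obtain c' where c': "c' \<in> ?C'" "c' \<notin> ?V'" using E.centralizer_in_grows[OF R's V'(1) R'V' V'n False'] by blast
    have VU: "V \<subset> ?U" "?V' \<subset> ?U'"
      using F.set_mult_sup[OF Cs V(1)] c F.set_mult_sup[OF C's V'(1)] c' by blast+
    have Cnn: "?C \<subseteq> normalizer_in G T R" "?C' \<subseteq> normalizer_in G T ?R'"
      using Cc F.centralizer_in_sub_normalizer_in[OF E.T subgroup.subset[OF Rs(1)]] F.centralizer_in_sub_normalizer_in[OF E.T subgroup.subset[OF R's(1)]] by blast+
    have Un: "?U \<subseteq> normalizer_in G T R" by (rule F.set_mult_least[OF E.normalizer_in_sub[OF Rs(1)] Cnn(1) less.prems(6)])
    have U'n: "?U' \<subseteq> normalizer_in G T ?R'" by (rule F.set_mult_least[OF E.normalizer_in_sub[OF R's(1)] Cnn(2) V'n])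
    let ?A = "(\<lambda>g. restrict (conj_by G g) V) ` ?C" and ?A' = "(\<lambda>g. restrict (conj_by G g) ?V') ` ?C'"
    \<comment> \<open>Corrections have to leave the map on R alone, so they are sought among
      automorphisms fixing \<psi>(R) pointwise. Both the action of C' and the transported action of
      C lie in this group, as C and C' centralize R and \<psi>(R).\<close>
    let ?K = "{\<tau> \<in> Auts OE ?V'. \<forall>x\<in>?R'. \<tau> x = x}"
    have Ks: "subgroup ?K (BijGroup ?V')" by (rule fix_aut_subgroup[OF V' R'V'])
    note As = OE.AutT_image_subgroup[OF V Cs Cn(1)] and A's = OE.AutT_image_subgroup[OF V' C's Cn(2)]
    have A'K: "?A' \<subseteq> ?K"
    proof (rule image_subsetI)
      fix g assume g: "g \<in> ?C'"
      have "restrict (conj_by G g) ?V' \<in> Auts OE ?V'" using OE.AutT_sub_Auts[OF V'] Cn(2) g unfolding AutT_def by blast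
      moreover have "\<forall>x\<in>?R'. restrict (conj_by G g) ?V' x = x" using CR'[OF g] R'V' by (auto simp: subset_iff)
      ultimately show "restrict (conj_by G g) ?V' \<in> ?K" by blast
    qed
    obtain k' where k': "card ?A' = p ^ k'" using A's(2) by blast
    obtain B where B: "subgroup B (BijGroup ?V')" "sylow_in p B ?K" "?A' \<subseteq> B"
      using sylow_in_containing[OF F.p_prime F.finite_subgroup[OF V'(1)] Ks A's(1) A'K k'] by blast
    have BK: "B \<subseteq> ?K" using B(2) unfolding sylow_in_def by blast
    hence BD: "B \<subseteq> Auts OE ?V'" by blast
    obtain kB where kB: "card B = p ^ kB" using B(2) unfolding sylow_in_def by blast
    let ?\<Phi> = "\<lambda>b. \<lambda>y\<in>?V'. \<psi> (b (inv_into V \<psi> y))"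
    have bij: "bij_betw \<psi> V ?V'" using OE.H_inj[OF less.prems(4)] unfolding bij_betw_def by blast
    note Phi = Bij_conj_subgroup[OF bij F.finite_subgroup[OF V(1)] As(1)]
    obtain kA where kA: "card (?\<Phi> ` ?A) = p ^ kA" using As(2) Phi(2) by metis
    have PhiK: "?\<Phi> ` ?A \<subseteq> ?K"
    proof
      fix t assume "t \<in> ?\<Phi> ` ?A"
      then obtain g where g: "g \<in> ?C" "t = ?\<Phi> (restrict (conj_by G g) V)" by blast
      have "restrict (conj_by G g) V \<in> Auts OE V" using OE.AutT_sub_Auts[OF V] Cn(1) g(1) unfolding AutT_def by blast
      hence 1: "t \<in> Auts OE ?V'" unfolding g(2) by (rule OE.H_conj_aut[OF less.prems(4) refl])
      have "t x = x" if x: "x \<in> ?R'" for x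
      proof -
        obtain z where z: "z \<in> R" "x = \<psi> z" using x by blast
        have zV: "z \<in> V" using z RV by blast
        thus ?thesis unfolding g(2) using OE.H_inv_l[OF less.prems(4) zV] z CR[OF g(1) z(1)] by simp
      qed
      thus "t \<in> ?K" using 1 by blast
    qed
    obtain \<kappa> where kap: "\<kappa> \<in> ?K" "\<forall>b\<in>?\<Phi> ` ?A. \<exists>s\<in>B. \<forall>x\<in>?V'. \<kappa> (b x) = s (\<kappa> x)"
      using sylow_in_conjugate[OF F.p_prime F.finite_subgroup[OF V'(1)] Ks B(1,2) Phi(1) PhiK kA] by blast
    have kap': "\<kappa> \<in> Auts OE ?V'" "\<forall>x\<in>?R'. \<kappa> x = x" using kap(1) by simp_all
    have kD: "OE ?V' \<kappa>" "\<kappa> ` ?V' = ?V'" "\<And>x. x \<in> ?R' \<Longrightarrow> \<kappa> x = x"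
      by (rule OE.AutsD[OF kap'(1)], rule OE.AutsD[OF kap'(1)], rule bspec[OF kap'(2)])
    obtain f1 where f1: "OE ?V' f1" "T_good (f1 ` ?V')" by (rule T_good_exists_OE[OF V'])
    let ?V2 = "f1 ` ?V'"
    have rc: "is_receptive G T OE ?V2" by (rule IH[OF f1(2)]) (use OE.H_card[OF f1(1)] cardV' cardV in simp)
    \<comment> \<open>A single \<chi> sends the whole Sylow subgroup B into Aut_T(V2); it therefore
      serves the action of C' and the corrected action of C at once.\<close>
    obtain \<chi> where chi: "OE ?V' \<chi>" "\<chi> ` ?V' = ?V2"
      "\<And>b. b \<in> B \<Longrightarrow> \<exists>u\<in>normalizer_in G T ?V2. \<forall>x\<in>?V'. \<chi> (b x) = conj_by G u (\<chi> x)"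
      by (rule OE.sylow_conj_hom[OF T_good_sub(2,1)[OF f1(2)] sylow_OE[OF f1(2)] f1(1) refl B(1) kB BD]) (rule that)
    have NN': "?C' \<subseteq> OE.ext_dom ?V' ?V2 \<chi>"
    proof
      fix g assume g: "g \<in> ?C'"
      have "restrict (conj_by G g) ?V' \<in> B" using g B(3) by blast
      from chi(3)[OF this] show "g \<in> OE.ext_dom ?V' ?V2 \<chi>" unfolding OE.ext_dom_def using g Cn(2) by auto
    qed
    obtain h' where h': "OE ?U' h'" "\<And>x. x \<in> ?V' \<Longrightarrow> h' x = \<chi> x"
      by (rule OE.is_receptive_mult[OF rc chi(1,2) C's NN']) (rule that)
    let ?f = "\<lambda>x. \<chi> (\<kappa> (\<psi> x))"
    have kp: "OE V (\<lambda>x. \<kappa> (\<psi> x))" "(\<lambda>x. \<kappa> (\<psi> x)) ` V = ?V'"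
      using OE.comp[OF less.prems(4) kD(1)] kD(2) by (auto simp: image_image[symmetric])
    have f: "OE V ?f" "?f ` V = ?V2"
    proof -
      show "OE V ?f" using OE.comp[OF kp(1), of \<chi>] kp(2) chi(1) by simp
      have "?f ` V = \<chi> ` (\<lambda>x. \<kappa> (\<psi> x)) ` V" by (simp only: image_image)
      thus "?f ` V = ?V2" using kp(2) chi(2) by simp
    qed
    have ext_dom: "?C \<subseteq> OE.ext_dom V ?V2 ?f"
    proof
      fix g assume g: "g \<in> ?C"
      obtain s where s: "s \<in> B" "\<forall>x\<in>?V'. \<kappa> (?\<Phi> (restrict (conj_by G g) V) x) = s (\<kappa> x)" using kap(2) g by blast
      obtain u where u: "u \<in> normalizer_in G T ?V2" "\<forall>x\<in>?V'. \<chi> (s x) = conj_by G u (\<chi> x)" using chi(3)[OF s(1)] by blast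
      have "?f (conj_by G g z) = conj_by G u (?f z)" if z: "z \<in> V" for z
      proof -
        have y: "\<psi> z \<in> ?V'" "\<kappa> (\<psi> z) \<in> ?V'" using z kp(2) by blast+
        have "\<kappa> (\<psi> (conj_by G g z)) = s (\<kappa> (\<psi> z))"
          using s(2)[rule_format, OF y(1)] y(1) z OE.H_inv_l[OF less.prems(4) z] by simp
        thus ?thesis using bspec[OF u(2) y(2)] by simp
      qed
      thus "g \<in> OE.ext_dom V ?V2 ?f" unfolding OE.ext_dom_def using g Cn(1) u(1) by blast
    qed
    obtain h where h: "OE ?U h" "\<And>x. x \<in> V \<Longrightarrow> h x = ?f x"
      by (rule OE.is_receptive_mult[OF rc f Cs ext_dom]) (rule that)
    let ?R2 = "\<chi> ` ?R'"
    have h'R: "h' ` ?R' = ?R2" by (rule image_cong) (use h'(2) R'V' in auto)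
    have hR: "h ` R = ?R2" unfolding image_image by (rule image_cong) (use h(2) RV kD(3) in auto)
    have chR: "OE ?R' \<chi>" by (rule OE.H_restr[OF chi(1) R's(1) R'V'])
    have R2s: "subgroup ?R2 G" "?R2 \<subseteq> T" using OE.H_img[OF chR] OE.H_imgT[OF chR] by auto
    \<comment> \<open>The induction hypothesis asks for a \<open>T_good\<close> image, which
      \<chi>(\<psi>(R)) need not be; \<eta> moves it there together with its normalizer, which
      contains both images.\<close>
    obtain \<eta> where eta: "OE (normalizer_in G T ?R2) \<eta>" "T_good (\<eta> ` ?R2)" by (rule OE_normalizer_in_to_T_good[OF R2s])
    have RU: "R \<subseteq> ?U" "?R' \<subseteq> ?U'" using VU RV by blast+
    have hU: "h ` ?U \<subseteq> normalizer_in G T ?R2"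
    proof (rule image_subsetI)
      fix g assume g: "g \<in> ?U"
      show "h g \<in> normalizer_in G T ?R2" unfolding hR[symmetric] by (rule OE.H_normalizer_in[OF h(1) g subsetD[OF Un g] RU(1)])
    qed
    have h'U: "h' ` ?U' \<subseteq> normalizer_in G T ?R2"
    proof (rule image_subsetI)
      fix g assume g: "g \<in> ?U'"
      show "h' g \<in> normalizer_in G T ?R2" unfolding h'R[symmetric] by (rule OE.H_normalizer_in[OF h'(1) g subsetD[OF U'n g] RU(2)])
    qed
    have e: "OE ?U (\<lambda>x. \<eta> (h x))" by (rule OE.H_comp[OF h(1) eta(1) hU])
    have e': "OE ?U' (\<lambda>x. \<eta> (h' x))" by (rule OE.H_comp[OF h'(1) eta(1) h'U])
    have eR: "(\<lambda>x. \<eta> (h x)) ` R = \<eta> ` ?R2" unfolding hR[symmetric] by (simp only: image_image)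
    have e'R: "(\<lambda>x. \<eta> (h' x)) ` ?R' = \<eta> ` ?R2" unfolding h'R[symmetric] by (simp only: image_image)
    have finT: "finite T" by (rule F.finite_subgroup[OF E.T])
    have UT: "?U \<subseteq> T" "?U' \<subseteq> T" using Un U'n E.nrmT by blast+
    have c1: "card V < card ?U" "card ?V' < card ?U'" "card ?U \<le> card T" "card ?U' \<le> card T"
      using psubset_card_mono[OF finite_subset[OF UT(1) finT] VU(1)] psubset_card_mono[OF finite_subset[OF UT(2) finT] VU(2)]
        card_mono[OF finT UT(1)] card_mono[OF finT UT(2)] by auto
    have X1: "extends_to_prod_CT R (\<eta> ` ?R2) (\<lambda>x. \<eta> (h x))"
      using less.hyps[OF _ less.prems(1) _ less.prems(3) e _ Un] eR eta(2) c1 VU RV by auto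
    have X2: "extends_to_prod_CT ?R' (\<eta> ` ?R2) (\<lambda>x. \<eta> (h' x))"
      using less.hyps[OF _ less.prems(2) _ cardR' e' _ U'n] e'R eta(2) c1 cardV' VU R'V' by auto
    have inj: "inj_on (\<lambda>x. \<eta> (h' x)) ?R'" by (rule inj_on_subset[OF OE.H_inj[OF e'] RU(2)])
    have X3: "extends_to_prod_CT R ?R' (\<lambda>x. inv_into ?R' (\<lambda>x. \<eta> (h' x)) (\<eta> (h x)))"
      by (rule extends_to_prod_CT_comp[OF X1 extends_to_prod_CT_inv[OF X2 inj]])
    show ?thesis
    proof (rule extends_to_prod_CT_cong[OF X3])
      fix x assume x: "x \<in> R"
      have y: "\<psi> x \<in> ?R'" using x by blast
      have "h x = h' (\<psi> x)" using h(2) h'(2) x y RV R'V' kD(3)[OF y] by auto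
      thus "inv_into ?R' (\<lambda>x. \<eta> (h' x)) (\<eta> (h x)) = \<psi> x"
        using inv_into_f_f[OF inj y] by simp
    qed
  qed
qed

text \<open>Receptivity of non-centric members of \<open>T_good\<close> is reduced to morphisms between such members: \<open>\<eta>\<close> and \<open>\<eta>'\<close> carry
  \<open>S\<close> and its image there. Quantifying over all choices makes the property provable by induction on \<open>OE\<close>.\<close>

definition compares :: "nat \<Rightarrow> 'a set \<Rightarrow> ('a \<Rightarrow> 'a) \<Rightarrow> bool" where
  "compares n U \<phi> \<longleftrightarrow> (\<forall>S \<eta> \<eta>'. subgroup S G \<longrightarrow> S \<subseteq> U \<longrightarrow> \<not> centric S \<longrightarrow> card S = n \<longrightarrow>
     OE (normalizer_in G T S) \<eta> \<longrightarrow> T_good (\<eta> ` S) \<longrightarrow> OE (normalizer_in G T (\<phi> ` S)) \<eta>' \<longrightarrow> T_good (\<eta>' ` \<phi> ` S) \<longrightarrow>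
     extends_to_prod_CT (\<eta> ` S) (\<eta>' ` \<phi> ` S) (\<lambda>y. \<eta>' (\<phi> (inv_into S \<eta> y))))"

lemma comparesD:
  assumes "compares n U \<phi>" "subgroup S G" "S \<subseteq> U" "\<not> centric S" "card S = n"
    "OE (normalizer_in G T S) \<eta>" "T_good (\<eta> ` S)" "OE (normalizer_in G T (\<phi> ` S)) \<eta>'" "T_good (\<eta>' ` \<phi> ` S)"
  shows "extends_to_prod_CT (\<eta> ` S) (\<eta>' ` \<phi> ` S) (\<lambda>y. \<eta>' (\<phi> (inv_into S \<eta> y)))"
  using assms unfolding compares_def by blast

lemma noncentric_img: assumes "FF S f" "\<not> centric S" shows "\<not> centric (f ` S)"
  using centric_img[of "f ` S" "inv_into S f"] FF_inv[OF assms(1) refl] assms(2) by auto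

text \<open>A noncentric S is proper in the centric U, so N_U(S) is strictly larger than S and
  \<phi> is defined on it; this is the overgroup from which extension over the centralizer
  starts.\<close>

lemma compares_centric:
  assumes IH: "\<And>R1. T_good R1 \<Longrightarrow> n < card R1 \<Longrightarrow> is_receptive G T OE R1"
    and U: "OE U \<phi>" "centric U"
  shows "compares n U \<phi>"
  unfolding compares_def
proof (intro allI impI)
  fix S \<eta> \<eta>'
  assume S: "subgroup S G" "S \<subseteq> U" "\<not> centric S" "card S = n"
    and e: "OE (normalizer_in G T S) \<eta>" "T_good (\<eta> ` S)" and e': "OE (normalizer_in G T (\<phi> ` S)) \<eta>'" "T_good (\<eta>' ` \<phi> ` S)"
  note Us = centric_sub[OF U(2)]
  have ST: "S \<subseteq> T" using S(2) Us(2) by blast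
  have SU: "S \<subset> U" using S(2,3) U(2) by blast
  let ?N = "normalizer_in G U S"
  have N: "subgroup ?N G" by (rule F.subgroup_normalizer_in[OF Us(1) S(1)])
  have NU: "?N \<subseteq> U" using F.normalizer_inD(1) by blast
  have SN: "S \<subset> ?N" by (rule F.normalizer_in_grows[OF Us(1) S(1) SU])
  have Nn: "?N \<subseteq> normalizer_in G T S" by (rule F.normalizer_in_mono[OF Us(2)])
  have eN: "OE ?N \<eta>" by (rule OE.H_restr[OF e(1) N Nn])
  have eS: "OE S \<eta>" by (rule OE.H_restr[OF e(1) S(1) E.sub_normalizer_in[OF S(1) ST]])
  let ?i = "inv_into ?N \<eta>"
  have i: "OE (\<eta> ` ?N) ?i" "?i ` \<eta> ` ?N = ?N" using OE.inv[OF eN] OE.H_inv_img[OF eN] by auto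
  have pN: "OE ?N \<phi>" by (rule OE.H_restr[OF U(1) N NU])
  have 1: "OE (\<eta> ` ?N) (\<lambda>y. \<phi> (?i y))" using OE.comp[OF i(1)] i(2) pN by simp
  have im: "(\<lambda>y. \<phi> (?i y)) ` \<eta> ` ?N = \<phi> ` ?N" using i(2) by (metis image_image)
  have pn: "\<phi> ` ?N \<subseteq> normalizer_in G T (\<phi> ` S)"
  proof (rule image_subsetI)
    fix g assume g: "g \<in> ?N"
    show "\<phi> g \<in> normalizer_in G T (\<phi> ` S)" by (rule OE.H_normalizer_in[OF pN g subsetD[OF Nn g]]) (use SN in blast)
  qed
  let ?\<psi> = "\<lambda>y. \<eta>' (\<phi> (?i y))"
  have psi: "OE (\<eta> ` ?N) ?\<psi>" by (rule OE.H_comp[OF 1 e'(1)]) (simp add: im pn)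
  have iS: "?i (\<eta> x) = x" if "x \<in> S" for x using OE.H_inv_l[OF eN, of x] that SN by blast
  have psiS: "?\<psi> ` \<eta> ` S = \<eta>' ` \<phi> ` S" unfolding image_image by (rule image_cong) (use iS in auto)
  have sub: "\<eta> ` S \<subset> \<eta> ` ?N"
  proof
    show "\<eta> ` S \<subseteq> \<eta> ` ?N" using SN by blast
    have "card (\<eta> ` S) < card (\<eta> ` ?N)"
      using psubset_card_mono[OF F.finite_subgroup[OF N] SN] OE.H_card[OF eN] OE.H_card[OF eS] by simp
    thus "\<eta> ` S \<noteq> \<eta> ` ?N" by auto
  qed
  have nn: "\<eta> ` ?N \<subseteq> normalizer_in G T (\<eta> ` S)"
  proof (rule image_subsetI)
    fix g assume g: "g \<in> ?N"
    show "\<eta> g \<in> normalizer_in G T (\<eta> ` S)" by (rule OE.H_normalizer_in[OF eN g subsetD[OF Nn g]]) (use SN in blast)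
  qed
  have "extends_to_prod_CT (\<eta> ` S) (?\<psi> ` \<eta> ` S) ?\<psi>"
    by (rule extends_to_prod_CT_if_extends[OF IH e(2) _ _ psi sub nn]) (use e'(2) psiS OE.H_card[OF eS] S(4) in simp_all)
  hence "extends_to_prod_CT (\<eta> ` S) (\<eta>' ` \<phi> ` S) ?\<psi>" unfolding psiS .
  thus "extends_to_prod_CT (\<eta> ` S) (\<eta>' ` \<phi> ` S) (\<lambda>y. \<eta>' (\<phi> (inv_into S \<eta> y)))"
  proof (rule extends_to_prod_CT_cong)
    fix y assume "y \<in> \<eta> ` S"
    then obtain x where x: "x \<in> S" "y = \<eta> x" by blast
    show "?\<psi> y = \<eta>' (\<phi> (inv_into S \<eta> y))" using iS[OF x(1)] OE.H_inv_l[OF eS x(1)] x(2) by simp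
  qed
qed

text \<open>Generators and \<open>ext\<close> live on centric subgroups. In a composite the middle
  subgroup receives an auxiliary \<eta>1, which cancels; this works because both induction
  hypotheses hold for every choice.\<close>

lemma compares_all:
  assumes IH: "\<And>R1. T_good R1 \<Longrightarrow> n < card R1 \<Longrightarrow> is_receptive G T OE R1"
  shows "OE U \<phi> \<Longrightarrow> compares n U \<phi>"
proof (induction rule: OE.induct)
  case (gen U t \<psi>)
  show ?case by (rule compares_centric[OF IH OE.gen[OF gen] gen(1)])
next
  case (ext \<alpha> Q)
  show ?case by (rule compares_centric[OF IH OE.ext[OF ext(1-3)] centric_T])
next
  case (congr Q f g)
  show ?case unfolding compares_def
  proof (intro allI impI)
    fix S \<eta> \<eta>'
    assume S: "subgroup S G" "S \<subseteq> Q" "\<not> centric S" "card S = n"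
      and e: "OE (normalizer_in G T S) \<eta>" "T_good (\<eta> ` S)" and e': "OE (normalizer_in G T (g ` S)) \<eta>'" "T_good (\<eta>' ` g ` S)"
    have fg: "f x = g x" if "x \<in> S" for x using congr(2) S(2) that by blast
    have im: "f ` S = g ` S" by (rule image_cong) (use fg in auto)
    have "extends_to_prod_CT (\<eta> ` S) (\<eta>' ` f ` S) (\<lambda>y. \<eta>' (f (inv_into S \<eta> y)))"
      by (rule comparesD[OF congr(3) S e]) (use e' im in simp_all)
    hence "extends_to_prod_CT (\<eta> ` S) (\<eta>' ` g ` S) (\<lambda>y. \<eta>' (f (inv_into S \<eta> y)))" unfolding im .
    thus "extends_to_prod_CT (\<eta> ` S) (\<eta>' ` g ` S) (\<lambda>y. \<eta>' (g (inv_into S \<eta> y)))"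
      by (rule extends_to_prod_CT_cong) (use fg inv_into_into[of _ \<eta> S] in auto)
  qed
next
  case (restr Q f Q')
  show ?case unfolding compares_def
  proof (intro allI impI)
    fix S \<eta> \<eta>'
    assume S: "subgroup S G" "S \<subseteq> Q'" "\<not> centric S" "card S = n"
      and e: "OE (normalizer_in G T S) \<eta>" "T_good (\<eta> ` S)" "OE (normalizer_in G T (f ` S)) \<eta>'" "T_good (\<eta>' ` f ` S)"
    show "extends_to_prod_CT (\<eta> ` S) (\<eta>' ` f ` S) (\<lambda>y. \<eta>' (f (inv_into S \<eta> y)))"
      by (rule comparesD[OF restr(4) S(1) _ S(3,4) e]) (use S(2) restr(3) in blast)
  qed
next
  case (comp Q f g)
  show ?case unfolding compares_def
  proof (intro allI impI)
    fix S \<eta> \<eta>'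
    assume S: "subgroup S G" "S \<subseteq> Q" "\<not> centric S" "card S = n"
      and e: "OE (normalizer_in G T S) \<eta>" "T_good (\<eta> ` S)"
      and e': "OE (normalizer_in G T ((\<lambda>x. g (f x)) ` S)) \<eta>'" "T_good (\<eta>' ` (\<lambda>x. g (f x)) ` S)"
    have im: "(\<lambda>x. g (f x)) ` S = g ` f ` S" by (simp add: image_image)
    have fS: "OE S f" by (rule OE.H_restr[OF comp(1) S(1,2)])
    have S1: "subgroup (f ` S) G" "f ` S \<subseteq> f ` Q" "\<not> centric (f ` S)" "card (f ` S) = n" "f ` S \<subseteq> T"
      using OE.H_img[OF fS] S(2) noncentric_img[OF OE_FF[OF fS] S(3)] OE.H_card[OF fS] S(4) OE.H_imgT[OF fS] by auto
    obtain \<eta>1 where e1: "OE (normalizer_in G T (f ` S)) \<eta>1" "T_good (\<eta>1 ` f ` S)" by (rule OE_normalizer_in_to_T_good[OF S1(1,5)])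
    have X1: "extends_to_prod_CT (\<eta> ` S) (\<eta>1 ` f ` S) (\<lambda>y. \<eta>1 (f (inv_into S \<eta> y)))"
      by (rule comparesD[OF comp(3) S e e1])
    have X2: "extends_to_prod_CT (\<eta>1 ` f ` S) (\<eta>' ` g ` f ` S) (\<lambda>y. \<eta>' (g (inv_into (f ` S) \<eta>1 y)))"
      by (rule comparesD[OF comp(4) S1(1-4) e1]) (use e' im in simp_all)
    have eS: "OE S \<eta>" by (rule OE.H_restr[OF e(1) S(1) E.sub_normalizer_in[OF S(1)]]) (use OE.H_subT[OF fS] in blast)
    have e1S: "OE (f ` S) \<eta>1" by (rule OE.H_restr[OF e1(1) S1(1) E.sub_normalizer_in[OF S1(1,5)]])
    have "extends_to_prod_CT (\<eta> ` S) (\<eta>' ` g ` f ` S) (\<lambda>y. \<eta>' (g (f (inv_into S \<eta> y))))"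
    proof (rule extends_to_prod_CT_cong[OF extends_to_prod_CT_comp[OF X1 X2]])
      fix y assume "y \<in> \<eta> ` S"
      then obtain x where x: "x \<in> S" "y = \<eta> x" by blast
      have "f x \<in> f ` S" using x by blast
      thus "\<eta>' (g (inv_into (f ` S) \<eta>1 (\<eta>1 (f (inv_into S \<eta> y))))) = \<eta>' (g (f (inv_into S \<eta> y)))"
        using OE.H_inv_l[OF eS x(1)] OE.H_inv_l[OF e1S] x(2) by simp
    qed
    thus "extends_to_prod_CT (\<eta> ` S) (\<eta>' ` (\<lambda>x. g (f x)) ` S) (\<lambda>y. \<eta>' (g (f (inv_into S \<eta> y))))" unfolding im .
  qed
next
  case (inv Q f)
  show ?case unfolding compares_def
  proof (intro allI impI)
    fix S \<eta> \<eta>'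
    let ?S = "inv_into Q f ` S"
    assume S: "subgroup S G" "S \<subseteq> f ` Q" "\<not> centric S" "card S = n"
      and e: "OE (normalizer_in G T S) \<eta>" "T_good (\<eta> ` S)" and e': "OE (normalizer_in G T ?S) \<eta>'" "T_good (\<eta>' ` ?S)"
    have iS: "OE S (inv_into Q f)" by (rule OE.H_restr[OF OE.inv[OF inv(1)] S(1,2)])
    have SQ: "?S \<subseteq> Q" using image_mono[OF S(2), of "inv_into Q f"] OE.H_inv_img[OF inv(1)] by simp
    have S1: "subgroup ?S G" "?S \<subseteq> Q" "\<not> centric ?S" "card ?S = n" "?S \<subseteq> T"
      using OE.H_img[OF iS] noncentric_img[OF OE_FF[OF iS] S(3)] OE.H_card[OF iS] S(4) OE.H_imgT[OF iS]
        SQ by auto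
    have fS: "f ` ?S = S"
    proof -
      have "f ` ?S = (\<lambda>x. x) ` S" unfolding image_image by (rule image_cong) (use S(2) f_inv_into_f[of _ f Q] in auto)
      thus ?thesis by simp
    qed
    have X: "extends_to_prod_CT (\<eta>' ` ?S) (\<eta> ` f ` ?S) (\<lambda>y. \<eta> (f (inv_into ?S \<eta>' y)))"
      by (rule comparesD[OF inv(2) S1(1-4) e']) (use e fS in simp_all)
    hence X': "extends_to_prod_CT (\<eta>' ` ?S) (\<eta> ` S) (\<lambda>y. \<eta> (f (inv_into ?S \<eta>' y)))" unfolding fS .
    have ST: "S \<subseteq> T" by (rule OE.H_subT[OF iS])
    have eS: "OE S \<eta>" by (rule OE.H_restr[OF e(1) S(1) E.sub_normalizer_in[OF S(1) ST]])
    have e'S: "OE ?S \<eta>'" by (rule OE.H_restr[OF e'(1) S1(1) E.sub_normalizer_in[OF S1(1,5)]])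
    have app: "\<eta> (f (inv_into ?S \<eta>' (\<eta>' (inv_into Q f x)))) = \<eta> x" if x: "x \<in> S" for x
    proof -
      have "inv_into Q f x \<in> ?S" "f (inv_into Q f x) = x" using x S(2) f_inv_into_f[of x f Q] by auto
      thus ?thesis using OE.H_inv_l[OF e'S] by simp
    qed
    have inj: "inj_on (\<lambda>y. \<eta> (f (inv_into ?S \<eta>' y))) (\<eta>' ` ?S)"
    proof (rule inj_onI)
      fix y z assume y: "y \<in> \<eta>' ` ?S" and z: "z \<in> \<eta>' ` ?S"
        and eq: "\<eta> (f (inv_into ?S \<eta>' y)) = \<eta> (f (inv_into ?S \<eta>' z))"
      obtain a where a: "a \<in> S" "y = \<eta>' (inv_into Q f a)" using y by blast
      obtain b where b: "b \<in> S" "z = \<eta>' (inv_into Q f b)" using z by blast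
      have "\<eta> a = \<eta> b" using eq app a b by simp
      thus "y = z" using OE.H_eq_iff[OF eS a(1) b(1)] a b by simp
    qed
    show "extends_to_prod_CT (\<eta> ` S) (\<eta>' ` ?S) (\<lambda>y. \<eta>' (inv_into Q f (inv_into S \<eta> y)))"
    proof (rule extends_to_prod_CT_cong[OF extends_to_prod_CT_inv[OF X' inj]])
      fix y assume "y \<in> \<eta> ` S"
      then obtain x where x: "x \<in> S" "y = \<eta> x" by blast
      have m: "\<eta>' (inv_into Q f x) \<in> \<eta>' ` ?S" using x by blast
      have "y = (\<lambda>y. \<eta> (f (inv_into ?S \<eta>' y))) (\<eta>' (inv_into Q f x))" using app[OF x(1)] x(2) by simp
      hence "inv_into (\<eta>' ` ?S) (\<lambda>y. \<eta> (f (inv_into ?S \<eta>' y))) y = \<eta>' (inv_into Q f x)"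
        using inv_into_f_f[OF inj m] by simp
      thus "inv_into (\<eta>' ` ?S) (\<lambda>y. \<eta> (f (inv_into ?S \<eta>' y))) y = \<eta>' (inv_into Q f (inv_into S \<eta> y))"
        using OE.H_inv_l[OF eS x(1)] x(2) by simp
    qed
  qed
qed

text \<open>In the noncentric case \<eta> moves S with its normalizer to a \<open>T_good\<close>
  subgroup, while the identity serves on the side of R. The map f \<eta>^-1 extends over the
  centralizer, hence over its whole extension domain, and this domain contains \<eta>(V).\<close>

lemma is_receptive_OE: "T_good R \<Longrightarrow> is_receptive G T OE R"
proof (induction "card T - card R" arbitrary: R rule: less_induct)
  case less
  note R = less.prems
  note Rs = T_good_sub(2,1)[OF R]
  have finT: "finite T" by (rule F.finite_subgroup[OF E.T])
  have IH: "is_receptive G T OE R1" if R1: "T_good R1" "card R < card R1" for R1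
    by (rule less.hyps[OF _ R1(1)]) (use R1(2) card_mono[OF finT T_good_sub(1)[OF R1(1)]] in linarith)
  show ?case
  proof (cases "centric R")
    case True thus ?thesis by (rule is_receptive_centric[OF R])
  next
    case False
    show ?thesis
    proof (rule OE.is_receptiveI)
      fix S f V assume f: "OE S f" "f ` S = R" and V: "subgroup V G" "S \<subseteq> V" "V \<subseteq> OE.ext_dom S R f"
      have S: "subgroup S G" "S \<subseteq> T" using OE.H_sub[OF f(1)] OE.H_subT[OF f(1)] by auto
      have nc: "\<not> centric S" using centric_img[OF _ OE_FF[OF f(1)]] f(2) False by blast
      obtain \<eta> where eta: "OE (normalizer_in G T S) \<eta>" "T_good (\<eta> ` S)" by (rule OE_normalizer_in_to_T_good[OF S])
      have idR: "OE (normalizer_in G T (f ` S)) (\<lambda>x. x)"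
        using OE.H_id[OF E.normalizer_in_sub[OF Rs(1)] E.nrmT] unfolding f(2) .
      let ?\<psi> = "\<lambda>y. f (inv_into S \<eta> y)"
      have "extends_to_prod_CT (\<eta> ` S) ((\<lambda>x. x) ` f ` S) (\<lambda>y. (\<lambda>x. x) (f (inv_into S \<eta> y)))"
        by (rule comparesD[OF compares_all[OF IH f(1)] S(1) subset_refl nc _ eta idR])
          (use OE.H_card[OF f(1)] f(2) R in simp_all)
      hence X: "extends_to_prod_CT (\<eta> ` S) R ?\<psi>" using f(2) by simp
      obtain h where h: "OE (OE.ext_dom (\<eta> ` S) R ?\<psi>) h" "\<forall>x\<in>\<eta> ` S. h x = ?\<psi> x" using extends_to_prod_CT_extend[OF X] by blast
      have Vn: "V \<subseteq> normalizer_in G T S" using V(3) OE.ext_dom_normalizer_in by blast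
      have eV: "OE V \<eta>" by (rule OE.H_restr[OF eta(1) V(1) Vn])
      have eS: "OE S \<eta>" by (rule OE.H_restr[OF eV S(1) V(2)])
      have sub: "\<eta> ` V \<subseteq> OE.ext_dom (\<eta> ` S) R ?\<psi>"
      proof (rule image_subsetI)
        fix g assume g: "g \<in> V"
        obtain u where u: "u \<in> normalizer_in G T R" "\<And>x. x \<in> S \<Longrightarrow> f (conj_by G g x) = conj_by G u (f x)"
          by (rule OE.ext_domD[OF subsetD[OF V(3) g]]) (rule that)
        have "\<eta> g \<in> normalizer_in G T (\<eta> ` S)" by (rule OE.H_normalizer_in[OF eV g subsetD[OF Vn g] V(2)])
        moreover have "?\<psi> (conj_by G (\<eta> g) y) = conj_by G u (?\<psi> y)" if y: "y \<in> \<eta> ` S" for y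
        proof -
          obtain x where x: "x \<in> S" "y = \<eta> x" using y by blast
          have c: "conj_by G g x \<in> S" using F.normalizer_inD(2)[of g T S x] g Vn x(1) by blast
          have "conj_by G (\<eta> g) y = \<eta> (conj_by G g x)" using OE.H_cjv[OF eV g, of x] x V(2) by auto
          thus ?thesis using OE.H_inv_l[OF eS c] OE.H_inv_l[OF eS x(1)] x(2) u(2)[OF x(1)] by simp
        qed
        ultimately show "\<eta> g \<in> OE.ext_dom (\<eta> ` S) R ?\<psi>" unfolding OE.ext_dom_def using u(1) by blast
      qed
      have "OE V (\<lambda>x. h (\<eta> x))" by (rule OE.H_comp[OF eV h(1) sub])
      moreover have "h (\<eta> x) = f x" if "x \<in> S" for x using h(2) that OE.H_inv_l[OF eS that] by simp
      ultimately show "\<exists>h. OE V h \<and> (\<forall>x\<in>S. h x = f x)" by blast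
    qed
  qed
qed

theorem OE_saturated: "OE.is_saturated"
  unfolding OE.is_saturated_def
proof (intro allI impI)
  fix Q assume Q: "subgroup Q G" "Q \<subseteq> T"
  obtain f where f: "OE Q f" "T_good (f ` Q)" by (rule T_good_exists_OE[OF Q])
  have "good p G T OE (f ` Q)"
    unfolding good_def using T_good_sub[OF f(2)] sylow_OE[OF f(2)] is_receptive_OE[OF f(2)] by blast
  thus "\<exists>f. OE Q f \<and> good p G T OE (f ` Q)" using f(1) by blast
qed

section \<open>Extension to the product with the centralizer\<close>

definition CP :: "'a set" where
  "CP = centralizer_in G (carrier G) T"

definition prod_CP :: "'a set \<Rightarrow> 'a set" where
  "prod_CP Q = Q <#> CP"

text \<open>A lift of f that is trivial modulo T. For Q = T it yields the commutator condition of
  normality, but it also makes sense on smaller Q, where it can be followed through the rules of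
  \<open>OE\<close>.\<close>

definition extends_mod_T :: "'a set \<Rightarrow> ('a \<Rightarrow> 'a) \<Rightarrow> bool" where
  "extends_mod_T Q f \<longleftrightarrow> (\<exists>h. FF (prod_CP Q) h \<and> (\<forall>x\<in>Q. h x = f x) \<and> (\<forall>y\<in>prod_CP Q. inv y \<otimes> h y \<in> T))"

lemma extends_mod_TE:
  assumes "extends_mod_T Q f"
  obtains h where "FF (prod_CP Q) h" "\<And>x. x \<in> Q \<Longrightarrow> h x = f x" "\<And>y. y \<in> prod_CP Q \<Longrightarrow> inv y \<otimes> h y \<in> T"
  using assms unfolding extends_mod_T_def by blast

lemma CP_sub: "subgroup CP G"
  unfolding CP_def by (rule F.centralizer_in_sub[OF E.T])

lemma CPG: "c \<in> CP \<Longrightarrow> c \<in> carrier G"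
  unfolding CP_def using F.centralizer_inD(1) by blast

lemma CP_comm: "c \<in> CP \<Longrightarrow> t \<in> T \<Longrightarrow> c \<otimes> t = t \<otimes> c"
  unfolding CP_def using F.centralizer_inD(2) by blast

lemma CP_conj_by: "c \<in> CP \<Longrightarrow> t \<in> T \<Longrightarrow> conj_by G t c = c" "c \<in> CP \<Longrightarrow> t \<in> T \<Longrightarrow> conj_by G c t = t"
  using CP_comm[of c t] CPG[of c] E.TG[of t] by (simp_all add: F.conj_by_commute)

lemma CP_centralizer_in: "Q \<subseteq> T \<Longrightarrow> CP \<subseteq> centralizer_in G (carrier G) Q"
  unfolding CP_def by (rule F.centralizer_in_mono(2))

lemma TC_centralizer_in: "Q \<subseteq> T \<Longrightarrow> t \<in> T \<Longrightarrow> t \<in> CP \<Longrightarrow> t \<in> centralizer_in G T Q"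
  unfolding CP_def centralizer_in_def by blast

lemma prod_CP_sub:
  assumes "subgroup Q G" "Q \<subseteq> T"
  shows "subgroup (prod_CP Q) G" "Q \<subseteq> prod_CP Q" "CP \<subseteq> prod_CP Q"
proof -
  show "subgroup (prod_CP Q) G" unfolding prod_CP_def
    by (rule F.subgroup_set_mult[OF assms(1) CP_sub]) (use CP_conj_by(1) assms(2) in auto)
  show "Q \<subseteq> prod_CP Q" "CP \<subseteq> prod_CP Q" unfolding prod_CP_def by (rule F.set_mult_sup[OF assms(1) CP_sub])+
qed

lemma prod_CP_mono: "Q \<subseteq> Q' \<Longrightarrow> prod_CP Q \<subseteq> prod_CP Q'"
  unfolding prod_CP_def set_mult_def by blast

lemma prod_CPE: assumes "y \<in> prod_CP Q" obtains q c where "q \<in> Q" "c \<in> CP" "y = q \<otimes> c"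
  using assms unfolding prod_CP_def set_mult_def by blast

lemma prod_CPI: "q \<in> Q \<Longrightarrow> c \<in> CP \<Longrightarrow> q \<otimes> c \<in> prod_CP Q"
  unfolding prod_CP_def by (rule F.set_mult_mem)

text \<open>An element of C_P(T) inside T centralizes Q, and so lies in Q.\<close>

lemma prod_CP_T: assumes "centric Q" "y \<in> prod_CP Q" "y \<in> T" shows "y \<in> Q"
proof -
  note Qs = centric_sub[OF assms(1)]
  obtain q c where qc: "q \<in> Q" "c \<in> CP" "y = q \<otimes> c" by (rule prod_CPE[OF assms(2)])
  have q: "q \<in> T" "q \<in> carrier G" "inv q \<in> T" using qc(1) Qs(2) E.TG E.T by (auto simp: subgroup.m_inv_closed)
  have "c = inv q \<otimes> y" using qc(3) q(2) CPG[OF qc(2)] by simp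
  hence "c \<in> T" using q(3) assms(3) E.T by (simp add: subgroup.m_closed)
  hence "c \<in> Q" using TC_centralizer_in[OF Qs(2) _ qc(2)] centric_centralizer_in[OF assms(1)] by blast
  thus ?thesis using qc Qs(1) by (simp add: subgroup.m_closed)
qed

lemma extends_mod_T_cong: assumes "extends_mod_T Q f" "\<And>x. x \<in> Q \<Longrightarrow> f x = g x" shows "extends_mod_T Q g"
proof -
  obtain h where "FF (prod_CP Q) h" "\<And>x. x \<in> Q \<Longrightarrow> h x = f x" "\<And>y. y \<in> prod_CP Q \<Longrightarrow> inv y \<otimes> h y \<in> T"
    by (rule extends_mod_TE[OF assms(1)]) (rule that)
  thus ?thesis unfolding extends_mod_T_def using assms(2) by (intro exI[of _ h]) auto
qed

lemma extends_mod_T_restr: assumes "extends_mod_T Q f" "subgroup Q' G" "Q' \<subseteq> Q" "Q \<subseteq> T" shows "extends_mod_T Q' f"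
proof -
  obtain h where h: "FF (prod_CP Q) h" "\<And>x. x \<in> Q \<Longrightarrow> h x = f x" "\<And>y. y \<in> prod_CP Q \<Longrightarrow> inv y \<otimes> h y \<in> T"
    by (rule extends_mod_TE[OF assms(1)]) (rule that)
  have Q'T: "Q' \<subseteq> T" using assms by blast
  have "FF (prod_CP Q') h" by (rule F.H_restr[OF h(1) prod_CP_sub(1)[OF assms(2) Q'T] prod_CP_mono[OF assms(3)]])
  thus ?thesis unfolding extends_mod_T_def using h(2,3) assms(3) prod_CP_mono[OF assms(3)] by (intro exI[of _ h]) auto
qed

text \<open>Both c and h(c) centralize h(Q), hence so does t = c^-1 h(c); being in T, it lies in
  h(Q) by centricity. Thus h moves C_P(T) only by elements of h(Q), and Q C_P(T) goes onto h(Q)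
  C_P(T).\<close>

lemma lift_shift:
  assumes Q: "centric Q" and h: "FF (prod_CP Q) h" "\<And>y. y \<in> prod_CP Q \<Longrightarrow> inv y \<otimes> h y \<in> T" and c: "c \<in> CP"
  obtains t where "t \<in> h ` Q" "h c = t \<otimes> c" "t \<in> T"
proof -
  note Qs = centric_sub[OF Q]
  note K = prod_CP_sub[OF Qs]
  have hQ: "FF Q h" by (rule F.H_restr[OF h(1) Qs(1) K(2)])
  have cK: "c \<in> prod_CP Q" using c K(3) by blast
  have hQT: "h ` Q \<subseteq> T" by (rule closed[OF hQ Qs(2)])
  let ?t = "inv c \<otimes> h c"
  have tT: "?t \<in> T" by (rule h(2)[OF cK])
  have G: "c \<in> carrier G" "h c \<in> carrier G" "?t \<in> carrier G" using CPG[OF c] F.H_mem(2)[OF h(1) cK] by auto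
  have e: "h c = ?t \<otimes> c" using CP_comm[OF c tT] G by simp
  have "h c \<in> centralizer_in G (carrier G) (h ` Q)"
    by (rule F.H_centralizer_in[OF h(1) cK _ K(2)]) (use CP_centralizer_in[OF Qs(2)] c in blast)
  moreover have "inv c \<in> centralizer_in G (carrier G) (h ` Q)"
    using CP_centralizer_in[OF hQT] c subgroup.m_inv_closed[OF CP_sub c] by blast
  ultimately have "?t \<in> centralizer_in G (carrier G) (h ` Q)"
    using subgroup.m_closed[OF F.centralizer_in_sub[OF F.H_img[OF hQ]]] by blast
  hence "?t \<in> centralizer_in G T (h ` Q)" using tT unfolding centralizer_in_def by blast
  hence "?t \<in> h ` Q" using centricD[OF Q hQ] by blast
  thus ?thesis using that e tT by blast
qed

lemma lift_img:
  assumes Q: "centric Q" and h: "FF (prod_CP Q) h" "\<And>y. y \<in> prod_CP Q \<Longrightarrow> inv y \<otimes> h y \<in> T"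
  shows "h ` prod_CP Q = prod_CP (h ` Q)"
proof -
  note Qs = centric_sub[OF Q]
  note K = prod_CP_sub[OF Qs]
  have hQ: "FF Q h" by (rule F.H_restr[OF h(1) Qs(1) K(2)])
  have hQs: "subgroup (h ` Q) G" "h ` Q \<subseteq> T" using F.H_img[OF hQ] closed[OF hQ Qs(2)] by auto
  show ?thesis
  proof
    show "h ` prod_CP Q \<subseteq> prod_CP (h ` Q)"
    proof (rule image_subsetI)
      fix y assume "y \<in> prod_CP Q"
      then obtain q c where qc: "q \<in> Q" "c \<in> CP" "y = q \<otimes> c" by (rule prod_CPE)
      obtain t where t: "t \<in> h ` Q" "h c = t \<otimes> c" "t \<in> T" by (rule lift_shift[OF Q h qc(2)])
      have m: "q \<in> prod_CP Q" "c \<in> prod_CP Q" using qc K by blast+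
      have "h y = h q \<otimes> t \<otimes> c"
        unfolding qc(3) using F.H_mult[OF h(1) m] t(2,3) F.H_mem(2)[OF h(1) m(1)] CPG[OF qc(2)] E.TG
        by (simp add: F.m_assoc)
      moreover have "h q \<otimes> t \<in> h ` Q" using subgroup.m_closed[OF hQs(1) _ t(1)] qc(1) by blast
      ultimately show "h y \<in> prod_CP (h ` Q)" using prod_CPI[OF _ qc(2)] by simp
    qed
    show "prod_CP (h ` Q) \<subseteq> h ` prod_CP Q"
    proof
      fix y assume "y \<in> prod_CP (h ` Q)"
      then obtain q c where qc: "q \<in> h ` Q" "c \<in> CP" "y = q \<otimes> c" by (rule prod_CPE)
      obtain t where t: "t \<in> h ` Q" "h c = t \<otimes> c" "t \<in> T" by (rule lift_shift[OF Q h qc(2)])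
      have s: "subgroup (h ` prod_CP Q) G" by (rule F.H_img[OF h(1)])
      have i: "q \<in> h ` prod_CP Q" "t \<in> h ` prod_CP Q" "h c \<in> h ` prod_CP Q" using qc t(1) K(2,3) by blast+
      have "c = inv t \<otimes> h c" using t(2,3) E.TG CPG[OF qc(2)] by simp
      hence "c \<in> h ` prod_CP Q" using subgroup.m_closed[OF s subgroup.m_inv_closed[OF s i(2)] i(3)] by simp
      thus "y \<in> h ` prod_CP Q" unfolding qc(3) using subgroup.m_closed[OF s i(1)] by blast
    qed
  qed
qed

lemma extends_mod_T_comp:
  assumes Q: "centric Q" and f: "extends_mod_T Q f" "extends_mod_T (f ` Q) g"
  shows "extends_mod_T Q (\<lambda>x. g (f x))"
proof -
  obtain h where h: "FF (prod_CP Q) h" "\<And>x. x \<in> Q \<Longrightarrow> h x = f x" "\<And>y. y \<in> prod_CP Q \<Longrightarrow> inv y \<otimes> h y \<in> T"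
    by (rule extends_mod_TE[OF f(1)]) (rule that)
  obtain k where k: "FF (prod_CP (f ` Q)) k" "\<And>x. x \<in> f ` Q \<Longrightarrow> k x = g x" "\<And>y. y \<in> prod_CP (f ` Q) \<Longrightarrow> inv y \<otimes> k y \<in> T"
    by (rule extends_mod_TE[OF f(2)]) (rule that)
  have "h ` Q = f ` Q" by (rule image_cong) (use h(2) in auto)
  hence im: "h ` prod_CP Q = prod_CP (f ` Q)" using lift_img[OF Q h(1,3)] by simp
  note hk = FF_comp(1)[OF h(1) im k(1)]
  have "inv y \<otimes> k (h y) \<in> T" if y: "y \<in> prod_CP Q" for y
  proof -
    have hy: "h y \<in> prod_CP (f ` Q)" using y im by blast
    have G: "y \<in> carrier G" "h y \<in> carrier G" "k (h y) \<in> carrier G"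
      using F.H_mem(1,2)[OF h(1) y] F.H_mem(2)[OF k(1) hy] by auto
    have "inv y \<otimes> k (h y) = (inv y \<otimes> h y) \<otimes> (inv (h y) \<otimes> k (h y))" using G by (simp add: F.m_assoc)
    thus ?thesis using subgroup.m_closed[OF E.T h(3)[OF y] k(3)[OF hy]] by simp
  qed
  thus ?thesis unfolding extends_mod_T_def using hk h(2) k(2) by (intro exI[of _ "\<lambda>x. k (h x)"]) auto
qed

lemma extends_mod_T_inv:
  assumes Q: "centric Q" and f: "extends_mod_T Q f"
  shows "extends_mod_T (f ` Q) (inv_into Q f)"
proof -
  obtain h where h: "FF (prod_CP Q) h" "\<And>x. x \<in> Q \<Longrightarrow> h x = f x" "\<And>y. y \<in> prod_CP Q \<Longrightarrow> inv y \<otimes> h y \<in> T"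
    by (rule extends_mod_TE[OF f]) (rule that)
  have "h ` Q = f ` Q" by (rule image_cong) (use h(2) in auto)
  hence im: "h ` prod_CP Q = prod_CP (f ` Q)" using lift_img[OF Q h(1,3)] by simp
  note i = FF_inv[OF h(1) im]
  have K: "Q \<subseteq> prod_CP Q" by (rule prod_CP_sub(2)[OF centric_sub[OF Q]])
  have injf: "inj_on f Q" using inj_on_subset[OF F.H_inj[OF h(1)] K] h(2) by (metis inj_on_cong)
  have "inv y \<otimes> inv_into (prod_CP Q) h y \<in> T" if y: "y \<in> prod_CP (f ` Q)" for y
  proof -
    obtain z where z: "z \<in> prod_CP Q" "y = h z" using y im by blast
    have G: "z \<in> carrier G" "h z \<in> carrier G" using F.H_mem(1,2)[OF h(1) z(1)] by auto
    have "inv y \<otimes> inv_into (prod_CP Q) h y = inv (inv z \<otimes> h z)"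
      using F.H_inv_l[OF h(1) z(1)] z(2) G by (simp add: F.inv_mult_group)
    thus ?thesis using subgroup.m_inv_closed[OF E.T h(3)[OF z(1)]] by simp
  qed
  moreover have "inv_into (prod_CP Q) h y = inv_into Q f y" if y: "y \<in> f ` Q" for y
  proof -
    obtain x where x: "x \<in> Q" "y = f x" using y by blast
    have "inv_into (prod_CP Q) h y = x" using F.H_inv_l[OF h(1), of x] h(2)[OF x(1)] x K by auto
    thus ?thesis using inv_into_f_f[OF injf x(1)] x(2) by simp
  qed
  ultimately show ?thesis unfolding extends_mod_T_def using i(1) by blast
qed

text \<open>C_P(V) acts trivially on V, so it lies in the extension domain of every automorphism of
  V.\<close>

lemma F_good_centralizer_in_ext:
  assumes V: "good p G (carrier G) FF V" and f: "FF V f" "f ` V = V"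
  obtains h where "FF (centralizer_in G (carrier G) V <#> V) h" "\<And>x. x \<in> V \<Longrightarrow> h x = f x"
    "h ` (centralizer_in G (carrier G) V <#> V) = centralizer_in G (carrier G) V <#> V"
proof -
  let ?C = "centralizer_in G (carrier G) V"
  have Vs: "subgroup V G" "is_receptive G (carrier G) FF V" using V unfolding good_def by auto
  have VG: "V \<subseteq> carrier G" by (rule subgroup.subset[OF Vs(1)])
  have Cs: "subgroup ?C G" by (rule F.centralizer_in_sub[OF Vs(1)])
  have ext_dom: "?C \<subseteq> F.ext_dom V V f"
  proof
    fix c assume c: "c \<in> ?C"
    have "c \<in> normalizer_in G (carrier G) V" using c F.centralizer_in_sub_normalizer_in[OF F.T VG] by blast
    moreover have "\<one> \<in> normalizer_in G (carrier G) V" by (rule subgroup.one_closed[OF F.normalizer_in_sub[OF Vs(1)]])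
    moreover have "f (conj_by G c x) = conj_by G \<one> (f x)" if "x \<in> V" for x
      using F.centralizer_in_conj_by[OF F.T VG F.centralizer_inD(1)[OF c]] c that F.H_mem(2)[OF f(1) that] by simp
    ultimately show "c \<in> F.ext_dom V V f" unfolding F.ext_dom_def by blast
  qed
  obtain h where h: "FF (?C <#> V) h" "\<And>x. x \<in> V \<Longrightarrow> h x = f x"
    by (rule F.is_receptive_mult[OF Vs(2) f Cs ext_dom]) (rule that)
  have hV: "h ` V = V" using f(2) h(2) by (metis image_cong)
  have sup: "?C \<subseteq> ?C <#> V" "V \<subseteq> ?C <#> V" by (rule F.set_mult_sup[OF Cs Vs(1)])+
  have "h ` (?C <#> V) \<subseteq> ?C <#> V"
  proof (rule image_subsetI)
    fix y assume "y \<in> ?C <#> V"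
    then obtain c v where cv: "c \<in> ?C" "v \<in> V" "y = c \<otimes> v" unfolding set_mult_def by blast
    have m: "c \<in> ?C <#> V" "v \<in> ?C <#> V" using cv(1,2) sup by blast+
    have "h c \<in> centralizer_in G (carrier G) (h ` V)" by (rule F.H_centralizer_in[OF h(1) m(1) cv(1) sup(2)])
    hence "h c \<in> ?C" "h v \<in> V" using hV cv(2) by auto
    thus "h y \<in> ?C <#> V" unfolding cv(3) F.H_mult[OF h(1) m] by (rule F.set_mult_mem)
  qed
  hence "h ` (?C <#> V) = ?C <#> V" by (rule endo_inj_surj[OF F.H_fin[OF h(1)] _ F.H_inj[OF h(1)]])
  thus ?thesis using that h by blast
qed

lemma commutator_T:
  assumes "y \<in> carrier G" "t \<in> T" shows "inv y \<otimes> conj_by G t y \<in> T"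
proof -
  have t: "t \<in> carrier G" "inv t \<in> T" using assms(2) E.TG E.T by (auto simp: subgroup.m_inv_closed)
  have "inv y \<otimes> conj_by G t y = conj_by G y (inv t) \<otimes> t" unfolding conj_by_def using assms(1) t(1) by (simp add: F.m_assoc)
  thus ?thesis using subgroup.m_closed[OF E.T T_normal[OF assms(1) t(2)] assms(2)] by simp
qed

text \<open>Let h extend \<psi> to W = C_P(V) V; it need not be trivial modulo T, but k = h c_t h^-1
  is. For y = h(w) the shift y^-1 k(y) is h applied to the commutator of w and t, which lies in T as
  T is normal and stays in T as T is strongly closed.\<close>

lemma extends_mod_T_F_good:
  assumes V: "good p G (carrier G) FF V" "V \<subseteq> T" and f: "FF V \<psi>" "\<psi> ` V = V" and t: "t \<in> normalizer_in G T V"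
  shows "extends_mod_T V (conj_fun V \<psi> (conj_by G t))"
proof -
  let ?C = "centralizer_in G (carrier G) V"
  let ?W = "?C <#> V"
  obtain h where h: "FF ?W h" "\<And>x. x \<in> V \<Longrightarrow> h x = \<psi> x" "h ` ?W = ?W"
    by (rule F_good_centralizer_in_ext[OF V(1) f]) (rule that)
  have Vs: "subgroup V G" using V unfolding good_def by auto
  have Cs: "subgroup ?C G" by (rule F.centralizer_in_sub[OF Vs(1)])
  have sup: "?C \<subseteq> ?W" "V \<subseteq> ?W" by (rule F.set_mult_sup[OF Cs Vs])+
  have Ws: "subgroup ?W G" by (rule F.H_sub[OF h(1)])
  have WG: "?W \<subseteq> carrier G" by (rule subgroup.subset[OF Ws])
  have tT: "t \<in> T" by (rule F.normalizer_inD(1)[OF t])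
  have tG: "t \<in> carrier G" using tT E.TG by blast
  have tV: "conj_by G t ` V = V" using t unfolding normalizer_in_def by blast
  have cjW: "FF ?W (conj_by G t)" by (rule F.H_conj_by[OF Ws WG tG])
  have "conj_by G t y \<in> ?W" if "y \<in> ?W" for y
  proof -
    obtain c v where cv: "c \<in> ?C" "v \<in> V" "y = c \<otimes> v" using \<open>y \<in> ?W\<close> unfolding set_mult_def by blast
    have m: "c \<in> ?W" "v \<in> ?W" using cv(1,2) sup by blast+
    have "conj_by G t c \<in> centralizer_in G (carrier G) (conj_by G t ` V)" by (rule F.H_centralizer_in[OF cjW m(1) cv(1) sup(2)])
    hence "conj_by G t c \<in> ?C" "conj_by G t v \<in> V" using tV cv(2) by auto
    thus ?thesis unfolding cv(3) F.H_mult[OF cjW m] by (rule F.set_mult_mem)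
  qed
  hence tW: "conj_by G t ` ?W = ?W" by (intro F.finite_normalizer_inI[OF F.H_fin[OF h(1)] WG tG])
  note hi = FF_inv[OF h(1,3)]
  let ?k = "\<lambda>y. h (conj_by G t (inv_into ?W h y))"
  have "FF ?W (\<lambda>y. conj_by G t (inv_into ?W h y))" "(\<lambda>y. conj_by G t (inv_into ?W h y)) ` ?W = ?W"
    using FF_comp[OF hi cjW] tW by auto
  from FF_comp(1)[OF this h(1)] have k: "FF ?W ?k" .
  have KW: "prod_CP V \<subseteq> ?W"
    unfolding prod_CP_def by (rule F.set_mult_least[OF Ws sup(2)]) (use CP_centralizer_in[OF V(2)] sup(1) in blast)
  have kK: "FF (prod_CP V) ?k" by (rule F.H_restr[OF k prod_CP_sub(1)[OF Vs V(2)] KW])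
  have hT: "h w \<in> T" if "w \<in> ?W" "w \<in> T" for w
  proof -
    have s: "subgroup (?W \<inter> T) G" by (rule F.subgroups_Inter_pair[OF Ws E.T])
    have "FF (?W \<inter> T) h" by (rule F.H_restr[OF h(1) s]) blast
    from closed[OF this] show ?thesis using that by blast
  qed
  have "inv y \<otimes> ?k y \<in> T" if y: "y \<in> ?W" for y
  proof -
    obtain w where w: "w \<in> ?W" "y = h w" using y h(3) by blast
    have wG: "w \<in> carrier G" using w WG by blast
    have cw: "conj_by G t w \<in> ?W" using w(1) tW by blast
    have iw: "inv w \<in> ?W" by (rule subgroup.m_inv_closed[OF Ws w(1)])
    have "inv y \<otimes> ?k y = h (inv w \<otimes> conj_by G t w)"
      unfolding w(2) F.H_inv_l[OF h(1) w(1)] F.H_mult[OF h(1) iw cw] F.H_minv[OF h(1) w(1)] ..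
    moreover have "inv w \<otimes> conj_by G t w \<in> ?W" by (rule subgroup.m_closed[OF Ws iw cw])
    ultimately show ?thesis using hT commutator_T[OF wG tT] by simp
  qed
  moreover have "?k x = conj_fun V \<psi> (conj_by G t) x" if x: "x \<in> V" for x
  proof -
    obtain z where z: "z \<in> V" "x = \<psi> z" using x f(2) by blast
    have c: "conj_by G t z \<in> V" using tV z(1) by blast
    have "?k (h z) = h (conj_by G t z)" using F.H_inv_l[OF h(1), of z] z(1) sup(2) by auto
    thus ?thesis using conj_fun_apply[OF F.H_inj[OF f(1)] z(1), of "conj_by G t"] h(2)[OF z(1)] h(2)[OF c] z(2) by simp
  qed
  ultimately show ?thesis unfolding extends_mod_T_def using kK KW by (intro exI[of _ ?k]) auto
qed

text \<open>T is the only member of its F-class and so is good in F; hence \<alpha> extends over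
  C_P(T). The extension preserves C_P(T) but may act nontrivially modulo T.\<close>

lemma L_ext:
  assumes a: "FF T \<alpha>"
  obtains b where "FF (prod_CP T) b" "\<And>x. x \<in> T \<Longrightarrow> b x = \<alpha> x" "b ` prod_CP T = prod_CP T"
    "\<And>V. subgroup V G \<Longrightarrow> V \<subseteq> T \<Longrightarrow> b ` prod_CP V = prod_CP (\<alpha> ` V)"
proof -
  let ?C = "centralizer_in G (carrier G) T"
  obtain f where f: "FF T f" "good p G (carrier G) FF (f ` T)" using F.is_saturatedE[OF F_sat E.T E.T_sub] by blast
  have g: "good p G (carrier G) FF T" using f(2) autT(1)[OF f(1)] by simp
  obtain h where h: "FF (?C <#> T) h" "\<And>x. x \<in> T \<Longrightarrow> h x = \<alpha> x" "h ` (?C <#> T) = ?C <#> T"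
    by (rule F_good_centralizer_in_ext[OF g a autT(1)[OF a]]) (rule that)
  have e: "?C <#> T = prod_CP T"
  proof -
    have "c \<otimes> t \<in> prod_CP T \<and> t \<otimes> c \<in> ?C <#> T" if "c \<in> CP" "t \<in> T" for c t
    proof -
      have "t \<otimes> c \<in> prod_CP T" "c \<otimes> t \<in> ?C <#> T"
        using prod_CPI[OF that(2,1)] F.set_mult_mem[of c ?C t T] that unfolding CP_def by auto
      thus ?thesis using CP_comm[OF that] by simp
    qed
    thus ?thesis unfolding prod_CP_def CP_def set_mult_def by blast
  qed
  note K = prod_CP_sub[OF E.T subset_refl]
  have hK: "FF (prod_CP T) h" using h(1) unfolding e .
  have hT: "h ` T = T" using autT(1)[OF a] h(2) by (metis image_cong)
  have "h ` CP \<subseteq> CP"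
  proof (rule image_subsetI)
    fix c assume c: "c \<in> CP"
    have "h c \<in> centralizer_in G (carrier G) (h ` T)"
      by (rule F.H_centralizer_in[OF hK _ _ K(2)]) (use c K(3) in \<open>auto simp: CP_def\<close>)
    thus "h c \<in> CP" unfolding hT CP_def .
  qed
  hence hC: "h ` CP = CP"
    by (rule endo_inj_surj[OF F.finite_subgroup[OF CP_sub] _ F.H_inj[OF F.H_restr[OF hK CP_sub K(3)]]])
  have hV: "h ` prod_CP V = prod_CP (\<alpha> ` V)" if V: "subgroup V G" "V \<subseteq> T" for V
  proof -
    have m: "h (v \<otimes> c) = \<alpha> v \<otimes> h c" if "v \<in> V" "c \<in> CP" for v c
    proof -
      have "v \<in> prod_CP T" "c \<in> prod_CP T" "v \<in> T" using that V K by blast+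
      thus ?thesis using F.H_mult[OF hK] h(2) by simp
    qed
    show ?thesis
    proof
      show "h ` prod_CP V \<subseteq> prod_CP (\<alpha> ` V)"
      proof (rule image_subsetI)
        fix y assume "y \<in> prod_CP V"
        then obtain v c where vc: "v \<in> V" "c \<in> CP" "y = v \<otimes> c" by (rule prod_CPE)
        show "h y \<in> prod_CP (\<alpha> ` V)" unfolding vc(3) m[OF vc(1,2)] by (rule prod_CPI) (use vc hC in blast)+
      qed
      show "prod_CP (\<alpha> ` V) \<subseteq> h ` prod_CP V"
      proof
        fix y assume "y \<in> prod_CP (\<alpha> ` V)"
        then obtain v c where vc: "v \<in> \<alpha> ` V" "c \<in> CP" "y = v \<otimes> c" by (rule prod_CPE)
        obtain v' where v': "v' \<in> V" "v = \<alpha> v'" using vc(1) by blast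
        obtain c' where c': "c' \<in> CP" "c = h c'" using vc(2) hC by blast
        have "y = h (v' \<otimes> c')" using m[OF v'(1) c'(1)] vc(3) v'(2) c'(2) by simp
        thus "y \<in> h ` prod_CP V" using prod_CPI[OF v'(1) c'(1)] by blast
      qed
    qed
  qed
  show ?thesis by (rule that[OF hK h(2) h(3)[unfolded e] hV])
qed

text \<open>The lift is conjugated by an extension b of \<beta> to T C_P(T); a shift t in T becomes
  \<beta>(t), again in T.\<close>

lemma extends_mod_T_autT:
  assumes b: "FF T \<beta>" and V: "subgroup V G" "V \<subseteq> T" "f ` V \<subseteq> T" and f: "extends_mod_T V f"
  shows "extends_mod_T (\<beta> ` V) (conj_fun T \<beta> f)"
proof -
  obtain h where h: "FF (prod_CP V) h" "\<And>x. x \<in> V \<Longrightarrow> h x = f x" "\<And>y. y \<in> prod_CP V \<Longrightarrow> inv y \<otimes> h y \<in> T"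
    by (rule extends_mod_TE[OF f]) (rule that)
  obtain b where b': "FF (prod_CP T) b" "\<And>x. x \<in> T \<Longrightarrow> b x = \<beta> x" "b ` prod_CP T = prod_CP T"
    "\<And>V. subgroup V G \<Longrightarrow> V \<subseteq> T \<Longrightarrow> b ` prod_CP V = prod_CP (\<beta> ` V)" by (rule L_ext[OF b]) (rule that)
  note K = prod_CP_sub[OF E.T subset_refl]
  have KV: "prod_CP V \<subseteq> prod_CP T" by (rule prod_CP_mono[OF V(2)])
  have bV: "FF (prod_CP V) b" by (rule F.H_restr[OF b'(1) prod_CP_sub(1)[OF V(1,2)] KV])
  note bi = FF_inv[OF bV b'(4)[OF V(1,2)]]
  have hy: "h y = y \<otimes> (inv y \<otimes> h y)" "h y \<in> prod_CP T" if y: "y \<in> prod_CP V" for y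
  proof -
    show e: "h y = y \<otimes> (inv y \<otimes> h y)" using F.H_mem(1,2)[OF h(1) y] by simp
    have "y \<otimes> (inv y \<otimes> h y) \<in> prod_CP T"
      by (rule subgroup.m_closed[OF K(1) subsetD[OF KV y] subsetD[OF K(2) h(3)[OF y]]])
    thus "h y \<in> prod_CP T" unfolding e[symmetric] .
  qed
  have hKT: "h ` prod_CP V \<subseteq> prod_CP T" using hy(2) by blast
  let ?k = "\<lambda>w. b (h (inv_into (prod_CP V) b w))"
  have 1: "FF (prod_CP (\<beta> ` V)) (\<lambda>w. h (inv_into (prod_CP V) b w))" "(\<lambda>w. h (inv_into (prod_CP V) b w)) ` prod_CP (\<beta> ` V) = h ` prod_CP V"
    using FF_comp[OF bi h(1)] by auto
  have k: "FF (prod_CP (\<beta> ` V)) ?k" by (rule F.H_comp[OF 1(1) b'(1)]) (use 1(2) hKT in blast)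
  have "inv w \<otimes> ?k w \<in> T" if w: "w \<in> prod_CP (\<beta> ` V)" for w
  proof -
    obtain y where y: "y \<in> prod_CP V" "w = b y" using w b'(4)[OF V(1,2)] by blast
    have yT: "y \<in> prod_CP T" using y KV by blast
    have t: "inv y \<otimes> h y \<in> T" "inv y \<otimes> h y \<in> prod_CP T" using h(3)[OF y(1)] K(2) by blast+
    have G: "b y \<in> carrier G" "b (inv y \<otimes> h y) \<in> carrier G"
      using F.H_mem(2)[OF b'(1)] yT t(2) by auto
    have "?k w = b (h y)" using F.H_inv_l[OF bV y(1)] y(2) by simp
    also have "\<dots> = b y \<otimes> b (inv y \<otimes> h y)" by (subst hy(1)[OF y(1)]) (rule F.H_mult[OF b'(1) yT t(2)])
    finally have "inv w \<otimes> ?k w = b (inv y \<otimes> h y)" using y(2) G by simp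
    thus ?thesis using b'(2)[OF t(1)] autT_memT[OF b t(1)] by simp
  qed
  moreover have "?k w = conj_fun T \<beta> f w" if w: "w \<in> \<beta> ` V" for w
  proof -
    obtain v where v: "v \<in> V" "w = \<beta> v" using w by blast
    have vT: "v \<in> T" "f v \<in> T" using v V(2,3) by blast+
    have vK: "v \<in> prod_CP V" using v(1) prod_CP_sub(2)[OF V(1,2)] by blast
    have "inv_into (prod_CP V) b w = v" using F.H_inv_l[OF bV vK] b'(2)[OF vT(1)] v(2) by simp
    thus ?thesis using conj_fun_apply[OF F.H_inj[OF b] vT(1), of f] h(2)[OF v(1)] b'(2)[OF vT(2)] v(2) by simp
  qed
  ultimately show ?thesis unfolding extends_mod_T_def using k by (intro exI[of _ ?k]) auto
qed

text \<open>An automorphism \<alpha> of T moves U to an F-good subgroup, where the generator has a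
  lift; the inverse of \<alpha> brings the lift back.\<close>

lemma extends_mod_T_gen:
  assumes U: "T_good U" "t \<in> normalizer_in G T U" "EE U \<psi>" "\<psi> ` U = U"
  shows "extends_mod_T U (conj_fun U \<psi> (conj_by G t))"
proof -
  note Us = T_good_sub(2,1)[OF U(1)]
  obtain \<alpha> where a: "FF T \<alpha>" "good p G (carrier G) FF (\<alpha> ` U)" using U(1) unfolding T_good_def by blast
  let ?V = "\<alpha> ` U" and ?\<psi> = "conj_fun T \<alpha> \<psi>" and ?\<beta> = "inv_into T \<alpha>"
  have inj: "inj_on \<alpha> T" by (rule F.H_inj[OF a(1)])
  have aU: "FF U \<alpha>" by (rule F.H_restr[OF a(1) Us])
  have Vs: "subgroup ?V G" "?V \<subseteq> T" using F.H_img[OF aU] closed[OF aU Us(2)] by auto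
  have psi: "FF ?V ?\<psi>" by (rule E_F[OF stableT[OF E_stable[OF a(1) subset_refl] U(3)]])
  have app: "?\<psi> (\<alpha> z) = \<alpha> (\<psi> z)" if "z \<in> U" for z using conj_fun_apply[OF inj, of z \<psi>] Us(2) that by blast
  have psiV: "?\<psi> ` ?V = ?V"
  proof -
    have "?\<psi> ` ?V = \<alpha> ` \<psi> ` U" unfolding image_image by (rule image_cong) (use app in auto)
    thus ?thesis using U(4) by simp
  qed
  have t': "\<alpha> t \<in> normalizer_in G T ?V" by (rule autT_normalizer_in[OF a(1) U(2) Us(2)])
  let ?f = "conj_fun ?V ?\<psi> (conj_by G (\<alpha> t))"
  have 1: "extends_mod_T ?V ?f" by (rule extends_mod_T_F_good[OF a(2) Vs(2) psi psiV t'])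
  have tT: "t \<in> T" by (rule F.normalizer_inD(1)[OF U(2)])
  have fx: "?f (\<alpha> (\<psi> z)) = \<alpha> (\<psi> (conj_by G t z))" if z: "z \<in> U" for z
  proof -
    have zT: "z \<in> T" using z Us(2) by blast
    have c: "conj_by G t z \<in> U" by (rule F.normalizer_inD(2)[OF U(2) z])
    have "?f (?\<psi> (\<alpha> z)) = ?\<psi> (conj_by G (\<alpha> t) (\<alpha> z))"
      by (rule conj_fun_apply[OF F.H_inj[OF psi]]) (use z in blast)
    also have "conj_by G (\<alpha> t) (\<alpha> z) = \<alpha> (conj_by G t z)" using F.H_cjv[OF a(1) tT zT] by simp
    finally show ?thesis unfolding app[OF z] app[OF c] .
  qed
  have fV: "?f ` ?V \<subseteq> T"
  proof (rule image_subsetI)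
    fix y assume "y \<in> ?V"
    then obtain z where z: "z \<in> U" "y = \<alpha> (\<psi> z)" by (subst (asm) U(4)[symmetric]) (auto simp: image_image)
    have "\<psi> (conj_by G t z) \<in> U" using F.normalizer_inD(2)[OF U(2) z(1)] U(4) by blast
    thus "?f y \<in> T" unfolding z(2) fx[OF z(1)] using Vs(2) by blast
  qed
  have "extends_mod_T (?\<beta> ` ?V) (conj_fun T ?\<beta> ?f)" by (rule extends_mod_T_autT[OF autT(2)[OF a(1)] Vs fV 1])
  hence 2: "extends_mod_T U (conj_fun T ?\<beta> ?f)" using inv_into_image_cancel[OF inj Us(2)] by simp
  show ?thesis
  proof (rule extends_mod_T_cong[OF 2])
    fix x assume x: "x \<in> U"
    obtain z where z: "z \<in> U" "x = \<psi> z" using x U(4) by blast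
    have xT: "x \<in> T" using x Us(2) by blast
    have c: "\<psi> (conj_by G t z) \<in> T" using F.normalizer_inD(2)[OF U(2) z(1)] U(4) Us(2) by blast
    have "conj_fun T ?\<beta> ?f x = ?\<beta> (?f (\<alpha> x))" unfolding conj_fun_def[of T ?\<beta>] autT(4)[OF a(1) xT] ..
    also have "\<dots> = \<psi> (conj_by G t z)" unfolding z(2) fx[OF z(1)] by (rule F.H_inv_l[OF a(1) c])
    also have "\<dots> = conj_fun U \<psi> (conj_by G t) x" unfolding z(2) by (rule conj_fun_apply[OF E.H_inj[OF U(3)] z(1), symmetric])
    finally show "conj_fun T ?\<beta> ?f x = conj_fun U \<psi> (conj_by G t) x" .
  qed
qed

end

section \<open>Powers of automorphisms and their p'-parts\<close>

context fusion_pred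
begin

lemma funpow_in: "f ` Q = Q \<Longrightarrow> x \<in> Q \<Longrightarrow> (f ^^ n) x \<in> Q"
  by (induction n) auto

lemma funpow_eq:
  assumes f: "f ` Q = Q" "\<And>x. x \<in> Q \<Longrightarrow> f x = g x" and x: "x \<in> Q"
  shows "(f ^^ n) x = (g ^^ n) x"
proof (induction n)
  case (Suc n)
  have "(f ^^ n) x \<in> Q" by (rule funpow_in[OF f(1) x])
  from f(2)[OF this] show ?case using Suc by simp
qed simp

lemma funpow_id_mult: "(\<And>x. x \<in> Q \<Longrightarrow> (f ^^ n) x = x) \<Longrightarrow> n dvd m \<Longrightarrow> x \<in> Q \<Longrightarrow> (f ^^ m) x = x"
proof -
  assume id: "\<And>x. x \<in> Q \<Longrightarrow> (f ^^ n) x = x" and "n dvd m" and x: "x \<in> Q"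
  then obtain j where j: "m = n * j" by blast
  have "((f ^^ n) ^^ j) x = x" using id x by (induction j) auto
  thus "(f ^^ m) x = x" unfolding j by (simp add: funpow_mult)
qed

lemma finite_order:
  assumes g: "H K \<gamma>" "\<gamma> ` K = K"
  obtains n where "n > 0" "\<And>x. x \<in> K \<Longrightarrow> (\<gamma> ^^ n) x = x"
proof -
  interpret B: group "BijGroup K" by (rule group_BijGroup)
  let ?g = "restrict \<gamma> K"
  have gB: "?g \<in> Bij K" using AutsI[OF g] Auts_Bij by blast
  have fin: "finite (carrier (BijGroup K))" unfolding BijGroup_carrier by (rule finite_Bij[OF H_fin[OF g(1)]])
  have "?g [^]\<^bsub>BijGroup K\<^esub> order (BijGroup K) = \<one>\<^bsub>BijGroup K\<^esub>"
    by (rule B.pow_order_eq_1) (simp add: BijGroup_carrier gB)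
  hence "(?g ^^ order (BijGroup K)) x = x" if "x \<in> K" for x
    using BijGroup_pow_apply[OF gB that, of "order (BijGroup K)"] that by (simp add: BijGroup_one)
  moreover have "(\<gamma> ^^ n) x = (?g ^^ n) x" if "x \<in> K" for x n
    by (rule funpow_eq[OF g(2) _ that]) simp
  moreover have "order (BijGroup K) > 0" using fin B.order_gt_0_iff_finite by blast
  ultimately show ?thesis using that by metis
qed

text \<open>With \<open>M = p ^ b * s\<close> and \<open>s\<close> prime to \<open>p\<close>, the \<open>m\<close>-th power of an element of order dividing \<open>M\<close> is its
  \<open>p'\<close>-part.\<close>

lemma p_part_split:
  assumes "M > 0"
  obtains b s m j where "M = p ^ b * s" "coprime s p" "p ^ b dvd m" "m = s * j + 1"
proof -
  have "\<not> is_unit p" using p_prime not_prime_unit by blast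
  then obtain s where s: "M = p ^ multiplicity p M * s" "\<not> p dvd s"
    using multiplicity_decompose'[of M p] assms by (metis less_numeral_extra(3))
  let ?b = "multiplicity p M"
  have c: "coprime s p" using s(2) p_prime by (simp add: coprime_commute prime_imp_coprime)
  hence "coprime s (p ^ ?b)" by simp
  then obtain x where x: "[s * x = 1] (mod p ^ ?b)" using cong_solve_coprime_nat by (metis One_nat_def)
  have pb: "p ^ ?b > 0" using p_prime by (simp add: prime_gt_0_nat)
  \<comment> \<open>As s x is 1 modulo p^b, the factor p^b - 1 plays the part of -1 among the
    naturals: with j = x (p^b - 1) the number s j + 1 is divisible by p^b.\<close>
  have "[s * x * (p ^ ?b - 1) + 1 = 1 * (p ^ ?b - 1) + 1] (mod p ^ ?b)"
    by (intro cong_add cong_mult x cong_refl)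
  moreover have "1 * (p ^ ?b - 1) + 1 = p ^ ?b" using pb by simp
  ultimately have "p ^ ?b dvd s * (x * (p ^ ?b - 1)) + 1"
    by (metis cong_dvd_iff dvd_refl mult.assoc)
  thus ?thesis using that[OF s(1) c] by blast
qed

end

section \<open>Lifting automorphisms of order prime to p along normalizers\<close>

context weakly_normal_pair
begin

text \<open>The F-automorphisms of H = Q C_P(T) that are trivial modulo T and act on Q through
  N_T(Q) form a p-group S. It contains the action of N_T(Q) and also the conjugate of that action by
  \<gamma>. Moving S into the automizer of an F-good subgroup V makes the transported \<gamma>
  extend over N_T(Q). The extension may be nontrivial on N_T(Q), but it has p-power order there; a
  suitable power removes this and leaves \<gamma> unchanged on H.\<close>

lemma lift_id_step:
  assumes Q: "centric Q" "Q \<noteq> T"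
    and g: "FF (prod_CP Q) \<gamma>" "\<gamma> ` prod_CP Q = prod_CP Q" "\<And>x. x \<in> Q \<Longrightarrow> \<gamma> x = x"
    and r: "coprime r p" "r > 0" "\<And>x. x \<in> prod_CP Q \<Longrightarrow> (\<gamma> ^^ r) x = x"
  shows "\<exists>\<gamma>' r'. FF (prod_CP (normalizer_in G T Q)) \<gamma>' \<and> \<gamma>' ` prod_CP (normalizer_in G T Q) = prod_CP (normalizer_in G T Q) \<and>
    (\<forall>x\<in>normalizer_in G T Q. \<gamma>' x = x) \<and> (\<forall>x\<in>prod_CP Q. \<gamma>' x = \<gamma> x) \<and>
    coprime r' p \<and> r' > 0 \<and> (\<forall>x\<in>prod_CP (normalizer_in G T Q). (\<gamma>' ^^ r') x = x)"
proof -
  note Qs = centric_sub[OF Q(1)]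
  let ?H = "prod_CP Q" and ?Q1 = "normalizer_in G T Q"
  let ?K = "prod_CP ?Q1"
  note Hs = prod_CP_sub[OF Qs]
  have Q1s: "subgroup ?Q1 G" "?Q1 \<subseteq> T" using E.normalizer_in_sub[OF Qs(1)] E.nrmT by auto
  note Ks = prod_CP_sub[OF Q1s]
  have QQ1: "Q \<subseteq> ?Q1" by (rule E.sub_normalizer_in[OF Qs])
  have HK: "?H \<subseteq> ?K" by (rule prod_CP_mono[OF QQ1])
  have HG: "?H \<subseteq> carrier G" by (rule subgroup.subset[OF Hs(1)])
  have Q1G: "t \<in> carrier G" if "t \<in> ?Q1" for t using that Q1s(2) E.TG by blast
  have QG: "x \<in> carrier G" if "x \<in> Q" for x using that Qs(2) E.TG by blast
  have Hn: "conj_by G t y \<in> ?H" if t: "t \<in> ?Q1" and y: "y \<in> ?H" for t y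
  proof -
    obtain q c where qc: "q \<in> Q" "c \<in> CP" "y = q \<otimes> c" by (rule prod_CPE[OF y])
    have "conj_by G t y = conj_by G t q \<otimes> c"
      unfolding qc(3) using F.conj_by_mult[OF Q1G[OF t] QG[OF qc(1)] CPG[OF qc(2)]] CP_conj_by(1)[OF qc(2)] t Q1s(2) by auto
    thus ?thesis using prod_CPI[OF F.normalizer_inD(2)[OF t qc(1)] qc(2)] by simp
  qed
  have Q1H: "?Q1 \<subseteq> normalizer_in G (carrier G) ?H"
  proof
    fix t assume t: "t \<in> ?Q1"
    have "conj_by G t ` ?H = ?H" by (rule F.finite_normalizer_inI[OF F.finite_subgroup[OF Hs(1)] HG Q1G[OF t] Hn[OF t]])
    thus "t \<in> normalizer_in G (carrier G) ?H" using Q1G[OF t] unfolding normalizer_in_def by blast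
  qed
  obtain k where k: "\<And>x. x \<in> carrier G \<Longrightarrow> x [^] (p ^ k) = \<one>" by (rule F.pow_p) (rule that)
  let ?S = "{\<kappa> \<in> Auts FF ?H. (\<forall>y\<in>?H. inv y \<otimes> \<kappa> y \<in> T) \<and> (\<exists>t\<in>?Q1. \<forall>x\<in>Q. \<kappa> x = conj_by G t x)}"
  have Ss: "subgroup ?S (BijGroup ?H)"
  proof (rule BijGroup_subgroupI[OF F.finite_subgroup[OF Hs(1)]])
    show "?S \<subseteq> Bij ?H" using F.Auts_Bij by blast
    have "(\<lambda>x\<in>?H. x) \<in> Auts FF ?H" by (rule F.AutsI[OF FF_id[OF Hs(1)]]) simp
    moreover have "\<forall>y\<in>?H. inv y \<otimes> (\<lambda>x\<in>?H. x) y \<in> T"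
      using HG subgroup.one_closed[OF E.T] by (auto simp: subset_iff)
    moreover have "\<forall>x\<in>Q. (\<lambda>x\<in>?H. x) x = conj_by G \<one> x" using Hs(2) QG by auto
    ultimately show "(\<lambda>x\<in>?H. x) \<in> ?S" using subgroup.one_closed[OF Q1s(1)] by blast
    fix a b assume a: "a \<in> ?S" and b: "b \<in> ?S"
    have aA: "a \<in> Auts FF ?H" "\<And>y. y \<in> ?H \<Longrightarrow> inv y \<otimes> a y \<in> T" using a by auto
    have bA: "b \<in> Auts FF ?H" "\<And>y. y \<in> ?H \<Longrightarrow> inv y \<otimes> b y \<in> T" using b by auto
    obtain u where u: "u \<in> ?Q1" "\<forall>x\<in>Q. a x = conj_by G u x" using a by blast
    obtain v where v: "v \<in> ?Q1" "\<forall>x\<in>Q. b x = conj_by G v x" using b by blast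
    have c: "compose ?H a b \<in> Auts FF ?H"
      using subgroup.m_closed[OF F.Auts_subgroup[OF Hs(1) HG] aA(1) bA(1)] BijGroup_mult[of a ?H b] aA(1) bA(1) F.Auts_Bij[of ?H]
      by (metis subsetD)
    have bH: "b y \<in> ?H" if "y \<in> ?H" for y using F.AutsD(2)[OF bA(1)] that by blast
    have aH: "a y \<in> ?H" if "y \<in> ?H" for y using F.AutsD(2)[OF aA(1)] that by blast
    have t: "inv y \<otimes> compose ?H a b y \<in> T" if y: "y \<in> ?H" for y
    proof -
      have Gs: "y \<in> carrier G" "b y \<in> carrier G" "a (b y) \<in> carrier G" using y bH aH HG by blast+
      have "inv y \<otimes> a (b y) = (inv y \<otimes> b y) \<otimes> (inv (b y) \<otimes> a (b y))" using Gs by (simp add: F.m_assoc)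
      thus ?thesis using subgroup.m_closed[OF E.T bA(2)[OF y] aA(2)[OF bH[OF y]]] y by (simp add: compose_eq)
    qed
    have q: "compose ?H a b x = conj_by G (v \<otimes> u) x" if x: "x \<in> Q" for x
    proof -
      have vx: "conj_by G v x \<in> Q" by (rule F.normalizer_inD(2)[OF v(1) x])
      have "x \<in> ?H" using x Hs(2) by blast
      thus ?thesis using v(2) u(2) x vx F.conj_by_conj_by[OF Q1G[OF v(1)] Q1G[OF u(1)] QG[OF x]] by (simp add: compose_eq)
    qed
    show "compose ?H a b \<in> ?S" using c t q subgroup.m_closed[OF Q1s(1) v(1) u(1)] by blast
  qed
  \<comment> \<open>A map trivial on Q and modulo T shifts each y by an element of C_T(Q), which
    lies in Q.\<close>
  have shiftQ: "inv y \<otimes> \<kappa> y \<in> Q"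
    if kk: "FF ?H \<kappa>" "\<And>x. x \<in> Q \<Longrightarrow> \<kappa> x = x" "\<And>y. y \<in> ?H \<Longrightarrow> inv y \<otimes> \<kappa> y \<in> T" and y: "y \<in> ?H" for \<kappa> y
  proof -
    have Hq: "?H \<subseteq> normalizer_in G (carrier G) Q"
      unfolding prod_CP_def by (rule F.set_mult_least[OF F.normalizer_in_sub[OF Qs(1)]])
        (use F.sub_normalizer_in[OF Qs(1) subgroup.subset[OF Qs(1)]] CP_centralizer_in[OF Qs(2)] F.centralizer_in_sub_normalizer_in[OF F.T subgroup.subset[OF Qs(1)]] in blast)+
    have "inv y \<otimes> \<kappa> y \<in> centralizer_in G (carrier G) Q"
      by (rule F.fix_sub_centralizes[OF kk(1,2) Qs(1) Hs(2) Hq y])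
    hence "inv y \<otimes> \<kappa> y \<in> centralizer_in G T Q" using kk(3)[OF y] unfolding centralizer_in_def by blast
    thus ?thesis using centric_centralizer_in[OF Q(1)] by blast
  qed
  obtain kS where kS: "card ?S = p ^ kS"
  proof -
    have "\<exists>n. card ?S = p ^ n"
    proof (rule p_power_card_if_funpow[OF F.p_prime F.finite_subgroup[OF Hs(1)] Ss])
      fix \<kappa> assume kS: "\<kappa> \<in> ?S"
      have kA: "\<kappa> \<in> Auts FF ?H" and kT: "\<And>y. y \<in> ?H \<Longrightarrow> inv y \<otimes> \<kappa> y \<in> T" using kS by auto
      obtain t where t: "t \<in> ?Q1" "\<forall>x\<in>Q. \<kappa> x = conj_by G t x" using kS by blast
      have kF: "FF ?H \<kappa>" "\<kappa> ` ?H = ?H" using F.AutsD[OF kA] by auto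
      let ?l = "\<kappa> ^^ (p ^ k)"
      have l: "FF ?H ?l" using F.H_funpow[OF kF] by blast
      have kQ: "\<kappa> ` Q = Q"
      proof -
        have "\<kappa> ` Q = conj_by G t ` Q" by (rule image_cong) (use t(2) in auto)
        thus ?thesis using t(1) unfolding normalizer_in_def by simp
      qed
      have lQ: "?l x = x" if x: "x \<in> Q" for x
      proof -
        have "?l x = (conj_by G t ^^ (p ^ k)) x" by (rule F.funpow_eq[OF kQ _ x]) (use t(2) in blast)
        also have "\<dots> = x" using F.conj_by_pow[OF Q1G[OF t(1)] QG[OF x]] k[OF Q1G[OF t(1)]] QG[OF x] by simp
        finally show ?thesis .
      qed
      have lT: "inv y \<otimes> (\<kappa> ^^ n) y \<in> T" if y: "y \<in> ?H" for y n
      proof (induction n)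
        case 0 thus ?case using y HG subgroup.one_closed[OF E.T] by auto
      next
        case (Suc n)
        have ky: "(\<kappa> ^^ n) y \<in> ?H" by (rule F.funpow_in[OF kF(2) y])
        have Gs: "y \<in> carrier G" "(\<kappa> ^^ n) y \<in> carrier G" "\<kappa> ((\<kappa> ^^ n) y) \<in> carrier G"
          using y ky HG F.H_mem(2)[OF kF(1) ky] by blast+
        have "inv y \<otimes> (\<kappa> ^^ Suc n) y = (inv y \<otimes> (\<kappa> ^^ n) y) \<otimes> (inv ((\<kappa> ^^ n) y) \<otimes> \<kappa> ((\<kappa> ^^ n) y))"
          using Gs by (simp add: F.m_assoc)
        thus ?case using subgroup.m_closed[OF E.T Suc kT[OF ky]] by simp
      qed
      have "(?l ^^ (p ^ k)) y = y" if y: "y \<in> ?H" for y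
        by (rule F.shift_funpow[OF l Qs(1) Hs(2) lQ shiftQ[OF l lQ lT] k y])
      \<comment> \<open>The first factor p^k makes \<kappa> trivial on Q; the second kills the
        remaining shifts by elements of Q.\<close>
      hence "\<forall>y\<in>?H. (\<kappa> ^^ (p ^ (k + k))) y = y" by (simp add: funpow_mult power_add)
      thus "\<exists>k. \<forall>y\<in>?H. (\<kappa> ^^ (p ^ k)) y = y" by blast
    qed
    thus ?thesis using that by blast
  qed
  obtain f0 where f0: "FF ?H f0" "good p G (carrier G) FF (f0 ` ?H)" by (rule F.is_saturatedE[OF F_sat Hs(1) HG])
  let ?V = "f0 ` ?H"
  have V: "subgroup ?V G" "?V \<subseteq> carrier G" "sylow_in p (AutT G (carrier G) ?V) (Auts FF ?V)" "is_receptive G (carrier G) FF ?V"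
    using f0(2) unfolding good_def by auto
  have SA: "?S \<subseteq> Auts FF ?H" by blast
  obtain c0 where c0: "FF ?H c0" "c0 ` ?H = ?V"
    "\<And>b. b \<in> ?S \<Longrightarrow> \<exists>u\<in>normalizer_in G (carrier G) ?V. \<forall>x\<in>?H. c0 (b x) = conj_by G u (c0 x)"
    by (rule F.sylow_conj_hom[OF V(1-3) f0(1) refl Ss kS SA]) (rule that)
  have cjS: "restrict (conj_by G t) ?H \<in> ?S" if t: "t \<in> ?Q1" for t
  proof -
    have "conj_by G t ` ?H = ?H" using Q1H t unfolding normalizer_in_def by blast
    hence "restrict (conj_by G t) ?H \<in> Auts FF ?H" by (rule F.AutsI[OF F.H_conj_by[OF Hs(1) HG Q1G[OF t]]])
    moreover have "inv y \<otimes> conj_by G t y \<in> T" if "y \<in> ?H" for y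
      using commutator_T[of y t] that HG t Q1s(2) by blast
    ultimately show ?thesis using t Hs(2) by (auto simp: subset_iff)
  qed
  have ext_dom: "?Q1 \<subseteq> F.ext_dom ?H ?V c0"
  proof
    fix t assume t: "t \<in> ?Q1"
    have "\<exists>u\<in>normalizer_in G (carrier G) ?V. \<forall>x\<in>?H. c0 (restrict (conj_by G t) ?H x) = conj_by G u (c0 x)" by (rule c0(3)[OF cjS[OF t]])
    thus "t \<in> F.ext_dom ?H ?V c0" unfolding F.ext_dom_def using t Q1H by auto
  qed
  obtain \<chi>' where chi': "FF (?Q1 <#> ?H) \<chi>'" "\<And>x. x \<in> ?H \<Longrightarrow> \<chi>' x = c0 x"
    by (rule F.is_receptive_mult[OF V(4) c0(1,2) Q1s(1) ext_dom]) (rule that)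
  have KQH: "?K \<subseteq> ?Q1 <#> ?H"
  proof
    fix y assume "y \<in> ?K"
    then obtain q c where qc: "q \<in> ?Q1" "c \<in> CP" "y = q \<otimes> c" by (rule prod_CPE)
    thus "y \<in> ?Q1 <#> ?H" using F.set_mult_mem[OF qc(1), of c ?H] Hs(3) by blast
  qed
  have chi: "FF ?K \<chi>'" by (rule F.H_restr[OF chi'(1) Ks(1) KQH])
  have chH: "\<chi>' ` ?H = ?V" using c0(2) chi'(2) by (metis image_cong)
  have chiH: "FF ?H \<chi>'" by (rule F.H_restr[OF chi Hs(1) HK])
  have chiQ1: "FF ?Q1 \<chi>'" by (rule F.H_restr[OF chi Q1s(1) Ks(2)])
  have QK: "Q \<subseteq> ?K" using QQ1 Ks(2) by blast
  have chiQ: "FF Q \<chi>'" by (rule F.H_restr[OF chi Qs(1) QK])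
  let ?Q1' = "\<chi>' ` ?Q1" and ?Q' = "\<chi>' ` Q" and ?K' = "\<chi>' ` ?K"
  have Q1's: "subgroup ?Q1' G" "?Q1' \<subseteq> T" using F.H_img[OF chiQ1] closed[OF chiQ1 Q1s(2)] by auto
  have Q's: "subgroup ?Q' G" using F.H_img[OF chiQ] .
  have K's: "subgroup ?K' G" by (rule F.H_img[OF chi])
  note hi = FF_inv[OF chiH chH]
  let ?g = "\<lambda>v. \<chi>' (\<gamma> (inv_into ?H \<chi>' v))"
  have g1: "FF ?V (\<lambda>v. \<gamma> (inv_into ?H \<chi>' v))" "(\<lambda>v. \<gamma> (inv_into ?H \<chi>' v)) ` ?V = ?H"
    using FF_comp[OF hi g(1)] g(2) by auto
  have gg: "FF ?V ?g" "?g ` ?V = ?V" using FF_comp[OF g1 chiH] chH by auto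
  have gapp: "?g (\<chi>' y) = \<chi>' (\<gamma> y)" if "y \<in> ?H" for y using F.H_inv_l[OF chiH that] by simp
  have gH: "\<gamma> y \<in> ?H" if "y \<in> ?H" for y using g(2) that by blast
  have conjS: "\<exists>\<kappa>\<in>?S. \<forall>y\<in>?H. \<gamma> (conj_by G t y) = \<kappa> (\<gamma> y)" if t: "t \<in> ?Q1" for t
  proof -
    let ?\<kappa> = "\<lambda>y\<in>?H. \<gamma> (restrict (conj_by G t) ?H (inv_into ?H \<gamma> y))"
    have cS: "restrict (conj_by G t) ?H \<in> ?S" by (rule cjS[OF t])
    have kA: "?\<kappa> \<in> Auts FF ?H" by (rule F.H_conj_aut[OF g(1,2)]) (use cS in blast)
    have app: "?\<kappa> (\<gamma> y) = \<gamma> (conj_by G t y)" if y: "y \<in> ?H" for y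
      using gH[OF y] F.H_inv_l[OF g(1) y] y by simp
    have kT: "inv y \<otimes> ?\<kappa> y \<in> T" if y: "y \<in> ?H" for y
    proof -
      obtain z where z: "z \<in> ?H" "y = \<gamma> z" using y g(2) by blast
      have zc: "conj_by G t z \<in> ?H" by (rule Hn[OF t z(1)])
      have iz: "inv z \<in> ?H" by (rule subgroup.m_inv_closed[OF Hs(1) z(1)])
      have d: "inv z \<otimes> conj_by G t z \<in> ?H" by (rule subgroup.m_closed[OF Hs(1) iz zc])
      have dT: "inv z \<otimes> conj_by G t z \<in> T" using commutator_T[of z t] z(1) HG t Q1s(2) by blast
      \<comment> \<open>The commutator of z and t lies in both H and T, hence in Q, where \<gamma>
        is trivial. So conjugation by \<gamma> does not destroy triviality modulo T.\<close>
      have dQ: "inv z \<otimes> conj_by G t z \<in> Q" by (rule prod_CP_T[OF Q(1) d dT])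
      have "inv y \<otimes> ?\<kappa> y = inv (\<gamma> z) \<otimes> \<gamma> (conj_by G t z)" unfolding z(2) app[OF z(1)] ..
      also have "\<dots> = \<gamma> (inv z \<otimes> conj_by G t z)" unfolding F.H_mult[OF g(1) iz zc] F.H_minv[OF g(1) z(1)] ..
      finally show ?thesis using g(3)[OF dQ] dT by simp
    qed
    have kq: "?\<kappa> x = conj_by G t x" if x: "x \<in> Q" for x
    proof -
      have xH: "x \<in> ?H" using x Hs(2) by blast
      have "?\<kappa> (\<gamma> x) = \<gamma> (conj_by G t x)" by (rule app[OF xH])
      thus ?thesis unfolding g(3)[OF x] g(3)[OF F.normalizer_inD(2)[OF t x]] .
    qed
    have "?\<kappa> \<in> ?S" using kA kT kq t by blast
    moreover have "\<forall>y\<in>?H. \<gamma> (conj_by G t y) = ?\<kappa> (\<gamma> y)" using app by simp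
    ultimately show ?thesis by blast
  qed
  have NN2: "?Q1' \<subseteq> F.ext_dom ?V ?V ?g"
  proof (rule image_subsetI)
    fix t assume t: "t \<in> ?Q1"
    have tK: "t \<in> ?K" using t Ks(2) by blast
    have "\<chi>' t \<in> normalizer_in G (carrier G) (\<chi>' ` ?H)" by (rule F.H_normalizer_in[OF chi tK subsetD[OF Q1H t] HK])
    hence n: "\<chi>' t \<in> normalizer_in G (carrier G) ?V" unfolding chH .
    obtain \<kappa> where kap: "\<kappa> \<in> ?S" "\<forall>y\<in>?H. \<gamma> (conj_by G t y) = \<kappa> (\<gamma> y)" using conjS[OF t] by blast
    obtain u where u: "u \<in> normalizer_in G (carrier G) ?V" "\<forall>x\<in>?H. c0 (\<kappa> x) = conj_by G u (c0 x)" using c0(3)[OF kap(1)] by blast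
    have "?g (conj_by G (\<chi>' t) v) = conj_by G u (?g v)" if v: "v \<in> ?V" for v
    proof -
      obtain y where y: "y \<in> ?H" "v = \<chi>' y" using v chH by blast
      have yK: "y \<in> ?K" using y HK by blast
      have c: "conj_by G t y \<in> ?H" by (rule Hn[OF t y(1)])
      have kH: "\<kappa> (\<gamma> y) \<in> ?H" using kap(1) F.AutsD(2)[of \<kappa> ?H] gH[OF y(1)] by blast
      have "?g (conj_by G (\<chi>' t) v) = \<chi>' (\<gamma> (conj_by G t y))"
        unfolding y(2) F.H_cjv[OF chi tK yK, symmetric] by (rule gapp[OF c])
      also have "\<dots> = c0 (\<kappa> (\<gamma> y))" using kap(2) y(1) chi'(2)[OF kH] by simp
      also have "\<dots> = conj_by G u (c0 (\<gamma> y))" using u(2) gH[OF y(1)] by blast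
      also have "\<dots> = conj_by G u (?g v)" unfolding y(2) gapp[OF y(1)] chi'(2)[OF gH[OF y(1)]] ..
      finally show ?thesis .
    qed
    thus "\<chi>' t \<in> F.ext_dom ?V ?V ?g" unfolding F.ext_dom_def using n u(1) by blast
  qed
  obtain e where e: "FF (?Q1' <#> ?V) e" "\<And>x. x \<in> ?V \<Longrightarrow> e x = ?g x"
    by (rule F.is_receptive_mult[OF V(4) gg Q1's(1) NN2]) (rule that)
  have K'sub: "?K' \<subseteq> ?Q1' <#> ?V"
  proof (rule image_subsetI)
    fix y assume "y \<in> ?K"
    then obtain q c where qc: "q \<in> ?Q1" "c \<in> CP" "y = q \<otimes> c" by (rule prod_CPE)
    have m: "q \<in> ?K" "c \<in> ?K" "c \<in> ?H" using qc Ks Hs(3) by blast+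
    have "\<chi>' c \<in> ?V" using m(3) chH by blast
    thus "\<chi>' y \<in> ?Q1' <#> ?V" unfolding qc(3) F.H_mult[OF chi m(1,2)] by (intro F.set_mult_mem imageI qc(1))
  qed
  have eK: "FF ?K' e" by (rule F.H_restr[OF e(1) K's K'sub])
  have eQ1: "FF ?Q1' e" by (rule F.H_restr[OF eK Q1's(1)]) (use Ks(2) in blast)
  have eQ': "e x = x" if x: "x \<in> ?Q'" for x
  proof -
    obtain z where z: "z \<in> Q" "x = \<chi>' z" using x by blast
    have zH: "z \<in> ?H" using z Hs(2) by blast
    have "x \<in> ?V" using z(2) zH chH by blast
    thus ?thesis using e(2) gapp[OF zH] g(3)[OF z(1)] z(2) by simp
  qed
  have Q1'n: "?Q1' \<subseteq> normalizer_in G (carrier G) ?Q'"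
  proof (rule image_subsetI)
    fix t assume t: "t \<in> ?Q1"
    show "\<chi>' t \<in> normalizer_in G (carrier G) ?Q'" by (rule F.H_normalizer_in[OF chiQ1 t _ QQ1]) (use t normalizer_in_T_carrier in blast)
  qed
  have eshift: "inv v \<otimes> e v \<in> ?Q'" if v: "v \<in> ?Q1'" for v
  proof -
    have "inv v \<otimes> e v \<in> centralizer_in G (carrier G) ?Q'"
      by (rule F.fix_sub_centralizes[OF eQ1 eQ' Q's image_mono[OF QQ1] Q1'n v])
    moreover have "e v \<in> T" using closed[OF eQ1 Q1's(2)] v by blast
    hence "inv v \<otimes> e v \<in> T" using v Q1's(2) subgroup.m_closed[OF E.T subgroup.m_inv_closed[OF E.T]] by blast
    ultimately have "inv v \<otimes> e v \<in> centralizer_in G T ?Q'" unfolding centralizer_in_def by blast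
    thus ?thesis using centricD[OF Q(1) chiQ] by blast
  qed
  \<comment> \<open>The map e preserves V, the image of H, and shifts the image of N_T(Q) only by
    elements of the image of Q.\<close>
  have eKK: "e ` ?K' \<subseteq> ?K'"
  proof (rule image_subsetI)
    fix v assume "v \<in> ?K'"
    then obtain y where y: "y \<in> ?K" "v = \<chi>' y" by blast
    obtain q c where qc: "q \<in> ?Q1" "c \<in> CP" "y = q \<otimes> c" by (rule prod_CPE[OF y(1)])
    have m: "q \<in> ?K" "c \<in> ?K" "c \<in> ?H" using qc Ks Hs(3) by blast+
    have m': "\<chi>' q \<in> ?K'" "\<chi>' c \<in> ?K'" "\<chi>' q \<in> ?Q1'" "\<chi>' c \<in> ?V" using m qc(1) chH by blast+
    have "e (\<chi>' c) \<in> ?V" using e(2)[OF m'(4)] gg(2) m'(4) by (metis imageI)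
    moreover have "?V \<subseteq> ?K'" using chH HK by blast
    ultimately have ec: "e (\<chi>' c) \<in> ?K'" by blast
    have G: "\<chi>' q \<in> carrier G" "e (\<chi>' q) \<in> carrier G" using F.H_mem(1,2)[OF eK m'(1)] by auto
    have "inv (\<chi>' q) \<otimes> e (\<chi>' q) \<in> ?K'" using eshift[OF m'(3)] QK by blast
    hence "\<chi>' q \<otimes> (inv (\<chi>' q) \<otimes> e (\<chi>' q)) \<in> ?K'" by (rule subgroup.m_closed[OF K's m'(1)])
    hence eq: "e (\<chi>' q) \<in> ?K'" using G by simp
    show "e v \<in> ?K'" unfolding y(2) qc(3) F.H_mult[OF chi m(1,2)] F.H_mult[OF eK m'(1,2)]
      by (rule subgroup.m_closed[OF K's eq ec])
  qed
  note ki = FF_inv[OF chi refl]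
  let ?d = "\<lambda>y. inv_into ?K \<chi>' (e (\<chi>' y))"
  have "FF ?K (\<lambda>y. e (\<chi>' y))" by (rule FF_comp(1)[OF chi refl eK])
  hence d: "FF ?K ?d" by (rule F.H_comp[OF _ ki(1)]) (use eKK in blast)
  have dK: "?d ` ?K = ?K"
    by (rule endo_inj_surj[OF F.H_fin[OF chi] _ F.H_inj[OF d]]) (use eKK ki(2) in blast)
  have dH: "?d y = \<gamma> y" if y: "y \<in> ?H" for y
  proof -
    have "\<chi>' y \<in> ?V" using y chH by blast
    hence "e (\<chi>' y) = \<chi>' (\<gamma> y)" using e(2) gapp[OF y] by simp
    thus ?thesis using F.H_inv_l[OF chi, of "\<gamma> y"] gH[OF y] HK by auto
  qed
  have dQ: "?d x = x" if x: "x \<in> Q" for x using dH[of x] g(3)[OF x] x Hs(2) by auto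
  have dQ1: "inv t \<otimes> ?d t \<in> Q" if t: "t \<in> ?Q1" for t
  proof -
    have tK: "t \<in> ?K" using t Ks(2) by blast
    have tQ1': "\<chi>' t \<in> ?Q1'" using t by blast
    obtain q where q: "q \<in> Q" "inv (\<chi>' t) \<otimes> e (\<chi>' t) = \<chi>' q" using eshift[OF tQ1'] by blast
    have qK: "q \<in> ?K" using q(1) QK by blast
    have G: "\<chi>' t \<in> carrier G" "e (\<chi>' t) \<in> carrier G" using F.H_mem(1,2)[OF eQ1 tQ1'] by auto
    have "e (\<chi>' t) = \<chi>' t \<otimes> \<chi>' q" using q(2)[symmetric] G by simp
    also have "\<dots> = \<chi>' (t \<otimes> q)" using F.H_mult[OF chi tK qK] by simp
    finally have "?d t = t \<otimes> q" using F.H_inv_l[OF chi subgroup.m_closed[OF Ks(1) tK qK]] by simp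
    thus ?thesis using Q1G[OF t] QG[OF q(1)] q(1) by simp
  qed
  have dQ1r: "FF ?Q1 ?d" by (rule F.H_restr[OF d Q1s(1) Ks(2)])
  have dp: "(?d ^^ (p ^ k)) t = t" if t: "t \<in> ?Q1" for t
    by (rule F.shift_funpow[OF dQ1r Qs(1) QQ1 dQ dQ1 k t])
  obtain n where n: "n > 0" "\<And>x. x \<in> ?K \<Longrightarrow> (?d ^^ n) x = x" by (rule F.finite_order[OF d dK]) (rule that)
  \<comment> \<open>The factors annihilate the extension d on K, \<gamma> on H, and d on N_T(Q).
    Since r is prime to p it divides s, so d^m is \<gamma> on H as m is 1 modulo s; p^k divides m,
    so d^m is trivial on N_T(Q). The number s becomes the new exponent prime to p.\<close>
  have M: "n * r * p ^ k > 0" using n(1) r(2) F.p_prime by (simp add: prime_gt_0_nat)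
  obtain b s m j where m: "n * r * p ^ k = p ^ b * s" "coprime s p" "p ^ b dvd m" "m = s * j + 1"
    by (rule F.p_part_split[OF M]) (rule that)
  have rs: "r dvd s"
  proof -
    have "r dvd p ^ b * s" unfolding m(1)[symmetric] by simp
    moreover have "coprime r (p ^ b)" using r(1) by simp
    ultimately show ?thesis using coprime_dvd_mult_right_iff by blast
  qed
  have kb: "p ^ k dvd m"
  proof -
    have "p ^ k dvd p ^ b * s" unfolding m(1)[symmetric] by simp
    moreover have "coprime (p ^ k) s" using m(2) by (simp add: coprime_commute)
    ultimately have "p ^ k dvd p ^ b" using coprime_dvd_mult_left_iff by blast
    thus ?thesis using m(3) dvd_trans by blast
  qed
  let ?\<gamma>' = "?d ^^ m"
  have f1: "FF ?K ?\<gamma>'" "?\<gamma>' ` ?K = ?K" using F.H_funpow[OF d dK] by auto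
  have f2: "\<forall>x\<in>?Q1. ?\<gamma>' x = x" using F.funpow_id_mult[OF dp kb] by blast
  have f3: "\<forall>x\<in>?H. ?\<gamma>' x = \<gamma> x"
  proof
    fix x assume x: "x \<in> ?H"
    have "?d ` ?H = \<gamma> ` ?H" by (rule image_cong[OF refl dH])
    hence dHH: "?d ` ?H = ?H" unfolding g(2) .
    have "?\<gamma>' x = (\<gamma> ^^ m) x" by (rule F.funpow_eq[OF dHH dH x])
    also have "\<dots> = \<gamma> ((\<gamma> ^^ (s * j)) x)" unfolding m(4) by simp
    also have "(\<gamma> ^^ (s * j)) x = x" by (rule F.funpow_id_mult[OF r(3) dvd_mult2[OF rs] x])
    finally show "?\<gamma>' x = \<gamma> x" .
  qed
  have f4: "s > 0" using m(1) M by (cases s) auto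
  have f5: "\<forall>x\<in>?K. (?\<gamma>' ^^ s) x = x"
  proof
    fix x assume x: "x \<in> ?K"
    have "n dvd p ^ b * s" unfolding m(1)[symmetric] by simp
    hence "n dvd m * s" using m(3) by (meson dvd_trans mult_dvd_mono dvd_refl)
    from F.funpow_id_mult[OF n(2) this x] show "(?\<gamma>' ^^ s) x = x" by (simp add: funpow_mult mult.commute)
  qed
  show ?thesis by (rule exI[of _ ?\<gamma>'], rule exI[of _ s], intro conjI f1 f2 f3 m(2) f4 f5)
qed

lemma lift_id:
  assumes "centric Q" "FF (prod_CP Q) \<gamma>" "\<gamma> ` prod_CP Q = prod_CP Q" "\<And>x. x \<in> Q \<Longrightarrow> \<gamma> x = x"
    "coprime r p" "r > 0" "\<And>x. x \<in> prod_CP Q \<Longrightarrow> (\<gamma> ^^ r) x = x"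
  shows "\<exists>\<gamma>'. FF (prod_CP T) \<gamma>' \<and> \<gamma>' ` prod_CP T = prod_CP T \<and> (\<forall>x\<in>T. \<gamma>' x = x) \<and> (\<forall>x\<in>prod_CP Q. \<gamma>' x = \<gamma> x)"
  using assms
proof (induction "card T - card Q" arbitrary: Q \<gamma> r rule: less_induct)
  case less
  note Qs = centric_sub[OF less.prems(1)]
  show ?case
  proof (cases "Q = T")
    case True thus ?thesis using less.prems by blast
  next
    case False
    let ?Q1 = "normalizer_in G T Q"
    have n: "Q \<subset> ?Q1" using F.normalizer_in_grows[OF E.T Qs(1)] Qs(2) False by blast
    have Q1s: "subgroup ?Q1 G" "?Q1 \<subseteq> T" using E.normalizer_in_sub[OF Qs(1)] E.nrmT by auto
    have c: "centric ?Q1" by (rule centric_sup[OF less.prems(1) _ Q1s]) (use n in blast)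
    have "\<exists>\<gamma>' r'. FF (prod_CP ?Q1) \<gamma>' \<and> \<gamma>' ` prod_CP ?Q1 = prod_CP ?Q1 \<and>
        (\<forall>x\<in>?Q1. \<gamma>' x = x) \<and> (\<forall>x\<in>prod_CP Q. \<gamma>' x = \<gamma> x) \<and>
        coprime r' p \<and> r' > 0 \<and> (\<forall>x\<in>prod_CP ?Q1. (\<gamma>' ^^ r') x = x)"
      by (rule lift_id_step[OF less.prems(1) False less.prems(2-7)])
    then obtain \<gamma>1 r1 where g: "FF (prod_CP ?Q1) \<gamma>1" "\<gamma>1 ` prod_CP ?Q1 = prod_CP ?Q1" "\<forall>x\<in>?Q1. \<gamma>1 x = x" "\<forall>x\<in>prod_CP Q. \<gamma>1 x = \<gamma> x"
      "coprime r1 p" "r1 > 0" "\<forall>x\<in>prod_CP ?Q1. (\<gamma>1 ^^ r1) x = x"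
      by (elim exE conjE) (rule that)
    have "card Q < card ?Q1" "card ?Q1 \<le> card T"
      using psubset_card_mono[OF F.finite_subgroup[OF Q1s(1)] n] card_mono[OF F.finite_subgroup[OF E.T] Q1s(2)] by auto
    hence lt: "card T - card ?Q1 < card T - card Q" by linarith
    have "\<exists>\<gamma>'. FF (prod_CP T) \<gamma>' \<and> \<gamma>' ` prod_CP T = prod_CP T \<and> (\<forall>x\<in>T. \<gamma>' x = x) \<and> (\<forall>x\<in>prod_CP ?Q1. \<gamma>' x = \<gamma>1 x)"
      by (rule less.hyps[OF lt c g(1,2) bspec[OF g(3)] g(5,6) bspec[OF g(7)]])
    then obtain \<gamma>' where g': "FF (prod_CP T) \<gamma>'" "\<gamma>' ` prod_CP T = prod_CP T" "\<forall>x\<in>T. \<gamma>' x = x" "\<forall>x\<in>prod_CP ?Q1. \<gamma>' x = \<gamma>1 x"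
      by (elim exE conjE) (rule that)
    have "prod_CP Q \<subseteq> prod_CP ?Q1" by (rule prod_CP_mono) (use n in blast)
    hence "\<forall>x\<in>prod_CP Q. \<gamma>' x = \<gamma> x" using g'(4) g(4) by (metis subsetD)
    thus ?thesis using g'(1-3) by blast
  qed
qed

text \<open>The p-group generated by \<delta> is conjugate in Aut_E(T) into the Sylow subgroup of
  inner automorphisms; as a conjugate of an inner automorphism is inner, so is \<delta>.\<close>

lemma E_p_inner:
  assumes d: "EE T \<delta>" "\<delta> ` T = T" "\<forall>x\<in>T. (\<delta> ^^ (p ^ k)) x = x"
  shows "\<exists>t\<in>T. \<forall>x\<in>T. \<delta> x = conj_by G t x"
proof -
  obtain B where B: "subgroup B (BijGroup T)" "\<exists>n. card B = p ^ n" "B \<subseteq> Auts EE T" "restrict \<delta> T \<in> B"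
    by (rule E.funpow_cyclic[OF d]) (rule that)
  obtain n where n: "card B = p ^ n" using B(2) by blast
  have s: "sylow_in p (AutT G T T) (Auts EE T)" using T_good_good[OF T_good_T] unfolding good_def by blast
  have i: "EE T (\<lambda>x. x)" by (rule E.H_id[OF E.T subset_refl])
  obtain c where c: "EE T c" "c ` T = T" "\<And>b. b \<in> B \<Longrightarrow> \<exists>u\<in>normalizer_in G T T. \<forall>x\<in>T. c (b x) = conj_by G u (c x)"
    by (rule E.sylow_conj_hom[OF E.T subset_refl s i image_ident B(1) n B(3)]) (rule that)
  obtain u where u: "u \<in> normalizer_in G T T" "\<forall>x\<in>T. c (restrict \<delta> T x) = conj_by G u (c x)" using c(3)[OF B(4)] by blast
  obtain t where t: "t \<in> T" "u = c t" using F.normalizer_inD(1)[OF u(1)] c(2) by blast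
  have "\<delta> x = conj_by G t x" if x: "x \<in> T" for x
  proof -
    have dx: "\<delta> x \<in> T" using d(2) x by blast
    have cx: "conj_by G t x \<in> T" by (rule F.conj_by_mem[OF E.T t(1) x])
    have "c (\<delta> x) = c (conj_by G t x)" using bspec[OF u(2) x] x t(2) E.H_cjv[OF c(1) t(1) x] by simp
    thus ?thesis using E.H_eq_iff[OF c(1) dx cx] by blast
  qed
  thus ?thesis using t(1) by blast
qed

lemma extends_mod_T_conj_by: assumes "t \<in> T" shows "extends_mod_T T (conj_by G t)"
proof -
  note K = prod_CP_sub[OF E.T subset_refl]
  have "FF (prod_CP T) (conj_by G t)" by (rule F.H_conj_by[OF K(1) subgroup.subset[OF K(1)] E.TG[OF assms]])
  moreover have "inv y \<otimes> conj_by G t y \<in> T" if "y \<in> prod_CP T" for y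
    by (rule commutator_T[OF subgroup.mem_carrier[OF K(1) that] assms])
  ultimately show ?thesis unfolding extends_mod_T_def by blast
qed

lemma extends_mod_T_ext:
  assumes a: "EE T \<alpha>" and Q: "centric Q" and C: "extends_mod_T Q \<alpha>"
  shows "extends_mod_T T \<alpha>"
proof -
  note Qs = centric_sub[OF Q]
  have aF: "FF T \<alpha>" by (rule E_F[OF a])
  have aT: "\<alpha> ` T = T" by (rule autT(1)[OF aF])
  obtain h where h: "FF (prod_CP Q) h" "\<And>x. x \<in> Q \<Longrightarrow> h x = \<alpha> x" "\<And>y. y \<in> prod_CP Q \<Longrightarrow> inv y \<otimes> h y \<in> T"
    by (rule extends_mod_TE[OF C]) (rule that)
  obtain b where b: "FF (prod_CP T) b" "\<And>x. x \<in> T \<Longrightarrow> b x = \<alpha> x" "b ` prod_CP T = prod_CP T"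
    "\<And>V. subgroup V G \<Longrightarrow> V \<subseteq> T \<Longrightarrow> b ` prod_CP V = prod_CP (\<alpha> ` V)" by (rule L_ext[OF aF]) (rule that)
  note L = prod_CP_sub[OF E.T subset_refl] and K = prod_CP_sub[OF Qs]
  have KL: "prod_CP Q \<subseteq> prod_CP T" by (rule prod_CP_mono[OF Qs(2)])
  have LG: "prod_CP T \<subseteq> carrier G" by (rule subgroup.subset[OF L(1)])
  have "h ` Q = \<alpha> ` Q" by (rule image_cong) (use h(2) in auto)
  hence hK: "h ` prod_CP Q = prod_CP (\<alpha> ` Q)" using lift_img[OF Q h(1,3)] by simp
  have bK: "FF (prod_CP Q) b" by (rule F.H_restr[OF b(1) K(1) KL])
  have bKi: "b ` prod_CP Q = prod_CP (\<alpha> ` Q)" by (rule b(4)[OF Qs])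
  note bi = FF_inv[OF bK bKi]
  let ?\<gamma> = "\<lambda>y. inv_into (prod_CP Q) b (h y)"
  have g: "FF (prod_CP Q) ?\<gamma>" "?\<gamma> ` prod_CP Q = prod_CP Q" using FF_comp[OF h(1) hK bi(1)] bi(2) by auto
  have bg: "b (?\<gamma> y) = h y" if "y \<in> prod_CP Q" for y
  proof -
    have "h y \<in> b ` prod_CP Q" using that hK bKi by blast
    thus ?thesis by (rule f_inv_into_f)
  qed
  have gQ: "?\<gamma> x = x" if x: "x \<in> Q" for x
  proof -
    have "x \<in> prod_CP Q" "x \<in> T" using x K(2) Qs(2) by blast+
    thus ?thesis using F.H_inv_l[OF bK, of x] h(2)[OF x] b(2) by simp
  qed
  have bT: "b ` T = T" using aT b(2) by (metis image_cong)
  obtain n1 where n1: "n1 > 0" "\<And>x. x \<in> prod_CP Q \<Longrightarrow> (?\<gamma> ^^ n1) x = x" by (rule F.finite_order[OF g]) (rule that)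
  obtain n2 where n2: "n2 > 0" "\<And>x. x \<in> T \<Longrightarrow> (\<alpha> ^^ n2) x = x" by (rule E.finite_order[OF a aT]) (rule that)
  \<comment> \<open>The product annihilates both \<gamma> on Q C_P(T) and \<alpha> on T, so one
    exponent m serves for both.\<close>
  have M: "n1 * n2 > 0" using n1 n2 by simp
  obtain e s m j where m: "n1 * n2 = p ^ e * s" "coprime s p" "p ^ e dvd m" "m = s * j + 1"
    by (rule F.p_part_split[OF M]) (rule that)
  have sp: "s > 0" using m(1) M by (cases s) auto
  let ?gm = "?\<gamma> ^^ m"
  have gm: "FF (prod_CP Q) ?gm" "?gm ` prod_CP Q = prod_CP Q" using F.H_funpow[OF g] by auto
  have gmQ: "?gm x = x" if "x \<in> Q" for x
    by (rule F.funpow_id_mult[of Q 1 ?\<gamma> m x]) (use gQ that in auto)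
  have gms: "(?gm ^^ s) x = x" if x: "x \<in> prod_CP Q" for x
  proof -
    have "n1 dvd p ^ e * s" unfolding m(1)[symmetric] by simp
    hence "n1 dvd m * s" using m(3) by (meson dvd_trans mult_dvd_mono dvd_refl)
    from F.funpow_id_mult[OF n1(2) this x] show ?thesis by (simp add: funpow_mult mult.commute)
  qed
  have "\<exists>\<gamma>'. FF (prod_CP T) \<gamma>' \<and> \<gamma>' ` prod_CP T = prod_CP T \<and> (\<forall>x\<in>T. \<gamma>' x = x) \<and> (\<forall>x\<in>prod_CP Q. \<gamma>' x = ?gm x)"
    by (rule lift_id[OF Q gm gmQ m(2) sp gms])
  then obtain \<gamma>' where g': "FF (prod_CP T) \<gamma>'" "\<gamma>' ` prod_CP T = prod_CP T" "\<forall>x\<in>T. \<gamma>' x = x" "\<forall>x\<in>prod_CP Q. \<gamma>' x = ?gm x"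
    by (elim exE conjE) (rule that)
  have bpow: "FF (prod_CP T) (b ^^ i)" "(b ^^ i) ` prod_CP T = prod_CP T" for i using F.H_funpow[OF b(1,3)] by auto
  have bpT: "(b ^^ i) t \<in> T" if "t \<in> T" for i t by (rule F.funpow_in[OF bT that])
  \<comment> \<open>Neither b nor \<gamma> need be trivial modulo T, but b^i \<gamma>^i is: inside
    b^(i+1) \<gamma>^(i+1) the middle pair b \<gamma> equals h, whose shift lies in T and is kept
    there by b^i.\<close>
  have modT: "inv y \<otimes> (b ^^ i) ((?\<gamma> ^^ i) y) \<in> T" if y: "y \<in> prod_CP Q" for i y
  proof (induction i)
    case 0 thus ?case using y KL LG subgroup.one_closed[OF E.T] by auto
  next
    case (Suc i)
    let ?w = "(?\<gamma> ^^ i) y"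
    have w: "?w \<in> prod_CP Q" by (rule F.funpow_in[OF g(2) y])
    have wL: "?w \<in> prod_CP T" using w KL by blast
    have t: "inv ?w \<otimes> h ?w \<in> T" by (rule h(3)[OF w])
    have tL: "inv ?w \<otimes> h ?w \<in> prod_CP T" using t L(2) by blast
    have hw: "h ?w = ?w \<otimes> (inv ?w \<otimes> h ?w)" using F.H_mem(1,2)[OF h(1) w] by simp
    have G: "y \<in> carrier G" "(b ^^ i) ?w \<in> carrier G" "(b ^^ i) (inv ?w \<otimes> h ?w) \<in> carrier G"
      using y KL LG F.H_mem(2)[OF bpow(1) wL] F.H_mem(2)[OF bpow(1) tL] by blast+
    have "(b ^^ Suc i) ((?\<gamma> ^^ Suc i) y) = (b ^^ i) (b (?\<gamma> ?w))" by (simp add: funpow_swap1)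
    also have "\<dots> = (b ^^ i) (h ?w)" unfolding bg[OF w] ..
    also have "\<dots> = (b ^^ i) ?w \<otimes> (b ^^ i) (inv ?w \<otimes> h ?w)"
      by (subst hw) (rule F.H_mult[OF bpow(1) wL tL])
    finally have "inv y \<otimes> (b ^^ Suc i) ((?\<gamma> ^^ Suc i) y) = (inv y \<otimes> (b ^^ i) ?w) \<otimes> (b ^^ i) (inv ?w \<otimes> h ?w)"
      using G by (simp add: F.m_assoc)
    thus ?case using subgroup.m_closed[OF E.T Suc bpT[OF t]] by simp
  qed
  let ?\<theta> = "\<lambda>y. (b ^^ m) (\<gamma>' y)"
  have th: "FF (prod_CP T) ?\<theta>" by (rule FF_comp(1)[OF g'(1,2) bpow(1)])
  have thT: "?\<theta> x = (\<alpha> ^^ m) x" if x: "x \<in> T" for x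
    using bspec[OF g'(3) x] F.funpow_eq[OF bT b(2) x, of m] by simp
  have apT: "(\<alpha> ^^ i) x \<in> T" if "x \<in> T" for i x by (rule F.funpow_in[OF aT that])
  \<comment> \<open>Split y into a part in T, which stays in T, and a part in C_P(T), where
    \<gamma>' agrees with \<gamma>^m; the two shifts combine because T is normal.\<close>
  have th_modT: "inv y \<otimes> ?\<theta> y \<in> T" if y: "y \<in> prod_CP T" for y
  proof -
    obtain t c where tc: "t \<in> T" "c \<in> CP" "y = t \<otimes> c" by (rule prod_CPE[OF y])
    have i: "t \<in> prod_CP T" "c \<in> prod_CP T" "c \<in> prod_CP Q" using tc L K(3) by blast+
    have c: "inv c \<otimes> ?\<theta> c \<in> T" using modT[OF i(3), of m] bspec[OF g'(4) i(3)] by simp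
    have t: "inv t \<otimes> ?\<theta> t \<in> T"
      using subgroup.m_closed[OF E.T subgroup.m_inv_closed[OF E.T tc(1)] apT[OF tc(1)]] thT[OF tc(1)] by simp
    have G: "t \<in> carrier G" "c \<in> carrier G" "?\<theta> t \<in> carrier G" "?\<theta> c \<in> carrier G"
      using i LG F.H_mem(2)[OF th] by blast+
    have "inv y \<otimes> ?\<theta> y = conj_by G c (inv t \<otimes> ?\<theta> t) \<otimes> (inv c \<otimes> ?\<theta> c)"
      unfolding tc(3) F.H_mult[OF th i(1,2)] conj_by_def using G by (simp add: F.m_assoc F.inv_mult_group)
    thus ?thesis using subgroup.m_closed[OF E.T T_normal[OF G(2) t] c] by simp
  qed
  have Cm: "extends_mod_T T (\<alpha> ^^ m)" unfolding extends_mod_T_def using th thT th_modT by (intro exI[of _ ?\<theta>]) auto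
  \<comment> \<open>As m = s j + 1, \<alpha>^m = \<alpha> \<delta>; and \<delta>^(p^e) is trivial
    since n2 divides p^e s.\<close>
  let ?\<delta> = "\<alpha> ^^ (s * j)"
  have d: "EE T ?\<delta>" "?\<delta> ` T = T" using E.H_funpow[OF a aT] by auto
  have "\<forall>x\<in>T. (?\<delta> ^^ (p ^ e)) x = x"
  proof
    fix x assume x: "x \<in> T"
    have "n2 dvd p ^ e * s" unfolding m(1)[symmetric] by simp
    hence "n2 dvd (s * j) * p ^ e" by (metis dvd_mult2 mult.assoc mult.commute)
    from F.funpow_id_mult[OF n2(2) this x] show "(?\<delta> ^^ (p ^ e)) x = x" by (simp add: funpow_mult mult.commute)
  qed
  from E_p_inner[OF d this] obtain t where t: "t \<in> T" "\<forall>x\<in>T. ?\<delta> x = conj_by G t x" by blast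
  have it: "inv t \<in> T" by (rule subgroup.m_inv_closed[OF E.T t(1)])
  have itT: "conj_by G (inv t) ` T = T" by (rule F.conj_by_image_subgroup[OF E.T it])
  have "extends_mod_T T (\<lambda>x. (\<alpha> ^^ m) (conj_by G (inv t) x))"
    by (rule extends_mod_T_comp[OF centric_T extends_mod_T_conj_by[OF it]]) (simp add: itT Cm)
  thus ?thesis
  proof (rule extends_mod_T_cong)
    fix x assume x: "x \<in> T"
    have c: "conj_by G (inv t) x \<in> T" using itT x by blast
    have "(\<alpha> ^^ m) (conj_by G (inv t) x) = \<alpha> (?\<delta> (conj_by G (inv t) x))" unfolding m(4) by simp
    also have "?\<delta> (conj_by G (inv t) x) = conj_by G t (conj_by G (inv t) x)" using t(2) c by blast
    also have "\<dots> = x" using E.TG[OF t(1)] E.TG[OF x] by simp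
    finally show "(\<alpha> ^^ m) (conj_by G (inv t) x) = \<alpha> x" .
  qed
qed

text \<open>Derivations in \<open>OE\<close> may pass through noncentric domains, over which no lift
  is claimed; therefore the property is asserted for the restrictions to all centric subgroups of
  the domain.\<close>

lemma OE_extends_mod_T: "OE U f \<Longrightarrow> centric Q \<Longrightarrow> Q \<subseteq> U \<Longrightarrow> extends_mod_T Q f"
proof (induction arbitrary: Q rule: OE.induct)
  case (gen U t \<psi>)
  show ?case
    by (rule extends_mod_T_restr[OF extends_mod_T_gen[OF gen(2-5)] centric_sub(1)[OF gen(6)] gen(7) centric_sub(2)[OF gen(1)]])
next
  case (congr Q' f g)
  show ?case by (rule extends_mod_T_cong[OF congr(3)[OF congr(4,5)]]) (use congr(2,5) in blast)
next
  case (comp Q' f g)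
  have fQ: "OE Q f" by (rule OE.H_restr[OF comp(1) centric_sub(1)[OF comp(5)] comp(6)])
  have c: "centric (f ` Q)" by (rule centric_img[OF comp(5) OE_FF[OF fQ]])
  show ?case by (rule extends_mod_T_comp[OF comp(5) comp(3)[OF comp(5,6)] comp(4)[OF c]]) (use comp(6) in blast)
next
  case (restr Q' f Q'')
  show ?case by (rule restr(4)[OF restr(5)]) (use restr(3,6) in blast)
next
  case (inv Q' f)
  let ?Q0 = "inv_into Q' f ` Q"
  have i: "OE Q (inv_into Q' f)" by (rule OE.H_restr[OF OE.inv[OF inv(1)] centric_sub(1)[OF inv(3)] inv(4)])
  have c: "centric ?Q0" by (rule centric_img[OF inv(3) OE_FF[OF i]])
  have sub: "?Q0 \<subseteq> Q'" using image_mono[OF inv(4), of "inv_into Q' f"] OE.H_inv_img[OF inv(1)] by simp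
  have im: "f ` ?Q0 = Q"
  proof -
    have "f ` ?Q0 = (\<lambda>x. x) ` Q" unfolding image_image by (rule image_cong) (use inv(4) f_inv_into_f[of _ f Q'] in auto)
    thus ?thesis by simp
  qed
  have "extends_mod_T (f ` ?Q0) (inv_into ?Q0 f)" by (rule extends_mod_T_inv[OF c inv(2)[OF c sub]])
  hence "extends_mod_T Q (inv_into ?Q0 f)" unfolding im .
  thus ?case
  proof (rule extends_mod_T_cong)
    fix y assume "y \<in> Q"
    then obtain x where x: "x \<in> ?Q0" "y = f x" using im by blast
    have "inv_into ?Q0 f y = x" unfolding x(2) by (rule inv_into_f_f[OF inj_on_subset[OF OE.H_inj[OF inv(1)] sub] x(1)])
    moreover have "inv_into Q' f y = x" unfolding x(2) using OE.H_inv_l[OF inv(1)] sub x(1) by blast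
    ultimately show "inv_into ?Q0 f y = inv_into Q' f y" by simp
  qed
next
  case (ext \<alpha> Q')
  have "extends_mod_T Q' \<alpha>" by (rule ext(4)[OF ext(2) subset_refl])
  from extends_mod_T_ext[OF ext(1,2) this] show ?case
    by (rule extends_mod_T_restr[OF _ centric_sub(1)[OF ext(5)] ext(6) subset_refl])
qed

text \<open>The shift of c lies in T because the lift is trivial modulo T, and in C_P(T) because h
  preserves T and so its centralizer; together this is the centre of T.\<close>

theorem OE_T_extends:
  assumes "OE T \<phi>"
  obtains h where "FF (prod_CP T) h" "\<And>x. x \<in> T \<Longrightarrow> h x = \<phi> x" "h ` prod_CP T = prod_CP T"
    "\<And>c. c \<in> CP \<Longrightarrow> inv c \<otimes> h c \<in> centralizer_in G T T"
proof -
  obtain h where h: "FF (prod_CP T) h" "\<And>x. x \<in> T \<Longrightarrow> h x = \<phi> x" "\<And>y. y \<in> prod_CP T \<Longrightarrow> inv y \<otimes> h y \<in> T"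
    by (rule extends_mod_TE[OF OE_extends_mod_T[OF assms centric_T subset_refl]]) (rule that)
  note K = prod_CP_sub[OF E.T subset_refl]
  have pT: "\<phi> ` T = T" by (rule autT(1)[OF OE_FF[OF assms]])
  have hT: "h ` T = T" using pT h(2) by (metis image_cong)
  have hK: "h ` prod_CP T = prod_CP T" using lift_img[OF centric_T h(1,3)] hT by simp
  have "inv c \<otimes> h c \<in> centralizer_in G T T" if c: "c \<in> CP" for c
  proof -
    have cK: "c \<in> prod_CP T" using c K(3) by blast
    have "h c \<in> centralizer_in G (carrier G) (h ` T)"
      by (rule F.H_centralizer_in[OF h(1) cK _ K(2)]) (use c in \<open>simp add: CP_def\<close>)
    hence "h c \<in> CP" unfolding hT CP_def .
    hence "inv c \<otimes> h c \<in> CP" using subgroup.m_closed[OF CP_sub subgroup.m_inv_closed[OF CP_sub c]] by blast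
    thus ?thesis using h(3)[OF cK] unfolding CP_def centralizer_in_def by blast
  qed
  thus ?thesis using that h(1,2) hK by blast
qed

end

section \<open>Translation to hom-sets\<close>

text \<open>The codomain is normalized to T and values outside Q are forgotten;
  \<open>homs_of\<close> restores codomains and extensionality.\<close>

definition mor_into :: "'a set \<Rightarrow> 'a hom_sets \<Rightarrow> 'a set \<Rightarrow> ('a \<Rightarrow> 'a) \<Rightarrow> bool" where
  "mor_into T E Q f \<longleftrightarrow> restrict f Q \<in> E Q T"

definition homs_of :: "('a, 'b) monoid_scheme \<Rightarrow> 'a set \<Rightarrow> ('a set \<Rightarrow> ('a \<Rightarrow> 'a) \<Rightarrow> bool) \<Rightarrow> 'a hom_sets" where
  "homs_of G T H Q R = {f \<in> extensional Q. H Q f \<and> subgroup R G \<and> R \<subseteq> T \<and> f ` Q \<subseteq> R}"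

lemma restrict_restrict_sub: "Q \<subseteq> R \<Longrightarrow> restrict (restrict f R) Q = restrict f Q"
  by (rule restrict_ext) auto

context finite_p_group
begin

context
  fixes T assumes T: "subgroup T G"
begin

lemma subgroup_T_iff: "subgroup Q (G\<lparr>carrier := T\<rparr>) \<longleftrightarrow> subgroup Q G \<and> Q \<subseteq> T"
  using incl_subgroup[OF T] subgroup_incl[OF _ T] subgroup.subset[of Q "G\<lparr>carrier := T\<rparr>"] by auto

lemma T_mem_carrier: "x \<in> T \<Longrightarrow> x \<in> carrier G"
  using T by (rule subgroup.mem_carrier)

lemma conj_map_T: "g \<in> T \<Longrightarrow> conj_map (G\<lparr>carrier := T\<rparr>) Q g = restrict (conj_by G g) Q"
  unfolding conj_map_def conj_by_def using m_inv_consistent[OF T] by simp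

lemma normalizer_T:
  assumes Q: "subgroup Q G" "Q \<subseteq> T" shows "normalizer (G\<lparr>carrier := T\<rparr>) Q = normalizer_in G T Q"
proof -
  have QG: "x \<in> carrier G" if "x \<in> Q" for x using Q(1) that by (rule subgroup.mem_carrier)
  have e: "(g <#\<^bsub>G\<lparr>carrier := T\<rparr>\<^esub> Q #>\<^bsub>G\<lparr>carrier := T\<rparr>\<^esub> (inv\<^bsub>G\<lparr>carrier := T\<rparr>\<^esub> g)) = conj_by G (inv g) ` Q" if g: "g \<in> T" for g
    unfolding l_coset_def r_coset_def conj_by_def using m_inv_consistent[OF T g] T_mem_carrier[OF g] by auto
  have e': "conj_by G (inv g) ` Q = Q \<longleftrightarrow> conj_by G g ` Q = Q" if g: "g \<in> T" for g
  proof -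
    have gG: "g \<in> carrier G" by (rule T_mem_carrier[OF g])
    have 1: "conj_by G g ` conj_by G (inv g) ` Q = Q" "conj_by G (inv g) ` conj_by G g ` Q = Q"
      unfolding image_image using gG QG by simp_all
    show ?thesis using 1 by metis
  qed
  have "g \<in> normalizer (G\<lparr>carrier := T\<rparr>) Q \<longleftrightarrow> g \<in> normalizer_in G T Q" for g
  proof (cases "g \<in> T")
    case True
    show ?thesis
      unfolding normalizer_def stabilizer_def normalizer_in_def using e[OF True] e'[OF True] True Q(2) by simp
  next
    case False
    thus ?thesis unfolding normalizer_def stabilizer_def normalizer_in_def by simp
  qed
  thus ?thesis by blast
qed

lemma conj_auts_T: assumes "subgroup Q G" "Q \<subseteq> T" shows "conj_auts (G\<lparr>carrier := T\<rparr>) Q = AutT G T Q"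
  unfolding conj_auts_def normalizer_T[OF assms] AutT_def
  by (rule image_cong) (auto simp: conj_map_T normalizer_inD(1))

lemma p_group_T: "p_group p (G\<lparr>carrier := T\<rparr>)"
proof -
  interpret T: group "G\<lparr>carrier := T\<rparr>" by (rule subgroup_imp_group[OF T])
  show ?thesis
    using finite_subgroup[OF T] subgroup_order_p_power[OF T] by unfold_locales (auto simp: order_def)
qed

context
  fixes E assumes fs: "fusion_system p (G\<lparr>carrier := T\<rparr>) E"
begin

interpretation E: fusion_system p "G\<lparr>carrier := T\<rparr>" E by (rule fs)

lemma fs_mor:
  assumes "\<phi> \<in> E Q R"
  shows "subgroup Q G" "Q \<subseteq> T" "subgroup R G" "R \<subseteq> T" "\<phi> ` Q \<subseteq> R" "inj_on \<phi> Q" "\<phi> \<in> extensional Q"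
    "\<And>x y. x \<in> Q \<Longrightarrow> y \<in> Q \<Longrightarrow> \<phi> (x \<otimes> y) = \<phi> x \<otimes> \<phi> y"
  using E.morphism[OF assms] unfolding subgroup_T_iff mon_def hom_def by auto

lemma fs_id: assumes "subgroup Q G" "subgroup R G" "Q \<subseteq> R" "R \<subseteq> T" shows "(\<lambda>x\<in>Q. x) \<in> E Q R"
proof -
  have QG: "x \<in> carrier G" if "x \<in> Q" for x using assms(1) that by (rule subgroup.mem_carrier)
  have o: "\<one> \<in> T" by (rule subgroup.one_closed[OF T])
  have e: "conj_map (G\<lparr>carrier := T\<rparr>) Q \<one> = (\<lambda>x\<in>Q. x)"
    unfolding conj_map_T[OF o] by (rule restrict_ext) (use QG in simp)
  have "conj_map (G\<lparr>carrier := T\<rparr>) Q \<one> \<in> E Q R"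
    by (rule E.conj_map_morphism) (use assms o e in \<open>auto simp: subgroup_T_iff\<close>)
  thus ?thesis unfolding e .
qed

text \<open>Shrink the codomain to the image, then compose with an inclusion, which is conjugation
  by the identity element.\<close>

lemma fs_enlarge: assumes "\<phi> \<in> E Q R" "\<phi> ` Q \<subseteq> R'" "subgroup R' G" "R' \<subseteq> T" shows "\<phi> \<in> E Q R'"
proof -
  have c: "\<phi> \<in> E Q (\<phi> ` Q)" by (rule E.corestrict_morphism[OF assms(1)])
  have "compose Q (\<lambda>x\<in>\<phi> ` Q. x) \<phi> \<in> E Q R'"
    by (rule E.compose_morphism[OF c fs_id[OF fs_mor(3)[OF c] assms(3,2,4)]])
  moreover have "compose Q (\<lambda>x\<in>\<phi> ` Q. x) \<phi> = \<phi>"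
    by (rule extensionalityI[of _ Q]) (use fs_mor(7)[OF assms(1)] in \<open>auto simp: compose_def\<close>)
  ultimately show ?thesis by simp
qed

lemma mor_into_mor: assumes "\<phi> \<in> E Q R" shows "mor_into T E Q \<phi>"
proof -
  have "\<phi> \<in> E Q T" by (rule fs_enlarge[OF assms _ T subset_refl]) (use fs_mor(4,5)[OF assms] in blast)
  moreover have "restrict \<phi> Q = \<phi>" by (rule extensional_restrict[OF fs_mor(7)[OF assms]])
  ultimately show ?thesis unfolding mor_into_def by simp
qed

lemma mor_mor_into: assumes "mor_into T E Q f" "f ` Q \<subseteq> R" "subgroup R G" "R \<subseteq> T" shows "restrict f Q \<in> E Q R"
  by (rule fs_enlarge[OF assms(1)[unfolded mor_into_def] _ assms(3,4)]) (use assms(2) in auto)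

lemma mor_into_fusion_pred: "fusion_pred p G T (mor_into T E)"
proof (rule fusion_pred.intro, rule finite_p_group_axioms, rule fusion_pred_axioms.intro)
  show "subgroup T G" by (rule T)
  show "subgroup Q G \<and> Q \<subseteq> T \<and> f ` Q \<subseteq> T \<and> inj_on f Q" if "mor_into T E Q f" for Q f
    using fs_mor(1,2,5,6)[OF that[unfolded mor_into_def]] by (auto simp: inj_on_def)
  show "f (x \<otimes> y) = f x \<otimes> f y" if "mor_into T E Q f" "x \<in> Q" "y \<in> Q" for Q f x y
    using fs_mor(8)[OF that(1)[unfolded mor_into_def] that(2,3)]
      subgroup.m_closed[OF fs_mor(1)[OF that(1)[unfolded mor_into_def]] that(2,3)] that(2,3) by simp
  show "mor_into T E Q g" if "mor_into T E Q f" "\<And>x. x \<in> Q \<Longrightarrow> f x = g x" for Q f g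
  proof -
    have "restrict f Q = restrict g Q" by (rule restrict_ext) (use that(2) in simp)
    thus ?thesis using that(1) unfolding mor_into_def by simp
  qed
  show "mor_into T E Q (conj_by G t)" if "subgroup Q G" "Q \<subseteq> T" "t \<in> T" for Q t
  proof -
    have "conj_map (G\<lparr>carrier := T\<rparr>) Q t \<in> E Q T"
    proof (rule E.conj_map_morphism)
      show "conj_map (G\<lparr>carrier := T\<rparr>) Q t ` Q \<subseteq> T"
        unfolding conj_map_T[OF that(3)] using conj_by_mem[OF T that(3)] that(2) by auto
    qed (use that T in \<open>auto simp: subgroup_T_iff\<close>)
    thus ?thesis unfolding mor_into_def conj_map_T[OF that(3)] .
  qed
  show "mor_into T E Q (\<lambda>x. g (f x))" if h: "mor_into T E Q f" "mor_into T E R g" "f ` Q \<subseteq> R" for Q R f g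
  proof -
    have R: "subgroup R G" "R \<subseteq> T" using fs_mor(1,2)[OF h(2)[unfolded mor_into_def]] by auto
    have "compose Q (restrict g R) (restrict f Q) \<in> E Q T"
      by (rule E.compose_morphism[OF mor_mor_into[OF h(1,3) R] h(2)[unfolded mor_into_def]])
    moreover have "compose Q (restrict g R) (restrict f Q) = restrict (\<lambda>x. g (f x)) Q"
      unfolding compose_def by (rule restrict_ext) (use h(3) in auto)
    ultimately show ?thesis unfolding mor_into_def by simp
  qed
  show "mor_into T E (f ` Q) (inv_into Q f)" if h: "mor_into T E Q f" for Q f
  proof -
    note h' = h[unfolded mor_into_def]
    have e: "restrict f Q ` Q = f ` Q" by (rule image_cong) auto
    have inj: "inj_on f Q" using fs_mor(6)[OF h'] by (auto simp: inj_on_def)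
    have "restrict (inv_into Q (restrict f Q)) (f ` Q) \<in> E (f ` Q) Q"
      using E.inverse_morphism[OF h'] unfolding e .
    moreover have "restrict (inv_into Q (restrict f Q)) (f ` Q) = restrict (inv_into Q f) (f ` Q)"
    proof (rule restrict_ext)
      fix y assume "y \<in> f ` Q"
      then obtain x where x: "x \<in> Q" "y = f x" by blast
      have "inv_into Q (restrict f Q) (restrict f Q x) = x" by (rule inv_into_f_f[OF fs_mor(6)[OF h'] x(1)])
      thus "inv_into Q (restrict f Q) y = inv_into Q f y" using x inv_into_f_f[OF inj x(1)] by simp
    qed
    ultimately have m: "restrict (inv_into Q f) (f ` Q) \<in> E (f ` Q) Q" by simp
    hence "restrict (inv_into Q f) (f ` Q) \<in> E (f ` Q) T"
      by (rule fs_enlarge[OF _ _ T subset_refl]) (use fs_mor(4,5)[OF m] in blast)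
    thus ?thesis unfolding mor_into_def .
  qed
qed

interpretation H: fusion_pred p G T "mor_into T E" by (rule mor_into_fusion_pred)

lemma E_Auts: "E Q Q = Auts (mor_into T E) Q"
proof (intro equalityI subsetI)
  fix f assume f: "f \<in> E Q Q"
  have "f ` Q = Q" by (rule endo_inj_surj[OF finite_subgroup[OF fs_mor(1)[OF f]] fs_mor(5,6)[OF f]])
  thus "f \<in> Auts (mor_into T E) Q" unfolding Auts_def using mor_into_mor[OF f] fs_mor(7)[OF f] by blast
next
  fix f assume f: "f \<in> Auts (mor_into T E) Q"
  have h: "mor_into T E Q f" "f ` Q = Q" "f \<in> extensional Q" using f unfolding Auts_def by auto
  have "restrict f Q \<in> E Q Q"
    by (rule mor_mor_into[OF h(1) _ H.H_sub[OF h(1)] H.H_subT[OF h(1)]]) (use h(2) in blast)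
  thus "f \<in> E Q Q" using extensional_restrict[OF h(3)] by simp
qed

lemma fully_automized_iff:
  assumes "subgroup R G" "R \<subseteq> T"
  shows "fully_automized p (G\<lparr>carrier := T\<rparr>) E R \<longleftrightarrow> sylow_in p (AutT G T R) (Auts (mor_into T E) R)"
proof -
  interpret B: group "BijGroup R" by (rule group_BijGroup)
  have "subgroup (AutT G T R) (BijGroup R\<lparr>carrier := Auts (mor_into T E) R\<rparr>)"
    by (rule B.subgroup_incl[OF H.AutT_subgroup(1)[OF assms] H.Auts_subgroup[OF assms] H.AutT_sub_Auts[OF assms]])
  thus ?thesis
    unfolding fully_automized_def sylow_subgroup_def sylow_in_def conj_auts_T[OF assms] Aut_def E_Auts
    using H.AutT_sub_Auts[OF assms] by (simp add: order_def)
qed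

lemma isos_iff: "\<phi> \<in> isos E S R \<longleftrightarrow> \<phi> \<in> extensional S \<and> mor_into T E S \<phi> \<and> \<phi> ` S = R"
proof
  assume "\<phi> \<in> isos E S R"
  thus "\<phi> \<in> extensional S \<and> mor_into T E S \<phi> \<and> \<phi> ` S = R"
    unfolding isos_def using mor_into_mor fs_mor(7) by blast
next
  assume a: "\<phi> \<in> extensional S \<and> mor_into T E S \<phi> \<and> \<phi> ` S = R"
  have R: "subgroup R G" "R \<subseteq> T" using H.H_img[of S \<phi>] H.H_imgT[of S \<phi>] a by auto
  have "restrict \<phi> S \<in> E S R" by (rule mor_mor_into[OF _ _ R]) (use a in auto)
  moreover have "restrict \<phi> S = \<phi>" by (rule extensional_restrict) (use a in blast)
  ultimately show "\<phi> \<in> isos E S R" unfolding isos_def using a by simp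
qed

lemma extension_domain_ext_dom:
  assumes f: "mor_into T E S \<phi>" "\<phi> ` S = R"
  shows "extension_domain (G\<lparr>carrier := T\<rparr>) S R \<phi> = H.ext_dom S R \<phi>"
proof -
  have S: "subgroup S G" "S \<subseteq> T" using H.H_sub[OF f(1)] H.H_subT[OF f(1)] by auto
  have R: "subgroup R G" "R \<subseteq> T" using H.H_img[OF f(1)] H.H_imgT[OF f(1)] f(2) by auto
  have key: "restrict (conj_by G g) S = compose S (inv_into S \<phi>) (compose S (restrict (conj_by G u) R) \<phi>) \<longleftrightarrow>
      (\<forall>x\<in>S. \<phi> (conj_by G g x) = conj_by G u (\<phi> x))" if g: "g \<in> normalizer_in G T S" and u: "u \<in> normalizer_in G T R" for g u
  proof -
    have "conj_by G g x = inv_into S \<phi> (conj_by G u (\<phi> x)) \<longleftrightarrow> \<phi> (conj_by G g x) = conj_by G u (\<phi> x)" if x: "x \<in> S" for x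
    proof -
      have a: "conj_by G g x \<in> S" by (rule normalizer_inD(2)[OF g x])
      have "\<phi> x \<in> R" using x f(2) by blast
      hence "conj_by G u (\<phi> x) \<in> \<phi> ` S" using normalizer_inD(2)[OF u] f(2) by blast
      then obtain z where z: "z \<in> S" "conj_by G u (\<phi> x) = \<phi> z" by blast
      show ?thesis unfolding z(2) H.H_inv_l[OF f(1) z(1)] using H.H_eq_iff[OF f(1) a z(1)] by blast
    qed
    moreover have "restrict (conj_by G g) S = compose S (inv_into S \<phi>) (compose S (restrict (conj_by G u) R) \<phi>) \<longleftrightarrow>
        (\<forall>x\<in>S. conj_by G g x = inv_into S \<phi> (conj_by G u (\<phi> x)))"
    proof -
      have e: "compose S (inv_into S \<phi>) (compose S (restrict (conj_by G u) R) \<phi>) = restrict (\<lambda>x. inv_into S \<phi> (conj_by G u (\<phi> x))) S"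
        unfolding compose_def by (rule restrict_ext) (use f(2) in auto)
      show ?thesis unfolding e by (metis (no_types, lifting) restrict_apply' restrict_ext)
    qed
    ultimately show ?thesis by simp
  qed
  show ?thesis
  proof (intro equalityI subsetI)
    fix g assume "g \<in> extension_domain (G\<lparr>carrier := T\<rparr>) S R \<phi>"
    hence g: "g \<in> normalizer_in G T S" and ex: "\<exists>\<alpha>. conj_map (G\<lparr>carrier := T\<rparr>) S g = compose S (inv_into S \<phi>) (compose S \<alpha> \<phi>) \<and> \<alpha> \<in> AutT G T R"
      unfolding extension_domain_def normalizer_T[OF S] conj_auts_T[OF R] by auto
    then obtain u where u: "u \<in> normalizer_in G T R"
      "conj_map (G\<lparr>carrier := T\<rparr>) S g = compose S (inv_into S \<phi>) (compose S (restrict (conj_by G u) R) \<phi>)"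
      unfolding AutT_def by blast
    have "\<forall>x\<in>S. \<phi> (conj_by G g x) = conj_by G u (\<phi> x)" using u(2) key[OF g u(1)] unfolding conj_map_T[OF normalizer_inD(1)[OF g]] by blast
    thus "g \<in> H.ext_dom S R \<phi>" unfolding H.ext_dom_def using g u(1) by blast
  next
    fix g assume g': "g \<in> H.ext_dom S R \<phi>"
    hence g: "g \<in> normalizer_in G T S" unfolding H.ext_dom_def by blast
    obtain u where u: "u \<in> normalizer_in G T R" "\<forall>x\<in>S. \<phi> (conj_by G g x) = conj_by G u (\<phi> x)" using g' unfolding H.ext_dom_def by blast
    have 1: "restrict (conj_by G g) S = compose S (inv_into S \<phi>) (compose S (restrict (conj_by G u) R) \<phi>)"
      using u(2) key[OF g u(1)] by blast
    have "restrict (conj_by G g) S \<in> AutT G T S" "restrict (conj_by G u) R \<in> AutT G T R" using g u(1) unfolding AutT_def by auto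
    thus "g \<in> extension_domain (G\<lparr>carrier := T\<rparr>) S R \<phi>"
      unfolding extension_domain_def normalizer_T[OF S] conj_auts_T[OF R] conj_auts_T[OF S]
      using g 1 conj_map_T[OF normalizer_inD(1)[OF g]] by auto
  qed
qed

text \<open>In one direction the extension to the full domain is restricted to V; in the other V is
  taken to be the full domain, which is a subgroup.\<close>

lemma receptive_iff:
  assumes R: "subgroup R G" "R \<subseteq> T"
  shows "receptive (G\<lparr>carrier := T\<rparr>) E R \<longleftrightarrow> is_receptive G T (mor_into T E) R"
proof
  assume r: "receptive (G\<lparr>carrier := T\<rparr>) E R"
  show "is_receptive G T (mor_into T E) R"
  proof (rule H.is_receptiveI)
    fix S f V assume f: "mor_into T E S f" "f ` S = R" and V: "subgroup V G" "S \<subseteq> V" "V \<subseteq> H.ext_dom S R f"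
    let ?\<phi> = "restrict f S"
    have p: "mor_into T E S ?\<phi>" by (rule H.H_cong[OF f(1)]) simp
    have pR: "?\<phi> ` S = R" using f(2) by simp
    have "?\<phi> \<in> isos E S R" unfolding isos_iff using p pR by simp
    then obtain \<psi> where psi: "\<psi> \<in> E (H.ext_dom S R ?\<phi>) T" "restrict \<psi> S = ?\<phi>"
      using r extension_domain_ext_dom[OF p pR] unfolding receptive_def by fastforce
    have "H.ext_dom S R ?\<phi> = H.ext_dom S R f" unfolding H.ext_dom_def using normalizer_inD(2)[of _ T S] by auto
    hence "mor_into T E (H.ext_dom S R f) \<psi>" using mor_into_mor[OF psi(1)] by simp
    hence "mor_into T E V \<psi>" by (rule H.H_restr[OF _ V(1,3)])
    moreover have "\<forall>x\<in>S. \<psi> x = f x" using psi(2) by (metis restrict_apply')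
    ultimately show "\<exists>h. mor_into T E V h \<and> (\<forall>x\<in>S. h x = f x)" by blast
  qed
next
  assume r: "is_receptive G T (mor_into T E) R"
  show "receptive (G\<lparr>carrier := T\<rparr>) E R"
    unfolding receptive_def
  proof (intro allI ballI)
    fix S \<phi> assume "\<phi> \<in> isos E S R"
    hence p: "\<phi> \<in> extensional S" "mor_into T E S \<phi>" "\<phi> ` S = R" unfolding isos_iff by auto
    note N = H.ext_dom_subgroup[OF p(2,3)]
    obtain h where h: "mor_into T E (H.ext_dom S R \<phi>) h" "\<And>x. x \<in> S \<Longrightarrow> h x = \<phi> x"
      by (rule H.is_receptive_ext_dom[OF r p(2,3) N subset_refl]) (rule that)
    have "restrict h (H.ext_dom S R \<phi>) \<in> E (H.ext_dom S R \<phi>) T" using h(1) unfolding mor_into_def .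
    moreover have "restrict (restrict h (H.ext_dom S R \<phi>)) S = \<phi>"
      unfolding restrict_restrict_sub[OF N(2)]
      by (rule extensionalityI[of _ S]) (use p(1) h(2) in auto)
    ultimately show "\<exists>\<psi>\<in>E (extension_domain (G\<lparr>carrier := T\<rparr>) S R \<phi>) (carrier (G\<lparr>carrier := T\<rparr>)). restrict \<psi> S = \<phi>"
      unfolding extension_domain_ext_dom[OF p(2,3)]
      by (intro bexI[of _ "restrict h (H.ext_dom S R \<phi>)"]) simp_all
  qed
qed

lemma saturated_iff: "saturated p (G\<lparr>carrier := T\<rparr>) E \<longleftrightarrow> H.is_saturated"
proof
  assume s: "saturated p (G\<lparr>carrier := T\<rparr>) E"
  show H.is_saturated unfolding H.is_saturated_def
  proof (intro allI impI)
    fix Q assume "subgroup Q G" "Q \<subseteq> T"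
    then obtain R where R: "isos E Q R \<noteq> {}" "fully_automized p (G\<lparr>carrier := T\<rparr>) E R" "receptive (G\<lparr>carrier := T\<rparr>) E R"
      using s unfolding saturated_def subgroup_T_iff by blast
    then obtain \<phi> where p: "mor_into T E Q \<phi>" "\<phi> ` Q = R" unfolding isos_iff ex_in_conv[symmetric] by blast
    have Rs: "subgroup R G" "R \<subseteq> T" using H.H_img[OF p(1)] H.H_imgT[OF p(1)] p(2) by auto
    have "good p G T (mor_into T E) R"
      unfolding good_def using Rs R(2,3) fully_automized_iff[OF Rs] receptive_iff[OF Rs] by blast
    thus "\<exists>f. mor_into T E Q f \<and> good p G T (mor_into T E) (f ` Q)" using p by blast
  qed
next
  assume s: H.is_saturated
  show "saturated p (G\<lparr>carrier := T\<rparr>) E"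
    unfolding saturated_def subgroup_T_iff
  proof (intro conjI allI impI fs)
    fix Q assume Q: "subgroup Q G \<and> Q \<subseteq> T"
    obtain f where f: "mor_into T E Q f" "good p G T (mor_into T E) (f ` Q)" using H.is_saturatedE[OF s] Q by blast
    have Rs: "subgroup (f ` Q) G" "f ` Q \<subseteq> T" using f(2) unfolding good_def by auto
    have "mor_into T E Q (restrict f Q)" by (rule H.H_cong[OF f(1)]) simp
    hence "restrict f Q \<in> isos E Q (f ` Q)" unfolding isos_iff by simp
    moreover have "fully_automized p (G\<lparr>carrier := T\<rparr>) E (f ` Q)" "receptive (G\<lparr>carrier := T\<rparr>) E (f ` Q)"
      using f(2) fully_automized_iff[OF Rs] receptive_iff[OF Rs] unfolding good_def by auto
    ultimately show "\<exists>R. isos E Q R \<noteq> {} \<and> fully_automized p (G\<lparr>carrier := T\<rparr>) E R \<and> receptive (G\<lparr>carrier := T\<rparr>) E R"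
      by blast
  qed
qed

end

lemma homs_of_fusion_system:
  assumes "fusion_pred p G T H" shows "fusion_system p (G\<lparr>carrier := T\<rparr>) (homs_of G T H)"
proof -
  interpret H: fusion_pred p G T H by (rule assms)
  show ?thesis
  proof (rule fusion_system.intro, rule p_group_T, rule fusion_system_axioms.intro)
    fix \<phi> Q R assume "\<phi> \<in> homs_of G T H Q R"
    hence p: "\<phi> \<in> extensional Q" "H Q \<phi>" "subgroup R G" "R \<subseteq> T" "\<phi> ` Q \<subseteq> R" unfolding homs_of_def by auto
    have Q: "subgroup Q G" "Q \<subseteq> T" using H.H_sub[OF p(2)] H.H_subT[OF p(2)] by auto
    show "subgroup Q (G\<lparr>carrier := T\<rparr>) \<and> subgroup R (G\<lparr>carrier := T\<rparr>) \<and>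
        \<phi> \<in> mon (G\<lparr>carrier := T, carrier := Q\<rparr>) (G\<lparr>carrier := T, carrier := R\<rparr>) \<and> \<phi> \<in> extensional Q"
      unfolding subgroup_T_iff mon_def hom_def using Q p H.H_mult[OF p(2)] H.H_inj[OF p(2)] by auto
    show "\<phi> \<in> homs_of G T H Q (\<phi> ` Q)"
      unfolding homs_of_def using p H.H_img[OF p(2)] H.H_imgT[OF p(2)] by simp
    have "H (\<phi> ` Q) (restrict (inv_into Q \<phi>) (\<phi> ` Q))" by (rule H.H_cong[OF H.H_inv[OF p(2)]]) simp
    moreover have "restrict (inv_into Q \<phi>) (\<phi> ` Q) ` \<phi> ` Q \<subseteq> Q" using inv_into_into[of _ \<phi> Q] by auto
    ultimately show "restrict (inv_into Q \<phi>) (\<phi> ` Q) \<in> homs_of G T H (\<phi> ` Q) Q"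
      unfolding homs_of_def using Q by simp
  next
    fix Q R g assume a: "subgroup Q (G\<lparr>carrier := T\<rparr>)" "subgroup R (G\<lparr>carrier := T\<rparr>)" "g \<in> carrier (G\<lparr>carrier := T\<rparr>)"
      "conj_map (G\<lparr>carrier := T\<rparr>) Q g ` Q \<subseteq> R"
    have g: "g \<in> T" using a(3) by simp
    have "H Q (restrict (conj_by G g) Q)"
      by (rule H.H_cong[OF H.H_conj_by[OF _ _ g]]) (use a(1) in \<open>auto simp: subgroup_T_iff\<close>)
    thus "conj_map (G\<lparr>carrier := T\<rparr>) Q g \<in> homs_of G T H Q R"
      using a(2,4) unfolding homs_of_def conj_map_T[OF g] subgroup_T_iff by simp
  next
    fix \<phi> \<psi> Q R S assume "\<phi> \<in> homs_of G T H Q R" "\<psi> \<in> homs_of G T H R S"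
    hence p: "H Q \<phi>" "\<phi> ` Q \<subseteq> R" "H R \<psi>" "subgroup S G" "S \<subseteq> T" "\<psi> ` R \<subseteq> S" unfolding homs_of_def by auto
    have "H Q (compose Q \<psi> \<phi>)" by (rule H.H_cong[OF H.H_comp[OF p(1,3,2)]]) (simp add: compose_def)
    moreover have "compose Q \<psi> \<phi> ` Q \<subseteq> S" using p(2,6) by (auto simp: compose_def)
    ultimately show "compose Q \<psi> \<phi> \<in> homs_of G T H Q S" unfolding homs_of_def using p(4,5) by (simp add: compose_def)
  qed
qed

lemma mor_into_homs_of:
  assumes "fusion_pred p G T H" shows "mor_into T (homs_of G T H) = H"
proof (intro ext iffI)
  interpret H: fusion_pred p G T H by (rule assms)
  fix Q f
  show "H Q f" if "mor_into T (homs_of G T H) Q f"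
  proof -
    have "H Q (restrict f Q)" using that unfolding mor_into_def homs_of_def by blast
    thus ?thesis by (rule H.H_cong) simp
  qed
  show "mor_into T (homs_of G T H) Q f" if h: "H Q f"
  proof -
    have "H Q (restrict f Q)" by (rule H.H_cong[OF h]) simp
    thus ?thesis unfolding mor_into_def homs_of_def using H.H_imgT[OF h] T by auto
  qed
qed

end

lemma homs_of_mono:
  assumes F: "fusion_system p (G\<lparr>carrier := S\<rparr>) F" and S: "subgroup S G"
    and sub: "\<And>Q f. D Q f \<Longrightarrow> mor_into S F Q f" and TS: "T \<subseteq> S"
  shows "homs_of G T D \<le> F"
proof (intro le_funI subsetI)
  fix Q R \<phi> assume "\<phi> \<in> homs_of G T D Q R"
  hence p: "\<phi> \<in> extensional Q" "D Q \<phi>" "subgroup R G" "R \<subseteq> T" "\<phi> ` Q \<subseteq> R" unfolding homs_of_def by auto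
  have "restrict \<phi> Q \<in> F Q R" by (rule mor_mor_into[OF S F sub[OF p(2)] p(5,3)]) (use p(4) TS in blast)
  thus "\<phi> \<in> F Q R" unfolding extensional_restrict[OF p(1)] .
qed

text \<open>The carrier S is arbitrary, so that this applies to E in F on the ambient group and also
  to weakly normal subsystems of E on T.\<close>

lemma weakly_normal_closed_fusion_sub:
  assumes S: "subgroup S G" and F: "fusion_system p (G\<lparr>carrier := S\<rparr>) F"
    and wn: "weakly_normal p (G\<lparr>carrier := S\<rparr>) F T E"
  shows "closed_fusion_sub p G S (mor_into S F) T (mor_into T E)" "fusion_pred.is_saturated p G T (mor_into T E)"
    "mor_into S F R \<psi> \<Longrightarrow> R \<subseteq> T \<Longrightarrow> stable (mor_into T E) R \<psi>" "subgroup T G"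
    "fusion_system p (G\<lparr>carrier := T\<rparr>) E"
proof -
  have T: "subgroup T G" "T \<subseteq> S" and E: "fusion_system p (G\<lparr>carrier := T\<rparr>) E" and EF: "E \<le> F"
    and sc: "\<And>Q \<phi>. Q \<subseteq> T \<Longrightarrow> \<phi> \<in> F Q S \<Longrightarrow> \<phi> ` Q \<subseteq> T"
    and inv: "\<And>Q R \<phi> \<psi>. Q \<subseteq> R \<Longrightarrow> R \<subseteq> T \<Longrightarrow> \<phi> \<in> E Q R \<Longrightarrow> \<psi> \<in> F R T \<Longrightarrow>
        (\<lambda>x\<in>\<psi> ` Q. \<psi> (\<phi> (inv_into R \<psi> x))) \<in> E (\<psi> ` Q) (\<psi> ` R)"
    and sat: "saturated p (G\<lparr>carrier := T\<rparr>) E"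
    using wn subgroup_T_iff[OF S]
    unfolding weakly_normal_def invariant_subsystem_def subsystem_def strongly_closed_def by auto
  interpret HF: fusion_pred p G S "mor_into S F" by (rule mor_into_fusion_pred[OF S F])
  interpret HE: fusion_pred p G T "mor_into T E" by (rule mor_into_fusion_pred[OF T(1) E])
  show closed_fusion_sub: "closed_fusion_sub p G S (mor_into S F) T (mor_into T E)"
  proof (rule closed_fusion_sub.intro, rule HF.fusion_pred_axioms, rule HE.fusion_pred_axioms, rule closed_fusion_sub_axioms.intro, rule T(2))
    show "mor_into S F Q f" if h: "mor_into T E Q f" for Q f
    proof -
      have "restrict f Q \<in> F Q T" using h EF unfolding mor_into_def le_fun_def by blast
      hence "mor_into S F Q (restrict f Q)" by (rule mor_into_mor[OF S F])
      thus ?thesis by (rule HF.H_cong) simp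
    qed
    show "f ` Q \<subseteq> T" if "mor_into S F Q f" "Q \<subseteq> T" for Q f
      using sc[OF that(2) that(1)[unfolded mor_into_def]] by simp
  qed
  show "HE.is_saturated" using sat saturated_iff[OF T(1) E] by blast
  show "subgroup T G" "fusion_system p (G\<lparr>carrier := T\<rparr>) E" by (rule T(1), rule E)
  interpret HS: closed_fusion_sub p G S "mor_into S F" T "mor_into T E" by (rule closed_fusion_sub)
  assume psi: "mor_into S F R \<psi>" and RT: "R \<subseteq> T"
  show "stable (mor_into T E) R \<psi>"
    unfolding stable_def
  proof (intro allI impI)
    fix Q f assume f: "mor_into T E Q f" "Q \<subseteq> R" "f ` Q \<subseteq> R"
    have R: "subgroup R G" by (rule HF.H_sub[OF psi])
    have inj: "inj_on \<psi> R" by (rule HF.H_inj[OF psi])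
    have 1: "restrict f Q \<in> E Q R" by (rule mor_mor_into[OF T(1) E f(1,3) R RT])
    have 2: "restrict \<psi> R \<in> F R T" by (rule mor_mor_into[OF S F psi HS.closed[OF psi RT] T])
    have im: "restrict \<psi> R ` Q = \<psi> ` Q" using f(2) by (intro image_cong) auto
    have "mor_into T E (\<psi> ` Q) (\<lambda>x\<in>\<psi> ` Q. restrict \<psi> R (restrict f Q (inv_into R (restrict \<psi> R) x)))"
      using mor_into_mor[OF T(1) E inv[OF f(2) RT 1 2]] unfolding im .
    thus "mor_into T E (\<psi> ` Q) (conj_fun R \<psi> f)"
    proof (rule HE.H_cong)
      fix y assume "y \<in> \<psi> ` Q"
      then obtain x where x: "x \<in> Q" "y = \<psi> x" by blast
      have xR: "x \<in> R" "f x \<in> R" using x f(2,3) by auto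
      have "inv_into R (restrict \<psi> R) (restrict \<psi> R x) = x"
        by (rule inv_into_f_f) (use inj xR in \<open>auto simp: inj_on_def\<close>)
      hence i: "inv_into R (restrict \<psi> R) y = x" using x xR by simp
      show "(\<lambda>x\<in>\<psi> ` Q. restrict \<psi> R (restrict f Q (inv_into R (restrict \<psi> R) x))) y = conj_fun R \<psi> f y"
        unfolding x(2) conj_fun_apply[OF inj xR(1)] using x xR i by simp
    qed
  qed
qed

lemma weakly_normal_homs_of:
  assumes S: "subgroup S G" and F: "fusion_system p (G\<lparr>carrier := S\<rparr>) F"
    and sub: "closed_fusion_sub p G S (mor_into S F) T D" and sat: "fusion_pred.is_saturated p G T D"
    and st: "\<And>R \<psi>. mor_into S F R \<psi> \<Longrightarrow> R \<subseteq> T \<Longrightarrow> stable D R \<psi>"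
  shows "weakly_normal p (G\<lparr>carrier := S\<rparr>) F T (homs_of G T D)"
proof -
  interpret HS: closed_fusion_sub p G S "mor_into S F" T D by (rule sub)
  note T = HS.E.T
  note fD = homs_of_fusion_system[OF T HS.E.fusion_pred_axioms]
  have "subgroup T (G\<lparr>carrier := S\<rparr>)" using T HS.TP subgroup_T_iff[OF S] by blast
  moreover have "homs_of G T D \<le> F" by (rule homs_of_mono[OF F S HS.E_F HS.TP])
  moreover have "\<phi> ` Q \<subseteq> T" if "Q \<subseteq> T" "\<phi> \<in> F Q S" for Q \<phi>
    by (rule HS.closed[OF mor_into_mor[OF S F that(2)] that(1)])
  moreover have "(\<lambda>x\<in>\<psi> ` Q. \<psi> (\<phi> (inv_into R \<psi> x))) \<in> homs_of G T D (\<psi> ` Q) (\<psi> ` R)"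
    if a: "Q \<subseteq> R" "R \<subseteq> T" "\<phi> \<in> homs_of G T D Q R" "\<psi> \<in> F R T" for Q R \<phi> \<psi>
  proof -
    have p: "D Q \<phi>" "\<phi> ` Q \<subseteq> R" using a(3) unfolding homs_of_def by auto
    have q: "mor_into S F R \<psi>" by (rule mor_into_mor[OF S F a(4)])
    have inj: "inj_on \<psi> R" by (rule HS.F.H_inj[OF q])
    have "D (\<psi> ` Q) (conj_fun R \<psi> \<phi>)" by (rule HS.E.stableD[OF st[OF q a(2)] p(1) a(1) p(2)])
    hence "D (\<psi> ` Q) (\<lambda>x\<in>\<psi> ` Q. \<psi> (\<phi> (inv_into R \<psi> x)))"
      by (rule HS.E.H_cong) (simp add: conj_fun_def)
    moreover have "(\<lambda>x\<in>\<psi> ` Q. \<psi> (\<phi> (inv_into R \<psi> x))) y \<in> \<psi> ` R" if y: "y \<in> \<psi> ` Q" for y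
    proof -
      obtain x where x: "x \<in> Q" "y = \<psi> x" using y by blast
      hence "inv_into R \<psi> (\<psi> x) = x" using inj a(1) by (intro inv_into_f_f) auto
      thus ?thesis using x p(2) by auto
    qed
    hence "(\<lambda>x\<in>\<psi> ` Q. \<psi> (\<phi> (inv_into R \<psi> x))) ` \<psi> ` Q \<subseteq> \<psi> ` R" by (rule image_subsetI)
    moreover have "subgroup (\<psi> ` R) G" by (rule HS.F.H_img[OF q])
    moreover have "\<psi> ` R \<subseteq> T" by (rule HS.closed[OF q a(2)])
    ultimately show ?thesis unfolding homs_of_def by simp
  qed
  moreover have "saturated p (G\<lparr>carrier := T\<rparr>) (homs_of G T D)"
    using sat saturated_iff[OF T fD] unfolding mor_into_homs_of[OF T HS.E.fusion_pred_axioms] by blast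
  ultimately show ?thesis
    using fD unfolding weakly_normal_def invariant_subsystem_def subsystem_def strongly_closed_def by simp
qed

end

section \<open>Identification of the smallest weakly normal subsystem, and its normality\<close>

theorem theoremA:
  fixes p :: nat
    and P :: "('a, 'b) monoid_scheme"
    and F E :: "'a hom_sets"
    and T :: "'a set"
  assumes "prime p"
    and "saturated p P F"
    and "weakly_normal p P F T E"
  shows "normal_subsystem p P F T (O_p_prime p (P\<lparr>carrier := T\<rparr>) E)"
proof -
  have fsF: "fusion_system p P F" using assms(2) unfolding saturated_def by blast
  interpret F0: fusion_system p P F by (rule fsF)
  interpret finite_p_group p P by unfold_locales (rule assms(1))
  let ?S = "carrier P" and ?FF = "mor_into (carrier P) F" and ?EE = "mor_into T E"
  have P: "P\<lparr>carrier := carrier P\<rparr> = P" by simp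
  have S: "subgroup ?S P" by (rule F0.subgroup_self)
  have fsF': "fusion_system p (P\<lparr>carrier := ?S\<rparr>) F" using fsF by simp
  have wn: "weakly_normal p (P\<lparr>carrier := ?S\<rparr>) F T E" using assms(3) by simp
  note W = weakly_normal_closed_fusion_sub[OF S fsF' wn]
  note T = W(4) and fsE = W(5)
  have Fsat: "fusion_pred.is_saturated p P ?S ?FF" using assms(2) saturated_iff[OF S fsF'] unfolding P by blast
  interpret weakly_normal_pair p P ?FF T ?EE
    by (rule weakly_normal_pair.intro, rule W(1), rule weakly_normal_pair_axioms.intro, rule Fsat, rule W(2), rule W(3))
  let ?D = "homs_of P T OE"
  have dd: "fusion_pred p P T OE" by (rule OE.fusion_pred_axioms)
  have subE: "closed_fusion_sub p P T ?EE T OE"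
    by (rule closed_fusion_sub.intro, rule E.fusion_pred_axioms, rule dd, rule closed_fusion_sub_axioms.intro) (auto intro: OE_EE dest: E.H_imgT)
  have subF: "closed_fusion_sub p P ?S ?FF T OE"
    by (rule closed_fusion_sub.intro, rule F.fusion_pred_axioms, rule dd, rule closed_fusion_sub_axioms.intro)
      (rule TP, erule OE_FF, erule (1) closed)
  have wE: "weakly_normal p (P\<lparr>carrier := T\<rparr>) E T ?D"
    by (rule weakly_normal_homs_of[OF T fsE subE OE_saturated]) (rule OE_E_stable)
  have wF: "weakly_normal p P F T ?D"
    using weakly_normal_homs_of[OF S fsF' subF OE_saturated] OE_F_stable unfolding P by blast
  have "O_p_prime p (P\<lparr>carrier := T\<rparr>) E = ?D"
    unfolding O_p_prime_def
  \<comment> \<open>A competitor D' is saturated and stable under E, so it satisfies all the rules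
    that generate \<open>OE\<close>.\<close>
  proof (rule Least_equality)
    show "weakly_normal p (P\<lparr>carrier := T\<rparr>) E (carrier (P\<lparr>carrier := T\<rparr>)) ?D" using wE by simp
    fix D' assume "weakly_normal p (P\<lparr>carrier := T\<rparr>) E (carrier (P\<lparr>carrier := T\<rparr>)) D'"
    hence w: "weakly_normal p (P\<lparr>carrier := T\<rparr>) E T D'" by simp
    note V = weakly_normal_closed_fusion_sub[OF T fsE w]
    show "?D \<le> D'"
    proof (rule homs_of_mono[OF V(5) T _ subset_refl])
      fix Q f assume DQ: "OE Q f"
      show "mor_into T D' Q f"
      proof (rule OE_least[of "mor_into T D'"])
        show "OE Q f" by (rule DQ)
        show "fusion_pred p P T (mor_into T D')" by (rule mor_into_fusion_pred[OF T V(5)])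
        show "stable (mor_into T D') R \<psi>" if "?EE R \<psi>" for R \<psi> by (rule V(3)[OF that E.H_subT[OF that]])
        show "fusion_pred.is_saturated p P T (mor_into T D')" by (rule V(2))
        show "?EE Q f" if "mor_into T D' Q f" for Q f using that by (rule closed_fusion_sub.E_F[OF V(1)])
      qed
    qed
  qed
  moreover have "normal_subsystem p P F T ?D"
    unfolding normal_subsystem_def
  proof (intro conjI ballI wF)
    have C: "centralizer P T = CP" unfolding centralizer_def CP_def centralizer_in_def ..
    have Z: "center (P\<lparr>carrier := T\<rparr>) = centralizer_in P T T" unfolding center_def centralizer_def centralizer_in_def by simp
    have K: "T <#>\<^bsub>P\<^esub> centralizer P T = prod_CP T" unfolding C prod_CP_def ..
    fix \<phi> assume "\<phi> \<in> ?D T T"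
    hence phi: "OE T \<phi>" "\<phi> \<in> extensional T" unfolding homs_of_def by auto
    obtain h where h: "?FF (prod_CP T) h" "\<And>x. x \<in> T \<Longrightarrow> h x = \<phi> x" "h ` prod_CP T = prod_CP T"
      "\<And>c. c \<in> CP \<Longrightarrow> inv\<^bsub>P\<^esub> c \<otimes>\<^bsub>P\<^esub> h c \<in> centralizer_in P T T"
      by (rule OE_T_extends[OF phi(1)]) (rule that)
    note KT = prod_CP_sub[OF E.T subset_refl]
    let ?\<psi> = "restrict h (prod_CP T)"
    have 1: "?\<psi> \<in> F (prod_CP T) (prod_CP T)"
      by (rule mor_mor_into[OF S fsF' h(1) _ KT(1)]) (use h(3) subgroup.subset[OF KT(1)] in auto)
    have 2: "restrict ?\<psi> T = \<phi>"
      unfolding restrict_restrict_sub[OF KT(2)]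
      by (rule extensionalityI[of _ T]) (use phi(2) h(2) in auto)
    have 3: "generate P {inv\<^bsub>P\<^esub> x \<otimes>\<^bsub>P\<^esub> ?\<psi> x | x. x \<in> CP} \<subseteq> centralizer_in P T T"
    proof (rule F0.generate_subgroup_incl)
      show "subgroup (centralizer_in P T T) P" by (rule F0.subgroup_centralizer_in[OF T]) (rule subgroup.subset[OF T])
      show "{inv\<^bsub>P\<^esub> x \<otimes>\<^bsub>P\<^esub> ?\<psi> x | x. x \<in> CP} \<subseteq> centralizer_in P T T"
        using h(4) KT(3) by (auto simp: subset_iff)
    qed
    show "\<exists>\<psi>\<in>F (T <#>\<^bsub>P\<^esub> centralizer P T) (T <#>\<^bsub>P\<^esub> centralizer P T). restrict \<psi> T = \<phi> \<and>
        generate P {inv\<^bsub>P\<^esub> x \<otimes>\<^bsub>P\<^esub> \<psi> x | x. x \<in> centralizer P T} \<subseteq> center (P\<lparr>carrier := T\<rparr>)"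
      unfolding K unfolding C Z using 1 2 3 by blast
  qed
  ultimately show ?thesis by simp
qed

end
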